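(* Let $P,f,\mathfrak K,M,K,\alpha,\beta,r,\sigma,z_i,w_i,Y,W$, the decompositions $M_1=M_{1,1}\oplus M_{1,2}$, $M_3=M_{3,1}\oplus M_{3,2}$, the homomorphism $X:M_1\to M_2$, and the maps $g_{\mathrm{even}},g_{\mathrm{odd}},\acute g_{\mathrm{even}},\acute g_{\mathrm{odd}}$ be the data fixed in the context. Let $\overline P=P/(f)$ and let $\overline{\phantom{x}}$ denote the functor $-\otimes_P\overline P$. Then the following statements hold. 1. The maps and modules $N:\ \cdots\xrightarrow{n_3}N_2\xrightarrow{n_2}N_1\xrightarrow{n_1}N_0$ form a resolution of $\overline P/\mathfrak K\overline P$ by free $\overline P$-modules, where $$N_0=\overline{K_0},\quad N_1=\overline{K_1},\quad N_2=\overline{M_{1,2}}\oplus\overline{K_2},\quad N_3=\overline{M_2}\oplus\overline{K_3},$$ $N_i=\overline{G_{\mathrm{even}}}$ if $4\le i$ and $i$ is even, $N_i=\overline{G_{\mathrm{odd}}}$ if $5\le i$ and $i$ is odd, and $$n_1=-\overline{k_1},\qquad n_2=\begin{bmatrix} (r\overline{\beta_1}+\overline{z_0\circ m_1})|_{\overline{M_{1,2}}} & -\overline{k_2} \end{bmatrix},\qquad n_3=\begin{bmatrix} \overline{\mathrm{proj}_{M_{1,2}}\circ m_2} & 0 \\ r\overline{\beta_2}-\overline Y & -\overline{k_3} \end{bmatrix},$$ $$n_4=\begin{bmatrix} (r\overline X-\overline{w_1})|_{\overline{M_{1,2}}} & \overline{\alpha_2} & \overline{m_3} & 0 \\ 0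 & -\overline{z_2} & r\overline{\beta_3} & -\overline{k_4} \end{bmatrix},$$ $n_i=\overline{g_{\mathrm{odd}}}$ if $5\le i$ and $i$ is odd, and $n_i=\overline{g_{\mathrm{even}}}$ if $6\le i$ and $i$ is even. 2. If $r$ is a unit, then the maps and modules $\acute N:\ \cdots\xrightarrow{\acute n_3}\acute N_2\xrightarrow{\acute n_2}\acute N_1\xrightarrow{\acute n_1}\acute N_0$ form a resolution of $\overline P/\mathfrak K\overline P$ by free $\overline P$-modules, where $$\acute N_0=\overline{K_0},\quad \acute N_1=\overline{K_1},\quad\acute N_2=\overline{M_{1,2}}\oplus\overline{K_2},$$ $\acute N_i=\overline{\acute G_{\mathrm{odd}}}$ if $3\le i$ and $i$ is odd, $\acute N_i=\overline{\acute G_{\mathrm{even}}}$ if $4\le i$ and $i$ is even, and $$\acute n_1=-\overline{k_1},\qquad \acute n_2=\begin{bmatrix} (r\overline{\beta_1}+\overline{z_0\circ m_1})|_{\overline{M_{1,2}}} & -\overline{k_2} \end{bmatrix},\qquad\acute n_3=\begin{bmatrix} \overline{\mathrm{proj}_{M_{1,2}}\circ m_2} \\ r\overline{\beta_2}-\overline Y \end{bmatrix},$$ $\acute n_i=\overline{\acute g_{\mathrm{even}}}$ if $4\le i$ and $i$ is even, and $\acute n_i=\overline{\acute g_{\mathrm{odd}}}$ if $5\le i$ and $i$ is odd.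
   Context: **DG$\Gamma$-algebras.** A DG-algebra $F$ over a commutative Noetherian ring $P$ is a complex of finitely generated free $P$-modules $\cdots\to F_1\xrightarrow{d_1}F_0=P$ with a unitary associative multiplication satisfying $F_iF_j\subseteq F_{i+j}$, $d(x_ix_j)=d(x_i)x_j+(-1)^ix_id(x_j)$, $x_ix_j=(-1)^{ij}x_jx_i$, and $x_i^2=0$ for $i$ odd ($x_\ell\in F_\ell$). It is a DG$\Gamma$-algebra if each $x_i\in F_i$ with $i$ positive and even has divided powers $x_i^{(k)}\in F_{ik}$ satisfying the usual divided power axioms and $d(x_i^{(k)})=d(x_i)x_i^{(k-1)}$. It exhibits Poincaré duality if for some $m$ one has $F_i=0$ for $i>m$, $F_m\cong P$, and each multiplication map $F_i\otimes_PF_{m-i}\to F_m$ is a perfect pairing. **Data.** $P$ is a commutative Noetherian ring, $f$ is a regular element (non-zero-divisor) of $P$, $\mathfrak K$ is an ideal of $P$ generated by a regular sequence of length four, and $$M:\ 0\to M_4\xrightarrow{m_4}M_3\xrightarrow{m_3}M_2\xrightarrow{m_2}M_1\xrightarrow{m_1}M_0=P$$ is a resolution of $P/(\mathfrak K:f)$ by free $P$-modules such that $M$ is a DG$\Gamma$-algebra which exhibits Poincaré duality, and $M_1=M_{1,1}\oplus M_{1,2}$ is a direct sum of two free submodules with $\mathrm{rank}\,M_{1,1}=4$ and $m_1(M_{1,1})=\mathfrak K$. **The maps $\alpha$ and $\beta$.** $K:\ 0\to K_4\xrightarrow{k_4}K_3\xrightarrow{k_3}K_2\xrightarrow{k_2}K_1\xrightarrow{k_1}K_0=P$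 is the Koszul complex which is a resolution of $P/\mathfrak K$ (a DG$\Gamma$-algebra with Poincaré duality; its product is written $\wedge$). Fix orientation isomorphisms $[-]_K:K_4\to P$ and $[-]_M:M_4\to P$. Let $\alpha_0:K_0=P\to M_0=P$ be the identity, and let $\alpha_1:K_1\to M_1$ be such that $\mathrm{proj}_{M_{1,1}}\circ\alpha_1:K_1\to M_{1,1}$ is the (fixed) isomorphism with $m_1|_{M_{1,1}}\circ\mathrm{proj}_{M_{1,1}}\circ\alpha_1=k_1$, and $\mathrm{proj}_{M_{1,2}}\circ\alpha_1=0$. Let $\alpha:K\to M$ be the map of DG$\Gamma$-algebras which extends $\alpha_0$ and $\alpha_1$. Define $\beta_i:M_i\to K_i$ by $[\beta_i(\theta_i)\wedge\phi_{4-i}]_K=[\theta_i\cdot\alpha_{4-i}(\phi_{4-i})]_M$ for all $\theta_i\in M_i$, $\phi_{4-i}\in K_{4-i}$. In particular $\beta_0(1)\in K_0=P$. **The adjoint.** For a homomorphism $h:M_1\to M_2$, $h^\dagger:M_2\to M_3$ is defined by $h^\dagger(\theta_2)\cdot\theta_1=\theta_2\cdot h(\theta_1)$ in $M_4$ for all $\theta_i\in M_i$. **Further data.** $r\in P$ and $\sigma\in K_1$ are fixed elements with $f=r\beta_0(1)+k_1(\sigma)$ (such elements exist by linkage theory). Put $M_{3,1}=\{\theta_3\in M_3\mid\theta_3M_{1,2}=0\}$ and $M_{3,2}=\{\theta_3\in M_3\mid\theta_3M_{1,1}=0\}$; then $M_3=M_{3,1}\oplus M_{3,2}$. The map $\beta_3|_{M_{3,1}}:M_{3,1}\to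 K_3$ is an isomorphism. Define $z_i:K_i\to K_{i+1}$ by $z_i(\phi_i)=\phi_i\wedge\sigma$ and $w_i:M_i\to M_{i+1}$ by $w_i(\theta_i)=\theta_i\cdot\alpha_1(\sigma)$. Define $Y:M_2\to K_2$ by $Y=z_1\circ(\mathrm{proj}_{M_{1,1}}\circ\alpha_1)^{-1}\circ\mathrm{proj}_{M_{1,1}}\circ m_2$ and $W:K_2\to M_2$ by $W=m_3\circ(\beta_3|_{M_{3,1}})^{-1}\circ z_2$. All projections are with respect to the stated direct sum decompositions of $M_1$ and $M_3$. **The map $X$.** $X:M_1\to M_2$ is a $P$-module homomorphism satisfying: (a) $X\circ\alpha_1=0$; (b) $m_2\circ X=\beta_0(1)\cdot\mathrm{id}_{M_1}-\alpha_1\circ\beta_1$; (c) $X\circ m_2+m_3\circ X^\dagger=\beta_0(1)\cdot\mathrm{id}_{M_2}-\alpha_2\circ\beta_2$; (d) $X^\dagger\circ X=0$; (e) $X^\dagger\circ\alpha_2=0$. **The maps $g$ and $\acute g$.** $G_{\mathrm{even}}=M_{1,2}\oplus K_2\oplus M_3\oplus K_4$, $G_{\mathrm{odd}}=M_2\oplus K_3\oplus M_4$, and $g_{\mathrm{even}}:G_{\mathrm{even}}\to G_{\mathrm{odd}}$, $g_{\mathrm{odd}}:G_{\mathrm{odd}}\to G_{\mathrm{even}}$ are $$g_{\mathrm{even}}=\begin{bmatrix} (rX-w_1)|_{M_{1,2}} & \alpha_2 & m_3 & 0 \\ 0 & -z_2 & r\beta_3 & -k_4 \\ 0 & 0 &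 -w_3 & \alpha_4 \end{bmatrix},\qquad g_{\mathrm{odd}}=\begin{bmatrix} \mathrm{proj}_{M_{1,2}}\circ m_2 & 0 & 0 \\ r\beta_2-Y & -k_3 & 0 \\ rX^\dagger+w_2 & \alpha_3 & m_4 \\ 0 & z_3 & r\beta_4 \end{bmatrix}.$$ When $r$ is a unit, $\acute G_{\mathrm{even}}=M_{1,2}\oplus K_2\oplus M_{3,2}$, $\acute G_{\mathrm{odd}}=M_2$, and $\acute g_{\mathrm{even}}:\acute G_{\mathrm{even}}\to\acute G_{\mathrm{odd}}$, $\acute g_{\mathrm{odd}}:\acute G_{\mathrm{odd}}\to\acute G_{\mathrm{even}}$ are $$\acute g_{\mathrm{even}}=\begin{bmatrix} (rX-w_1)|_{M_{1,2}} & \alpha_2+r^{-1}W & m_3|_{M_{3,2}} \end{bmatrix},\qquad \acute g_{\mathrm{odd}}=\begin{bmatrix} \mathrm{proj}_{M_{1,2}}\circ m_2 \\ r\beta_2-Y \\ \mathrm{proj}_{M_{3,2}}\circ(rX^\dagger+w_2) \end{bmatrix}.$$ *)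

theory Defs
  imports
    "HOL-Algebra.Module"
    "HOL-Algebra.QuotRing"
    "HOL-Algebra.Ring_Divisibility"
    "HOL-Algebra.Generated_Groups"
    "HOL-Algebra.Free_Abelian_Groups"
begin

definition ring_module :: "('r, 'x) ring_scheme \<Rightarrow> ('r, 'r) module" where
  "ring_module R =
    \<lparr>carrier = carrier R, monoid.mult = monoid.mult R, one = one R,
     ring.zero = ring.zero R, ring.add = ring.add R, smult = monoid.mult R\<rparr>"

definition quot_module :: "('r, 'x) ring_scheme \<Rightarrow> 'r set \<Rightarrow> ('r, 'r set) module" where
  "quot_module R I =
    \<lparr>carrier = carrier (R Quot I), monoid.mult = monoid.mult (R Quot I), one = one (R Quot I),
     ring.zero = ring.zero (R Quot I), ring.add = ring.add (R Quot I),
     smult = (\<lambda>a X. (I +>\<^bsub>R\<^esub> a) \<otimes>\<^bsub>R Quot I\<^esub> X)\<rparr>"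

definition module_hom ::
  "('r, 'x) ring_scheme \<Rightarrow> ('r, 'a) module \<Rightarrow> ('r, 'b) module \<Rightarrow> ('a \<Rightarrow> 'b) set" where
  "module_hom R A B =
    {h \<in> carrier A \<rightarrow> carrier B.
      (\<forall>x\<in>carrier A. \<forall>y\<in>carrier A. h (x \<oplus>\<^bsub>A\<^esub> y) = h x \<oplus>\<^bsub>B\<^esub> h y) \<and>
      (\<forall>a\<in>carrier R. \<forall>x\<in>carrier A. h (a \<odot>\<^bsub>A\<^esub> x) = a \<odot>\<^bsub>B\<^esub> h x)}"

definition module_iso ::
  "('r, 'x) ring_scheme \<Rightarrow> ('r, 'a) module \<Rightarrow> ('r, 'b) module \<Rightarrow> ('a \<Rightarrow> 'b) set" where
  "module_iso R A B = {h \<in> module_hom R A B. bij_betw h (carrier A) (carrier B)}"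

definition is_basis :: "('r, 'x) ring_scheme \<Rightarrow> ('r, 'a) module \<Rightarrow> 'a set \<Rightarrow> bool" where
  "is_basis R A B \<longleftrightarrow> B \<subseteq> carrier A \<and>
    (\<forall>x\<in>carrier A. \<exists>!c. c \<in> B \<rightarrow>\<^sub>E carrier R \<and> finite {b \<in> B. c b \<noteq> \<zero>\<^bsub>R\<^esub>} \<and>
       x = (\<Oplus>\<^bsub>A\<^esub>b\<in>{b \<in> B. c b \<noteq> \<zero>\<^bsub>R\<^esub>}. c b \<odot>\<^bsub>A\<^esub> b))"

definition free_module :: "('r, 'x) ring_scheme \<Rightarrow> ('r, 'a) module \<Rightarrow> bool" where
  "free_module R A \<longleftrightarrow> module R A \<and> (\<exists>B. is_basis R A B)"

definition fg_free_module :: "('r, 'x) ring_scheme \<Rightarrow> ('r, 'a) module \<Rightarrow> bool" where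
  "fg_free_module R A \<longleftrightarrow> module R A \<and> (\<exists>B. finite B \<and> is_basis R A B)"

definition free_of_rank :: "('r, 'x) ring_scheme \<Rightarrow> ('r, 'a) module \<Rightarrow> nat \<Rightarrow> bool" where
  "free_of_rank R A n \<longleftrightarrow> module R A \<and> (\<exists>B. finite B \<and> card B = n \<and> is_basis R A B)"

text \<open>In a complex the differential \<open>d i\<close> goes from \<open>C i\<close> to \<open>C (i - 1)\<close> and is only meaningful
  for \<open>i \<ge> 1\<close>. The last conjunct says that the cokernel of \<open>d 1\<close> is isomorphic to \<open>A\<close>.\<close>

definition free_resolution ::
  "('r, 'x) ring_scheme \<Rightarrow> (nat \<Rightarrow> ('r, 'c) module) \<Rightarrow> (nat \<Rightarrow> 'c \<Rightarrow> 'c) \<Rightarrow> ('r, 'a) module \<Rightarrow> bool"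
  where
  "free_resolution R C d A \<longleftrightarrow>
    (\<forall>i. free_module R (C i)) \<and>
    (\<forall>i\<ge>1. d i \<in> module_hom R (C i) (C (i - 1))) \<and>
    (\<forall>i\<ge>1. d (i + 1) ` carrier (C (i + 1)) = {x \<in> carrier (C i). d i x = \<zero>\<^bsub>C (i - 1)\<^esub>}) \<and>
    (\<exists>e \<in> module_hom R (C 0) A. e ` carrier (C 0) = carrier A \<and>
       d 1 ` carrier (C 1) = {x \<in> carrier (C 0). e x = \<zero>\<^bsub>A\<^esub>})"

definition zero_module :: "('r, 'a) module \<Rightarrow> ('r, 'a) module" where
  "zero_module A = A\<lparr>carrier := {\<zero>\<^bsub>A\<^esub>}\<rparr>"

definition direct_sum ::
  "('r, 'a) module \<Rightarrow> ('r, 'b) module \<Rightarrow> ('r, 'a \<times> 'b) module" (infixr "\<boxplus>" 66) where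
  "A \<boxplus> B =
    \<lparr>carrier = carrier A \<times> carrier B,
     monoid.mult = (\<lambda>(x, y) (x', y'). (x \<otimes>\<^bsub>A\<^esub> x', y \<otimes>\<^bsub>B\<^esub> y')), one = (\<one>\<^bsub>A\<^esub>, \<one>\<^bsub>B\<^esub>),
     ring.zero = (\<zero>\<^bsub>A\<^esub>, \<zero>\<^bsub>B\<^esub>), ring.add = (\<lambda>(x, y) (x', y'). (x \<oplus>\<^bsub>A\<^esub> x', y \<oplus>\<^bsub>B\<^esub> y')),
     smult = (\<lambda>a (x, y). (a \<odot>\<^bsub>A\<^esub> x, a \<odot>\<^bsub>B\<^esub> y))\<rparr>"

definition internal_direct_sum :: "('r, 'a) module \<Rightarrow> 'a set \<Rightarrow> 'a set \<Rightarrow> bool" where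
  "internal_direct_sum A U V \<longleftrightarrow> U \<subseteq> carrier A \<and> V \<subseteq> carrier A \<and>
    (\<forall>x\<in>carrier A. \<exists>!(u, v). u \<in> U \<and> v \<in> V \<and> x = u \<oplus>\<^bsub>A\<^esub> v)"

text \<open>Projection onto the first summand \<open>U\<close> of the internal direct sum \<open>A = U \<oplus> V\<close>.\<close>

definition proj :: "('r, 'a) module \<Rightarrow> 'a set \<Rightarrow> 'a set \<Rightarrow> 'a \<Rightarrow> 'a" where
  "proj A U V x = (THE u. u \<in> U \<and> (\<exists>v\<in>V. x = u \<oplus>\<^bsub>A\<^esub> v))"

text \<open>For a ring homomorphism \<open>\<phi> : R \<rightarrow> S\<close> and an \<open>R\<close>-module \<open>A\<close>, the \<open>S\<close>-module
  \<open>A \<otimes>\<^sub>R S\<close> is the free abelian group on \<open>A \<times> S\<close> modulo the usual relations. The record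
  fields \<open>mult\<close> and \<open>one\<close> play no role for modules.\<close>

definition tensor_relations ::
  "('r, 'x) ring_scheme \<Rightarrow> ('s, 'y) ring_scheme \<Rightarrow> ('r \<Rightarrow> 's) \<Rightarrow> ('r, 'a) module
    \<Rightarrow> (('a \<times> 's) \<Rightarrow>\<^sub>0 int) set" where
  "tensor_relations R S \<phi> A =
    {frag_of (x \<oplus>\<^bsub>A\<^esub> y, s) - frag_of (x, s) - frag_of (y, s) | x y s.
       x \<in> carrier A \<and> y \<in> carrier A \<and> s \<in> carrier S} \<union>
    {frag_of (x, s \<oplus>\<^bsub>S\<^esub> t) - frag_of (x, s) - frag_of (x, t) | x s t.
       x \<in> carrier A \<and> s \<in> carrier S \<and> t \<in> carrier S} \<union>
    {frag_of (a \<odot>\<^bsub>A\<^esub> x, s) - frag_of (x, \<phi> a \<otimes>\<^bsub>S\<^esub> s) | a x s.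
       a \<in> carrier R \<and> x \<in> carrier A \<and> s \<in> carrier S}"

definition tensor_null ::
  "('r, 'x) ring_scheme \<Rightarrow> ('s, 'y) ring_scheme \<Rightarrow> ('r \<Rightarrow> 's) \<Rightarrow> ('r, 'a) module
    \<Rightarrow> (('a \<times> 's) \<Rightarrow>\<^sub>0 int) set" where
  "tensor_null R S \<phi> A =
    generate (free_Abelian_group (carrier A \<times> carrier S)) (tensor_relations R S \<phi> A)"

definition extend_scalars ::
  "('r, 'x) ring_scheme \<Rightarrow> ('s, 'y) ring_scheme \<Rightarrow> ('r \<Rightarrow> 's) \<Rightarrow> ('r, 'a) module
    \<Rightarrow> ('s, (('a \<times> 's) \<Rightarrow>\<^sub>0 int) set) module" where
  "extend_scalars R S \<phi> A =
    (let G = free_Abelian_group (carrier A \<times> carrier S); Z = tensor_null R S \<phi> A in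
     \<lparr>carrier = carrier (G Mod Z), monoid.mult = undefined, one = undefined,
      ring.zero = one (G Mod Z), ring.add = monoid.mult (G Mod Z),
      smult = (\<lambda>s X. Z <#>\<^bsub>G\<^esub> frag_extend (\<lambda>(x, t). frag_of (x, s \<otimes>\<^bsub>S\<^esub> t)) ` X)\<rparr>)"

text \<open>The homomorphism \<open>h \<otimes> id\<close> induced by an \<open>R\<close>-linear map \<open>h\<close> into \<open>B\<close>.\<close>

definition extend_scalars_map ::
  "('r, 'x) ring_scheme \<Rightarrow> ('s, 'y) ring_scheme \<Rightarrow> ('r \<Rightarrow> 's) \<Rightarrow> ('r, 'b) module
    \<Rightarrow> ('a \<Rightarrow> 'b) \<Rightarrow> (('a \<times> 's) \<Rightarrow>\<^sub>0 int) set \<Rightarrow> (('b \<times> 's) \<Rightarrow>\<^sub>0 int) set" where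
  "extend_scalars_map R S \<phi> B h X =
    tensor_null R S \<phi> B <#>\<^bsub>free_Abelian_group (carrier B \<times> carrier S)\<^esub>
      frag_extend (\<lambda>(x, t). frag_of (h x, t)) ` X"

definition colon_ideal :: "('r, 'x) ring_scheme \<Rightarrow> 'r set \<Rightarrow> 'r \<Rightarrow> 'r set" where
  "colon_ideal R I f = {p \<in> carrier R. p \<otimes>\<^bsub>R\<^esub> f \<in> I}"

definition regular_element :: "('r, 'x) ring_scheme \<Rightarrow> 'r \<Rightarrow> bool" where
  "regular_element R x \<longleftrightarrow>
    x \<in> carrier R \<and> (\<forall>y\<in>carrier R. x \<otimes>\<^bsub>R\<^esub> y = \<zero>\<^bsub>R\<^esub> \<longrightarrow> y = \<zero>\<^bsub>R\<^esub>)"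

definition regular_sequence :: "('r, 'x) ring_scheme \<Rightarrow> 'r list \<Rightarrow> bool" where
  "regular_sequence R xs \<longleftrightarrow> set xs \<subseteq> carrier R \<and> Idl\<^bsub>R\<^esub> (set xs) \<noteq> carrier R \<and>
    (\<forall>i<length xs. let I = Idl\<^bsub>R\<^esub> (set (take i xs)) in
       regular_element (R Quot I) (I +>\<^bsub>R\<^esub> xs ! i))"

text \<open>A graded object with homogeneous components \<open>part F i\<close>, differentials
  \<open>bd F i\<close> from degree \<open>i\<close> to degree \<open>i - 1\<close> (for \<open>i \<ge> 1\<close>), products \<open>gmult F i j\<close> of elements of
  degrees \<open>i\<close> and \<open>j\<close>, unit \<open>gone F\<close>, and divided powers: \<open>divpow F i k x\<close> is the \<open>k\<close>-th
  divided power of \<open>x\<close> of degree \<open>i\<close>.\<close>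

record ('p, 'f) dg =
  part :: "nat \<Rightarrow> ('p, 'f) module"
  bd :: "nat \<Rightarrow> 'f \<Rightarrow> 'f"
  gmult :: "nat \<Rightarrow> nat \<Rightarrow> 'f \<Rightarrow> 'f \<Rightarrow> 'f"
  gone :: "'f"
  divpow :: "nat \<Rightarrow> nat \<Rightarrow> 'f \<Rightarrow> 'f"

definition signed :: "nat \<Rightarrow> ('p, 'f) module \<Rightarrow> 'f \<Rightarrow> 'f" where
  "signed n A x = (if even n then x else \<ominus>\<^bsub>A\<^esub> x)"

text \<open>The condition \<open>F\<^sub>0 = P\<close> is expressed by saying that \<open>p \<mapsto> p\<cdot>1\<close> is a bijection
  \<open>P \<rightarrow> F\<^sub>0\<close>. In the Leibniz rule a factor of degree \<open>0\<close> has differential \<open>0\<close>.\<close>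

locale dg_algebra = cring P for P :: "('p, 'x) ring_scheme" (structure) +
  fixes F :: "('p, 'f) dg"
  assumes part_fg_free: "fg_free_module P (part F i)"
    and gone_closed: "gone F \<in> carrier (part F 0)"
    and part_0: "bij_betw (\<lambda>p. p \<odot>\<^bsub>part F 0\<^esub> gone F) (carrier P) (carrier (part F 0))"
    and bd_hom: "1 \<le> i \<Longrightarrow> bd F i \<in> module_hom P (part F i) (part F (i - 1))"
    and bd_bd: "\<lbrakk>1 \<le> i; x \<in> carrier (part F (i + 1))\<rbrakk>
      \<Longrightarrow> bd F i (bd F (i + 1) x) = \<zero>\<^bsub>part F (i - 1)\<^esub>"
    and gmult_hom_right: "x \<in> carrier (part F i)
      \<Longrightarrow> gmult F i j x \<in> module_hom P (part F j) (part F (i + j))"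
    and gmult_hom_left: "y \<in> carrier (part F j)
      \<Longrightarrow> (\<lambda>x. gmult F i j x y) \<in> module_hom P (part F i) (part F (i + j))"
    and gmult_assoc: "\<lbrakk>x \<in> carrier (part F i); y \<in> carrier (part F j); z \<in> carrier (part F l)\<rbrakk>
      \<Longrightarrow> gmult F (i + j) l (gmult F i j x y) z = gmult F i (j + l) x (gmult F j l y z)"
    and gone_left: "x \<in> carrier (part F i) \<Longrightarrow> gmult F 0 i (gone F) x = x"
    and gone_right: "x \<in> carrier (part F i) \<Longrightarrow> gmult F i 0 x (gone F) = x"
    and leibniz: "\<lbrakk>0 < i + j; x \<in> carrier (part F i); y \<in> carrier (part F j)\<rbrakk>
      \<Longrightarrow> bd F (i + j) (gmult F i j x y) =
          (if i = 0 then \<zero>\<^bsub>part F (i + j - 1)\<^esub> else gmult F (i - 1) j (bd F i x) y)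
          \<oplus>\<^bsub>part F (i + j - 1)\<^esub>
          signed i (part F (i + j - 1))
            (if j = 0 then \<zero>\<^bsub>part F (i + j - 1)\<^esub> else gmult F i (j - 1) x (bd F j y))"
    and gmult_comm: "\<lbrakk>x \<in> carrier (part F i); y \<in> carrier (part F j)\<rbrakk>
      \<Longrightarrow> gmult F i j x y = signed (i * j) (part F (i + j)) (gmult F j i y x)"
    and gmult_odd_square: "\<lbrakk>odd i; x \<in> carrier (part F i)\<rbrakk>
      \<Longrightarrow> gmult F i i x x = \<zero>\<^bsub>part F (i + i)\<^esub>"

primrec gpow :: "('p, 'f) dg \<Rightarrow> nat \<Rightarrow> nat \<Rightarrow> 'f \<Rightarrow> 'f" where
  "gpow F i 0 x = gone F"
| "gpow F i (Suc k) x = gmult F i (i * k) x (gpow F i k x)"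

text \<open>The divided power axioms are those of Gulliksen and Levin. The axiom for products of an
  even element with an even element of positive degree includes the behaviour under
  scalars, \<open>F\<^sub>0\<close> being \<open>P\<close>.\<close>

locale dgg_algebra = dg_algebra +
  assumes divpow_closed: "\<lbrakk>even i; 0 < i; x \<in> carrier (part F i)\<rbrakk>
      \<Longrightarrow> divpow F i k x \<in> carrier (part F (i * k))"
    and divpow_0: "\<lbrakk>even i; 0 < i; x \<in> carrier (part F i)\<rbrakk> \<Longrightarrow> divpow F i 0 x = gone F"
    and divpow_1: "\<lbrakk>even i; 0 < i; x \<in> carrier (part F i)\<rbrakk> \<Longrightarrow> divpow F i 1 x = x"
    and divpow_mult: "\<lbrakk>even i; 0 < i; x \<in> carrier (part F i)\<rbrakk>
      \<Longrightarrow> gmult F (i * j) (i * k) (divpow F i j x) (divpow F i k x)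
          = [((j + k) choose j)] \<cdot>\<^bsub>part F (i * (j + k))\<^esub> divpow F i (j + k) x"
    and divpow_add: "\<lbrakk>even i; 0 < i; x \<in> carrier (part F i); y \<in> carrier (part F i)\<rbrakk>
      \<Longrightarrow> divpow F i k (x \<oplus>\<^bsub>part F i\<^esub> y)
          = (\<Oplus>\<^bsub>part F (i * k)\<^esub>j\<in>{..k}. gmult F (i * j) (i * (k - j)) (divpow F i j x) (divpow F i (k - j) y))"
    and divpow_odd_odd: "\<lbrakk>odd i; odd j; 2 \<le> k; x \<in> carrier (part F i); y \<in> carrier (part F j)\<rbrakk>
      \<Longrightarrow> divpow F (i + j) k (gmult F i j x y) = \<zero>\<^bsub>part F ((i + j) * k)\<^esub>"
    and divpow_even_even: "\<lbrakk>even i; even j; 0 < j; x \<in> carrier (part F i); y \<in> carrier (part F j)\<rbrakk>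
      \<Longrightarrow> divpow F (i + j) k (gmult F i j x y)
          = gmult F (i * k) (j * k) (gpow F i k x) (divpow F j k y)"
    and divpow_divpow: "\<lbrakk>even i; 0 < i; 1 \<le> k; x \<in> carrier (part F i)\<rbrakk>
      \<Longrightarrow> divpow F (i * k) l (divpow F i k x)
          = [(fact (k * l) div (fact l * fact k ^ l) :: nat)] \<cdot>\<^bsub>part F (i * (k * l))\<^esub> divpow F i (k * l) x"
    and bd_divpow: "\<lbrakk>even i; 0 < i; 1 \<le> k; x \<in> carrier (part F i)\<rbrakk>
      \<Longrightarrow> bd F (i * k) (divpow F i k x)
          = gmult F (i - 1) (i * (k - 1)) (bd F i x) (divpow F i (k - 1) x)"

definition dgg_hom ::
  "('p, 'x) ring_scheme \<Rightarrow> ('p, 'f) dg \<Rightarrow> ('p, 'g) dg \<Rightarrow> (nat \<Rightarrow> 'f \<Rightarrow> 'g) \<Rightarrow> bool" where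
  "dgg_hom P F G a \<longleftrightarrow>
    (\<forall>i. a i \<in> module_hom P (part F i) (part G i)) \<and>
    (\<forall>i\<ge>1. \<forall>x\<in>carrier (part F i). a (i - 1) (bd F i x) = bd G i (a i x)) \<and>
    a 0 (gone F) = gone G \<and>
    (\<forall>i j. \<forall>x\<in>carrier (part F i). \<forall>y\<in>carrier (part F j).
       a (i + j) (gmult F i j x y) = gmult G i j (a i x) (a j y)) \<and>
    (\<forall>i k. \<forall>x\<in>carrier (part F i). even i \<and> 0 < i \<longrightarrow>
       a (i * k) (divpow F i k x) = divpow G i k (a i x))"

definition perfect_pairing ::
  "('p, 'x) ring_scheme \<Rightarrow> ('p, 'a) module \<Rightarrow> ('p, 'b) module \<Rightarrow> ('p, 'c) module
    \<Rightarrow> ('a \<Rightarrow> 'b \<Rightarrow> 'c) \<Rightarrow> bool" where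
  "perfect_pairing P A B C b \<longleftrightarrow>
    bij_betw (\<lambda>x. \<lambda>y\<in>carrier B. b x y) (carrier A)
      (module_hom P B C \<inter> extensional (carrier B)) \<and>
    bij_betw (\<lambda>y. \<lambda>x\<in>carrier A. b x y) (carrier B)
      (module_hom P A C \<inter> extensional (carrier A))"

definition poincare_duality :: "('p, 'x) ring_scheme \<Rightarrow> ('p, 'f) dg \<Rightarrow> bool" where
  "poincare_duality P F \<longleftrightarrow> (\<exists>m.
    (\<forall>i>m. carrier (part F i) = {\<zero>\<^bsub>part F i\<^esub>}) \<and>
    module_iso P (part F m) (ring_module P) \<noteq> {} \<and>
    (\<forall>i\<le>m. perfect_pairing P (part F i) (part F (m - i)) (part F m) (gmult F i (m - i))))"

primrec gprod1 :: "('p, 'f) dg \<Rightarrow> 'f list \<Rightarrow> 'f" where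
  "gprod1 F [] = gone F"
| "gprod1 F (x # xs) = gmult F 1 (length xs) x (gprod1 F xs)"

text \<open>\<open>F\<close> is the Koszul complex on \<open>as\<close>: the exterior algebra on a free module with basis
  \<open>e\<^sub>0, \<dots>, e\<^sub>n\<^sub>-\<^sub>1\<close>, with \<open>e\<^sub>j\<close> mapped to \<open>as ! j\<close>. As an algebra it is characterised by
  having the ordered products of \<open>i\<close> distinct \<open>e\<^sub>j\<close>'s as a basis in degree \<open>i\<close>.\<close>

definition koszul_complex ::
  "('p, 'x) ring_scheme \<Rightarrow> 'p list \<Rightarrow> ('p, 'f) dg \<Rightarrow> bool" where
  "koszul_complex P as F \<longleftrightarrow> dgg_algebra P F \<and>
    (\<exists>e. (\<forall>j<length as. e j \<in> carrier (part F 1) \<and>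
            bd F 1 (e j) = as ! j \<odot>\<^bsub>part F 0\<^esub> gone F) \<and>
      (\<forall>i. let S = {J. J \<subseteq> {..<length as} \<and> card J = i};
               eS = (\<lambda>J. gprod1 F (map e (sorted_list_of_set J)))
           in inj_on eS S \<and> is_basis P (part F i) (eS ` S)))"

text \<open>The identification of the degree \<open>0\<close> component with \<open>P\<close>.\<close>

definition coef :: "('p, 'x) ring_scheme \<Rightarrow> ('p, 'f) dg \<Rightarrow> 'f \<Rightarrow> 'p" where
  "coef P F x = (THE p. p \<in> carrier P \<and> x = p \<odot>\<^bsub>part F 0\<^esub> gone F)"

locale linkage_params =
  fixes P :: "'p ring" (structure)
    and f :: 'p
    and KK :: "'p set"
    and M :: "('p, 'm) dg"
    and M11 M12 :: "'m set"
    and K :: "('p, 'k) dg"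
    and orK :: "'k \<Rightarrow> 'p"
    and orM :: "'m \<Rightarrow> 'p"
    and \<alpha> :: "nat \<Rightarrow> 'k \<Rightarrow> 'm"
    and r :: 'p
    and \<sigma> :: 'k
    and X :: "'m \<Rightarrow> 'm"
begin

definition \<beta> :: "nat \<Rightarrow> 'm \<Rightarrow> 'k" where
  "\<beta> i \<theta> = (THE x. x \<in> carrier (part K i) \<and>
     (\<forall>\<phi>\<in>carrier (part K (4 - i)).
        orK (gmult K i (4 - i) x \<phi>) = orM (gmult M i (4 - i) \<theta> (\<alpha> (4 - i) \<phi>))))"

definition \<beta>01 :: 'p where
  "\<beta>01 = coef P K (\<beta> 0 (gone M))"

definition adjoint :: "('m \<Rightarrow> 'm) \<Rightarrow> 'm \<Rightarrow> 'm" where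
  "adjoint h \<theta>2 = (THE y. y \<in> carrier (part M 3) \<and>
     (\<forall>\<theta>1\<in>carrier (part M 1). gmult M 3 1 y \<theta>1 = gmult M 2 2 \<theta>2 (h \<theta>1)))"

abbreviation p11 :: "'m \<Rightarrow> 'm" where
  "p11 \<equiv> proj (part M 1) M11 M12"

abbreviation p12 :: "'m \<Rightarrow> 'm" where
  "p12 \<equiv> proj (part M 1) M12 M11"

definition M31 :: "'m set" where
  "M31 = {\<theta> \<in> carrier (part M 3). \<forall>\<theta>1\<in>M12. gmult M 3 1 \<theta> \<theta>1 = \<zero>\<^bsub>part M 4\<^esub>}"

definition M32 :: "'m set" where
  "M32 = {\<theta> \<in> carrier (part M 3). \<forall>\<theta>1\<in>M11. gmult M 3 1 \<theta> \<theta>1 = \<zero>\<^bsub>part M 4\<^esub>}"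

abbreviation p32 :: "'m \<Rightarrow> 'm" where
  "p32 \<equiv> proj (part M 3) M32 M31"

definition z :: "nat \<Rightarrow> 'k \<Rightarrow> 'k" where
  "z i \<phi> = gmult K i 1 \<phi> \<sigma>"

definition w :: "nat \<Rightarrow> 'm \<Rightarrow> 'm" where
  "w i \<theta> = gmult M i 1 \<theta> (\<alpha> 1 \<sigma>)"

definition Y :: "'m \<Rightarrow> 'k" where
  "Y \<theta> = z 1 (inv_into (carrier (part K 1)) (\<lambda>\<phi>. p11 (\<alpha> 1 \<phi>)) (p11 (bd M 2 \<theta>)))"

definition W :: "'k \<Rightarrow> 'm" where
  "W \<phi> = bd M 3 (inv_into M31 (\<beta> 3) (z 2 \<phi>))"

text \<open>All the direct sums that occur are written with four slots of types
  \<open>'m\<close>, \<open>'k\<close>, \<open>'m\<close>, \<open>'k\<close> in this order, unused slots being filled with zero modules.\<close>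

definition G_even :: "('p, 'm \<times> 'k \<times> 'm \<times> 'k) module" where
  "G_even = (part M 1)\<lparr>carrier := M12\<rparr> \<boxplus> part K 2 \<boxplus> part M 3 \<boxplus> part K 4"

definition G_odd :: "('p, 'm \<times> 'k \<times> 'm \<times> 'k) module" where
  "G_odd = part M 2 \<boxplus> part K 3 \<boxplus> part M 4 \<boxplus> zero_module (part K 0)"

fun g_even :: "'m \<times> 'k \<times> 'm \<times> 'k \<Rightarrow> 'm \<times> 'k \<times> 'm \<times> 'k" where
  "g_even (a, b, c, d) =
    ((r \<odot>\<^bsub>part M 2\<^esub> X a \<ominus>\<^bsub>part M 2\<^esub> w 1 a) \<oplus>\<^bsub>part M 2\<^esub> \<alpha> 2 b \<oplus>\<^bsub>part M 2\<^esub> bd M 3 c,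
     (\<ominus>\<^bsub>part K 3\<^esub> z 2 b) \<oplus>\<^bsub>part K 3\<^esub> r \<odot>\<^bsub>part K 3\<^esub> \<beta> 3 c \<ominus>\<^bsub>part K 3\<^esub> bd K 4 d,
     (\<ominus>\<^bsub>part M 4\<^esub> w 3 c) \<oplus>\<^bsub>part M 4\<^esub> \<alpha> 4 d,
     \<zero>\<^bsub>part K 0\<^esub>)"

fun g_odd :: "'m \<times> 'k \<times> 'm \<times> 'k \<Rightarrow> 'm \<times> 'k \<times> 'm \<times> 'k" where
  "g_odd (a, b, c, d) =
    (p12 (bd M 2 a),
     (r \<odot>\<^bsub>part K 2\<^esub> \<beta> 2 a \<ominus>\<^bsub>part K 2\<^esub> Y a) \<ominus>\<^bsub>part K 2\<^esub> bd K 3 b,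
     (r \<odot>\<^bsub>part M 3\<^esub> adjoint X a \<oplus>\<^bsub>part M 3\<^esub> w 2 a) \<oplus>\<^bsub>part M 3\<^esub> \<alpha> 3 b \<oplus>\<^bsub>part M 3\<^esub> bd M 4 c,
     z 3 b \<oplus>\<^bsub>part K 4\<^esub> r \<odot>\<^bsub>part K 4\<^esub> \<beta> 4 c)"

definition G'_even :: "('p, 'm \<times> 'k \<times> 'm \<times> 'k) module" where
  "G'_even = (part M 1)\<lparr>carrier := M12\<rparr> \<boxplus> part K 2 \<boxplus> (part M 3)\<lparr>carrier := M32\<rparr>
     \<boxplus> zero_module (part K 0)"

definition G'_odd :: "('p, 'm \<times> 'k \<times> 'm \<times> 'k) module" where
  "G'_odd = part M 2 \<boxplus> zero_module (part K 0) \<boxplus> zero_module (part M 0) \<boxplus> zero_module (part K 0)"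

fun g'_even :: "'m \<times> 'k \<times> 'm \<times> 'k \<Rightarrow> 'm \<times> 'k \<times> 'm \<times> 'k" where
  "g'_even (a, b, c, d) =
    ((r \<odot>\<^bsub>part M 2\<^esub> X a \<ominus>\<^bsub>part M 2\<^esub> w 1 a)
       \<oplus>\<^bsub>part M 2\<^esub> (\<alpha> 2 b \<oplus>\<^bsub>part M 2\<^esub> inv r \<odot>\<^bsub>part M 2\<^esub> W b) \<oplus>\<^bsub>part M 2\<^esub> bd M 3 c,
     \<zero>\<^bsub>part K 0\<^esub>, \<zero>\<^bsub>part M 0\<^esub>, \<zero>\<^bsub>part K 0\<^esub>)"

fun g'_odd :: "'m \<times> 'k \<times> 'm \<times> 'k \<Rightarrow> 'm \<times> 'k \<times> 'm \<times> 'k" where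
  "g'_odd (a, b, c, d) =
    (p12 (bd M 2 a),
     r \<odot>\<^bsub>part K 2\<^esub> \<beta> 2 a \<ominus>\<^bsub>part K 2\<^esub> Y a,
     p32 (r \<odot>\<^bsub>part M 3\<^esub> adjoint X a \<oplus>\<^bsub>part M 3\<^esub> w 2 a),
     \<zero>\<^bsub>part K 0\<^esub>)"

text \<open>\<open>L\<close>, \<open>l\<close> (and \<open>L'\<close>, \<open>l'\<close>) are the modules and maps over \<open>P\<close> whose images under
  \<open>- \<otimes>\<^sub>P P/(f)\<close> are \<open>N\<close>, \<open>n\<close> (and \<open>N'\<close>, \<open>n'\<close>); over \<open>P\<close> they need not form a
  complex. Since the functor is additive, the image of a direct sum (of a block matrix) is the
  direct sum (the block matrix) of the images.\<close>

definition L0 :: "('p, 'm \<times> 'k \<times> 'm \<times> 'k) module" where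
  "L0 = zero_module (part M 0) \<boxplus> part K 0 \<boxplus> zero_module (part M 0) \<boxplus> zero_module (part K 0)"

definition L1 :: "('p, 'm \<times> 'k \<times> 'm \<times> 'k) module" where
  "L1 = zero_module (part M 0) \<boxplus> part K 1 \<boxplus> zero_module (part M 0) \<boxplus> zero_module (part K 0)"

definition L2 :: "('p, 'm \<times> 'k \<times> 'm \<times> 'k) module" where
  "L2 = (part M 1)\<lparr>carrier := M12\<rparr> \<boxplus> part K 2 \<boxplus> zero_module (part M 0) \<boxplus> zero_module (part K 0)"

definition L3 :: "('p, 'm \<times> 'k \<times> 'm \<times> 'k) module" where
  "L3 = part M 2 \<boxplus> part K 3 \<boxplus> zero_module (part M 0) \<boxplus> zero_module (part K 0)"

fun l1 :: "'m \<times> 'k \<times> 'm \<times> 'k \<Rightarrow> 'm \<times> 'k \<times> 'm \<times> 'k" where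
  "l1 (a, b, c, d) = (\<zero>\<^bsub>part M 0\<^esub>, \<ominus>\<^bsub>part K 0\<^esub> bd K 1 b, \<zero>\<^bsub>part M 0\<^esub>, \<zero>\<^bsub>part K 0\<^esub>)"

text \<open>In \<open>z\<^sub>0 \<circ> m\<^sub>1\<close> the modules \<open>M\<^sub>0\<close> and \<open>K\<^sub>0\<close> are both identified with \<open>P\<close>.\<close>

fun l2 :: "'m \<times> 'k \<times> 'm \<times> 'k \<Rightarrow> 'm \<times> 'k \<times> 'm \<times> 'k" where
  "l2 (a, b, c, d) =
    (\<zero>\<^bsub>part M 0\<^esub>,
     (r \<odot>\<^bsub>part K 1\<^esub> \<beta> 1 a \<oplus>\<^bsub>part K 1\<^esub> z 0 (coef P M (bd M 1 a) \<odot>\<^bsub>part K 0\<^esub> gone K))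
       \<ominus>\<^bsub>part K 1\<^esub> bd K 2 b,
     \<zero>\<^bsub>part M 0\<^esub>, \<zero>\<^bsub>part K 0\<^esub>)"

fun l3 :: "'m \<times> 'k \<times> 'm \<times> 'k \<Rightarrow> 'm \<times> 'k \<times> 'm \<times> 'k" where
  "l3 (a, b, c, d) =
    (p12 (bd M 2 a),
     (r \<odot>\<^bsub>part K 2\<^esub> \<beta> 2 a \<ominus>\<^bsub>part K 2\<^esub> Y a) \<ominus>\<^bsub>part K 2\<^esub> bd K 3 b,
     \<zero>\<^bsub>part M 0\<^esub>, \<zero>\<^bsub>part K 0\<^esub>)"

fun l4 :: "'m \<times> 'k \<times> 'm \<times> 'k \<Rightarrow> 'm \<times> 'k \<times> 'm \<times> 'k" where
  "l4 (a, b, c, d) =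
    ((r \<odot>\<^bsub>part M 2\<^esub> X a \<ominus>\<^bsub>part M 2\<^esub> w 1 a) \<oplus>\<^bsub>part M 2\<^esub> \<alpha> 2 b \<oplus>\<^bsub>part M 2\<^esub> bd M 3 c,
     (\<ominus>\<^bsub>part K 3\<^esub> z 2 b) \<oplus>\<^bsub>part K 3\<^esub> r \<odot>\<^bsub>part K 3\<^esub> \<beta> 3 c \<ominus>\<^bsub>part K 3\<^esub> bd K 4 d,
     \<zero>\<^bsub>part M 0\<^esub>, \<zero>\<^bsub>part K 0\<^esub>)"

definition L :: "nat \<Rightarrow> ('p, 'm \<times> 'k \<times> 'm \<times> 'k) module" where
  "L i = (if i = 0 then L0 else if i = 1 then L1 else if i = 2 then L2 else if i = 3 then L3
          else if even i then G_even else G_odd)"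

definition l :: "nat \<Rightarrow> 'm \<times> 'k \<times> 'm \<times> 'k \<Rightarrow> 'm \<times> 'k \<times> 'm \<times> 'k" where
  "l i = (if i = 1 then l1 else if i = 2 then l2 else if i = 3 then l3 else if i = 4 then l4
          else if odd i then g_odd else g_even)"

fun l'3 :: "'m \<times> 'k \<times> 'm \<times> 'k \<Rightarrow> 'm \<times> 'k \<times> 'm \<times> 'k" where
  "l'3 (a, b, c, d) =
    (p12 (bd M 2 a),
     r \<odot>\<^bsub>part K 2\<^esub> \<beta> 2 a \<ominus>\<^bsub>part K 2\<^esub> Y a,
     \<zero>\<^bsub>part M 0\<^esub>, \<zero>\<^bsub>part K 0\<^esub>)"

definition L' :: "nat \<Rightarrow> ('p, 'm \<times> 'k \<times> 'm \<times> 'k) module" where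
  "L' i = (if i = 0 then L0 else if i = 1 then L1 else if i = 2 then L2
           else if odd i then G'_odd else G'_even)"

definition l' :: "nat \<Rightarrow> 'm \<times> 'k \<times> 'm \<times> 'k \<Rightarrow> 'm \<times> 'k \<times> 'm \<times> 'k" where
  "l' i = (if i = 1 then l1 else if i = 2 then l2 else if i = 3 then l'3
           else if even i then g'_even else g'_odd)"

abbreviation Pbar :: "'p set ring" where
  "Pbar \<equiv> P Quot (PIdl f)"

abbreviation bar :: "('p, 'a) module \<Rightarrow> ('p set, (('a \<times> 'p set) \<Rightarrow>\<^sub>0 int) set) module" where
  "bar \<equiv> extend_scalars P Pbar (\<lambda>p. PIdl f +> p)"

abbreviation bar_map :: "('p, 'b) module \<Rightarrow> ('a \<Rightarrow> 'b)
    \<Rightarrow> (('a \<times> 'p set) \<Rightarrow>\<^sub>0 int) set \<Rightarrow> (('b \<times> 'p set) \<Rightarrow>\<^sub>0 int) set" where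
  "bar_map \<equiv> extend_scalars_map P Pbar (\<lambda>p. PIdl f +> p)"

definition N where "N i = bar (L i)"

definition n where "n i = bar_map (L (i - 1)) (l i)"

definition N' where "N' i = bar (L' i)"

definition n' where "n' i = bar_map (L' (i - 1)) (l' i)"

definition KKbar :: "'p set set" where
  "KKbar = Idl\<^bsub>Pbar\<^esub> ((\<lambda>p. PIdl f +> p) ` KK)"

end

locale linkage_data = linkage_params +
  assumes cring_P: "cring P"
    and noetherian_P: "noetherian_ring P"
    and f_regular: "regular_element P f"
    and KK_koszul: "\<exists>as. length as = 4 \<and> regular_sequence P as \<and> KK = Idl (set as) \<and>
      koszul_complex P as K"
    and K_resolution: "free_resolution P (part K) (bd K) (quot_module P KK)"
    and K_duality: "poincare_duality P K"
    and M_dgg: "dgg_algebra P M"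
    and M_duality: "poincare_duality P M"
    and M_resolution: "free_resolution P (part M) (bd M) (quot_module P (colon_ideal P KK f))"
    and M_length: "\<forall>i>4. carrier (part M i) = {\<zero>\<^bsub>part M i\<^esub>}"
    and M11_submodule: "submodule M11 P (part M 1)"
    and M12_submodule: "submodule M12 P (part M 1)"
    and M1_sum: "internal_direct_sum (part M 1) M11 M12"
    and M11_free: "free_of_rank P ((part M 1)\<lparr>carrier := M11\<rparr>) 4"
    and M12_free: "free_module P ((part M 1)\<lparr>carrier := M12\<rparr>)"
    and M11_image: "(\<lambda>\<theta>. coef P M (bd M 1 \<theta>)) ` M11 = KK"
    and orK_iso: "orK \<in> module_iso P (part K 4) (ring_module P)"
    and orM_iso: "orM \<in> module_iso P (part M 4) (ring_module P)"
    and \<alpha>_hom: "dgg_hom P K M \<alpha>"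
    and \<alpha>1_iso: "(\<lambda>\<phi>. p11 (\<alpha> 1 \<phi>)) \<in> module_iso P (part K 1) ((part M 1)\<lparr>carrier := M11\<rparr>)"
    and \<alpha>1_k1: "\<forall>\<phi>\<in>carrier (part K 1). coef P M (bd M 1 (p11 (\<alpha> 1 \<phi>))) = coef P K (bd K 1 \<phi>)"
    and \<alpha>1_p12: "\<forall>\<phi>\<in>carrier (part K 1). p12 (\<alpha> 1 \<phi>) = \<zero>\<^bsub>part M 1\<^esub>"
    and r_closed: "r \<in> carrier P"
    and \<sigma>_closed: "\<sigma> \<in> carrier (part K 1)"
    and f_eq: "f = r \<otimes> \<beta>01 \<oplus> coef P K (bd K 1 \<sigma>)"
    and X_hom: "X \<in> module_hom P (part M 1) (part M 2)"
    and X_a: "\<forall>\<phi>\<in>carrier (part K 1). X (\<alpha> 1 \<phi>) = \<zero>\<^bsub>part M 2\<^esub>"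
    and X_b: "\<forall>\<theta>\<in>carrier (part M 1).
      bd M 2 (X \<theta>) = \<beta>01 \<odot>\<^bsub>part M 1\<^esub> \<theta> \<ominus>\<^bsub>part M 1\<^esub> \<alpha> 1 (\<beta> 1 \<theta>)"
    and X_c: "\<forall>\<theta>\<in>carrier (part M 2).
      X (bd M 2 \<theta>) \<oplus>\<^bsub>part M 2\<^esub> bd M 3 (adjoint X \<theta>)
        = \<beta>01 \<odot>\<^bsub>part M 2\<^esub> \<theta> \<ominus>\<^bsub>part M 2\<^esub> \<alpha> 2 (\<beta> 2 \<theta>)"
    and X_d: "\<forall>\<theta>\<in>carrier (part M 1). adjoint X (X \<theta>) = \<zero>\<^bsub>part M 3\<^esub>"
    and X_e: "\<forall>\<phi>\<in>carrier (part K 2). adjoint X (\<alpha> 2 \<phi>) = \<zero>\<^bsub>part M 3\<^esub>"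

end

theory Submission
  imports Defs
begin

text \<open>Reduction modulo \<open>f\<close>. The module \<open>A \<otimes> P/(f)\<close> is \<open>A/fA\<close>: every tensor has the form \<open>x \<otimes> 1\<close>,
  and \<open>x \<otimes> 1 = 0\<close> exactly if \<open>x \<in> fA\<close> (\<open>\<tau>_surj\<close>, \<open>\<tau>_kernel\<close>). So both claims are claims
  about congruences modulo \<open>f\<close> between maps over \<open>P\<close> (\<open>exact_mod\<close>, \<open>resolution_bar\<close>).

  In high degrees everything rests on matrix factorizations. If \<open>g\<close> and \<open>h\<close> are maps of free modules
  with \<open>gh = f\<close> and \<open>hg = f\<close>, then \<open>gx = fy\<close> gives \<open>fx = hgx = fhy\<close>, so \<open>x = hy\<close> because \<open>f\<close> is
  regular (\<open>factorization_exact_mod\<close>). The maps \<open>g_even\<close> and \<open>g_odd\<close> are such a pair. Indeed \<open>\<beta>\<close> is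
  the adjoint of \<open>\<alpha>\<close> under the two dualities, hence a chain map, and \<open>\<beta>\<alpha> = \<beta>\<^sub>0(1)\<close>. Multiplication
  by \<open>\<sigma>\<close> is, by the Leibniz rule, a null homotopy of \<open>k\<^sub>1(\<sigma>)\<close> on \<open>K\<close> and, through \<open>\<alpha>\<close>, on \<open>M\<close>. The
  maps \<open>X\<close> and \<open>X\<^sup>\<dagger>\<close> form a homotopy from \<open>\<alpha>\<beta>\<close> to \<open>\<beta>\<^sub>0(1)\<close> on \<open>M\<close>. Since \<open>f = r\<beta>\<^sub>0(1) + k\<^sub>1(\<sigma>)\<close>,
  \<open>r\<close> times the second homotopy and multiplication by \<open>\<sigma>\<close> add up to one for \<open>f\<close>, with \<open>\<alpha>\<close> and
  \<open>r\<beta>\<close> as the connecting maps between \<open>M\<close> and \<open>K\<close>. The one relation needed that does not follow by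
  rewriting is that \<open>X\<^sup>\<dagger>(\<theta> \<cdot> \<alpha>\<^sub>1\<sigma>) = X(\<theta>) \<cdot> \<alpha>\<^sub>1\<sigma>\<close> (\<open>Xd_w1\<close>). The
  summand \<open>M\<^sub>1\<^sub>,\<^sub>1\<close> of \<open>M\<^sub>1\<close> does not occur because \<open>\<alpha>\<^sub>1\<close> identifies it with \<open>K\<^sub>1\<close>, and the map \<open>Y\<close>
  accounts for its removal.

  In low degrees \<open>N\<close> is a truncation of this periodic complex. In degree four the
  map, and in degree three the chain as well, lacks components of the factorization. For a cycle modulo \<open>f\<close>
  the missing components of its image under \<open>g_even\<close> or \<open>g_odd\<close> are, or can be made,
  divisible by \<open>f\<close>, as \<open>M\<close> and \<open>K\<close> remain exact modulo \<open>f\<close> in degrees at least two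
  (\<open>exact_4\<close>, \<open>exact_3\<close>). In degree two a cycle \<open>(a, b)\<close> gives a cycle
  \<open>a - \<alpha>\<^sub>1(c)\<close> of \<open>M\<^sub>1\<close> (\<open>exact_2\<close>). In degree one, \<open>k\<^sub>1(\<phi>) = fp\<close> says that \<open>p\<close> lies in
  the colon ideal \<open>KK : f\<close>, the image of \<open>m\<^sub>1\<close>. This is where it matters which ideal \<open>M\<close> resolves
  (\<open>exact_1\<close>).

  If \<open>r\<close> is a unit, then \<open>r\<beta>\<^sub>3 : M\<^sub>3\<^sub>,\<^sub>1 \<rightarrow> K\<^sub>3\<close> and \<open>r\<beta>\<^sub>4 : M\<^sub>4 \<rightarrow> K\<^sub>4\<close> are isomorphisms, and the
  factorization that is left after cancelling along them is the pair \<open>g'_even\<close>, \<open>g'_odd\<close>. The cancellation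
  is realised by embeddings \<open>\<iota>\<close> and \<open>\<epsilon>\<close> of the small modules into the large ones that
  intertwine the two pairs (\<open>g_even_\<iota>\<close>, \<open>g_odd_\<epsilon>\<close>), so that the identities for the small pair
  follow from those for the large one. The module \<open>M\<^sub>3\<^sub>,\<^sub>2\<close> that appears here is free because it is dual
  to \<open>M\<^sub>1\<^sub>,\<^sub>2\<close> (\<open>M32_fg_free\<close>).\<close>

section \<open>Modules and homomorphisms\<close>

text \<open>Degrees are written as numerals, so \<open>1\<close> is kept as the normal form of \<open>Suc 0\<close>.\<close>

declare One_nat_def [simp del] One_nat_def [symmetric, simp]

lemma (in abelian_group) diff_zero_iff:
  assumes "x \<in> carrier G" "y \<in> carrier G"
  shows "x \<ominus> y = \<zero> \<longleftrightarrow> x = y"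
proof
  assume "x \<ominus> y = \<zero>"
  then have "\<ominus> (\<ominus> y) = x" using assms by (intro minus_equality) (auto simp: a_minus_def)
  then show "x = y" using assms by simp
qed (use assms in \<open>simp add: a_minus_def r_neg\<close>)

lemma (in abelian_group) add_diff:
  assumes "x \<in> carrier G" "y \<in> carrier G"
  shows "x \<oplus> (y \<ominus> x) = y"
  using assms by (simp add: a_minus_def a_lcomm[of x y] r_neg)

text \<open>Equips modules with the normalization method \<open>algebra\<close>, so that the identities between block matrices
  below reduce to computations with generators. An iterated scalar multiple is normalized to a multiple by
  the product.\<close>

lemmas (in module) module_simprules
  [algebra module "ring.zero M" "ring.add M" "a_inv M" "a_minus M" "smult M"
    "monoid.mult R" "one R" "ring.zero R" "ring.add R" "a_inv R"] =
  M.a_closed M.zero_closed M.a_inv_closed M.minus_closed smult_closed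
  R.a_closed R.zero_closed R.a_inv_closed R.minus_closed R.m_closed R.one_closed
  M.a_assoc M.l_zero M.l_neg M.a_comm M.minus_eq M.r_zero M.r_neg M.r_neg2 M.r_neg1
  M.minus_add M.minus_minus M.a_lcomm
  smult_l_distr smult_r_distr smult_assoc1[symmetric] smult_one smult_r_minus smult_l_minus
  smult_l_null smult_r_null
  R.m_assoc R.m_comm R.m_lcomm R.l_one R.r_one R.l_null R.r_null R.l_minus R.r_minus
  R.r_distr R.l_distr R.minus_eq

lemma module_homI:
  assumes "\<And>x. x \<in> carrier A \<Longrightarrow> h x \<in> carrier B"
    and "\<And>x y. x \<in> carrier A \<Longrightarrow> y \<in> carrier A \<Longrightarrow> h (x \<oplus>\<^bsub>A\<^esub> y) = h x \<oplus>\<^bsub>B\<^esub> h y"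
    and "\<And>a x. a \<in> carrier R \<Longrightarrow> x \<in> carrier A \<Longrightarrow> h (a \<odot>\<^bsub>A\<^esub> x) = a \<odot>\<^bsub>B\<^esub> h x"
  shows "h \<in> module_hom R A B"
  using assms by (auto simp: module_hom_def)

lemma module_hom_closed: "h \<in> module_hom R A B \<Longrightarrow> x \<in> carrier A \<Longrightarrow> h x \<in> carrier B"
  by (auto simp: module_hom_def)

lemma module_hom_add:
  "h \<in> module_hom R A B \<Longrightarrow> x \<in> carrier A \<Longrightarrow> y \<in> carrier A \<Longrightarrow> h (x \<oplus>\<^bsub>A\<^esub> y) = h x \<oplus>\<^bsub>B\<^esub> h y"
  by (auto simp: module_hom_def)

lemma module_hom_smult:
  "h \<in> module_hom R A B \<Longrightarrow> a \<in> carrier R \<Longrightarrow> x \<in> carrier A \<Longrightarrow> h (a \<odot>\<^bsub>A\<^esub> x) = a \<odot>\<^bsub>B\<^esub> h x"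
  by (auto simp: module_hom_def)

lemma module_hom_zero:
  assumes "h \<in> module_hom R A B" "module R A" "module R B"
  shows "h \<zero>\<^bsub>A\<^esub> = \<zero>\<^bsub>B\<^esub>"
proof -
  interpret A: module R A by fact
  interpret B: module R B by fact
  have "h (\<zero>\<^bsub>R\<^esub> \<odot>\<^bsub>A\<^esub> \<zero>\<^bsub>A\<^esub>) = \<zero>\<^bsub>R\<^esub> \<odot>\<^bsub>B\<^esub> h \<zero>\<^bsub>A\<^esub>"
    using assms(1) by (intro module_hom_smult) auto
  then show ?thesis
    using module_hom_closed[OF assms(1)] by simp
qed

lemma module_hom_neg:
  assumes "h \<in> module_hom R A B" "module R A" "module R B" "x \<in> carrier A"
  shows "h (\<ominus>\<^bsub>A\<^esub> x) = \<ominus>\<^bsub>B\<^esub> h x"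
proof -
  interpret A: module R A by fact
  interpret B: module R B by fact
  have "h ((\<ominus>\<^bsub>R\<^esub> \<one>\<^bsub>R\<^esub>) \<odot>\<^bsub>A\<^esub> x) = (\<ominus>\<^bsub>R\<^esub> \<one>\<^bsub>R\<^esub>) \<odot>\<^bsub>B\<^esub> h x"
    using assms(1,4) by (intro module_hom_smult) auto
  then show ?thesis
    using module_hom_closed[OF assms(1,4)] assms(4) by (simp add: A.smult_l_minus B.smult_l_minus)
qed

lemma module_hom_minus:
  assumes "h \<in> module_hom R A B" "module R A" "module R B" "x \<in> carrier A" "y \<in> carrier A"
  shows "h (x \<ominus>\<^bsub>A\<^esub> y) = h x \<ominus>\<^bsub>B\<^esub> h y"
proof -
  interpret A: module R A by fact
  interpret B: module R B by fact
  show ?thesis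
    using assms module_hom_closed[OF assms(1)]
    by (simp add: a_minus_def module_hom_add[OF assms(1)] module_hom_neg[OF assms(1-3)])
qed

lemma module_hom_finsum:
  assumes "h \<in> module_hom R A B" "module R A" "module R B" "finite I" "g \<in> I \<rightarrow> carrier A"
  shows "h (\<Oplus>\<^bsub>A\<^esub>i\<in>I. g i) = (\<Oplus>\<^bsub>B\<^esub>i\<in>I. h (g i))"
  using assms(4,5)
proof (induction I)
  case empty
  interpret A: module R A by fact
  interpret B: module R B by fact
  show ?case using module_hom_zero[OF assms(1-3)] by simp
next
  case (insert i I)
  interpret A: module R A by fact
  interpret B: module R B by fact
  have "(\<lambda>i. h (g i)) \<in> insert i I \<rightarrow> carrier B"
    using insert.prems module_hom_closed[OF assms(1)] by auto
  then show ?case using insert by (simp add: module_hom_add[OF assms(1)] Pi_def)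
qed

lemma module_hom_comp:
  "g \<in> module_hom R B C \<Longrightarrow> h \<in> module_hom R A B \<Longrightarrow> (\<lambda>x. g (h x)) \<in> module_hom R A C"
  by (auto simp: module_hom_def Pi_def)

lemma module_hom_plus:
  assumes "module R B" "h \<in> module_hom R A B" "g \<in> module_hom R A B"
  shows "(\<lambda>x. h x \<oplus>\<^bsub>B\<^esub> g x) \<in> module_hom R A B"
proof -
  interpret B: module R B by fact
  show ?thesis
    using assms(2,3) by (auto simp: module_hom_def Pi_def B.a_ac B.smult_r_distr)
qed

lemma module_hom_scale:
  assumes "module R B" "h \<in> module_hom R A B" "a \<in> carrier R"
  shows "(\<lambda>x. a \<odot>\<^bsub>B\<^esub> h x) \<in> module_hom R A B"
proof -
  interpret B: module R B by fact
  show ?thesis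
    using assms(2,3)
    by (auto simp: module_hom_def Pi_def B.smult_r_distr B.smult_assoc1[symmetric] B.m_comm)
qed

lemma module_hom_uminus:
  assumes "module R B" "h \<in> module_hom R A B"
  shows "(\<lambda>x. \<ominus>\<^bsub>B\<^esub> h x) \<in> module_hom R A B"
proof -
  interpret B: module R B by fact
  show ?thesis
    using assms(2)
    by (auto simp: module_hom_def Pi_def B.minus_add B.smult_r_minus)
qed

lemma module_hom_diff:
  assumes "module R B" "h \<in> module_hom R A B" "g \<in> module_hom R A B"
  shows "(\<lambda>x. h x \<ominus>\<^bsub>B\<^esub> g x) \<in> module_hom R A B"
  unfolding a_minus_def by (intro module_hom_plus module_hom_uminus assms)

lemma module_hom_const_zero:
  assumes "module R B"
  shows "(\<lambda>x. \<zero>\<^bsub>B\<^esub>) \<in> module_hom R A B"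
proof -
  interpret B: module R B by fact
  show ?thesis by (auto simp: module_hom_def)
qed

lemma module_isoD: "h \<in> module_iso R A B \<Longrightarrow> h \<in> module_hom R A B"
  "h \<in> module_iso R A B \<Longrightarrow> bij_betw h (carrier A) (carrier B)"
  by (auto simp: module_iso_def)

lemma direct_sum_simps [simp]:
  "carrier (A \<boxplus> B) = carrier A \<times> carrier B"
  "\<zero>\<^bsub>A \<boxplus> B\<^esub> = (\<zero>\<^bsub>A\<^esub>, \<zero>\<^bsub>B\<^esub>)"
  "(x, y) \<oplus>\<^bsub>A \<boxplus> B\<^esub> (x', y') = (x \<oplus>\<^bsub>A\<^esub> x', y \<oplus>\<^bsub>B\<^esub> y')"
  "a \<odot>\<^bsub>A \<boxplus> B\<^esub> (x, y) = (a \<odot>\<^bsub>A\<^esub> x, a \<odot>\<^bsub>B\<^esub> y)"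
  by (auto simp: direct_sum_def)

lemma module_direct_sum:
  assumes "module R A" "module R B"
  shows "module R (A \<boxplus> B)"
proof -
  interpret A: module R A by fact
  interpret B: module R B by fact
  show ?thesis
  proof (rule moduleI)
    show "abelian_group (A \<boxplus> B)"
    proof (rule abelian_groupI)
      fix x assume "x \<in> carrier (A \<boxplus> B)"
      then show "\<exists>y\<in>carrier (A \<boxplus> B). y \<oplus>\<^bsub>A \<boxplus> B\<^esub> x = \<zero>\<^bsub>A \<boxplus> B\<^esub>"
        by (intro bexI[of _ "(\<ominus>\<^bsub>A\<^esub> fst x, \<ominus>\<^bsub>B\<^esub> snd x)"]) (auto simp: A.l_neg B.l_neg)
    qed (auto simp: A.a_ac B.a_ac)
  qed (auto simp: A.is_cring A.smult_l_distr B.smult_l_distr A.smult_r_distr B.smult_r_distr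
      A.smult_assoc1 B.smult_assoc1 intro: A.R.cring_axioms)
qed

lemma module_hom_Pair:
  "h \<in> module_hom R C A \<Longrightarrow> g \<in> module_hom R C B \<Longrightarrow> (\<lambda>x. (h x, g x)) \<in> module_hom R C (A \<boxplus> B)"
  by (auto simp: module_hom_def Pi_def)

lemma zero_module_simps [simp]:
  "carrier (zero_module A) = {\<zero>\<^bsub>A\<^esub>}" "\<zero>\<^bsub>zero_module A\<^esub> = \<zero>\<^bsub>A\<^esub>"
  "x \<oplus>\<^bsub>zero_module A\<^esub> y = x \<oplus>\<^bsub>A\<^esub> y" "a \<odot>\<^bsub>zero_module A\<^esub> x = a \<odot>\<^bsub>A\<^esub> x"
  by (auto simp: zero_module_def)

lemma module_zero_module:
  assumes "module R A" shows "module R (zero_module A)"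
proof -
  interpret A: module R A by fact
  have "submodule {\<zero>\<^bsub>A\<^esub>} R A" by (rule A.submoduleI) auto
  from submodule.submodule_is_module[OF this assms] show ?thesis
    by (simp add: zero_module_def)
qed

lemma module_hom_into_sub:
  "h \<in> module_hom R A (B\<lparr>carrier := U\<rparr>) \<Longrightarrow> U \<subseteq> carrier B \<Longrightarrow> h \<in> module_hom R A B"
  by (auto simp: module_hom_def)

lemma module_hom_zero_module:
  assumes "module R B" shows "(\<lambda>x. \<zero>\<^bsub>B\<^esub>) \<in> module_hom R A (zero_module B)"
  using module_hom_const_zero[OF module_zero_module[OF assms], of A] by simp

section \<open>Coordinates and free modules\<close>

text \<open>An isomorphism of \<open>A\<close> with \<open>R\<^sup>I\<close>. Unlike a basis, which is a subset of \<open>A\<close>, coordinates have an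
  index set that survives quotients, duals and direct sums, also when distinct unit vectors
  collapse because the ring is trivial.\<close>

definition coords :: "('r, 'x) ring_scheme \<Rightarrow> ('r, 'a) module \<Rightarrow> 'i set \<Rightarrow> ('a \<Rightarrow> 'i \<Rightarrow> 'r) \<Rightarrow> bool" where
  "coords R A I \<phi> \<longleftrightarrow> finite I \<and> bij_betw \<phi> (carrier A) (I \<rightarrow>\<^sub>E carrier R) \<and>
    (\<forall>x\<in>carrier A. \<forall>y\<in>carrier A. \<forall>i\<in>I. \<phi> (x \<oplus>\<^bsub>A\<^esub> y) i = \<phi> x i \<oplus>\<^bsub>R\<^esub> \<phi> y i) \<and>
    (\<forall>a\<in>carrier R. \<forall>x\<in>carrier A. \<forall>i\<in>I. \<phi> (a \<odot>\<^bsub>A\<^esub> x) i = a \<otimes>\<^bsub>R\<^esub> \<phi> x i)"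

lemma coordsD:
  assumes "coords R A I \<phi>"
  shows "finite I" "bij_betw \<phi> (carrier A) (I \<rightarrow>\<^sub>E carrier R)"
    "\<lbrakk>x \<in> carrier A; y \<in> carrier A; i \<in> I\<rbrakk> \<Longrightarrow> \<phi> (x \<oplus>\<^bsub>A\<^esub> y) i = \<phi> x i \<oplus>\<^bsub>R\<^esub> \<phi> y i"
    "\<lbrakk>a \<in> carrier R; x \<in> carrier A; i \<in> I\<rbrakk> \<Longrightarrow> \<phi> (a \<odot>\<^bsub>A\<^esub> x) i = a \<otimes>\<^bsub>R\<^esub> \<phi> x i"
    "\<lbrakk>x \<in> carrier A; i \<in> I\<rbrakk> \<Longrightarrow> \<phi> x i \<in> carrier R"
  using assms by (auto simp: coords_def bij_betw_def)

lemma coords_eqI: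
  assumes "coords R A I \<phi>" "x \<in> carrier A" "y \<in> carrier A" "\<And>i. i \<in> I \<Longrightarrow> \<phi> x i = \<phi> y i"
  shows "x = y"
proof -
  have "\<phi> x \<in> I \<rightarrow>\<^sub>E carrier R" "\<phi> y \<in> I \<rightarrow>\<^sub>E carrier R"
    using assms(1-3) by (auto simp: coords_def bij_betw_def)
  then have "\<phi> x = \<phi> y" using assms(4) by (intro PiE_ext) auto
  then show ?thesis using assms(1-3) by (auto simp: coords_def bij_betw_def inj_on_def)
qed

lemma coords_surj:
  assumes "coords R A I \<phi>" "\<And>i. i \<in> I \<Longrightarrow> c i \<in> carrier R"
  obtains x where "x \<in> carrier A" "\<And>i. i \<in> I \<Longrightarrow> \<phi> x i = c i"
proof -
  have "restrict c I \<in> \<phi> ` carrier A"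
    using assms by (auto simp: coords_def bij_betw_def)
  then obtain x where "x \<in> carrier A" "\<phi> x = restrict c I" by auto
  then show ?thesis using that[of x] by simp
qed

lemma restrict_eq_at: "restrict f I = restrict g I \<Longrightarrow> i \<in> I \<Longrightarrow> f i = g i"
  by (metis restrict_apply')

lemma coordsI:
  assumes "finite I"
    and "\<And>x i. x \<in> carrier A \<Longrightarrow> i \<in> I \<Longrightarrow> \<phi> x i \<in> carrier R"
    and "\<And>x y. x \<in> carrier A \<Longrightarrow> y \<in> carrier A \<Longrightarrow> (\<And>i. i \<in> I \<Longrightarrow> \<phi> x i = \<phi> y i) \<Longrightarrow> x = y"
    and "\<And>c. c \<in> I \<rightarrow>\<^sub>E carrier R \<Longrightarrow> \<exists>x\<in>carrier A. \<forall>i\<in>I. \<phi> x i = c i"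
    and "\<And>x y i. x \<in> carrier A \<Longrightarrow> y \<in> carrier A \<Longrightarrow> i \<in> I \<Longrightarrow> \<phi> (x \<oplus>\<^bsub>A\<^esub> y) i = \<phi> x i \<oplus>\<^bsub>R\<^esub> \<phi> y i"
    and "\<And>a x i. a \<in> carrier R \<Longrightarrow> x \<in> carrier A \<Longrightarrow> i \<in> I \<Longrightarrow> \<phi> (a \<odot>\<^bsub>A\<^esub> x) i = a \<otimes>\<^bsub>R\<^esub> \<phi> x i"
    and "module R A"
  shows "coords R A I (\<lambda>x. restrict (\<phi> x) I)"
proof -
  interpret A: module R A by fact
  have "inj_on (\<lambda>x. restrict (\<phi> x) I) (carrier A)"
    by (intro inj_onI assms(3)) (auto dest: restrict_eq_at)
  moreover have "(\<lambda>x. restrict (\<phi> x) I) ` carrier A = I \<rightarrow>\<^sub>E carrier R"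
  proof
    show "(\<lambda>x. restrict (\<phi> x) I) ` carrier A \<subseteq> I \<rightarrow>\<^sub>E carrier R" using assms(2) by auto
    show "I \<rightarrow>\<^sub>E carrier R \<subseteq> (\<lambda>x. restrict (\<phi> x) I) ` carrier A"
    proof
      fix c assume c: "c \<in> I \<rightarrow>\<^sub>E carrier R"
      then obtain x where "x \<in> carrier A" "\<forall>i\<in>I. \<phi> x i = c i" using assms(4) by blast
      then have "restrict (\<phi> x) I = c" using c by (auto simp: restrict_def fun_eq_iff PiE_def extensional_def)
      then show "c \<in> (\<lambda>x. restrict (\<phi> x) I) ` carrier A" using \<open>x \<in> carrier A\<close> by blast
    qed
  qed
  ultimately show ?thesis
    using assms(1,5,6) by (auto simp: coords_def bij_betw_def)
qed

lemma is_basis_finite_iff: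
  assumes "module R A" "finite B"
  shows "is_basis R A B \<longleftrightarrow> B \<subseteq> carrier A \<and>
    (\<forall>x\<in>carrier A. \<exists>!c. c \<in> B \<rightarrow>\<^sub>E carrier R \<and> x = (\<Oplus>\<^bsub>A\<^esub>b\<in>B. c b \<odot>\<^bsub>A\<^esub> b))"
proof -
  interpret A: module R A by fact
  have eq: "(\<Oplus>\<^bsub>A\<^esub>b\<in>{b \<in> B. c b \<noteq> \<zero>\<^bsub>R\<^esub>}. c b \<odot>\<^bsub>A\<^esub> b) = (\<Oplus>\<^bsub>A\<^esub>b\<in>B. c b \<odot>\<^bsub>A\<^esub> b)"
    if "c \<in> B \<rightarrow>\<^sub>E carrier R" "B \<subseteq> carrier A" for c
    using that assms(2) by (intro A.M.add.finprod_mono_neutral_cong_left) auto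
  show ?thesis
  proof (cases "B \<subseteq> carrier A")
    case True
    have "(c \<in> B \<rightarrow>\<^sub>E carrier R \<and> finite {b \<in> B. c b \<noteq> \<zero>\<^bsub>R\<^esub>} \<and>
       x = (\<Oplus>\<^bsub>A\<^esub>b\<in>{b \<in> B. c b \<noteq> \<zero>\<^bsub>R\<^esub>}. c b \<odot>\<^bsub>A\<^esub> b)) \<longleftrightarrow>
       (c \<in> B \<rightarrow>\<^sub>E carrier R \<and> x = (\<Oplus>\<^bsub>A\<^esub>b\<in>B. c b \<odot>\<^bsub>A\<^esub> b))" for c x
      using eq[OF _ True] assms(2) by auto
    then show ?thesis unfolding is_basis_def by simp
  qed (simp add: is_basis_def)
qed

lemma coords_of_basis:
  assumes "module R A" "finite B" "is_basis R A B"
  obtains \<phi> where "coords R A B \<phi>" "\<And>x. x \<in> carrier A \<Longrightarrow> x = (\<Oplus>\<^bsub>A\<^esub>b\<in>B. \<phi> x b \<odot>\<^bsub>A\<^esub> b)"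
proof -
  interpret A: module R A by fact
  have B: "B \<subseteq> carrier A"
    and ex: "\<And>x. x \<in> carrier A \<Longrightarrow> \<exists>!c. c \<in> B \<rightarrow>\<^sub>E carrier R \<and> x = (\<Oplus>\<^bsub>A\<^esub>b\<in>B. c b \<odot>\<^bsub>A\<^esub> b)"
    using assms by (auto simp: is_basis_finite_iff)
  define \<phi> where "\<phi> x = (THE c. c \<in> B \<rightarrow>\<^sub>E carrier R \<and> x = (\<Oplus>\<^bsub>A\<^esub>b\<in>B. c b \<odot>\<^bsub>A\<^esub> b))" for x
  have \<phi>: "\<phi> x \<in> B \<rightarrow>\<^sub>E carrier R" "x = (\<Oplus>\<^bsub>A\<^esub>b\<in>B. \<phi> x b \<odot>\<^bsub>A\<^esub> b)" if "x \<in> carrier A" for x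
    using theI'[OF ex[OF that]] unfolding \<phi>_def by blast+
  have \<phi>_eq: "\<phi> x = c" if "x \<in> carrier A" "c \<in> B \<rightarrow>\<^sub>E carrier R" "x = (\<Oplus>\<^bsub>A\<^esub>b\<in>B. c b \<odot>\<^bsub>A\<^esub> b)" for x c
    using ex[OF that(1)] \<phi>[OF that(1)] that(2,3) by blast
  have \<phi>_in: "\<phi> x b \<in> carrier R" if "x \<in> carrier A" "b \<in> B" for x b
    using \<phi>(1)[OF that(1)] that(2) by auto
  have add: "\<phi> (x \<oplus>\<^bsub>A\<^esub> y) = (\<lambda>b\<in>B. \<phi> x b \<oplus>\<^bsub>R\<^esub> \<phi> y b)" if xy: "x \<in> carrier A" "y \<in> carrier A" for x y
  proof (rule \<phi>_eq)
    have "x \<oplus>\<^bsub>A\<^esub> y = (\<Oplus>\<^bsub>A\<^esub>b\<in>B. \<phi> x b \<odot>\<^bsub>A\<^esub> b) \<oplus>\<^bsub>A\<^esub> (\<Oplus>\<^bsub>A\<^esub>b\<in>B. \<phi> y b \<odot>\<^bsub>A\<^esub> b)"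
      using \<phi>(2) xy by metis
    also have "\<dots> = (\<Oplus>\<^bsub>A\<^esub>b\<in>B. \<phi> x b \<odot>\<^bsub>A\<^esub> b \<oplus>\<^bsub>A\<^esub> \<phi> y b \<odot>\<^bsub>A\<^esub> b)"
      using B \<phi>_in xy by (intro A.M.finsum_addf[symmetric]) auto
    also have "\<dots> = (\<Oplus>\<^bsub>A\<^esub>b\<in>B. (\<lambda>b\<in>B. \<phi> x b \<oplus>\<^bsub>R\<^esub> \<phi> y b) b \<odot>\<^bsub>A\<^esub> b)"
      using B \<phi>_in xy by (intro A.M.finsum_cong') (auto simp: A.smult_l_distr subset_iff)
    finally show "x \<oplus>\<^bsub>A\<^esub> y = (\<Oplus>\<^bsub>A\<^esub>b\<in>B. (\<lambda>b\<in>B. \<phi> x b \<oplus>\<^bsub>R\<^esub> \<phi> y b) b \<odot>\<^bsub>A\<^esub> b)" .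
  qed (use xy \<phi>_in in auto)
  have smult: "\<phi> (a \<odot>\<^bsub>A\<^esub> x) = (\<lambda>b\<in>B. a \<otimes>\<^bsub>R\<^esub> \<phi> x b)" if xy: "x \<in> carrier A" "a \<in> carrier R" for x a
  proof (rule \<phi>_eq)
    have "a \<odot>\<^bsub>A\<^esub> x = a \<odot>\<^bsub>A\<^esub> (\<Oplus>\<^bsub>A\<^esub>b\<in>B. \<phi> x b \<odot>\<^bsub>A\<^esub> b)"
      using \<phi>(2) xy by metis
    also have "\<dots> = (\<Oplus>\<^bsub>A\<^esub>b\<in>B. a \<odot>\<^bsub>A\<^esub> (\<phi> x b \<odot>\<^bsub>A\<^esub> b))"
      using B \<phi>_in xy by (intro A.finsum_smult_ldistr assms) auto
    also have "\<dots> = (\<Oplus>\<^bsub>A\<^esub>b\<in>B. (\<lambda>b\<in>B. a \<otimes>\<^bsub>R\<^esub> \<phi> x b) b \<odot>\<^bsub>A\<^esub> b)"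
      using B \<phi>_in xy by (intro A.M.finsum_cong') (auto simp: A.smult_assoc1 subset_iff)
    finally show "a \<odot>\<^bsub>A\<^esub> x = (\<Oplus>\<^bsub>A\<^esub>b\<in>B. (\<lambda>b\<in>B. a \<otimes>\<^bsub>R\<^esub> \<phi> x b) b \<odot>\<^bsub>A\<^esub> b)" .
  qed (use xy \<phi>_in in auto)
  have inj: "inj_on \<phi> (carrier A)"
    by (rule inj_onI) (metis \<phi>(2))
  have "\<phi> ` carrier A = B \<rightarrow>\<^sub>E carrier R"
  proof
    show "B \<rightarrow>\<^sub>E carrier R \<subseteq> \<phi> ` carrier A"
    proof
      fix c assume c: "c \<in> B \<rightarrow>\<^sub>E carrier R"
      have "(\<Oplus>\<^bsub>A\<^esub>b\<in>B. c b \<odot>\<^bsub>A\<^esub> b) \<in> carrier A" using B c by (intro A.M.finsum_closed) auto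
      then have "\<phi> (\<Oplus>\<^bsub>A\<^esub>b\<in>B. c b \<odot>\<^bsub>A\<^esub> b) = c" using \<phi>_eq[OF _ c] by blast
      then show "c \<in> \<phi> ` carrier A" using \<open>_ \<in> carrier A\<close> by (rule image_eqI[OF sym])
    qed
  qed (use \<phi>(1) in auto)
  then have "coords R A B \<phi>"
    using inj assms(2) by (auto simp: coords_def bij_betw_def add smult)
  then show ?thesis using that[of \<phi>] \<phi>(2) by blast
qed

lemma coords_expand:
  assumes "module R A" "coords R A I \<phi>" "\<And>i. i \<in> I \<Longrightarrow> e i \<in> carrier A"
    and "\<And>i j. i \<in> I \<Longrightarrow> j \<in> I \<Longrightarrow> \<phi> (e i) j = (if i = j then \<one>\<^bsub>R\<^esub> else \<zero>\<^bsub>R\<^esub>)"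
    and "\<And>i. i \<in> I \<Longrightarrow> c i \<in> carrier R" "j \<in> I"
  shows "\<phi> (\<Oplus>\<^bsub>A\<^esub>i\<in>I. c i \<odot>\<^bsub>A\<^esub> e i) j = c j"
proof -
  interpret A: module R A by fact
  note D = coordsD[OF assms(2)]
  have z: "\<phi> \<zero>\<^bsub>A\<^esub> j = \<zero>\<^bsub>R\<^esub>" if "j \<in> I" for j
  proof -
    have "\<phi> (\<zero>\<^bsub>R\<^esub> \<odot>\<^bsub>A\<^esub> \<zero>\<^bsub>A\<^esub>) j = \<zero>\<^bsub>R\<^esub> \<otimes>\<^bsub>R\<^esub> \<phi> \<zero>\<^bsub>A\<^esub> j" using that by (intro D(4)) auto
    then show ?thesis using D(5)[of "\<zero>\<^bsub>A\<^esub>" j] that by simp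
  qed
  have "\<phi> (\<Oplus>\<^bsub>A\<^esub>i\<in>J. c i \<odot>\<^bsub>A\<^esub> e i) j = (if j \<in> J then c j else \<zero>\<^bsub>R\<^esub>)" if "J \<subseteq> I" for J
    using finite_subset[OF that D(1)] that
  proof (induction J)
    case empty
    then show ?case using z assms(6) by simp
  next
    case (insert i J)
    have "(\<lambda>i. c i \<odot>\<^bsub>A\<^esub> e i) \<in> J \<rightarrow> carrier A" using insert.prems assms(3,5) by auto
    moreover have "(\<Oplus>\<^bsub>A\<^esub>i\<in>J. c i \<odot>\<^bsub>A\<^esub> e i) \<in> carrier A" using calculation by (rule A.M.finsum_closed)
    ultimately show ?case using insert assms(3,4,5,6)
      by (auto simp: D(3,4))
  qed
  from this[of I] show ?thesis using assms(6) by simp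
qed

lemma fg_free_of_coords:
  assumes "module R A" "coords R A I \<phi>"
  shows "fg_free_module R A"
proof -
  interpret A: module R A by fact
  note D = coordsD[OF assms(2)]
  show ?thesis
  proof (cases "\<one>\<^bsub>R\<^esub> = \<zero>\<^bsub>R\<^esub>")
    case True
    \<comment> \<open>Over the trivial ring all unit vectors coincide, and the basis is empty.\<close>
    have "x = \<zero>\<^bsub>A\<^esub>" if "x \<in> carrier A" for x
      using A.smult_one[OF that] True that by simp
    then have "is_basis R A {}"
      by (subst is_basis_finite_iff) (use assms(1) in \<open>auto intro!: ex1I[of _ "\<lambda>_. undefined"]\<close>)
    then show ?thesis using assms(1) by (auto simp: fg_free_module_def)
  next
    case False
    have "\<exists>x. x \<in> carrier A \<and> (\<forall>j\<in>I. \<phi> x j = (if i = j then \<one>\<^bsub>R\<^esub> else \<zero>\<^bsub>R\<^esub>))" for i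
      by (rule coords_surj[OF assms(2), of "\<lambda>j. if i = j then \<one>\<^bsub>R\<^esub> else \<zero>\<^bsub>R\<^esub>"]) auto
    then obtain e where e: "\<And>i. e i \<in> carrier A"
      "\<And>i j. j \<in> I \<Longrightarrow> \<phi> (e i) j = (if i = j then \<one>\<^bsub>R\<^esub> else \<zero>\<^bsub>R\<^esub>)" by metis
    have inj: "inj_on e I"
      by (rule inj_onI) (metis False e(2))
    have expand: "\<phi> (\<Oplus>\<^bsub>A\<^esub>i\<in>I. c i \<odot>\<^bsub>A\<^esub> e i) j = c j" if "\<And>i. i \<in> I \<Longrightarrow> c i \<in> carrier R" "j \<in> I" for c j
      using coords_expand[OF assms(1,2), of e c j] e that by simp
    have reindex: "(\<Oplus>\<^bsub>A\<^esub>b\<in>e ` I. c b \<odot>\<^bsub>A\<^esub> b) = (\<Oplus>\<^bsub>A\<^esub>i\<in>I. c (e i) \<odot>\<^bsub>A\<^esub> e i)"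
      if "c \<in> e ` I \<rightarrow>\<^sub>E carrier R" for c
      using that e inj by (intro A.M.finsum_reindex) auto
    have "is_basis R A (e ` I)"
    proof (subst is_basis_finite_iff[OF assms(1)], simp add: D(1), intro conjI ballI ex_ex1I)
      show "e ` I \<subseteq> carrier A" using e by auto
      fix x assume x: "x \<in> carrier A"
      define c where "c = (\<lambda>b\<in>e ` I. \<phi> x (the_inv_into I e b))"
      have c: "c \<in> e ` I \<rightarrow>\<^sub>E carrier R" "\<And>i. i \<in> I \<Longrightarrow> c (e i) = \<phi> x i"
        using D(5)[OF x] by (auto simp: c_def the_inv_into_f_f[OF inj])
      have "(\<Oplus>\<^bsub>A\<^esub>i\<in>I. c (e i) \<odot>\<^bsub>A\<^esub> e i) \<in> carrier A"
        using c(1) e by (intro A.M.finsum_closed) auto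
      then have "x = (\<Oplus>\<^bsub>A\<^esub>i\<in>I. c (e i) \<odot>\<^bsub>A\<^esub> e i)"
        using x expand[of "\<lambda>i. c (e i)"] c D(5)[OF x] by (intro coords_eqI[OF assms(2)]) auto
      then show "\<exists>c. c \<in> e ` I \<rightarrow>\<^sub>E carrier R \<and> x = (\<Oplus>\<^bsub>A\<^esub>b\<in>e ` I. c b \<odot>\<^bsub>A\<^esub> b)"
        using c(1) reindex[OF c(1)] by metis
    next
      fix x c d
      assume x: "x \<in> carrier A"
        and c: "c \<in> e ` I \<rightarrow>\<^sub>E carrier R \<and> x = (\<Oplus>\<^bsub>A\<^esub>b\<in>e ` I. c b \<odot>\<^bsub>A\<^esub> b)"
        and d: "d \<in> e ` I \<rightarrow>\<^sub>E carrier R \<and> x = (\<Oplus>\<^bsub>A\<^esub>b\<in>e ` I. d b \<odot>\<^bsub>A\<^esub> b)"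
      have "c (e j) = d (e j)" if "j \<in> I" for j
      proof -
        have "\<phi> x j = c (e j)" using expand[of "\<lambda>i. c (e i)" j] c reindex[of c] that by auto
        moreover have "\<phi> x j = d (e j)" using expand[of "\<lambda>i. d (e i)" j] d reindex[of d] that by auto
        ultimately show ?thesis by simp
      qed
      then show "c = d" using c d by (intro PiE_ext[of c "e ` I" "\<lambda>_. carrier R"]) auto
    qed
    then show ?thesis using assms(1) D(1) by (auto simp: fg_free_module_def)
  qed
qed

lemma fg_free_obtain_coords:
  fixes A :: "('r, 'a) module"
  assumes "fg_free_module R A"
  obtains B :: "'a set" and \<phi> where "coords R A B \<phi>" "module R A"
  using assms coords_of_basis[of R A] unfolding fg_free_module_def by metis

lemma fg_free_imp_module: "fg_free_module R A \<Longrightarrow> module R A"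
  by (simp add: fg_free_module_def)

lemma free_of_fg_free: "fg_free_module R A \<Longrightarrow> free_module R A"
  by (auto simp: fg_free_module_def free_module_def)

lemma fg_free_direct_sum:
  fixes A :: "('r, 'a) module" and B :: "('r, 'b) module"
  assumes "fg_free_module R A" "fg_free_module R B"
  shows "fg_free_module R (A \<boxplus> B)"
proof -
  obtain I :: "'a set" and \<phi> where \<phi>: "coords R A I \<phi>" "module R A" using fg_free_obtain_coords[OF assms(1)] .
  obtain J :: "'b set" and \<psi> where \<psi>: "coords R B J \<psi>" "module R B" using fg_free_obtain_coords[OF assms(2)] .
  note D = coordsD[OF \<phi>(1)] and E = coordsD[OF \<psi>(1)]
  have "coords R (A \<boxplus> B) (I <+> J) (\<lambda>x. restrict (case_sum (\<phi> (fst x)) (\<psi> (snd x))) (I <+> J))"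
  proof (rule coordsI)
    fix x y assume "x \<in> carrier (A \<boxplus> B)" "y \<in> carrier (A \<boxplus> B)"
      and eq: "\<And>i. i \<in> I <+> J \<Longrightarrow> case_sum (\<phi> (fst x)) (\<psi> (snd x)) i = case_sum (\<phi> (fst y)) (\<psi> (snd y)) i"
    moreover have "\<phi> (fst x) i = \<phi> (fst y) i" if "i \<in> I" for i using eq[OF InlI[OF that]] by simp
    moreover have "\<psi> (snd x) i = \<psi> (snd y) i" if "i \<in> J" for i using eq[OF InrI[OF that]] by simp
    ultimately show "x = y"
      using coords_eqI[OF \<phi>(1), of "fst x" "fst y"] coords_eqI[OF \<psi>(1), of "snd x" "snd y"]
      by (auto simp: prod_eq_iff)
  next
    fix c assume c: "c \<in> (I <+> J) \<rightarrow>\<^sub>E carrier R"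
    obtain x where "x \<in> carrier A" "\<And>i. i \<in> I \<Longrightarrow> \<phi> x i = c (Inl i)"
      using coords_surj[OF \<phi>(1), of "\<lambda>i. c (Inl i)"] c by auto
    moreover obtain y where "y \<in> carrier B" "\<And>i. i \<in> J \<Longrightarrow> \<psi> y i = c (Inr i)"
      using coords_surj[OF \<psi>(1), of "\<lambda>i. c (Inr i)"] c by auto
    ultimately show "\<exists>x\<in>carrier (A \<boxplus> B). \<forall>i\<in>I <+> J. case_sum (\<phi> (fst x)) (\<psi> (snd x)) i = c i"
      by (intro bexI[of _ "(x, y)"]) auto
  qed (use D E in \<open>auto intro: module_direct_sum \<phi> \<psi>\<close>)
  then show ?thesis using module_direct_sum[OF \<phi>(2) \<psi>(2)] fg_free_of_coords by blast
qed

lemma fg_free_zero_module: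
  fixes A :: "('r, 'a) module"
  assumes "module R A"
  shows "fg_free_module R (zero_module A)"
proof -
  have "coords R (zero_module A) ({} :: nat set) (\<lambda>x. restrict (\<lambda>_. \<zero>\<^bsub>R\<^esub>) {})"
    by (rule coordsI) (auto intro: module_zero_module assms)
  then show ?thesis using module_zero_module[OF assms] fg_free_of_coords by blast
qed

text \<open>The images of the finitely many generators of \<open>A\<close> involve only finitely many elements of a basis of
  \<open>D\<close>. These span \<open>D\<close>, so a further basis element would have two expansions, which differ since
  \<open>1 \<noteq> 0\<close>.\<close>

lemma fg_free_of_surjection:
  fixes D :: "('r, 'd) module" and A :: "('r, 'a) module"
  assumes D_free: "free_module R D" and A_free: "fg_free_module R A"
    and h: "h \<in> module_hom R A D" and h_surj: "h ` carrier A = carrier D"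
    and nontrivial: "\<one>\<^bsub>R\<^esub> \<noteq> \<zero>\<^bsub>R\<^esub>"
  shows "fg_free_module R D"
proof -
  obtain B where B: "is_basis R D B" and D: "module R D"
    using D_free by (auto simp: free_module_def)
  interpret D: module R D by (rule D)
  obtain E where E: "finite E" "is_basis R A E" and A: "module R A"
    using A_free by (auto simp: fg_free_module_def)
  interpret A: module R A by (rule A)
  have Bsub: "B \<subseteq> carrier D" using B by (simp add: is_basis_def)
  define supp where "supp c = {b \<in> B. c b \<noteq> \<zero>\<^bsub>R\<^esub>}" for c :: "'d \<Rightarrow> 'r"
  have Bex: "\<exists>!c. c \<in> B \<rightarrow>\<^sub>E carrier R \<and> finite (supp c) \<and> x = (\<Oplus>\<^bsub>D\<^esub>b\<in>supp c. c b \<odot>\<^bsub>D\<^esub> b)"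
    if "x \<in> carrier D" for x
    using B that unfolding is_basis_def supp_def by simp
  define cf where "cf x = (THE c. c \<in> B \<rightarrow>\<^sub>E carrier R \<and> finite (supp c) \<and> x = (\<Oplus>\<^bsub>D\<^esub>b\<in>supp c. c b \<odot>\<^bsub>D\<^esub> b))" for x
  have cf: "cf x \<in> B \<rightarrow>\<^sub>E carrier R" "finite (supp (cf x))" "x = (\<Oplus>\<^bsub>D\<^esub>b\<in>supp (cf x). cf x b \<odot>\<^bsub>D\<^esub> b)"
    if "x \<in> carrier D" for x
    using theI'[OF Bex[OF that]] unfolding cf_def by blast+
  define S where "S = (\<Union>e\<in>E. supp (cf (h e)))"
  have Esub: "E \<subseteq> carrier A" using E(2) by (simp add: is_basis_def)
  have pe: "h e \<in> carrier D" if "e \<in> E" for e using module_hom_closed[OF h] Esub that by blast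
  have finS: "finite S" unfolding S_def using E(1) cf(2)[OF pe] by blast
  have SB: "S \<subseteq> B" unfolding S_def supp_def by blast
  define span where "span = {\<Oplus>\<^bsub>D\<^esub>b\<in>S. d b \<odot>\<^bsub>D\<^esub> b | d. d \<in> S \<rightarrow> carrier R}"
  have Scar: "b \<in> carrier D" if "b \<in> S" for b using that SB Bsub by auto
  have span_sub: "submodule span R D"
  proof (rule D.submoduleI)
    show "span \<subseteq> carrier D"
      unfolding span_def using Scar by (auto intro!: D.M.finsum_closed D.smult_closed)
    have "(\<Oplus>\<^bsub>D\<^esub>b\<in>S. \<zero>\<^bsub>R\<^esub> \<odot>\<^bsub>D\<^esub> b) = \<zero>\<^bsub>D\<^esub>"
      using Scar by (intro D.M.add.finprod_one_eqI) simp
    then show "\<zero>\<^bsub>D\<^esub> \<in> span" unfolding span_def by (intro CollectI exI[of _ "\<lambda>_. \<zero>\<^bsub>R\<^esub>"]) simp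
    have sm: "a \<odot>\<^bsub>D\<^esub> x \<in> span" if a: "a \<in> carrier R" and x: "x \<in> span" for a x
    proof -
      obtain d where d: "d \<in> S \<rightarrow> carrier R" "x = (\<Oplus>\<^bsub>D\<^esub>b\<in>S. d b \<odot>\<^bsub>D\<^esub> b)"
        using x unfolding span_def by blast
      have "a \<odot>\<^bsub>D\<^esub> x = (\<Oplus>\<^bsub>D\<^esub>b\<in>S. a \<odot>\<^bsub>D\<^esub> (d b \<odot>\<^bsub>D\<^esub> b))"
        unfolding d(2) by (rule D.finsum_smult_ldistr[OF finS a]) (use d(1) Scar in \<open>auto intro!: D.smult_closed\<close>)
      also have "\<dots> = (\<Oplus>\<^bsub>D\<^esub>b\<in>S. (a \<otimes>\<^bsub>R\<^esub> d b) \<odot>\<^bsub>D\<^esub> b)"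
        using d(1) Scar a by (intro D.M.finsum_cong') (auto intro!: D.smult_closed D.smult_assoc1[symmetric])
      finally show ?thesis unfolding span_def using d(1) a by (intro CollectI exI[of _ "\<lambda>b. a \<otimes>\<^bsub>R\<^esub> d b"]) auto
    qed
    show "\<ominus>\<^bsub>D\<^esub> x \<in> span" if "x \<in> span" for x
    proof -
      have "x \<in> carrier D" using that \<open>span \<subseteq> carrier D\<close> by blast
      then have "\<ominus>\<^bsub>D\<^esub> x = (\<ominus>\<^bsub>R\<^esub> \<one>\<^bsub>R\<^esub>) \<odot>\<^bsub>D\<^esub> x"
        using D.smult_l_minus[of "\<one>\<^bsub>R\<^esub>" x] D.smult_one[of x] by simp
      then show ?thesis using sm[of "\<ominus>\<^bsub>R\<^esub> \<one>\<^bsub>R\<^esub>" x] that by simp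
    qed
    show "x \<oplus>\<^bsub>D\<^esub> y \<in> span" if x: "x \<in> span" and y: "y \<in> span" for x y
    proof -
      obtain d where d: "d \<in> S \<rightarrow> carrier R" "x = (\<Oplus>\<^bsub>D\<^esub>b\<in>S. d b \<odot>\<^bsub>D\<^esub> b)"
        using x unfolding span_def by blast
      obtain d' where d': "d' \<in> S \<rightarrow> carrier R" "y = (\<Oplus>\<^bsub>D\<^esub>b\<in>S. d' b \<odot>\<^bsub>D\<^esub> b)"
        using y unfolding span_def by blast
      have "x \<oplus>\<^bsub>D\<^esub> y = (\<Oplus>\<^bsub>D\<^esub>b\<in>S. d b \<odot>\<^bsub>D\<^esub> b \<oplus>\<^bsub>D\<^esub> d' b \<odot>\<^bsub>D\<^esub> b)"
        unfolding d(2) d'(2) by (rule D.M.finsum_addf[symmetric]) (use d(1) d'(1) Scar in \<open>auto intro!: D.smult_closed\<close>)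
      also have "\<dots> = (\<Oplus>\<^bsub>D\<^esub>b\<in>S. (d b \<oplus>\<^bsub>R\<^esub> d' b) \<odot>\<^bsub>D\<^esub> b)"
        using d(1) d'(1) Scar by (intro D.M.finsum_cong') (auto intro!: D.smult_closed D.smult_l_distr[symmetric])
      finally show ?thesis unfolding span_def using d(1) d'(1) by (intro CollectI exI[of _ "\<lambda>b. d b \<oplus>\<^bsub>R\<^esub> d' b"]) auto
    qed
    show "a \<odot>\<^bsub>D\<^esub> x \<in> span" if "a \<in> carrier R" "x \<in> span" for a x
      using sm that .
  qed
  note SE = D.submoduleE[OF span_sub]
  have pe_span: "h e \<in> span" if e: "e \<in> E" for e
  proof -
    define c where "c = cf (h e)"
    have c: "c \<in> B \<rightarrow>\<^sub>E carrier R" "h e = (\<Oplus>\<^bsub>D\<^esub>b\<in>supp c. c b \<odot>\<^bsub>D\<^esub> b)"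
      unfolding c_def using cf[OF pe[OF e]] by blast+
    have "supp c \<subseteq> S" unfolding S_def c_def using e by blast
    have cS: "c b \<in> carrier R" if "b \<in> S" for b using c(1) SB that by (auto simp: PiE_def)
    have "(\<Oplus>\<^bsub>D\<^esub>b\<in>supp c. c b \<odot>\<^bsub>D\<^esub> b) = (\<Oplus>\<^bsub>D\<^esub>b\<in>S. c b \<odot>\<^bsub>D\<^esub> b)"
    proof (rule D.M.add.finprod_mono_neutral_cong_left[OF finS \<open>supp c \<subseteq> S\<close>])
      fix b assume "b \<in> S - supp c"
      then have "c b = \<zero>\<^bsub>R\<^esub>" "b \<in> carrier D" using SB Scar unfolding supp_def by blast+
      then show "c b \<odot>\<^bsub>D\<^esub> b = \<zero>\<^bsub>D\<^esub>" using D.smult_l_null[of b] by simp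
    next
      show "(\<lambda>b. c b \<odot>\<^bsub>D\<^esub> b) \<in> S \<rightarrow> carrier D"
        using D.smult_closed[OF cS Scar] by auto
    qed simp
    then show ?thesis unfolding span_def c(2) using cS by (intro CollectI exI[of _ c]) auto
  qed
  have all_span: "x \<in> span" if x: "x \<in> carrier D" for x
  proof -
    have "x \<in> h ` carrier A" using x h_surj by simp
    then obtain y where x1: "y \<in> carrier A" and xy: "x = h y" by auto
    obtain \<phi> where \<phi>: "coords R A E \<phi>" "\<And>x. x \<in> carrier A \<Longrightarrow> x = (\<Oplus>\<^bsub>A\<^esub>b\<in>E. \<phi> x b \<odot>\<^bsub>A\<^esub> b)"
      using coords_of_basis[OF A E] by blast
    have ce: "\<phi> y e \<odot>\<^bsub>A\<^esub> e \<in> carrier A" if "e \<in> E" for e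
      using coordsD(5)[OF \<phi>(1) x1 that] Esub that by auto
    have "x = h (\<Oplus>\<^bsub>A\<^esub>e\<in>E. \<phi> y e \<odot>\<^bsub>A\<^esub> e)" using \<phi>(2)[OF x1] xy by simp
    also have "\<dots> = (\<Oplus>\<^bsub>D\<^esub>e\<in>E. h (\<phi> y e \<odot>\<^bsub>A\<^esub> e))"
      by (rule module_hom_finsum[OF h A D E(1)]) (use ce in auto)
    finally have x_eq: "x = (\<Oplus>\<^bsub>D\<^esub>e\<in>E. h (\<phi> y e \<odot>\<^bsub>A\<^esub> e))" .
    have in_span: "h (\<phi> y e \<odot>\<^bsub>A\<^esub> e) \<in> span" if "e \<in> E" for e
    proof -
      have "h (\<phi> y e \<odot>\<^bsub>A\<^esub> e) = \<phi> y e \<odot>\<^bsub>D\<^esub> h e"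
        using module_hom_smult[OF h coordsD(5)[OF \<phi>(1) x1 that], of e] Esub that by auto
      then show ?thesis using SE(4)[OF coordsD(5)[OF \<phi>(1) x1 that] pe_span[OF that]] by simp
    qed
    have "(\<Oplus>\<^bsub>D\<^esub>e\<in>F. h (\<phi> y e \<odot>\<^bsub>A\<^esub> e)) \<in> span" if "finite F" "F \<subseteq> E" for F
      using that
    proof (induction F)
      case empty
      show ?case using subgroup.one_closed[OF submodule.axioms(1)[OF span_sub]] by simp
    next
      case (insert e F)
      have "(\<lambda>e. h (\<phi> y e \<odot>\<^bsub>A\<^esub> e)) \<in> F \<rightarrow> carrier D"
        "h (\<phi> y e \<odot>\<^bsub>A\<^esub> e) \<in> carrier D"
        using in_span insert.prems SE(1) by blast+
      with insert in_span show ?case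
        using D.M.finsum_insert[of F e "\<lambda>e. h (\<phi> y e \<odot>\<^bsub>A\<^esub> e)"] SE(5) by auto
    qed
    from this[OF E(1) subset_refl] show ?thesis using x_eq by simp
  qed
  have "B \<subseteq> S"
  proof
    fix b assume b: "b \<in> B"
    show "b \<in> S"
    proof (rule ccontr)
      assume nb: "b \<notin> S"
      have bM: "b \<in> carrier D" using b Bsub by blast
      obtain d where d: "d \<in> S \<rightarrow> carrier R" "b = (\<Oplus>\<^bsub>D\<^esub>b\<in>S. d b \<odot>\<^bsub>D\<^esub> b)"
        using all_span[OF bM] unfolding span_def by blast
      define c1 where "c1 = (\<lambda>b'\<in>B. if b' = b then \<one>\<^bsub>R\<^esub> else \<zero>\<^bsub>R\<^esub>)"
      define c2 where "c2 = (\<lambda>b'\<in>B. if b' \<in> S then d b' else \<zero>\<^bsub>R\<^esub>)"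
      have s1: "supp c1 = {b}" using b nontrivial by (auto simp: supp_def c1_def)
      have s2: "supp c2 \<subseteq> S" by (auto simp: supp_def c2_def)
      have "c1 \<in> B \<rightarrow>\<^sub>E carrier R" "finite (supp c1)" "c2 \<in> B \<rightarrow>\<^sub>E carrier R" "finite (supp c2)"
        using d(1) s1 finite_subset[OF s2 finS] by (auto simp: c1_def c2_def)
      moreover have "b = (\<Oplus>\<^bsub>D\<^esub>b\<in>supp c1. c1 b \<odot>\<^bsub>D\<^esub> b)"
      proof -
        have "(\<lambda>b. c1 b \<odot>\<^bsub>D\<^esub> b) \<in> {} \<rightarrow> carrier D" "c1 b \<odot>\<^bsub>D\<^esub> b = b" "b \<in> carrier D"
          using b bM D.smult_one[of b] by (auto simp: c1_def)
        then show ?thesis unfolding s1 using D.M.finsum_insert[of "{}" b "\<lambda>b. c1 b \<odot>\<^bsub>D\<^esub> b"]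
            D.M.r_zero[of b] by simp
      qed
      moreover have "b = (\<Oplus>\<^bsub>D\<^esub>b\<in>supp c2. c2 b \<odot>\<^bsub>D\<^esub> b)"
      proof -
        have "(\<Oplus>\<^bsub>D\<^esub>b\<in>supp c2. c2 b \<odot>\<^bsub>D\<^esub> b) = (\<Oplus>\<^bsub>D\<^esub>b\<in>S. d b \<odot>\<^bsub>D\<^esub> b)"
        proof (rule D.M.add.finprod_mono_neutral_cong_left[OF finS s2])
          fix b' assume "b' \<in> S - supp c2"
          then have "d b' = \<zero>\<^bsub>R\<^esub>" "b' \<in> carrier D" using SB Scar unfolding supp_def c2_def by auto
          then show "d b' \<odot>\<^bsub>D\<^esub> b' = \<zero>\<^bsub>D\<^esub>" using D.smult_l_null[of b'] by simp
        next
          fix b' assume "b' \<in> supp c2"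
          then show "c2 b' \<odot>\<^bsub>D\<^esub> b' = d b' \<odot>\<^bsub>D\<^esub> b'"
            using s2 SB by (auto simp: c2_def)
        next
          show "(\<lambda>b. d b \<odot>\<^bsub>D\<^esub> b) \<in> S \<rightarrow> carrier D"
            using D.smult_closed[OF _ Scar] d(1) by auto
        qed
        then show ?thesis using d(2) by simp
      qed
      ultimately have "c1 = c2" using Bex[OF bM] by blast
      then have "c1 b = c2 b" by simp
      then show False using b nb nontrivial by (simp add: c1_def c2_def)
    qed
  qed
  then have "finite B" using finS finite_subset by blast
  then show ?thesis using B D by (auto simp: fg_free_module_def)
qed

lemma regular_smult_zero:
  fixes A :: "('r, 'a) module"
  assumes "fg_free_module R A" "regular_element R f" "x \<in> carrier A" "f \<odot>\<^bsub>A\<^esub> x = \<zero>\<^bsub>A\<^esub>"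
  shows "x = \<zero>\<^bsub>A\<^esub>"
proof -
  obtain I :: "'a set" and \<phi> where \<phi>: "coords R A I \<phi>" "module R A" using fg_free_obtain_coords[OF assms(1)] .
  interpret A: module R A by fact
  note D = coordsD[OF \<phi>(1)]
  have f: "f \<in> carrier R" using assms(2) by (auto simp: regular_element_def)
  have z: "\<phi> \<zero>\<^bsub>A\<^esub> i = \<zero>\<^bsub>R\<^esub>" if "i \<in> I" for i
    using D(4)[of "\<zero>\<^bsub>R\<^esub>" "\<zero>\<^bsub>A\<^esub>" i] D(5)[of "\<zero>\<^bsub>A\<^esub>" i] that by simp
  show ?thesis
  proof (rule coords_eqI[OF \<phi>(1)])
    fix i assume i: "i \<in> I"
    have "f \<otimes>\<^bsub>R\<^esub> \<phi> x i = \<zero>\<^bsub>R\<^esub>" using D(4)[of f x i] assms(3,4) f i z by simp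
    then show "\<phi> x i = \<phi> \<zero>\<^bsub>A\<^esub> i" using assms(2,3) D(5) i z by (auto simp: regular_element_def)
  qed (use assms in auto)
qed

lemma regular_smult_inject:
  assumes "fg_free_module R A" "regular_element R f" "x \<in> carrier A" "y \<in> carrier A"
    "f \<odot>\<^bsub>A\<^esub> x = f \<odot>\<^bsub>A\<^esub> y"
  shows "x = y"
proof -
  interpret A: module R A using assms(1) by (simp add: fg_free_module_def)
  have f: "f \<in> carrier R" using assms(2) by (auto simp: regular_element_def)
  have "f \<odot>\<^bsub>A\<^esub> (x \<ominus>\<^bsub>A\<^esub> y) = \<zero>\<^bsub>A\<^esub>"
    unfolding a_minus_def using assms(3,4) f
    by (simp add: A.smult_r_distr A.smult_r_minus assms(5) A.M.r_neg)
  then have "x \<ominus>\<^bsub>A\<^esub> y = \<zero>\<^bsub>A\<^esub>"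
    by (rule regular_smult_zero[OF assms(1,2) A.M.minus_closed[OF assms(3,4)]])
  then show ?thesis using assms(3,4) by (simp add: A.M.diff_zero_iff)
qed

section \<open>Extension of scalars along a surjection\<close>

text \<open>The criterion for an additive map on generators to respect the relations of a tensor product.\<close>

lemma generate_frag_map:
  assumes "rel \<subseteq> carrier (free_Abelian_group S)"
    and "\<And>u. u \<in> rel \<Longrightarrow> frag_extend g u \<in> generate (free_Abelian_group S') rel'"
    and "rel' \<subseteq> carrier (free_Abelian_group S')"
    and "u \<in> generate (free_Abelian_group S) rel"
  shows "frag_extend g u \<in> generate (free_Abelian_group S') rel'"
proof -
  interpret S: comm_group "free_Abelian_group S" by (rule abelian_free_Abelian_group)
  interpret S': comm_group "free_Abelian_group S'" by (rule abelian_free_Abelian_group)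
  interpret Z: subgroup "generate (free_Abelian_group S') rel'" "free_Abelian_group S'"
    by (rule S'.generate_is_subgroup[OF assms(3)])
  show ?thesis using assms(4)
  proof (induction rule: generate.induct)
    case one
    then show ?case using Z.one_closed by (simp del: Z.one_closed)
  next
    case (incl h)
    then show ?case by (rule assms(2))
  next
    case (inv h)
    have h: "h \<in> carrier (free_Abelian_group S)" using inv assms(1) by blast
    have "inv\<^bsub>free_Abelian_group S'\<^esub> frag_extend g h \<in> generate (free_Abelian_group S') rel'"
      by (rule Z.m_inv_closed[OF assms(2)[OF inv]])
    moreover have "frag_extend g h \<in> carrier (free_Abelian_group S')"
      using Z.mem_carrier[OF assms(2)[OF inv]] .
    ultimately show ?case using h by (simp add: frag_extend_minus)
  next
    case (eng h1 h2)
    then show ?case using Z.m_closed[OF eng.IH] by (simp add: frag_extend_add)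
  qed
qed

text \<open>The scalar action on a tensor product and the induced homomorphisms send a coset to the sum of the relation
  subgroup with the elementwise image. This lemma evaluates them on representatives.\<close>

lemma frag_coset_image:
  assumes "subgroup Z (free_Abelian_group S)" "subgroup Z' (free_Abelian_group S')"
    and "\<And>u. u \<in> Z \<Longrightarrow> frag_extend g u \<in> Z'"
    and "frag_extend g c \<in> carrier (free_Abelian_group S')"
  shows "Z' <#>\<^bsub>free_Abelian_group S'\<^esub> frag_extend g ` (Z #>\<^bsub>free_Abelian_group S\<^esub> c)
    = Z' #>\<^bsub>free_Abelian_group S'\<^esub> frag_extend g c"
proof -
  interpret Z: subgroup Z "free_Abelian_group S" by fact
  interpret Z': subgroup Z' "free_Abelian_group S'" by fact
  show ?thesis
  proof
    show "Z' <#>\<^bsub>free_Abelian_group S'\<^esub> frag_extend g ` (Z #>\<^bsub>free_Abelian_group S\<^esub> c)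
      \<subseteq> Z' #>\<^bsub>free_Abelian_group S'\<^esub> frag_extend g c"
    proof
      fix v assume "v \<in> Z' <#>\<^bsub>free_Abelian_group S'\<^esub> frag_extend g ` (Z #>\<^bsub>free_Abelian_group S\<^esub> c)"
      then obtain z' u where "z' \<in> Z'" "u \<in> Z" "v = z' + frag_extend g (u + c)"
        by (auto simp: set_mult_def r_coset_def)
      then have "v = (z' + frag_extend g u) + frag_extend g c" "z' + frag_extend g u \<in> Z'"
        using Z'.m_closed[OF \<open>z' \<in> Z'\<close> assms(3)[OF \<open>u \<in> Z\<close>]] by (simp_all add: frag_extend_add)
      then show "v \<in> Z' #>\<^bsub>free_Abelian_group S'\<^esub> frag_extend g c" by (auto simp: r_coset_def)
    qed
    show "Z' #>\<^bsub>free_Abelian_group S'\<^esub> frag_extend g c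
      \<subseteq> Z' <#>\<^bsub>free_Abelian_group S'\<^esub> frag_extend g ` (Z #>\<^bsub>free_Abelian_group S\<^esub> c)"
    proof
      fix v assume "v \<in> Z' #>\<^bsub>free_Abelian_group S'\<^esub> frag_extend g c"
      then obtain z' where "z' \<in> Z'" "v = z' + frag_extend g c" by (auto simp: r_coset_def)
      moreover have "c \<in> Z #>\<^bsub>free_Abelian_group S\<^esub> c"
        using Z.one_closed by (force simp: r_coset_def)
      ultimately show "v \<in> Z' <#>\<^bsub>free_Abelian_group S'\<^esub> frag_extend g ` (Z #>\<^bsub>free_Abelian_group S\<^esub> c)"
        by (force simp: set_mult_def)
    qed
  qed
qed

locale base_change = ring_hom_cring R S \<phi> + A: module R A
  for R :: "('r, 'x) ring_scheme" and S :: "('s, 'y) ring_scheme" and \<phi> and A :: "('r, 'a) module" +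
  assumes \<phi>_surj: "\<phi> ` carrier R = carrier S"
begin

abbreviation "FG \<equiv> free_Abelian_group (carrier A \<times> carrier S)"
abbreviation "Z \<equiv> tensor_null R S \<phi> A"

definition \<tau> :: "'a \<Rightarrow> (('a \<times> 's) \<Rightarrow>\<^sub>0 int) set" where
  "\<tau> x = Z #>\<^bsub>FG\<^esub> frag_of (x, \<one>\<^bsub>S\<^esub>)"

lemma relations_subset: "tensor_relations R S \<phi> A \<subseteq> carrier FG"
  unfolding tensor_relations_def
  by (auto simp: carrier_free_Abelian_group_iff dest!: subsetD[OF keys_diff])

lemma Z_subgroup: "subgroup Z FG"
  unfolding tensor_null_def by (rule group.generate_is_subgroup) (auto simp: relations_subset)

lemma rel_add_left:
  assumes "x \<in> carrier A" "y \<in> carrier A" "s \<in> carrier S"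
  shows "frag_of (x \<oplus>\<^bsub>A\<^esub> y, s) - frag_of (x, s) - frag_of (y, s) \<in> Z"
  unfolding tensor_null_def
  by (rule generate.incl) (use assms in \<open>unfold tensor_relations_def, blast\<close>)

lemma rel_add_right:
  assumes "x \<in> carrier A" "s \<in> carrier S" "t \<in> carrier S"
  shows "frag_of (x, s \<oplus>\<^bsub>S\<^esub> t) - frag_of (x, s) - frag_of (x, t) \<in> Z"
  unfolding tensor_null_def
  by (rule generate.incl) (use assms in \<open>unfold tensor_relations_def, blast\<close>)

lemma rel_smult:
  assumes "x \<in> carrier A" "s \<in> carrier S" "a \<in> carrier R"
  shows "frag_of (a \<odot>\<^bsub>A\<^esub> x, s) - frag_of (x, \<phi> a \<otimes>\<^bsub>S\<^esub> s) \<in> Z"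
  unfolding tensor_null_def
  by (rule generate.incl) (use assms in \<open>unfold tensor_relations_def, blast\<close>)

lemma Z_add: "u \<in> Z \<Longrightarrow> v \<in> Z \<Longrightarrow> u + v \<in> Z"
  using subgroup.m_closed[OF Z_subgroup, of u v] by simp

lemma Z_neg: "u \<in> Z \<Longrightarrow> - u \<in> Z"
  using subgroup.m_inv_closed[OF Z_subgroup, of u] subgroup.mem_carrier[OF Z_subgroup, of u] by simp

lemma Z_diff: "u \<in> Z \<Longrightarrow> v \<in> Z \<Longrightarrow> u - v \<in> Z"
  using Z_add[of u "- v"] Z_neg[of v] by simp

lemma coset_eq_iff:
  "Z #>\<^bsub>FG\<^esub> c = Z #>\<^bsub>FG\<^esub> d \<longleftrightarrow> c - d \<in> Z"
proof
  assume eq: "Z #>\<^bsub>FG\<^esub> c = Z #>\<^bsub>FG\<^esub> d"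
  have "c \<in> Z #>\<^bsub>FG\<^esub> c" using subgroup.one_closed[OF Z_subgroup] by (force simp: r_coset_def)
  then have "c \<in> Z #>\<^bsub>FG\<^esub> d" by (simp add: eq)
  then obtain h where "h \<in> Z" "c = h + d" by (auto simp: r_coset_def)
  then show "c - d \<in> Z" by simp
next
  assume h: "c - d \<in> Z"
  have "h + c \<in> Z #>\<^bsub>FG\<^esub> d" if "h \<in> Z" for h
    using Z_add[OF that h] by (force simp: r_coset_def)
  moreover have "h + d \<in> Z #>\<^bsub>FG\<^esub> c" if "h \<in> Z" for h
    using Z_diff[OF that h] by (force simp: r_coset_def)
  ultimately show "Z #>\<^bsub>FG\<^esub> c = Z #>\<^bsub>FG\<^esub> d"
    by (auto simp: r_coset_def)
qed

lemma frag_carrier: "x \<in> carrier A \<Longrightarrow> s \<in> carrier S \<Longrightarrow> frag_of (x, s) \<in> carrier FG"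
  by simp

lemma carrier_ext: "carrier (extend_scalars R S \<phi> A) = {Z #>\<^bsub>FG\<^esub> c | c. c \<in> carrier FG}"
  by (auto simp: extend_scalars_def Let_def FactGroup_def RCOSETS_def)

text \<open>As \<open>\<phi>\<close> is onto, \<open>x \<otimes> \<phi>(a) = ax \<otimes> 1\<close>, and differences of tensors of the form \<open>x \<otimes> 1\<close> have
  this form again.\<close>

lemma pure_tensor:
  assumes "c \<in> carrier FG"
  shows "\<exists>x\<in>carrier A. c - frag_of (x, \<one>\<^bsub>S\<^esub>) \<in> Z"
proof -
  have "Poly_Mapping.keys c \<subseteq> carrier A \<times> carrier S" using assms by simp
  then show ?thesis
  proof (induction c rule: frag_induction)
    case zero
    have "frag_of (\<zero>\<^bsub>A\<^esub> \<oplus>\<^bsub>A\<^esub> \<zero>\<^bsub>A\<^esub>, \<one>\<^bsub>S\<^esub>) - frag_of (\<zero>\<^bsub>A\<^esub>, \<one>\<^bsub>S\<^esub>) - frag_of (\<zero>\<^bsub>A\<^esub>, \<one>\<^bsub>S\<^esub>) \<in> Z"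
      by (rule rel_add_left) auto
    then show ?case by (intro bexI[of _ "\<zero>\<^bsub>A\<^esub>"]) auto
  next
    case (one p)
    then obtain x s where p: "p = (x, s)" "x \<in> carrier A" "s \<in> carrier S" by auto
    then obtain a where a: "a \<in> carrier R" "s = \<phi> a" using \<phi>_surj by blast
    have "- (frag_of (a \<odot>\<^bsub>A\<^esub> x, \<one>\<^bsub>S\<^esub>) - frag_of (x, \<phi> a \<otimes>\<^bsub>S\<^esub> \<one>\<^bsub>S\<^esub>)) \<in> Z"
      using p a by (intro Z_neg rel_smult) auto
    then show ?case using p a by (intro bexI[of _ "a \<odot>\<^bsub>A\<^esub> x"]) auto
  next
    case (diff c d)
    then obtain x y where x: "x \<in> carrier A" "c - frag_of (x, \<one>\<^bsub>S\<^esub>) \<in> Z"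
      and y: "y \<in> carrier A" "d - frag_of (y, \<one>\<^bsub>S\<^esub>) \<in> Z" by blast
    have "(x \<ominus>\<^bsub>A\<^esub> y) \<oplus>\<^bsub>A\<^esub> y = x"
      using x(1) y(1) by (simp add: a_minus_def A.M.a_assoc A.M.l_neg)
    then have "frag_of (x, \<one>\<^bsub>S\<^esub>) - frag_of (x \<ominus>\<^bsub>A\<^esub> y, \<one>\<^bsub>S\<^esub>) - frag_of (y, \<one>\<^bsub>S\<^esub>) \<in> Z"
      using rel_add_left[of "x \<ominus>\<^bsub>A\<^esub> y" y "\<one>\<^bsub>S\<^esub>"] x(1) y(1) by simp
    from Z_add[OF Z_diff[OF x(2) y(2)] this]
    have "c - d - frag_of (x \<ominus>\<^bsub>A\<^esub> y, \<one>\<^bsub>S\<^esub>) \<in> Z" by (simp add: algebra_simps)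
    then show ?case using x(1) y(1) by (intro bexI[of _ "x \<ominus>\<^bsub>A\<^esub> y"]) auto
  qed
qed

lemma \<tau>_surj: "carrier (extend_scalars R S \<phi> A) = \<tau> ` carrier A"
proof
  show "carrier (extend_scalars R S \<phi> A) \<subseteq> \<tau> ` carrier A"
    using pure_tensor unfolding carrier_ext \<tau>_def by (auto simp: coset_eq_iff image_iff)
  show "\<tau> ` carrier A \<subseteq> carrier (extend_scalars R S \<phi> A)"
    unfolding carrier_ext \<tau>_def by (auto intro: frag_carrier)
qed

lemma \<tau>_add:
  assumes "x \<in> carrier A" "y \<in> carrier A"
  shows "\<tau> x \<oplus>\<^bsub>extend_scalars R S \<phi> A\<^esub> \<tau> y = \<tau> (x \<oplus>\<^bsub>A\<^esub> y)"
proof -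
  interpret FG: comm_group FG by (rule abelian_free_Abelian_group)
  interpret N: normal Z FG by (rule FG.subgroup_imp_normal[OF Z_subgroup])
  have "\<tau> x \<oplus>\<^bsub>extend_scalars R S \<phi> A\<^esub> \<tau> y = Z #>\<^bsub>FG\<^esub> (frag_of (x, \<one>\<^bsub>S\<^esub>) + frag_of (y, \<one>\<^bsub>S\<^esub>))"
    unfolding \<tau>_def extend_scalars_def Let_def
    using N.rcos_sum[of "frag_of (x, \<one>\<^bsub>S\<^esub>)" "frag_of (y, \<one>\<^bsub>S\<^esub>)"] assms
    by (simp add: FactGroup_def)
  also have "\<dots> = \<tau> (x \<oplus>\<^bsub>A\<^esub> y)"
    using Z_neg[OF rel_add_left[OF assms, of "\<one>\<^bsub>S\<^esub>"]]
    by (simp add: \<tau>_def coset_eq_iff algebra_simps)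
  finally show ?thesis .
qed

lemma zero_ext: "\<zero>\<^bsub>extend_scalars R S \<phi> A\<^esub> = Z"
  by (simp add: extend_scalars_def Let_def FactGroup_def)

lemma \<tau>_zero_iff: "\<tau> x = \<zero>\<^bsub>extend_scalars R S \<phi> A\<^esub> \<longleftrightarrow> frag_of (x, \<one>\<^bsub>S\<^esub>) \<in> Z"
proof -
  have "Z = Z #>\<^bsub>FG\<^esub> 0" by (auto simp: r_coset_def)
  then show ?thesis unfolding zero_ext \<tau>_def using coset_eq_iff[of _ 0] by simp
qed

lemma \<tau>_smult:
  assumes "a \<in> carrier R" "x \<in> carrier A"
  shows "\<phi> a \<odot>\<^bsub>extend_scalars R S \<phi> A\<^esub> \<tau> x = \<tau> (a \<odot>\<^bsub>A\<^esub> x)"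
proof -
  let ?g = "\<lambda>(x, t). frag_of (x, \<phi> a \<otimes>\<^bsub>S\<^esub> t)"
  have rel: "frag_extend ?g u \<in> Z" if "u \<in> tensor_relations R S \<phi> A" for u
    using that assms(1) unfolding tensor_relations_def
    by (auto simp: frag_extend_diff S.r_distr S.m_lcomm intro!: rel_add_left rel_add_right rel_smult)
  have "\<phi> a \<odot>\<^bsub>extend_scalars R S \<phi> A\<^esub> \<tau> x = Z <#>\<^bsub>FG\<^esub> frag_extend ?g ` (Z #>\<^bsub>FG\<^esub> frag_of (x, \<one>\<^bsub>S\<^esub>))"
    by (simp add: extend_scalars_def Let_def \<tau>_def)
  also have "\<dots> = Z #>\<^bsub>FG\<^esub> frag_extend ?g (frag_of (x, \<one>\<^bsub>S\<^esub>))"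
  proof (rule frag_coset_image[OF Z_subgroup Z_subgroup])
    fix u assume "u \<in> Z"
    then show "frag_extend ?g u \<in> Z"
      unfolding tensor_null_def
      by (rule generate_frag_map[OF relations_subset _ relations_subset, rotated])
        (rule rel[unfolded tensor_null_def])
  qed (use assms in auto)
  also have "\<dots> = \<tau> (a \<odot>\<^bsub>A\<^esub> x)"
    using Z_neg[OF rel_smult[OF assms(2) S.one_closed assms(1)]] assms
    by (simp add: \<tau>_def coset_eq_iff)
  finally show ?thesis .
qed

lemma module_ext: "module S (extend_scalars R S \<phi> A)"
proof (rule moduleI)
  let ?E = "extend_scalars R S \<phi> A"
  have zero: "\<zero>\<^bsub>?E\<^esub> = \<tau> \<zero>\<^bsub>A\<^esub>"
  proof -
    have "frag_of (\<zero>\<^bsub>A\<^esub> \<oplus>\<^bsub>A\<^esub> \<zero>\<^bsub>A\<^esub>, \<one>\<^bsub>S\<^esub>) - frag_of (\<zero>\<^bsub>A\<^esub>, \<one>\<^bsub>S\<^esub>) - frag_of (\<zero>\<^bsub>A\<^esub>, \<one>\<^bsub>S\<^esub>) \<in> Z"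
      by (rule rel_add_left) auto
    from Z_neg[OF this] show ?thesis using \<tau>_zero_iff[of "\<zero>\<^bsub>A\<^esub>"] by simp
  qed
  show "cring S" by (rule S.cring_axioms)
  show "abelian_group ?E"
  proof (rule abelian_groupI)
    fix x assume "x \<in> carrier ?E"
    then obtain u where u: "u \<in> carrier A" "x = \<tau> u" by (auto simp: \<tau>_surj)
    then show "\<exists>y\<in>carrier ?E. y \<oplus>\<^bsub>?E\<^esub> x = \<zero>\<^bsub>?E\<^esub>"
      by (intro bexI[of _ "\<tau> (\<ominus>\<^bsub>A\<^esub> u)"]) (auto simp: \<tau>_surj zero \<tau>_add A.M.l_neg)
  qed (auto simp: \<tau>_surj zero \<tau>_add A.M.a_ac)
  fix a x assume "a \<in> carrier S" "x \<in> carrier ?E"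
  then obtain b u where u: "b \<in> carrier R" "a = \<phi> b" "u \<in> carrier A" "x = \<tau> u"
    using \<phi>_surj \<tau>_surj by blast
  then show "a \<odot>\<^bsub>?E\<^esub> x \<in> carrier ?E" by (simp add: \<tau>_smult \<tau>_surj)
next
  let ?E = "extend_scalars R S \<phi> A"
  fix a b x assume "a \<in> carrier S" "b \<in> carrier S" "x \<in> carrier ?E"
  then obtain c d u where u: "c \<in> carrier R" "a = \<phi> c" "d \<in> carrier R" "b = \<phi> d" "u \<in> carrier A" "x = \<tau> u"
    using \<phi>_surj \<tau>_surj by (metis (no_types, lifting) imageE)
  then show "(a \<oplus>\<^bsub>S\<^esub> b) \<odot>\<^bsub>?E\<^esub> x = a \<odot>\<^bsub>?E\<^esub> x \<oplus>\<^bsub>?E\<^esub> b \<odot>\<^bsub>?E\<^esub> x"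
    by (simp add: \<tau>_smult \<tau>_add A.smult_l_distr flip: hom_add)
  show "(a \<otimes>\<^bsub>S\<^esub> b) \<odot>\<^bsub>?E\<^esub> x = a \<odot>\<^bsub>?E\<^esub> (b \<odot>\<^bsub>?E\<^esub> x)"
    using u by (simp add: \<tau>_smult A.smult_assoc1 flip: hom_mult)
next
  let ?E = "extend_scalars R S \<phi> A"
  fix a x y assume "a \<in> carrier S" "x \<in> carrier ?E" "y \<in> carrier ?E"
  then obtain c u v where u: "c \<in> carrier R" "a = \<phi> c" "v \<in> carrier A" "y = \<tau> v" "u \<in> carrier A" "x = \<tau> u"
    using \<phi>_surj \<tau>_surj by (metis (no_types, lifting) imageE)
  then show "a \<odot>\<^bsub>?E\<^esub> (x \<oplus>\<^bsub>?E\<^esub> y) = a \<odot>\<^bsub>?E\<^esub> x \<oplus>\<^bsub>?E\<^esub> a \<odot>\<^bsub>?E\<^esub> y"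
    by (simp add: \<tau>_smult \<tau>_add A.smult_r_distr)
next
  let ?E = "extend_scalars R S \<phi> A"
  fix x assume "x \<in> carrier ?E"
  then obtain u where u: "u \<in> carrier A" "x = \<tau> u" by (auto simp: \<tau>_surj)
  then show "\<one>\<^bsub>S\<^esub> \<odot>\<^bsub>?E\<^esub> x = x" using \<tau>_smult[of "\<one>\<^bsub>R\<^esub>" u] by simp
qed

text \<open>For the direction that needs an argument, \<open>x \<otimes> s \<mapsto> ax + fA\<close> with \<open>\<phi>(a) = s\<close> is a homomorphism to
  \<open>A/fA\<close>, well defined because two choices of \<open>a\<close> differ by a multiple of \<open>f\<close>. It sends
  \<open>x \<otimes> 1\<close> to the class of \<open>x\<close>.\<close>

lemma \<tau>_kernel:
  assumes ker: "\<And>a. a \<in> carrier R \<Longrightarrow> \<phi> a = \<zero>\<^bsub>S\<^esub> \<longleftrightarrow> (\<exists>b\<in>carrier R. a = b \<otimes>\<^bsub>R\<^esub> f)"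
    and f: "f \<in> carrier R" and x: "x \<in> carrier A"
  shows "\<tau> x = \<zero>\<^bsub>extend_scalars R S \<phi> A\<^esub> \<longleftrightarrow> (\<exists>y\<in>carrier A. x = f \<odot>\<^bsub>A\<^esub> y)"
proof
  assume "\<exists>y\<in>carrier A. x = f \<odot>\<^bsub>A\<^esub> y"
  then obtain y where y: "y \<in> carrier A" "x = f \<odot>\<^bsub>A\<^esub> y" by blast
  have "\<phi> f = \<zero>\<^bsub>S\<^esub>" using ker[OF f] f R.l_one[OF f] by (metis R.one_closed)
  then show "\<tau> x = \<zero>\<^bsub>extend_scalars R S \<phi> A\<^esub>"
    using y f \<tau>_smult[OF f y(1)] module.smult_l_null[OF module_ext, of "\<tau> y"] by (simp add: \<tau>_surj)
next
  assume "\<tau> x = \<zero>\<^bsub>extend_scalars R S \<phi> A\<^esub>"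
  then have xZ: "frag_of (x, \<one>\<^bsub>S\<^esub>) \<in> Z" by (simp add: \<tau>_zero_iff)
  define H where "H = (\<lambda>y. f \<odot>\<^bsub>A\<^esub> y) ` carrier A"
  have "submodule H R A"
  proof (rule A.submoduleI)
    show "\<zero>\<^bsub>A\<^esub> \<in> H" using f by (auto simp: H_def intro!: image_eqI[of _ _ "\<zero>\<^bsub>A\<^esub>"])
    show "\<ominus>\<^bsub>A\<^esub> a \<in> H" if "a \<in> H" for a
      using that f by (auto simp: H_def A.smult_r_minus[symmetric])
    show "a \<oplus>\<^bsub>A\<^esub> b \<in> H" if "a \<in> H" "b \<in> H" for a b
      using that f by (auto simp: H_def A.smult_r_distr[symmetric])
    show "a \<odot>\<^bsub>A\<^esub> b \<in> H" if "a \<in> carrier R" "b \<in> H" for a b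
    proof -
      obtain y where y: "y \<in> carrier A" "b = f \<odot>\<^bsub>A\<^esub> y" using \<open>b \<in> H\<close> by (auto simp: H_def)
      then have "a \<odot>\<^bsub>A\<^esub> b = f \<odot>\<^bsub>A\<^esub> (a \<odot>\<^bsub>A\<^esub> y)"
        using f that(1) by (simp add: A.smult_assoc1[symmetric] R.m_comm)
      then show ?thesis using y(1) that(1) by (auto simp: H_def)
    qed
  qed (use f in \<open>auto simp: H_def\<close>)
  note HE = A.submoduleE[OF this]
  have sub: "subgroup H (add_monoid A)" using \<open>submodule H R A\<close> by (rule submodule.axioms)
  have N: "normal H (add_monoid A)" by (rule A.M.add.subgroup_imp_normal[OF sub])
  have Q: "comm_group (add_monoid A Mod H)" by (rule A.M.add.abelian_FactGroup[OF sub])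
  have group_Q: "group (add_monoid A Mod H)" using Q by (rule comm_group.axioms)
  define rep where "rep s = (SOME a. a \<in> carrier R \<and> \<phi> a = s)" for s
  have rep: "rep s \<in> carrier R" "\<phi> (rep s) = s" if "s \<in> carrier S" for s
  proof -
    have "\<exists>a. a \<in> carrier R \<and> \<phi> a = s" using that unfolding \<phi>_surj[symmetric] by auto
    from someI_ex[OF this] show "rep s \<in> carrier R" "\<phi> (rep s) = s" by (simp_all add: rep_def)
  qed
  define q where "q x = H #>\<^bsub>add_monoid A\<^esub> x" for x
  have q_in: "q x \<in> carrier (add_monoid A Mod H)" if "x \<in> carrier A" for x
    using that by (auto simp: q_def FactGroup_def RCOSETS_def)
  have q_add: "q x \<otimes>\<^bsub>add_monoid A Mod H\<^esub> q y = q (x \<oplus>\<^bsub>A\<^esub> y)" if "x \<in> carrier A" "y \<in> carrier A" for x y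
    using normal.rcos_sum[OF N, of x y] that by (simp add: q_def FactGroup_def)
  have q_one: "q x = \<one>\<^bsub>add_monoid A Mod H\<^esub> \<longleftrightarrow> x \<in> H" if "x \<in> carrier A" for x
    using that A.M.add.coset_join1[of H x] A.M.add.coset_join2[of x H] sub HE(1)
    by (auto simp: q_def FactGroup_def)
  have q_smult: "q (a \<odot>\<^bsub>A\<^esub> x) = q (b \<odot>\<^bsub>A\<^esub> x)"
    if ab: "a \<in> carrier R" "b \<in> carrier R" "x \<in> carrier A" "\<phi> a = \<phi> b" for a b x
  proof -
    have "\<phi> (a \<ominus>\<^bsub>R\<^esub> b) = \<zero>\<^bsub>S\<^esub>" using ab by (simp add: a_minus_def S.r_neg)
    then obtain c where c: "c \<in> carrier R" "a \<ominus>\<^bsub>R\<^esub> b = c \<otimes>\<^bsub>R\<^esub> f" using ker[of "a \<ominus>\<^bsub>R\<^esub> b"] ab by auto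
    have "a = (c \<otimes>\<^bsub>R\<^esub> f) \<oplus>\<^bsub>R\<^esub> b" using ab c(2)[symmetric] by (simp add: a_minus_def R.a_assoc R.l_neg)
    then have "a \<odot>\<^bsub>A\<^esub> x = f \<odot>\<^bsub>A\<^esub> (c \<odot>\<^bsub>A\<^esub> x) \<oplus>\<^bsub>A\<^esub> b \<odot>\<^bsub>A\<^esub> x"
      using ab c f by (simp add: A.smult_l_distr A.smult_assoc1[symmetric] R.m_comm)
    moreover have "f \<odot>\<^bsub>A\<^esub> (c \<odot>\<^bsub>A\<^esub> x) \<in> H" using c ab by (auto simp: H_def)
    ultimately have "q (a \<odot>\<^bsub>A\<^esub> x) = \<one>\<^bsub>add_monoid A Mod H\<^esub> \<otimes>\<^bsub>add_monoid A Mod H\<^esub> q (b \<odot>\<^bsub>A\<^esub> x)"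
      using q_add[of "f \<odot>\<^bsub>A\<^esub> (c \<odot>\<^bsub>A\<^esub> x)" "b \<odot>\<^bsub>A\<^esub> x"] q_one[of "f \<odot>\<^bsub>A\<^esub> (c \<odot>\<^bsub>A\<^esub> x)"] ab c f
      by (metis A.smult_closed)
    then show ?thesis
      using monoid.l_one[OF group.is_monoid[OF group_Q] q_in[of "b \<odot>\<^bsub>A\<^esub> x"]] ab by simp
  qed
  have "(\<lambda>(x, s). q (rep s \<odot>\<^bsub>A\<^esub> x)) ` (carrier A \<times> carrier S) \<subseteq> carrier (add_monoid A Mod H)"
    using rep by (auto intro!: q_in)
  from comm_group.free_Abelian_group_universal[OF Q this] obtain h where h: "h \<in> hom FG (add_monoid A Mod H)"
    "\<And>u. u \<in> carrier A \<times> carrier S \<Longrightarrow> h (frag_of u) = (\<lambda>(x, s). q (rep s \<odot>\<^bsub>A\<^esub> x)) u"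
    by blast
  interpret h: group_hom FG "add_monoid A Mod H" h
    using h(1) group_Q by (simp add: group_hom_def group_hom_axioms_def)
  have hf: "h (frag_of (x, s)) = q (rep s \<odot>\<^bsub>A\<^esub> x)" if "x \<in> carrier A" "s \<in> carrier S" for x s
    using h(2)[of "(x, s)"] that by simp
  have h_diff: "h (u - v) = \<one>\<^bsub>add_monoid A Mod H\<^esub>" if "u \<in> carrier FG" "v \<in> carrier FG" "h u = h v" for u v
  proof -
    note [simp del] = mult_FactGroup one_FactGroup
    have "h (u \<otimes>\<^bsub>FG\<^esub> inv\<^bsub>FG\<^esub> v) = h u \<otimes>\<^bsub>add_monoid A Mod H\<^esub> inv\<^bsub>add_monoid A Mod H\<^esub> h v"
      by (simp only: h.hom_mult[OF that(1) h.G.inv_closed[OF that(2)]] h.hom_inv[OF that(2)])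
    also have "\<dots> = \<one>\<^bsub>add_monoid A Mod H\<^esub>"
      using group.r_inv[OF group_Q h.hom_closed[OF that(2)]] that(3) by simp
    finally show ?thesis using that by simp
  qed
  have h_add: "h (u + v) = h u \<otimes>\<^bsub>add_monoid A Mod H\<^esub> h v" if "u \<in> carrier FG" "v \<in> carrier FG" for u v
    using h.hom_mult[OF that] by simp
  have plus_in: "u + v \<in> carrier FG" if "u \<in> carrier FG" "v \<in> carrier FG" for u v
    using h.G.m_closed[OF that] by simp
  have rel: "h u = \<one>\<^bsub>add_monoid A Mod H\<^esub>" if "u \<in> tensor_relations R S \<phi> A" for u
  proof -
    have c: "frag_of (x, s) \<in> carrier FG" if "x \<in> carrier A" "s \<in> carrier S" for x s
      using frag_carrier[OF that] .
    from that show ?thesis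
      unfolding tensor_relations_def diff_diff_eq
    proof (elim UnE CollectE exE conjE)
      fix x y s assume 1: "x \<in> carrier A" "y \<in> carrier A" "s \<in> carrier S"
        "u = frag_of (x \<oplus>\<^bsub>A\<^esub> y, s) - (frag_of (x, s) + frag_of (y, s))"
      have "h (frag_of (x \<oplus>\<^bsub>A\<^esub> y, s)) = q (rep s \<odot>\<^bsub>A\<^esub> x \<oplus>\<^bsub>A\<^esub> rep s \<odot>\<^bsub>A\<^esub> y)"
        using 1(1-3) rep by (simp add: hf A.smult_r_distr)
      also have "\<dots> = h (frag_of (x, s) + frag_of (y, s))"
        using h_add[OF c[OF 1(1,3)] c[OF 1(2,3)]] 1(1-3) rep by (simp only: hf q_add A.smult_closed)
      finally show ?thesis
        unfolding 1(4) using 1(1-3) by (intro h_diff plus_in c) auto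
    next
      fix x s t assume 2: "x \<in> carrier A" "s \<in> carrier S" "t \<in> carrier S"
        "u = frag_of (x, s \<oplus>\<^bsub>S\<^esub> t) - (frag_of (x, s) + frag_of (x, t))"
      have "h (frag_of (x, s \<oplus>\<^bsub>S\<^esub> t)) = q (rep (s \<oplus>\<^bsub>S\<^esub> t) \<odot>\<^bsub>A\<^esub> x)"
        using 2(1-3) by (simp add: hf)
      also have "\<dots> = q ((rep s \<oplus>\<^bsub>R\<^esub> rep t) \<odot>\<^bsub>A\<^esub> x)"
        using 2(1-3) by (intro q_smult) (auto simp: rep)
      also have "\<dots> = q (rep s \<odot>\<^bsub>A\<^esub> x \<oplus>\<^bsub>A\<^esub> rep t \<odot>\<^bsub>A\<^esub> x)"
        using 2(1-3) rep by (simp add: A.smult_l_distr)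
      also have "\<dots> = h (frag_of (x, s) + frag_of (x, t))"
        using h_add[OF c[OF 2(1,2)] c[OF 2(1,3)]] 2(1-3) rep by (simp only: hf q_add A.smult_closed)
      finally show ?thesis
        unfolding 2(4) using 2(1-3) by (intro h_diff plus_in c) auto
    next
      fix a x s assume 3: "a \<in> carrier R" "x \<in> carrier A" "s \<in> carrier S"
        "u = frag_of (a \<odot>\<^bsub>A\<^esub> x, s) - frag_of (x, \<phi> a \<otimes>\<^bsub>S\<^esub> s)"
      have "h (frag_of (a \<odot>\<^bsub>A\<^esub> x, s)) = q ((rep s \<otimes>\<^bsub>R\<^esub> a) \<odot>\<^bsub>A\<^esub> x)"
        using 3(1-3) rep by (simp add: hf A.smult_assoc1)
      also have "\<dots> = q (rep (\<phi> a \<otimes>\<^bsub>S\<^esub> s) \<odot>\<^bsub>A\<^esub> x)"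
        using 3(1-3) by (intro q_smult) (auto simp: rep S.m_comm)
      also have "\<dots> = h (frag_of (x, \<phi> a \<otimes>\<^bsub>S\<^esub> s))"
        using 3(1-3) by (simp add: hf)
      finally show ?thesis
        unfolding 3(4) using 3(1-3) by (intro h_diff plus_in c) auto
    qed
  qed
  have "h u = \<one>\<^bsub>add_monoid A Mod H\<^esub>" if "u \<in> Z" for u
    using that unfolding tensor_null_def
  proof (induction rule: generate.induct)
    case one
    then show ?case by (rule h.hom_one)
  next
    case (incl u)
    then show ?case by (rule rel)
  next
    case (inv u)
    then have u: "u \<in> carrier FG" using relations_subset by blast
    show ?case by (simp only: h.hom_inv[OF u] rel[OF inv] h.H.inv_one)
  next
    case (eng u v)
    have "u \<in> carrier FG" "v \<in> carrier FG"
      using eng.hyps subgroup.mem_carrier[OF Z_subgroup] unfolding tensor_null_def by blast+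
    then show ?case by (simp only: h.hom_mult eng.IH h.H.l_one h.H.one_closed)
  qed
  from this[OF xZ] have "q (rep \<one>\<^bsub>S\<^esub> \<odot>\<^bsub>A\<^esub> x) = \<one>\<^bsub>add_monoid A Mod H\<^esub>" using hf x by simp
  moreover have "q (rep \<one>\<^bsub>S\<^esub> \<odot>\<^bsub>A\<^esub> x) = q (\<one>\<^bsub>R\<^esub> \<odot>\<^bsub>A\<^esub> x)" using x by (intro q_smult) (auto simp: rep)
  ultimately show "\<exists>y\<in>carrier A. x = f \<odot>\<^bsub>A\<^esub> y" using q_one[OF x] x by (auto simp: H_def)
qed

end

lemma extend_scalars_map_tau:
  assumes "base_change R S \<phi> A" "base_change R S \<phi> B" "h \<in> module_hom R A B" "x \<in> carrier A"
  shows "extend_scalars_map R S \<phi> B h (base_change.\<tau> R S \<phi> A x) = base_change.\<tau> R S \<phi> B (h x)"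
proof -
  interpret A: base_change R S \<phi> A by fact
  interpret B: base_change R S \<phi> B by fact
  let ?g = "\<lambda>(x, t). frag_of (h x, t)"
  have rel: "frag_extend ?g u \<in> B.Z" if "u \<in> tensor_relations R S \<phi> A" for u
    using that unfolding tensor_relations_def
    by (auto simp: frag_extend_diff module_hom_add[OF assms(3)] module_hom_smult[OF assms(3)]
        module_hom_closed[OF assms(3)]
        intro!: B.rel_add_left B.rel_add_right B.rel_smult)
  have "B.Z <#>\<^bsub>B.FG\<^esub> frag_extend ?g ` (A.Z #>\<^bsub>A.FG\<^esub> frag_of (x, \<one>\<^bsub>S\<^esub>))
    = B.Z #>\<^bsub>B.FG\<^esub> frag_extend ?g (frag_of (x, \<one>\<^bsub>S\<^esub>))"
  proof (rule frag_coset_image[OF A.Z_subgroup B.Z_subgroup])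
    fix u assume "u \<in> A.Z"
    then show "frag_extend ?g u \<in> B.Z"
      unfolding tensor_null_def
      by (rule generate_frag_map[OF A.relations_subset _ B.relations_subset, rotated])
        (rule rel[unfolded tensor_null_def])
  qed (use assms(4) module_hom_closed[OF assms(3)] in auto)
  then show ?thesis unfolding extend_scalars_map_def A.\<tau>_def B.\<tau>_def by simp
qed

section \<open>Resolutions modulo f\<close>

lemma (in ideal) quot_zero_iff:
  assumes "a \<in> carrier R"
  shows "I +> a = \<zero>\<^bsub>R Quot I\<^esub> \<longleftrightarrow> a \<in> I"
  using assms rcos_const_imp_mem a_rcos_zero[OF is_ideal] by (auto simp: FactRing_def)

lemma (in ideal) quot_eq_iff:
  assumes "a \<in> carrier R" "b \<in> carrier R"
  shows "I +> a = I +> b \<longleftrightarrow> a \<ominus> b \<in> I"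
  using quotient_eq_iff_same_a_r_cos[OF is_ideal assms] by blast

lemma (in ideal) carrier_quot: "carrier (R Quot I) = (\<lambda>a. I +> a) ` carrier R"
  by (auto simp: FactRing_def A_RCOSETS_def')

lemma quot_module_simps [simp]:
  "carrier (quot_module R I) = carrier (R Quot I)" "\<zero>\<^bsub>quot_module R I\<^esub> = \<zero>\<^bsub>R Quot I\<^esub>"
  "x \<oplus>\<^bsub>quot_module R I\<^esub> y = x \<oplus>\<^bsub>R Quot I\<^esub> y"
  "a \<odot>\<^bsub>quot_module R I\<^esub> x = (I +>\<^bsub>R\<^esub> a) \<otimes>\<^bsub>R Quot I\<^esub> x"
  by (simp_all add: quot_module_def)

lemma ring_module_simps [simp]:
  "carrier (ring_module R) = carrier R" "\<zero>\<^bsub>ring_module R\<^esub> = \<zero>\<^bsub>R\<^esub>"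
  "x \<oplus>\<^bsub>ring_module R\<^esub> y = x \<oplus>\<^bsub>R\<^esub> y"
  "a \<odot>\<^bsub>ring_module R\<^esub> x = a \<otimes>\<^bsub>R\<^esub> x"
  by (simp_all add: ring_module_def)

lemma (in cring) module_ring_module: "module R (ring_module R)"
proof (rule moduleI)
  show "abelian_group (ring_module R)"
  proof (rule abelian_groupI)
    fix x assume "x \<in> carrier (ring_module R)"
    then show "\<exists>y\<in>carrier (ring_module R). y \<oplus>\<^bsub>ring_module R\<^esub> x = \<zero>\<^bsub>ring_module R\<^esub>"
      by (intro bexI[of _ "\<ominus> x"]) (auto simp: l_neg)
  qed (auto simp: a_ac)
qed (auto simp: l_distr r_distr m_assoc is_cring)

locale reduction = cring P for P :: "('p, 'x) ring_scheme" (structure) +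
  fixes f assumes f_carrier: "f \<in> carrier P"
begin

abbreviation Pb where "Pb \<equiv> P Quot (PIdl f)"

abbreviation bar :: "('p, 'a) module \<Rightarrow> ('p set, (('a \<times> 'p set) \<Rightarrow>\<^sub>0 int) set) module" where
  "bar \<equiv> extend_scalars P Pb (\<lambda>p. PIdl f +> p)"

abbreviation bar_map :: "('p, 'b) module \<Rightarrow> ('a \<Rightarrow> 'b)
    \<Rightarrow> (('a \<times> 'p set) \<Rightarrow>\<^sub>0 int) set \<Rightarrow> (('b \<times> 'p set) \<Rightarrow>\<^sub>0 int) set" where
  "bar_map \<equiv> extend_scalars_map P Pb (\<lambda>p. PIdl f +> p)"

abbreviation tau :: "('p, 'a) module \<Rightarrow> 'a \<Rightarrow> (('a \<times> 'p set) \<Rightarrow>\<^sub>0 int) set" where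
  "tau \<equiv> base_change.\<tau> P Pb (\<lambda>p. PIdl f +> p)"

lemma f_ideal: "ideal (PIdl f) P"
  by (rule cgenideal_ideal[OF f_carrier])

lemma rho_hom: "ring_hom_cring P Pb (\<lambda>p. PIdl f +> p)"
  using ideal.rcos_ring_hom_cring[OF f_ideal is_cring] .

lemma Pb_cring: "cring Pb"
  using rho_hom by (simp add: ring_hom_cring_def)

lemma rho_zero_iff: "a \<in> carrier P \<Longrightarrow> PIdl f +> a = \<zero>\<^bsub>Pb\<^esub> \<longleftrightarrow> (\<exists>b\<in>carrier P. a = b \<otimes> f)"
  using ideal.quot_zero_iff[OF f_ideal] by (auto simp: cgenideal_def)

lemma base_change: "module P A \<Longrightarrow> base_change P Pb (\<lambda>p. PIdl f +> p) A"
  using rho_hom ideal.carrier_quot[OF f_ideal]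
  by (auto simp: base_change_def base_change_axioms_def)

lemmas bar_carrier = base_change.\<tau>_surj[OF base_change]
lemmas bar_module = base_change.module_ext[OF base_change]
lemmas tau_add = base_change.\<tau>_add[OF base_change]
lemmas tau_smult = base_change.\<tau>_smult[OF base_change]
lemmas bar_map_tau = extend_scalars_map_tau[OF base_change base_change]

lemma tau_zero_iff:
  assumes "module P A" "x \<in> carrier A"
  shows "tau A x = \<zero>\<^bsub>bar A\<^esub> \<longleftrightarrow> (\<exists>y\<in>carrier A. x = f \<odot>\<^bsub>A\<^esub> y)"
  by (rule base_change.\<tau>_kernel[OF base_change[OF assms(1)] _ f_carrier assms(2)]) (rule rho_zero_iff)

lemma tau_hom: "module P A \<Longrightarrow> x \<in> carrier A \<Longrightarrow> tau A x \<in> carrier (bar A)"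
  by (simp add: bar_carrier)

lemma tau_neg:
  assumes "module P A" "x \<in> carrier A"
  shows "tau A (\<ominus>\<^bsub>A\<^esub> x) = \<ominus>\<^bsub>bar A\<^esub> tau A x"
proof -
  interpret A: module P A by fact
  interpret B: module Pb "bar A" by (rule bar_module[OF assms(1)])
  have "tau A (\<ominus>\<^bsub>A\<^esub> x) \<oplus>\<^bsub>bar A\<^esub> tau A x = tau A \<zero>\<^bsub>A\<^esub>"
    using assms by (simp add: tau_add A.M.l_neg)
  also have "\<dots> = \<zero>\<^bsub>bar A\<^esub>"
    using f_carrier by (subst tau_zero_iff[OF assms(1)]) (auto intro!: bexI[of _ "\<zero>\<^bsub>A\<^esub>"])
  finally show ?thesis using assms tau_hom[OF assms(1)] by (intro B.M.minus_equality[symmetric]) auto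
qed

lemma tau_eq_iff:
  assumes "module P A" "x \<in> carrier A" "y \<in> carrier A"
  shows "tau A x = tau A y \<longleftrightarrow> (\<exists>v\<in>carrier A. x = y \<oplus>\<^bsub>A\<^esub> f \<odot>\<^bsub>A\<^esub> v)"
proof -
  interpret A: module P A by fact
  interpret B: module Pb "bar A" by (rule bar_module[OF assms(1)])
  have "tau A x = tau A y \<longleftrightarrow> tau A x \<ominus>\<^bsub>bar A\<^esub> tau A y = \<zero>\<^bsub>bar A\<^esub>"
    using assms by (simp add: B.M.diff_zero_iff tau_hom)
  also have "tau A x \<ominus>\<^bsub>bar A\<^esub> tau A y = tau A (x \<ominus>\<^bsub>A\<^esub> y)"
    using assms by (simp add: a_minus_def tau_add tau_neg[symmetric])
  also have "\<dots> = \<zero>\<^bsub>bar A\<^esub> \<longleftrightarrow> (\<exists>v\<in>carrier A. x \<ominus>\<^bsub>A\<^esub> y = f \<odot>\<^bsub>A\<^esub> v)"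
    using assms by (simp add: tau_zero_iff)
  also have "\<dots> \<longleftrightarrow> (\<exists>v\<in>carrier A. x = y \<oplus>\<^bsub>A\<^esub> f \<odot>\<^bsub>A\<^esub> v)"
  proof (intro bex_cong refl)
    fix v assume v: "v \<in> carrier A"
    have "x \<ominus>\<^bsub>A\<^esub> y = f \<odot>\<^bsub>A\<^esub> v \<longleftrightarrow> f \<odot>\<^bsub>A\<^esub> v = x \<oplus>\<^bsub>A\<^esub> \<ominus>\<^bsub>A\<^esub> y" by (auto simp: a_minus_def)
    also have "\<dots> \<longleftrightarrow> x = f \<odot>\<^bsub>A\<^esub> v \<oplus>\<^bsub>A\<^esub> y"
      using A.M.add.inv_solve_right[of "f \<odot>\<^bsub>A\<^esub> v" x y] v assms f_carrier by (simp add: a_inv_def)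
    finally show "x \<ominus>\<^bsub>A\<^esub> y = f \<odot>\<^bsub>A\<^esub> v \<longleftrightarrow> x = y \<oplus>\<^bsub>A\<^esub> f \<odot>\<^bsub>A\<^esub> v"
      using v assms f_carrier by (simp add: A.M.a_comm)
  qed
  finally show ?thesis .
qed

lemma bar_map_hom:
  assumes "module P A" "module P B" "h \<in> module_hom P A B"
  shows "bar_map B h \<in> module_hom Pb (bar A) (bar B)"
proof (rule module_homI)
  interpret A: module P A by fact
  note hc = module_hom_closed[OF assms(3)]
  show "bar_map B h x \<in> carrier (bar B)" if "x \<in> carrier (bar A)" for x
    using that assms hc by (auto simp: bar_carrier bar_map_tau)
  show "bar_map B h (x \<oplus>\<^bsub>bar A\<^esub> y) = bar_map B h x \<oplus>\<^bsub>bar B\<^esub> bar_map B h y"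
    if "x \<in> carrier (bar A)" "y \<in> carrier (bar A)" for x y
    using that assms hc by (auto simp: bar_carrier bar_map_tau tau_add module_hom_add[OF assms(3)])
  show "bar_map B h (a \<odot>\<^bsub>bar A\<^esub> x) = a \<odot>\<^bsub>bar B\<^esub> bar_map B h x"
    if "a \<in> carrier Pb" "x \<in> carrier (bar A)" for a x
    using that assms hc
    by (auto simp: bar_carrier bar_map_tau tau_smult module_hom_smult[OF assms(3)]
        ideal.carrier_quot[OF f_ideal])
qed

text \<open>The coordinates of a class are the classes of the coordinates of any representative.\<close>

lemma fg_free_bar:
  fixes A :: "('p, 'a) module"
  assumes "fg_free_module P A"
  shows "fg_free_module Pb (bar A)"
proof -
  obtain I :: "'a set" and \<phi> where \<phi>: "coords P A I \<phi>" and A: "module P A"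
    using fg_free_obtain_coords[OF assms] .
  interpret A: module P A by fact
  interpret rho: ring_hom_cring P Pb "\<lambda>p. PIdl f +> p" by (rule rho_hom)
  note D = coordsD[OF \<phi>]
  define lift where "lift \<xi> = (SOME x. x \<in> carrier A \<and> tau A x = \<xi>)" for \<xi>
  define \<psi> where "\<psi> \<xi> i = PIdl f +> \<phi> (lift \<xi>) i" for \<xi> i
  have \<psi>: "\<psi> (tau A x) i = PIdl f +> \<phi> x i" if xi: "x \<in> carrier A" "i \<in> I" for x i
  proof -
    have "lift (tau A x) \<in> carrier A \<and> tau A (lift (tau A x)) = tau A x"
      unfolding lift_def by (rule someI_ex) (use xi(1) in blast)
    then obtain v where v: "v \<in> carrier A" "lift (tau A x) = x \<oplus>\<^bsub>A\<^esub> f \<odot>\<^bsub>A\<^esub> v"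
      using tau_eq_iff[OF A, of "lift (tau A x)" x] xi by auto
    have "PIdl f +> f = \<zero>\<^bsub>Pb\<^esub>" using rho_zero_iff[OF f_carrier] l_one[OF f_carrier] one_closed by metis
    then show ?thesis using v xi f_carrier D(5) by (simp add: \<psi>_def D(3,4))
  qed
  have "coords Pb (bar A) I (\<lambda>\<xi>. restrict (\<psi> \<xi>) I)"
  proof (rule coordsI)
    fix \<xi> \<eta> assume "\<xi> \<in> carrier (bar A)" "\<eta> \<in> carrier (bar A)"
      and eq: "\<And>i. i \<in> I \<Longrightarrow> \<psi> \<xi> i = \<psi> \<eta> i"
    then obtain x y where xy: "x \<in> carrier A" "\<xi> = tau A x" "y \<in> carrier A" "\<eta> = tau A y"
      by (auto simp: bar_carrier[OF A])
    have "\<exists>b\<in>carrier P. \<phi> x i = \<phi> y i \<oplus> f \<otimes> b" if "i \<in> I" for i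
    proof -
      have c: "\<phi> x i \<in> carrier P" "\<phi> y i \<in> carrier P" using D(5) xy that by auto
      have "PIdl f +> \<phi> x i = PIdl f +> \<phi> y i" using eq[OF that] xy that by (simp add: \<psi>)
      then have "\<phi> x i \<ominus> \<phi> y i \<in> PIdl f" using ideal.quot_eq_iff[OF f_ideal c] by simp
      then obtain b where b: "b \<in> carrier P" "\<phi> x i \<ominus> \<phi> y i = b \<otimes> f" by (auto simp: cgenideal_def)
      have "\<phi> x i = \<phi> y i \<oplus> (\<phi> x i \<ominus> \<phi> y i)"
        by (rule add_diff[OF c(2,1), symmetric])
      then show ?thesis using b f_carrier by (auto simp: m_comm)
    qed
    then obtain b where b: "\<And>i. i \<in> I \<Longrightarrow> b i \<in> carrier P" "\<And>i. i \<in> I \<Longrightarrow> \<phi> x i = \<phi> y i \<oplus> f \<otimes> b i" by metis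
    obtain v where v: "v \<in> carrier A" "\<And>i. i \<in> I \<Longrightarrow> \<phi> v i = b i"
      using coords_surj[OF \<phi>, of b] b(1) by blast
    have "x = y \<oplus>\<^bsub>A\<^esub> f \<odot>\<^bsub>A\<^esub> v"
      using xy v b f_carrier by (intro coords_eqI[OF \<phi>]) (auto simp: D(3,4))
    then show "\<xi> = \<eta>" using tau_eq_iff[OF A, of x y] xy v by auto
  next
    fix c assume c: "c \<in> I \<rightarrow>\<^sub>E carrier Pb"
    have "\<exists>p\<in>carrier P. c i = PIdl f +> p" if "i \<in> I" for i
      using PiE_mem[OF c that] unfolding ideal.carrier_quot[OF f_ideal] by auto
    then obtain p where p: "\<And>i. i \<in> I \<Longrightarrow> p i \<in> carrier P" "\<And>i. i \<in> I \<Longrightarrow> c i = PIdl f +> p i" by metis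
    obtain x where "x \<in> carrier A" "\<And>i. i \<in> I \<Longrightarrow> \<phi> x i = p i"
      using coords_surj[OF \<phi>, of p] p(1) by blast
    then show "\<exists>\<xi>\<in>carrier (bar A). \<forall>i\<in>I. \<psi> \<xi> i = c i"
      using p(2) by (intro bexI[of _ "tau A x"]) (auto simp: \<psi> tau_hom[OF A])
  next
    fix a \<xi> i assume "a \<in> carrier Pb" "\<xi> \<in> carrier (bar A)" "i \<in> I"
    then show "\<psi> (a \<odot>\<^bsub>bar A\<^esub> \<xi>) i = a \<otimes>\<^bsub>Pb\<^esub> \<psi> \<xi> i"
      using D(5) by (auto simp: bar_carrier[OF A] ideal.carrier_quot[OF f_ideal] \<psi> tau_smult[OF A] D(4))
  qed (use D(1,5) in \<open>auto simp: bar_carrier[OF A] \<psi> tau_add[OF A] D(3) bar_module[OF A]\<close>)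
  then show ?thesis using bar_module[OF A] fg_free_of_coords by blast
qed

text \<open>Exactness at \<open>B/fB\<close> of the sequence induced by \<open>h : A \<rightarrow> B\<close> and \<open>g : B \<rightarrow> C\<close>, in terms of
  representatives.\<close>

definition exact_mod :: "('p, 'a) module \<Rightarrow> ('a \<Rightarrow> 'b) \<Rightarrow> ('p, 'b) module \<Rightarrow> ('b \<Rightarrow> 'c) \<Rightarrow> ('p, 'c) module \<Rightarrow> bool" where
  "exact_mod A h B g C \<longleftrightarrow>
    (\<forall>x\<in>carrier A. \<exists>y\<in>carrier C. g (h x) = f \<odot>\<^bsub>C\<^esub> y) \<and>
    (\<forall>x\<in>carrier B. \<forall>y\<in>carrier C. g x = f \<odot>\<^bsub>C\<^esub> y \<longrightarrow>
      (\<exists>u\<in>carrier A. \<exists>v\<in>carrier B. x = h u \<oplus>\<^bsub>B\<^esub> f \<odot>\<^bsub>B\<^esub> v))"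

text \<open>If \<open>gx = fy\<close>, then \<open>fx = hgx = fhy\<close>, and \<open>f\<close> can be cancelled in a free module. So \<open>x\<close> is even
  an image under \<open>h\<close> itself, not just modulo \<open>f\<close>.\<close>

lemma factorization_exact_mod:
  assumes f: "regular_element P f" and free: "fg_free_module P B"
    and h: "h \<in> module_hom P A B" and gh: "\<And>x. x \<in> carrier A \<Longrightarrow> g (h x) = f \<odot>\<^bsub>A\<^esub> x"
    and hg: "\<And>x. x \<in> carrier B \<Longrightarrow> h (g x) = f \<odot>\<^bsub>B\<^esub> x"
  shows "exact_mod A h B g A"
  unfolding exact_mod_def
proof (intro conjI ballI impI)
  interpret B: module P B using free by (simp add: fg_free_module_def)
  fix x assume "x \<in> carrier A"
  then show "\<exists>y\<in>carrier A. g (h x) = f \<odot>\<^bsub>A\<^esub> y" using gh by blast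
next
  interpret B: module P B using free by (simp add: fg_free_module_def)
  fix x y assume x: "x \<in> carrier B" and y: "y \<in> carrier A" and eq: "g x = f \<odot>\<^bsub>A\<^esub> y"
  have "f \<odot>\<^bsub>B\<^esub> x = f \<odot>\<^bsub>B\<^esub> h y"
    using hg[OF x] module_hom_smult[OF h f_carrier y] eq by simp
  then have "x = h y"
    by (rule regular_smult_inject[OF free f x module_hom_closed[OF h y]])
  then show "\<exists>u\<in>carrier A. \<exists>v\<in>carrier B. x = h u \<oplus>\<^bsub>B\<^esub> f \<odot>\<^bsub>B\<^esub> v"
    using y x f_carrier by (intro bexI[of _ y] bexI[of _ "\<zero>\<^bsub>B\<^esub>"]) auto
qed

text \<open>The augmentation sends the class of \<open>x\<close> to the class of \<open>c(x)\<close> in \<open>P/(f)\<close> modulo the extension of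
  \<open>J\<close>. It is defined through an arbitrary representative, on which the value does not depend.\<close>

lemma resolution_bar:
  fixes C :: "nat \<Rightarrow> ('p, 'c) module"
  assumes free: "\<And>i. fg_free_module P (C i)"
    and hom: "\<And>i. 1 \<le> i \<Longrightarrow> d i \<in> module_hom P (C i) (C (i - 1))"
    and exact_mod: "\<And>i. 1 \<le> i \<Longrightarrow> exact_mod (C (i + 1)) (d (i + 1)) (C i) (d i) (C (i - 1))"
    and c: "c \<in> module_iso P (C 0) (ring_module P)"
    and J: "ideal J P" "c ` d 1 ` carrier (C 1) = J"
  shows "free_resolution Pb (\<lambda>i. bar (C i)) (\<lambda>i. bar_map (C (i - 1)) (d i))
    (quot_module Pb (Idl\<^bsub>Pb\<^esub> ((\<lambda>p. PIdl f +> p) ` J)))"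
proof -
  have complex: "\<exists>y\<in>carrier (C (i - 1)). d i (d (i + 1) x) = f \<odot>\<^bsub>C (i - 1)\<^esub> y"
    if "1 \<le> i" "x \<in> carrier (C (i + 1))" for i x
    using exact_mod[OF that(1)] that(2) unfolding exact_mod_def by blast
  have exact: "\<exists>u\<in>carrier (C (i + 1)). \<exists>v\<in>carrier (C i). x = d (i + 1) u \<oplus>\<^bsub>C i\<^esub> f \<odot>\<^bsub>C i\<^esub> v"
    if "1 \<le> i" "x \<in> carrier (C i)" "y \<in> carrier (C (i - 1))" "d i x = f \<odot>\<^bsub>C (i - 1)\<^esub> y" for i x y
    using exact_mod[OF that(1)] that(2-4) unfolding exact_mod_def by blast
  have mC: "module P (C i)" for i using free[of i] by (simp add: fg_free_module_def)
  have dc: "d i x \<in> carrier (C (i - 1))" if "1 \<le> i" "x \<in> carrier (C i)" for i x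
    using module_hom_closed[OF hom] that by blast
  have dc': "d (i + 1) x \<in> carrier (C i)" if "x \<in> carrier (C (i + 1))" for i x
    using dc[of "i + 1" x] that by simp
  note tau_d = bar_map_tau[OF mC mC hom]
  have tau_d': "bar_map (C i) (d (i + 1)) (tau (C (i + 1)) x) = tau (C i) (d (i + 1) x)"
    if "x \<in> carrier (C (i + 1))" for i x
    using tau_d[of "i + 1" x] that by simp
  interpret rho: ring_hom_cring P Pb "\<lambda>p. PIdl f +> p" by (rule rho_hom)
  define KK where "KK = (\<lambda>p. PIdl f +> p) ` J"
  have idealKK: "ideal KK Pb"
    unfolding KK_def using ring_ideal_imp_quot_ideal[OF f_ideal J(1)] .
  have Jsub: "J \<subseteq> carrier P" by (rule additive_subgroup.a_subset[OF ideal.axioms(1)[OF J(1)]])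
  have "ring Pb" using Pb_cring by (simp add: cring_def)
  then have KK_eq: "Idl\<^bsub>Pb\<^esub> ((\<lambda>p. PIdl f +> p) ` J) = KK"
    using ring.genideal_minimal[OF _ idealKK, of KK] ring.genideal_self[of Pb KK]
      additive_subgroup.a_subset[OF ideal.axioms(1)[OF idealKK]]
    unfolding KK_def[symmetric] by blast
  note quotKK = ideal.carrier_quot[OF idealKK] ideal.carrier_quot[OF f_ideal]
  interpret rho2: ring_hom_cring Pb "Pb Quot KK" "\<lambda>p. KK +>\<^bsub>Pb\<^esub> p"
    by (rule ideal.rcos_ring_hom_cring[OF idealKK Pb_cring])
  note ch = module_isoD(1)[OF c]
  have c_in: "c x \<in> carrier P" if "x \<in> carrier (C 0)" for x
    using module_hom_closed[OF ch that] by simp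
  have c_add: "c (x \<oplus>\<^bsub>C 0\<^esub> y) = c x \<oplus> c y" if "x \<in> carrier (C 0)" "y \<in> carrier (C 0)" for x y
    using module_hom_add[OF ch that] by simp
  have c_smult: "c (a \<odot>\<^bsub>C 0\<^esub> x) = a \<otimes> c x" if "a \<in> carrier P" "x \<in> carrier (C 0)" for a x
    using module_hom_smult[OF ch that] by simp
  have c_surj: "c ` carrier (C 0) = carrier P" and c_inj: "inj_on c (carrier (C 0))"
    using module_isoD(2)[OF c] by (auto simp: bij_betw_def)
  interpret C0: module P "C 0" by (rule mC)
  define lift where "lift \<xi> = (SOME x. x \<in> carrier (C 0) \<and> tau (C 0) x = \<xi>)" for \<xi>
  define e where "e \<xi> = KK +>\<^bsub>Pb\<^esub> (PIdl f +> c (lift \<xi>))" for \<xi>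
  have e: "e (tau (C 0) x) = KK +>\<^bsub>Pb\<^esub> (PIdl f +> c x)" if xi: "x \<in> carrier (C 0)" for x
  proof -
    have "lift (tau (C 0) x) \<in> carrier (C 0) \<and> tau (C 0) (lift (tau (C 0) x)) = tau (C 0) x"
      unfolding lift_def by (rule someI_ex) (use xi(1) in blast)
    then obtain v where v: "v \<in> carrier (C 0)" "lift (tau (C 0) x) = x \<oplus>\<^bsub>C 0\<^esub> f \<odot>\<^bsub>C 0\<^esub> v"
      using tau_eq_iff[OF mC, of "lift (tau (C 0) x)" 0 x] xi by auto
    have "PIdl f +> f = \<zero>\<^bsub>Pb\<^esub>" using rho_zero_iff[OF f_carrier] l_one[OF f_carrier] one_closed by metis
    then show ?thesis using v xi f_carrier by (simp add: e_def c_add c_smult c_in)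
  qed
  have e_hom: "e \<in> module_hom Pb (bar (C 0)) (quot_module Pb KK)"
  proof (rule module_homI)
    fix a x assume "a \<in> carrier Pb" "x \<in> carrier (bar (C 0))"
    then show "e (a \<odot>\<^bsub>bar (C 0)\<^esub> x) = a \<odot>\<^bsub>quot_module Pb KK\<^esub> e x"
      by (auto simp: bar_carrier[OF mC] quotKK(2) tau_smult[OF mC] e c_smult c_in)
  qed (auto simp: bar_carrier[OF mC] e c_in tau_add[OF mC] c_add)
  have e_surj: "e ` carrier (bar (C 0)) = carrier (quot_module Pb KK)"
  proof -
    have "e ` carrier (bar (C 0)) = (\<lambda>p. KK +>\<^bsub>Pb\<^esub> (PIdl f +> p)) ` c ` carrier (C 0)"
      unfolding bar_carrier[OF mC] image_image using e by (intro image_cong) auto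
    also have "\<dots> = carrier (quot_module Pb KK)"
      unfolding c_surj by (simp add: quotKK image_image)
    finally show ?thesis .
  qed
  have e_ker: "e \<xi> = \<zero>\<^bsub>quot_module Pb KK\<^esub> \<longleftrightarrow> \<xi> \<in> bar_map (C 0) (d 1) ` carrier (bar (C 1))"
    if xi: "\<xi> \<in> carrier (bar (C 0))" for \<xi>
  proof -
    obtain x where x: "x \<in> carrier (C 0)" "\<xi> = tau (C 0) x" using xi by (auto simp: bar_carrier[OF mC])
    have "e \<xi> = \<zero>\<^bsub>quot_module Pb KK\<^esub> \<longleftrightarrow> PIdl f +> c x \<in> KK"
      using ideal.quot_zero_iff[OF idealKK, of "PIdl f +> c x"] x c_in by (simp add: e)
    also have "\<dots> \<longleftrightarrow> (\<exists>u\<in>carrier (C 1). PIdl f +> c x = PIdl f +> c (d 1 u))"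
      unfolding KK_def J(2)[symmetric] by auto
    also have "\<dots> \<longleftrightarrow> (\<exists>u\<in>carrier (C 1). \<xi> = tau (C 0) (d 1 u))"
    proof (intro bex_cong refl)
      fix u assume u: "u \<in> carrier (C 1)"
      have du: "d 1 u \<in> carrier (C 0)" using dc[of 1 u] u by simp
      show "PIdl f +> c x = PIdl f +> c (d 1 u) \<longleftrightarrow> \<xi> = tau (C 0) (d 1 u)"
      proof
        assume "PIdl f +> c x = PIdl f +> c (d 1 u)"
        then have "c x \<ominus> c (d 1 u) \<in> PIdl f" using ideal.quot_eq_iff[OF f_ideal] c_in x du by blast
        then obtain b where b: "b \<in> carrier P" "c x \<ominus> c (d 1 u) = b \<otimes> f" by (auto simp: cgenideal_def)
        have "b \<in> c ` carrier (C 0)" by (simp add: c_surj b(1))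
        then obtain v where v: "v \<in> carrier (C 0)" "c v = b" by auto
        have "c x = c (d 1 u) \<oplus> (c x \<ominus> c (d 1 u))"
          by (rule add_diff[OF c_in[OF du] c_in[OF x(1)], symmetric])
        also have "\<dots> = c (d 1 u) \<oplus> f \<otimes> b"
          unfolding b(2) by (simp only: m_comm[OF b(1) f_carrier])
        also have "\<dots> = c (d 1 u \<oplus>\<^bsub>C 0\<^esub> f \<odot>\<^bsub>C 0\<^esub> v)"
          using c_add[OF du C0.smult_closed[OF f_carrier v(1)]] c_smult[OF f_carrier v(1)] v(2) by simp
        finally have "x = d 1 u \<oplus>\<^bsub>C 0\<^esub> f \<odot>\<^bsub>C 0\<^esub> v"
          using c_inj x du v f_carrier by (auto simp: inj_on_def)
        then show "\<xi> = tau (C 0) (d 1 u)" using tau_eq_iff[OF mC x(1) du] x v by auto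
      next
        assume "\<xi> = tau (C 0) (d 1 u)"
        then obtain v where v: "v \<in> carrier (C 0)" "x = d 1 u \<oplus>\<^bsub>C 0\<^esub> f \<odot>\<^bsub>C 0\<^esub> v"
          using tau_eq_iff[OF mC x(1) du] x by auto
        have "PIdl f +> f = \<zero>\<^bsub>Pb\<^esub>" using rho_zero_iff[OF f_carrier] l_one[OF f_carrier] one_closed by metis
        then show "PIdl f +> c x = PIdl f +> c (d 1 u)"
          using v du f_carrier by (simp add: c_add c_smult c_in)
      qed
    qed
    also have "\<dots> \<longleftrightarrow> \<xi> \<in> bar_map (C 0) (d 1) ` carrier (bar (C 1))"
      using tau_d[of 1] by (auto simp: bar_carrier[OF mC] image_iff)
    finally show ?thesis .
  qed
  show ?thesis
    unfolding free_resolution_def KK_eq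
  proof (intro conjI allI impI)
    fix i show "free_module Pb (bar (C i))" by (rule free_of_fg_free[OF fg_free_bar[OF free]])
  next
    fix i :: nat assume "1 \<le> i"
    then show "bar_map (C (i - 1)) (d i) \<in> module_hom Pb (bar (C i)) (bar (C (i - 1)))"
      by (intro bar_map_hom mC hom)
  next
    fix i :: nat assume i: "1 \<le> i"
    have "bar_map (C i) (d (i + 1)) ` carrier (bar (C (i + 1))) =
      {x \<in> carrier (bar (C i)). bar_map (C (i - 1)) (d i) x = \<zero>\<^bsub>bar (C (i - 1))\<^esub>}"
    proof (intro equalityI subsetI)
      fix \<xi> assume "\<xi> \<in> bar_map (C i) (d (i + 1)) ` carrier (bar (C (i + 1)))"
      then obtain x where x: "x \<in> carrier (C (i + 1))" "\<xi> = tau (C i) (d (i + 1) x)"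
        by (auto simp: bar_carrier[OF mC] tau_d')
      then show "\<xi> \<in> {x \<in> carrier (bar (C i)). bar_map (C (i - 1)) (d i) x = \<zero>\<^bsub>bar (C (i - 1))\<^esub>}"
        using complex[OF i x(1)] dc' i tau_zero_iff[OF mC dc[OF i dc'[OF x(1)]]]
        by (simp add: tau_d tau_hom[OF mC])
    next
      fix \<xi> assume xi: "\<xi> \<in> {x \<in> carrier (bar (C i)). bar_map (C (i - 1)) (d i) x = \<zero>\<^bsub>bar (C (i - 1))\<^esub>}"
      then obtain x where x: "x \<in> carrier (C i)" "\<xi> = tau (C i) x" by (auto simp: bar_carrier[OF mC])
      have "tau (C (i - 1)) (d i x) = \<zero>\<^bsub>bar (C (i - 1))\<^esub>" using xi x i by (simp add: tau_d)
      then obtain y where "y \<in> carrier (C (i - 1))" "d i x = f \<odot>\<^bsub>C (i - 1)\<^esub> y"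
        using tau_zero_iff[OF mC dc[OF i x(1)]] by blast
      from exact[OF i x(1) this] obtain u v where uv: "u \<in> carrier (C (i + 1))" "v \<in> carrier (C i)"
        "x = d (i + 1) u \<oplus>\<^bsub>C i\<^esub> f \<odot>\<^bsub>C i\<^esub> v" by blast
      then have "\<xi> = tau (C i) (d (i + 1) u)" using tau_eq_iff[OF mC x(1) dc'[OF uv(1)]] x by blast
      then have "\<xi> = bar_map (C i) (d (i + 1)) (tau (C (i + 1)) u)" using tau_d'[OF uv(1)] by simp
      then show "\<xi> \<in> bar_map (C i) (d (i + 1)) ` carrier (bar (C (i + 1)))"
        using tau_hom[OF mC uv(1)] by blast
    qed
    then show "bar_map (C (i + 1 - 1)) (d (i + 1)) ` carrier (bar (C (i + 1))) =
      {x \<in> carrier (bar (C i)). bar_map (C (i - 1)) (d i) x = \<zero>\<^bsub>bar (C (i - 1))\<^esub>}"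
      by simp
  next
    show "\<exists>e\<in>module_hom Pb (bar (C 0)) (quot_module Pb KK).
       e ` carrier (bar (C 0)) = carrier (quot_module Pb KK) \<and>
       bar_map (C (1 - 1)) (d 1) ` carrier (bar (C 1)) =
       {x \<in> carrier (bar (C 0)). e x = \<zero>\<^bsub>quot_module Pb KK\<^esub>}"
    proof (intro bexI[OF _ e_hom] conjI e_surj)
      have "bar_map (C 0) (d 1) ` carrier (bar (C 1)) \<subseteq> carrier (bar (C 0))"
        using module_hom_closed[OF bar_map_hom[OF mC mC hom], of 1] by auto
      then show "bar_map (C (1 - 1)) (d 1) ` carrier (bar (C 1)) =
        {x \<in> carrier (bar (C 0)). e x = \<zero>\<^bsub>quot_module Pb KK\<^esub>}"
        using e_ker by auto
    qed
  qed
qed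

end

section \<open>DG-algebras with Poincare duality\<close>

context dg_algebra
begin

lemma part_module: "module P (part F i)"
  by (rule fg_free_imp_module[OF part_fg_free])

interpretation Fm: module P "part F i" for i
  by (rule part_module)

lemma gmult_closed:
  "x \<in> carrier (part F i) \<Longrightarrow> y \<in> carrier (part F j) \<Longrightarrow> gmult F i j x y \<in> carrier (part F (i + j))"
  by (rule module_hom_closed[OF gmult_hom_right])

lemma coef_props:
  assumes "x \<in> carrier (part F 0)"
  shows "coef P F x \<in> carrier P" "coef P F x \<odot>\<^bsub>part F 0\<^esub> gone F = x"
proof -
  have "\<exists>!p. p \<in> carrier P \<and> x = p \<odot>\<^bsub>part F 0\<^esub> gone F"
    using part_0 assms by (auto simp: bij_betw_def inj_on_def)
  from theI'[OF this] show "coef P F x \<in> carrier P" "coef P F x \<odot>\<^bsub>part F 0\<^esub> gone F = x"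
    unfolding coef_def by auto
qed

lemma coef_smult_gone [simp]:
  assumes "p \<in> carrier P"
  shows "coef P F (p \<odot>\<^bsub>part F 0\<^esub> gone F) = p"
proof -
  have "p \<odot>\<^bsub>part F 0\<^esub> gone F \<in> carrier (part F 0)" using assms gone_closed by simp
  from coef_props[OF this] show ?thesis
    using part_0 assms by (auto simp: bij_betw_def inj_on_def)
qed

lemma coef_eqI:
  "p \<in> carrier P \<Longrightarrow> x = p \<odot>\<^bsub>part F 0\<^esub> gone F \<Longrightarrow> coef P F x = p"
  by simp

lemma coef_iso: "coef P F \<in> module_iso P (part F 0) (ring_module P)"
proof -
  have "coef P F \<in> module_hom P (part F 0) (ring_module P)"
  proof (rule module_homI)
    fix x y assume xy: "x \<in> carrier (part F 0)" "y \<in> carrier (part F 0)"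
    have "x \<oplus>\<^bsub>part F 0\<^esub> y = (coef P F x \<oplus> coef P F y) \<odot>\<^bsub>part F 0\<^esub> gone F"
      using coef_props[OF xy(1)] coef_props[OF xy(2)] gone_closed by (simp add: Fm.smult_l_distr)
    then show "coef P F (x \<oplus>\<^bsub>part F 0\<^esub> y) = coef P F x \<oplus>\<^bsub>ring_module P\<^esub> coef P F y"
      using coef_props[OF xy(1)] coef_props[OF xy(2)] by simp
  next
    fix a x assume ax: "a \<in> carrier P" "x \<in> carrier (part F 0)"
    have "a \<odot>\<^bsub>part F 0\<^esub> x = (a \<otimes> coef P F x) \<odot>\<^bsub>part F 0\<^esub> gone F"
      using coef_props[OF ax(2)] gone_closed ax by (simp add: Fm.smult_assoc1)
    then show "coef P F (a \<odot>\<^bsub>part F 0\<^esub> x) = a \<odot>\<^bsub>ring_module P\<^esub> coef P F x"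
      using coef_props[OF ax(2)] ax by simp
  qed (simp add: coef_props)
  moreover have "bij_betw (coef P F) (carrier (part F 0)) (carrier P)"
    by (rule bij_betw_byWitness[of _ "\<lambda>p. p \<odot>\<^bsub>part F 0\<^esub> gone F"])
      (use coef_props gone_closed in auto)
  ultimately show ?thesis by (simp add: module_iso_def)
qed

lemma gmult_0_left:
  assumes "x \<in> carrier (part F 0)" "y \<in> carrier (part F i)"
  shows "gmult F 0 i x y = coef P F x \<odot>\<^bsub>part F i\<^esub> y"
  using module_hom_smult[OF gmult_hom_left[OF assms(2), of 0] coef_props(1)[OF assms(1)] gone_closed]
    coef_props(2)[OF assms(1)] gone_left[OF assms(2)] by simp

lemma gmult_0_right:
  assumes "x \<in> carrier (part F 0)" "y \<in> carrier (part F i)"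
  shows "gmult F i 0 y x = coef P F x \<odot>\<^bsub>part F i\<^esub> y"
  using module_hom_smult[OF gmult_hom_right[OF assms(2), of 0] coef_props(1)[OF assms(1)] gone_closed]
    coef_props(2)[OF assms(1)] gone_right[OF assms(2)] by simp

lemma gmult_add_left:
  "\<lbrakk>x \<in> carrier (part F i); y \<in> carrier (part F i); v \<in> carrier (part F j)\<rbrakk> \<Longrightarrow>
    gmult F i j (x \<oplus>\<^bsub>part F i\<^esub> y) v = gmult F i j x v \<oplus>\<^bsub>part F (i + j)\<^esub> gmult F i j y v"
  using module_hom_add[OF gmult_hom_left, of v j x i y] by simp

lemma gmult_smult_left:
  "\<lbrakk>a \<in> carrier P; x \<in> carrier (part F i); v \<in> carrier (part F j)\<rbrakk> \<Longrightarrow>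
    gmult F i j (a \<odot>\<^bsub>part F i\<^esub> x) v = a \<odot>\<^bsub>part F (i + j)\<^esub> gmult F i j x v"
  using module_hom_smult[OF gmult_hom_left, of v j a x i] by simp

lemma gmult_neg_left:
  "\<lbrakk>x \<in> carrier (part F i); v \<in> carrier (part F j)\<rbrakk> \<Longrightarrow>
    gmult F i j (\<ominus>\<^bsub>part F i\<^esub> x) v = \<ominus>\<^bsub>part F (i + j)\<^esub> gmult F i j x v"
  using module_hom_neg[OF gmult_hom_left part_module part_module, of v j x i] by simp

lemma gmult_zero_left:
  "v \<in> carrier (part F j) \<Longrightarrow> gmult F i j (\<zero>\<^bsub>part F i\<^esub>) v = \<zero>\<^bsub>part F (i + j)\<^esub>"
  using module_hom_zero[OF gmult_hom_left part_module part_module, of v j i] by simp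

lemmas gmult_add_right = module_hom_add[OF gmult_hom_right]
lemmas gmult_smult_right = module_hom_smult[OF gmult_hom_right]
lemmas gmult_neg_right = module_hom_neg[OF gmult_hom_right part_module part_module]
lemmas gmult_zero_right = module_hom_zero[OF gmult_hom_right part_module part_module]

lemma bd_closed: "1 \<le> i \<Longrightarrow> x \<in> carrier (part F i) \<Longrightarrow> bd F i x \<in> carrier (part F (i - 1))"
  by (rule module_hom_closed[OF bd_hom])

text \<open>The product \<open>xy\<close> lies in a degree where the algebra vanishes, so the two terms of \<open>d(xy)\<close> cancel: up to
  sign the differential is its own adjoint for the multiplication pairing.\<close>

lemma leibniz_top:
  assumes "0 < i" "0 < j" "carrier (part F (i + j)) = {\<zero>\<^bsub>part F (i + j)\<^esub>}"
    and x: "x \<in> carrier (part F i)" and y: "y \<in> carrier (part F j)"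
  shows "gmult F (i - 1) j (bd F i x) y = signed (i + 1) (part F (i + j - 1)) (gmult F i (j - 1) x (bd F j y))"
proof -
  have e: "i - 1 + j = i + j - 1" "i + (j - 1) = i + j - 1" using assms(1,2) by simp_all
  have c: "gmult F (i - 1) j (bd F i x) y \<in> carrier (part F (i + j - 1))"
    "gmult F i (j - 1) x (bd F j y) \<in> carrier (part F (i + j - 1))"
    using gmult_closed[OF bd_closed y, of i x] gmult_closed[OF x bd_closed, of j y] assms(1,2) x y
    unfolding e by auto
  have "gmult F i j x y = \<zero>\<^bsub>part F (i + j)\<^esub>" using gmult_closed[OF x y] assms(3) by simp
  then have "bd F (i + j) (gmult F i j x y) = \<zero>\<^bsub>part F (i + j - 1)\<^esub>"
    using module_hom_zero[OF bd_hom part_module part_module, of "i + j"] assms(1) by simp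
  then have "gmult F (i - 1) j (bd F i x) y \<oplus>\<^bsub>part F (i + j - 1)\<^esub>
    signed i (part F (i + j - 1)) (gmult F i (j - 1) x (bd F j y)) = \<zero>\<^bsub>part F (i + j - 1)\<^esub>"
    using leibniz[of i j x y] assms by simp
  then show ?thesis
    using c by (cases "even i")
      (auto simp: signed_def dest: Fm.M.minus_equality[symmetric])
qed

text \<open>As \<open>dy\<close> is a scalar, right multiplication by \<open>y\<close> is a homotopy between this scalar and zero, up to sign.\<close>

lemma leibniz_one:
  assumes "1 \<le> i" "x \<in> carrier (part F i)" "y \<in> carrier (part F 1)"
  shows "bd F (i + 1) (gmult F i 1 x y) = gmult F (i - 1) 1 (bd F i x) y \<oplus>\<^bsub>part F i\<^esub>
    signed i (part F i) (coef P F (bd F 1 y) \<odot>\<^bsub>part F i\<^esub> x)"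
  using leibniz[of i 1 x y] assms gmult_0_right[of "bd F 1 y" x i] bd_closed[of 1 y] by simp

end

text \<open>Poincare duality leaves the top degree existentially quantified. Here it is a parameter, together with
  the chosen orientation.\<close>

locale duality_algebra = dg_algebra P F for P :: "('p, 'x) ring_scheme" (structure) and F :: "('p, 'f) dg" +
  fixes m :: nat and ori :: "'f \<Rightarrow> 'p"
  assumes top: "m < i \<Longrightarrow> carrier (part F i) = {\<zero>\<^bsub>part F i\<^esub>}"
    and perfect: "i \<le> m \<Longrightarrow>
      perfect_pairing P (part F i) (part F (m - i)) (part F m) (gmult F i (m - i))"
    and ori: "ori \<in> module_iso P (part F m) (ring_module P)"
begin

interpretation Fm: module P "part F i" for i
  by (rule part_module)

lemma ori_hom: "ori \<in> module_hom P (part F m) (ring_module P)"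
  using module_isoD(1)[OF ori] .

lemma ori_eq_iff:
  "x \<in> carrier (part F m) \<Longrightarrow> y \<in> carrier (part F m) \<Longrightarrow> ori x = ori y \<longleftrightarrow> x = y"
  using module_isoD(2)[OF ori] by (auto simp: bij_betw_def inj_on_def)

lemma pairing_closed:
  "i \<le> m \<Longrightarrow> x \<in> carrier (part F i) \<Longrightarrow> y \<in> carrier (part F (m - i)) \<Longrightarrow>
    gmult F i (m - i) x y \<in> carrier (part F m)"
  using gmult_closed[of x i y "m - i"] by simp

lemma pairing_eqI:
  assumes "i \<le> m" "x \<in> carrier (part F i)" "y \<in> carrier (part F i)"
    and "\<And>v. v \<in> carrier (part F (m - i)) \<Longrightarrow> gmult F i (m - i) x v = gmult F i (m - i) y v"
  shows "x = y"
proof -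
  have "inj_on (\<lambda>x. \<lambda>y\<in>carrier (part F (m - i)). gmult F i (m - i) x y) (carrier (part F i))"
    using perfect[OF assms(1)] by (simp add: perfect_pairing_def bij_betw_def)
  moreover have "(\<lambda>v\<in>carrier (part F (m - i)). gmult F i (m - i) x v) =
    (\<lambda>v\<in>carrier (part F (m - i)). gmult F i (m - i) y v)"
    using assms(4) by (rule restrict_ext)
  ultimately show ?thesis using assms(2,3) by (auto simp: inj_on_def)
qed

lemma ori_pairing_eqI:
  assumes "i \<le> m" "x \<in> carrier (part F i)" "y \<in> carrier (part F i)"
    and "\<And>v. v \<in> carrier (part F (m - i)) \<Longrightarrow> ori (gmult F i (m - i) x v) = ori (gmult F i (m - i) y v)"
  shows "x = y"
proof (rule pairing_eqI[OF assms(1-3)])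
  fix v assume v: "v \<in> carrier (part F (m - i))"
  show "gmult F i (m - i) x v = gmult F i (m - i) y v"
    using assms(4)[OF v] ori_eq_iff[OF pairing_closed[OF assms(1,2) v] pairing_closed[OF assms(1,3) v]]
    by blast
qed

lemma pairing_represent:
  assumes "i \<le> m" "h \<in> module_hom P (part F (m - i)) (part F m)"
  shows "\<exists>x\<in>carrier (part F i). \<forall>v\<in>carrier (part F (m - i)). gmult F i (m - i) x v = h v"
proof -
  have "restrict h (carrier (part F (m - i))) \<in>
    module_hom P (part F (m - i)) (part F m) \<inter> extensional (carrier (part F (m - i)))"
    using assms(2) by (auto simp: module_hom_def)
  then have "restrict h (carrier (part F (m - i))) \<in>
    (\<lambda>x. \<lambda>y\<in>carrier (part F (m - i)). gmult F i (m - i) x y) ` carrier (part F i)"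
    using perfect[OF assms(1)] by (simp add: perfect_pairing_def bij_betw_def)
  then obtain x where "x \<in> carrier (part F i)"
    "restrict h (carrier (part F (m - i))) = (\<lambda>y\<in>carrier (part F (m - i)). gmult F i (m - i) x y)"
    by auto
  then show ?thesis by (metis restrict_apply')
qed

lemma ori_represent:
  assumes "i \<le> m" "h \<in> module_hom P (part F (m - i)) (ring_module P)"
  shows "\<exists>x\<in>carrier (part F i). \<forall>v\<in>carrier (part F (m - i)). ori (gmult F i (m - i) x v) = h v"
proof -
  define inv_ori where "inv_ori = inv_into (carrier (part F m)) ori"
  have bij: "bij_betw ori (carrier (part F m)) (carrier P)" using module_isoD(2)[OF ori] by simp
  have io: "inv_ori p \<in> carrier (part F m)" "ori (inv_ori p) = p" if "p \<in> carrier P" for p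
    using bij_betw_inv_into_right[OF bij that] bij_betwE[OF bij_betw_inv_into[OF bij]] that
    by (auto simp: inv_ori_def)
  have hc: "h v \<in> carrier P" if "v \<in> carrier (part F (m - i))" for v
    using module_hom_closed[OF assms(2) that] by simp
  have "(\<lambda>v. inv_ori (h v)) \<in> module_hom P (part F (m - i)) (part F m)"
  proof (rule module_homI)
    fix x y assume xy: "x \<in> carrier (part F (m - i))" "y \<in> carrier (part F (m - i))"
    show "inv_ori (h (x \<oplus>\<^bsub>part F (m - i)\<^esub> y)) = inv_ori (h x) \<oplus>\<^bsub>part F m\<^esub> inv_ori (h y)"
      using xy io hc module_hom_add[OF ori_hom] module_hom_add[OF assms(2)]
      by (subst ori_eq_iff[symmetric]) auto
  next
    fix a x assume xy: "a \<in> carrier P" "x \<in> carrier (part F (m - i))"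
    show "inv_ori (h (a \<odot>\<^bsub>part F (m - i)\<^esub> x)) = a \<odot>\<^bsub>part F m\<^esub> inv_ori (h x)"
      using xy io hc module_hom_smult[OF ori_hom] module_hom_smult[OF assms(2)]
      by (subst ori_eq_iff[symmetric]) auto
  qed (use io hc in auto)
  from pairing_represent[OF assms(1) this] show ?thesis using io hc by metis
qed

end

text \<open>A degree above which the algebra vanishes and in which it is isomorphic to a nonzero ring is unique.\<close>

lemma (in dg_algebra) duality_algebraI:
  assumes "poincare_duality P F" "\<And>i. m < i \<Longrightarrow> carrier (part F i) = {\<zero>\<^bsub>part F i\<^esub>}"
    and "ori \<in> module_iso P (part F m) (ring_module P)" "\<one> \<noteq> \<zero>"
  shows "duality_algebra P F m ori"
proof -
  have nontriv: "carrier (part F i) \<noteq> {\<zero>\<^bsub>part F i\<^esub>}" if h: "h \<in> module_iso P (part F i) (ring_module P)" for i h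
  proof
    assume "carrier (part F i) = {\<zero>\<^bsub>part F i\<^esub>}"
    moreover have "h ` carrier (part F i) = carrier P"
      using module_isoD(2)[OF h] by (auto simp: bij_betw_def)
    ultimately have "carrier P = {h \<zero>\<^bsub>part F i\<^esub>}" by auto
    then show False using assms(4) one_closed zero_closed by (metis singletonD)
  qed
  obtain l where l: "\<forall>i>l. carrier (part F i) = {\<zero>\<^bsub>part F i\<^esub>}"
    "module_iso P (part F l) (ring_module P) \<noteq> {}"
    "\<forall>i\<le>l. perfect_pairing P (part F i) (part F (l - i)) (part F l) (gmult F i (l - i))"
    using assms(1) unfolding poincare_duality_def by blast
  then obtain h where h: "h \<in> module_iso P (part F l) (ring_module P)" by blast
  have "l = m"
    using nontriv[OF h] nontriv[OF assms(3)] l(1) assms(2) by (metis linorder_neqE_nat)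
  then show ?thesis
    using l assms(2,3) dg_algebra_axioms by (auto simp: duality_algebra_def duality_algebra_axioms_def)
qed

section \<open>Direct sums\<close>

locale direct_decomposition = module R A for R :: "('r, 'x) ring_scheme" and A :: "('r, 'a) module" (structure) +
  fixes U V :: "'a set"
  assumes U: "submodule U R A" and V: "submodule V R A" and sum: "internal_direct_sum A U V"
begin

lemmas UE = submoduleE[OF U] and VE = submoduleE[OF V]

lemma proj_eqI:
  assumes "u \<in> U" "v \<in> V" "x = u \<oplus> v"
  shows "proj A U V x = u" "proj A V U x = v"
proof -
  have uv: "u \<in> carrier A" "v \<in> carrier A" using assms(1,2) UE(1) VE(1) by auto
  then have "x \<in> carrier A" using assms(3) by simp
  then have "\<exists>!(u, v). u \<in> U \<and> v \<in> V \<and> x = u \<oplus> v"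
    using sum unfolding internal_direct_sum_def by blast
  then obtain p where p: "\<And>q. (case q of (u, v) \<Rightarrow> u \<in> U \<and> v \<in> V \<and> x = u \<oplus> v) \<Longrightarrow> q = p"
    by (elim ex1E) blast
  have uniq: "u' = u" "v' = v" if "u' \<in> U" "v' \<in> V" "x = u' \<oplus> v'" for u' v'
    using p[of "(u', v')"] p[of "(u, v)"] assms that by simp_all
  have comm: "v' \<oplus> u' = u' \<oplus> v'" if "u' \<in> U" "v' \<in> V" for u' v'
    using that UE(1) VE(1) by (intro M.a_comm) auto
  show "proj A U V x = u"
    unfolding proj_def
  proof (rule the_equality)
    show "u \<in> U \<and> (\<exists>v\<in>V. x = u \<oplus> v)" using assms by blast
    show "u' = u" if "u' \<in> U \<and> (\<exists>v\<in>V. x = u' \<oplus> v)" for u' using that uniq(1) by blast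
  qed
  show "proj A V U x = v"
    unfolding proj_def
  proof (rule the_equality)
    show "v \<in> V \<and> (\<exists>u\<in>U. x = v \<oplus> u)" using assms comm by auto
    fix v' assume "v' \<in> V \<and> (\<exists>u\<in>U. x = v' \<oplus> u)"
    then obtain u' where "u' \<in> U" "v' \<in> V" "x = v' \<oplus> u'" by blast
    then show "v' = v" using uniq(2)[of u' v'] comm[of u' v'] by simp
  qed
qed

lemma proj_props:
  assumes "x \<in> carrier A"
  shows "proj A U V x \<in> U" "proj A V U x \<in> V" "proj A U V x \<oplus> proj A V U x = x"
proof -
  obtain u v where uv: "u \<in> U" "v \<in> V" "x = u \<oplus> v"
    using sum assms unfolding internal_direct_sum_def by blast
  from proj_eqI[OF this] uv show "proj A U V x \<in> U" "proj A V U x \<in> V" "proj A U V x \<oplus> proj A V U x = x"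
    by auto
qed

lemma zero_in: "\<zero> \<in> U" "\<zero> \<in> V"
  using subgroup.one_closed[OF submodule.axioms(1)[OF U]] subgroup.one_closed[OF submodule.axioms(1)[OF V]]
  by auto

lemma proj_on:
  "u \<in> U \<Longrightarrow> proj A U V u = u" "u \<in> U \<Longrightarrow> proj A V U u = \<zero>"
  "v \<in> V \<Longrightarrow> proj A V U v = v" "v \<in> V \<Longrightarrow> proj A U V v = \<zero>"
  using proj_eqI[of u \<zero> u] proj_eqI[of \<zero> v v] UE(1) VE(1) zero_in by (auto simp: subset_iff)

lemma proj_add:
  assumes "x \<in> carrier A" "y \<in> carrier A"
  shows "proj A U V (x \<oplus> y) = proj A U V x \<oplus> proj A U V y" (is ?A)
    "proj A V U (x \<oplus> y) = proj A V U x \<oplus> proj A V U y" (is ?B)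
proof -
  note px = proj_props[OF assms(1)] and py = proj_props[OF assms(2)]
  have c: "proj A U V x \<in> carrier A" "proj A U V y \<in> carrier A"
    "proj A V U x \<in> carrier A" "proj A V U y \<in> carrier A"
    using px py UE(1) VE(1) by auto
  have "x \<oplus> y = (proj A U V x \<oplus> proj A V U x) \<oplus> (proj A U V y \<oplus> proj A V U y)"
    using px(3) py(3) by simp
  also have "\<dots> = (proj A U V x \<oplus> proj A U V y) \<oplus> (proj A V U x \<oplus> proj A V U y)"
    using c by (simp add: M.a_ac)
  finally show ?A ?B
    using UE(5)[OF px(1) py(1)] VE(5)[OF px(2) py(2)] by (auto intro: proj_eqI)
qed

lemma proj_smult:
  assumes "a \<in> carrier R" "x \<in> carrier A"
  shows "proj A U V (a \<odot> x) = a \<odot> proj A U V x" (is ?A)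
    "proj A V U (a \<odot> x) = a \<odot> proj A V U x" (is ?B)
proof -
  note px = proj_props[OF assms(2)]
  have c: "proj A U V x \<in> carrier A" "proj A V U x \<in> carrier A"
    using px UE(1) VE(1) by auto
  have "a \<odot> x = a \<odot> (proj A U V x \<oplus> proj A V U x)" using px(3) by simp
  also have "\<dots> = a \<odot> proj A U V x \<oplus> a \<odot> proj A V U x" using c assms by (simp add: smult_r_distr)
  finally show ?A ?B
    using UE(4)[OF assms(1) px(1)] VE(4)[OF assms(1) px(2)] by (auto intro: proj_eqI)
qed

lemma proj_hom:
  "proj A U V \<in> module_hom R A (A\<lparr>carrier := U\<rparr>)" "proj A V U \<in> module_hom R A (A\<lparr>carrier := V\<rparr>)"
  "proj A U V \<in> module_hom R A A" "proj A V U \<in> module_hom R A A"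
  using proj_props UE(1) VE(1) by (auto intro!: module_homI simp: proj_add proj_smult)

end

lemma empty_basis:
  assumes "module R A" "is_basis R A {}"
  shows "carrier A = {\<zero>\<^bsub>A\<^esub>}"
proof -
  interpret A: module R A by fact
  show ?thesis using assms(2) by (auto simp: is_basis_def)
qed

text \<open>There are no sets of \<open>i\<close> indices, so the prescribed basis in degree \<open>i\<close> is empty.\<close>

lemma koszul_vanishing:
  assumes "koszul_complex P as F" "length as < i"
  shows "carrier (part F i) = {\<zero>\<^bsub>part F i\<^esub>}"
proof -
  have "dgg_algebra P F" using assms(1) by (simp add: koszul_complex_def)
  then interpret F: dg_algebra P F by (simp add: dgg_algebra_def)
  interpret Fi: module P "part F i" by (rule F.part_module)
  obtain e where e: "\<And>i. let S = {J. J \<subseteq> {..<length as} \<and> card J = i};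
      eS = (\<lambda>J. gprod1 F (map e (sorted_list_of_set J)))
    in inj_on eS S \<and> is_basis P (part F i) (eS ` S)"
    using assms(1) unfolding koszul_complex_def by blast
  have "card J \<noteq> i" if "J \<subseteq> {..<length as}" for J
    using assms(2) card_mono[OF finite_lessThan that] by simp
  then have none: "{J. J \<subseteq> {..<length as} \<and> card J = i} = {}" by blast
  have "is_basis P (part F i) {}"
    using e[of i] unfolding Let_def none by simp
  then show ?thesis using empty_basis[OF F.part_module] by blast
qed

text \<open>The augmentation of a resolution of \<open>P/J\<close> may send \<open>1\<close> to any generator of \<open>P/J\<close>, but each of these
  has annihilator \<open>J\<close>.\<close>

lemma (in dg_algebra) resolution_image:
  assumes res: "free_resolution P (part F) (bd F) (quot_module P J)" and J: "ideal J P"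
  shows "(\<lambda>x. coef P F (bd F 1 x)) ` carrier (part F 1) = J"
proof -
  interpret J: ideal J P by (rule J)
  interpret q: ring_hom_cring P "P Quot J" "(+>) J" by (rule J.rcos_ring_hom_cring[OF is_cring])
  interpret F0: module P "part F 0" by (rule part_module)
  have "\<exists>e\<in>module_hom P (part F 0) (quot_module P J).
    e ` carrier (part F 0) = carrier (quot_module P J) \<and>
    bd F 1 ` carrier (part F 1) = {x \<in> carrier (part F 0). e x = \<zero>\<^bsub>quot_module P J\<^esub>}"
    using res unfolding free_resolution_def by (elim conjE)
  then obtain e where e: "e \<in> module_hom P (part F 0) (quot_module P J)"
    "e ` carrier (part F 0) = carrier (P Quot J)"
    "bd F 1 ` carrier (part F 1) = {x \<in> carrier (part F 0). e x = \<zero>\<^bsub>P Quot J\<^esub>}"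
    unfolding quot_module_simps by (elim bexE conjE)
  define u where "u = e (gone F)"
  have u: "u \<in> carrier (P Quot J)" using module_hom_closed[OF e(1) gone_closed] by (simp add: u_def)
  have e_eq: "e (p \<odot>\<^bsub>part F 0\<^esub> gone F) = (J +> p) \<otimes>\<^bsub>P Quot J\<^esub> u" if "p \<in> carrier P" for p
    using module_hom_smult[OF e(1) that gone_closed] by (simp add: u_def)
  have zero_iff: "(J +> p) \<otimes>\<^bsub>P Quot J\<^esub> u = \<zero>\<^bsub>P Quot J\<^esub> \<longleftrightarrow> p \<in> J" if p: "p \<in> carrier P" for p
  proof
    assume "p \<in> J"
    then show "(J +> p) \<otimes>\<^bsub>P Quot J\<^esub> u = \<zero>\<^bsub>P Quot J\<^esub>" using J.quot_zero_iff[OF p] u by simp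
  next
    assume z: "(J +> p) \<otimes>\<^bsub>P Quot J\<^esub> u = \<zero>\<^bsub>P Quot J\<^esub>"
    have "J +> \<one> \<in> e ` carrier (part F 0)" by (simp add: e(2))
    then obtain x where x: "x \<in> carrier (part F 0)" "J +> \<one> = e x" by auto
    then have "J +> \<one> = (J +> coef P F x) \<otimes>\<^bsub>P Quot J\<^esub> u"
      using e_eq[of "coef P F x"] coef_props[OF x(1)] by simp
    then have "J +> p = (J +> p) \<otimes>\<^bsub>P Quot J\<^esub> ((J +> coef P F x) \<otimes>\<^bsub>P Quot J\<^esub> u)"
      using q.S.r_one[of "J +> p"] p by simp
    also have "\<dots> = (J +> coef P F x) \<otimes>\<^bsub>P Quot J\<^esub> ((J +> p) \<otimes>\<^bsub>P Quot J\<^esub> u)"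
      using p u coef_props(1)[OF x(1)] by (intro q.S.m_lcomm) auto
    also have "\<dots> = \<zero>\<^bsub>P Quot J\<^esub>" using z coef_props(1)[OF x(1)] by simp
    finally show "p \<in> J" using J.quot_zero_iff[OF p] by simp
  qed
  show ?thesis
  proof (intro equalityI subsetI)
    fix p assume "p \<in> (\<lambda>x. coef P F (bd F 1 x)) ` carrier (part F 1)"
    then obtain x where x: "x \<in> carrier (part F 1)" "p = coef P F (bd F 1 x)" by auto
    have b: "bd F 1 x \<in> carrier (part F 0)" using bd_closed[of 1 x] x by simp
    have "e (bd F 1 x) = \<zero>\<^bsub>P Quot J\<^esub>" using e(3) x(1) by auto
    then show "p \<in> J" using zero_iff[of p] e_eq[of p] coef_props[OF b] x(2) by simp
  next
    fix p assume p: "p \<in> J"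
    then have pc: "p \<in> carrier P" by (rule J.Icarr)
    then have "e (p \<odot>\<^bsub>part F 0\<^esub> gone F) = \<zero>\<^bsub>P Quot J\<^esub>" using e_eq zero_iff p by simp
    then have "p \<odot>\<^bsub>part F 0\<^esub> gone F \<in> bd F 1 ` carrier (part F 1)"
      unfolding e(3) using pc gone_closed by simp
    then obtain x where x: "x \<in> carrier (part F 1)" "bd F 1 x = p \<odot>\<^bsub>part F 0\<^esub> gone F" by auto
    then show "p \<in> (\<lambda>x. coef P F (bd F 1 x)) ` carrier (part F 1)"
      using pc by (intro image_eqI[of _ _ x]) auto
  qed
qed

lemma (in cring) colon_ideal_ideal:
  assumes "ideal J R" "f \<in> carrier R"
  shows "ideal (colon_ideal R J f) R"
proof -
  interpret J: ideal J R by fact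
  show ?thesis
  proof (rule idealI[OF ring_axioms])
    show "subgroup (colon_ideal R J f) (add_monoid R)"
    proof (rule add.subgroupI)
      show "colon_ideal R J f \<noteq> {}" using assms(2) J.zero_closed by (auto simp: colon_ideal_def intro!: exI[of _ \<zero>])
    qed (use assms(2) in \<open>auto simp: colon_ideal_def l_distr l_minus a_inv_def[symmetric]\<close>)
  next
    fix a x assume ax: "a \<in> colon_ideal R J f" "x \<in> carrier R"
    then have "x \<otimes> (a \<otimes> f) \<in> J" by (auto simp: colon_ideal_def J.I_l_closed)
    then show "x \<otimes> a \<in> colon_ideal R J f"
      using ax assms(2) by (auto simp: colon_ideal_def m_assoc)
    then show "a \<otimes> x \<in> colon_ideal R J f"
      using ax assms(2) by (simp add: m_comm colon_ideal_def)
  qed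
qed

section \<open>The comparison maps between the Koszul complex and M\<close>

context linkage_data
begin

lemma K_dg: "dg_algebra P K" and M_dg: "dg_algebra P M"
  using KK_koszul M_dgg by (auto simp: koszul_complex_def dgg_algebra_def)

lemma one_neq_zero: "\<one> \<noteq> \<zero>"
proof
  assume 0: "\<one> = \<zero>"
  interpret cring P by (rule cring_P)
  obtain as where as: "set as \<subseteq> carrier P" "Idl (set as) \<noteq> carrier P"
    using KK_koszul by (auto simp: regular_sequence_def)
  interpret I: ideal "Idl (set as)" P by (rule genideal_ideal[OF as(1)])
  have "\<one> \<in> Idl (set as)" using 0 I.zero_closed by simp
  then show False using I.one_imp_carrier as(2) by simp
qed

lemma K_vanish: "4 < i \<Longrightarrow> carrier (part K i) = {\<zero>\<^bsub>part K i\<^esub>}"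
  using KK_koszul koszul_vanishing[of P _ K i] by auto

lemma KK_ideal: "ideal KK P"
  using KK_koszul ring.genideal_ideal[of P] cring_P by (auto simp: cring_def regular_sequence_def)

lemma f_carrier: "f \<in> carrier P"
  using f_regular by (simp add: regular_element_def)

end

sublocale linkage_data \<subseteq> K: duality_algebra P K 4 orK
  using dg_algebra.duality_algebraI[OF K_dg K_duality K_vanish orK_iso one_neq_zero] .

sublocale linkage_data \<subseteq> M: duality_algebra P M 4 orM
  using dg_algebra.duality_algebraI[OF M_dg M_duality _ orM_iso one_neq_zero] M_length by blast

sublocale linkage_data \<subseteq> MK: module P "part K i" for i
  by (rule K.part_module)

sublocale linkage_data \<subseteq> MM: module P "part M i" for i
  by (rule M.part_module)

sublocale linkage_data \<subseteq> R: reduction P f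
  using cring_P f_carrier by (simp add: reduction_def reduction_axioms_def)

context linkage_data
begin

abbreviation "M0 \<equiv> part M 0"
abbreviation "M1 \<equiv> part M 1"
abbreviation "M2 \<equiv> part M 2"
abbreviation "M3 \<equiv> part M 3"
abbreviation "M4 \<equiv> part M 4"
abbreviation "K0 \<equiv> part K 0"
abbreviation "K1 \<equiv> part K 1"
abbreviation "K2 \<equiv> part K 2"
abbreviation "K3 \<equiv> part K 3"
abbreviation "K4 \<equiv> part K 4"
abbreviation s where "s \<equiv> coef P K (bd K 1 \<sigma>)"
abbreviation Xd where "Xd \<equiv> adjoint X"

lemma \<alpha>_module_hom: "\<alpha> i \<in> module_hom P (part K i) (part M i)"
  using \<alpha>_hom by (simp add: dgg_hom_def)

lemmas \<alpha>_closed = module_hom_closed[OF \<alpha>_module_hom]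

lemma \<alpha>_chain: "1 \<le> i \<Longrightarrow> x \<in> carrier (part K i) \<Longrightarrow> bd M i (\<alpha> i x) = \<alpha> (i - 1) (bd K i x)"
  using \<alpha>_hom by (simp add: dgg_hom_def)

lemma \<alpha>_gone: "\<alpha> 0 (gone K) = gone M"
  using \<alpha>_hom by (simp add: dgg_hom_def)

lemma \<alpha>_mult: "x \<in> carrier (part K i) \<Longrightarrow> y \<in> carrier (part K j) \<Longrightarrow>
    \<alpha> (i + j) (gmult K i j x y) = gmult M i j (\<alpha> i x) (\<alpha> j y)"
  using \<alpha>_hom by (simp add: dgg_hom_def)

lemma coef_\<alpha>: "x \<in> carrier K0 \<Longrightarrow> coef P M (\<alpha> 0 x) = coef P K x"
  using module_hom_smult[OF \<alpha>_module_hom[of 0] K.coef_props(1) K.gone_closed, of x]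
    K.coef_props[of x] \<alpha>_gone by (intro M.coef_eqI) auto

lemma s_closed: "s \<in> carrier P"
  using K.coef_props(1) K.bd_closed[of 1 \<sigma>] \<sigma>_closed by simp

lemma orK_smult: "a \<in> carrier P \<Longrightarrow> x \<in> carrier K4 \<Longrightarrow> orK (a \<odot>\<^bsub>K4\<^esub> x) = a \<otimes> orK x"
  using module_hom_smult[OF K.ori_hom] by simp

lemma orM_smult: "a \<in> carrier P \<Longrightarrow> x \<in> carrier M4 \<Longrightarrow> orM (a \<odot>\<^bsub>M4\<^esub> x) = a \<otimes> orM x"
  using module_hom_smult[OF M.ori_hom] by simp

lemma orK_closed: "x \<in> carrier K4 \<Longrightarrow> orK x \<in> carrier P"
  using module_hom_closed[OF K.ori_hom] by simp

lemma orM_closed: "x \<in> carrier M4 \<Longrightarrow> orM x \<in> carrier P"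
  using module_hom_closed[OF M.ori_hom] by simp

lemma orK_neg: "x \<in> carrier K4 \<Longrightarrow> orK (\<ominus>\<^bsub>K4\<^esub> x) = \<ominus> orK x"
  using module_hom_smult[OF K.ori_hom, of "\<ominus> \<one>" x] orK_closed[of x]
  by (simp add: MK.smult_l_minus K.l_minus)

lemma orM_neg: "x \<in> carrier M4 \<Longrightarrow> orM (\<ominus>\<^bsub>M4\<^esub> x) = \<ominus> orM x"
  using module_hom_smult[OF M.ori_hom, of "\<ominus> \<one>" x] orM_closed[of x]
  by (simp add: MM.smult_l_minus K.l_minus)

lemma \<beta>_unique:
  assumes "i \<le> 4" "\<theta> \<in> carrier (part M i)"
  shows "\<exists>!x. x \<in> carrier (part K i) \<and> (\<forall>\<phi>\<in>carrier (part K (4 - i)).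
    orK (gmult K i (4 - i) x \<phi>) = orM (gmult M i (4 - i) \<theta> (\<alpha> (4 - i) \<phi>)))"
proof (rule ex_ex1I)
  have e: "i + (4 - i) = 4" using assms(1) by simp
  have "(\<lambda>\<phi>. orM (gmult M i (4 - i) \<theta> (\<alpha> (4 - i) \<phi>))) \<in> module_hom P (part K (4 - i)) (ring_module P)"
    using module_hom_comp[OF module_hom_comp[OF M.ori_hom M.gmult_hom_right[OF assms(2), of "4 - i", unfolded e]]
      \<alpha>_module_hom[of "4 - i"]] .
  from K.ori_represent[OF assms(1) this]
  show "\<exists>x. x \<in> carrier (part K i) \<and> (\<forall>\<phi>\<in>carrier (part K (4 - i)).
    orK (gmult K i (4 - i) x \<phi>) = orM (gmult M i (4 - i) \<theta> (\<alpha> (4 - i) \<phi>)))" by blast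
next
  fix x y
  assume "x \<in> carrier (part K i) \<and> (\<forall>\<phi>\<in>carrier (part K (4 - i)).
      orK (gmult K i (4 - i) x \<phi>) = orM (gmult M i (4 - i) \<theta> (\<alpha> (4 - i) \<phi>)))"
    and "y \<in> carrier (part K i) \<and> (\<forall>\<phi>\<in>carrier (part K (4 - i)).
      orK (gmult K i (4 - i) y \<phi>) = orM (gmult M i (4 - i) \<theta> (\<alpha> (4 - i) \<phi>)))"
  then show "x = y" by (intro K.ori_pairing_eqI[OF assms(1)]) auto
qed

lemma \<beta>_closed: "i \<le> 4 \<Longrightarrow> \<theta> \<in> carrier (part M i) \<Longrightarrow> \<beta> i \<theta> \<in> carrier (part K i)"
  and \<beta>_pair: "i \<le> 4 \<Longrightarrow> \<theta> \<in> carrier (part M i) \<Longrightarrow> \<phi> \<in> carrier (part K (4 - i)) \<Longrightarrow>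
    orK (gmult K i (4 - i) (\<beta> i \<theta>) \<phi>) = orM (gmult M i (4 - i) \<theta> (\<alpha> (4 - i) \<phi>))"
  using theI'[OF \<beta>_unique[of i \<theta>]] unfolding \<beta>_def by blast+

lemma \<beta>_eqI:
  assumes "i \<le> 4" "\<theta> \<in> carrier (part M i)" "x \<in> carrier (part K i)"
    and "\<And>\<phi>. \<phi> \<in> carrier (part K (4 - i)) \<Longrightarrow>
      orK (gmult K i (4 - i) x \<phi>) = orM (gmult M i (4 - i) \<theta> (\<alpha> (4 - i) \<phi>))"
  shows "\<beta> i \<theta> = x"
  using \<beta>_pair[OF assms(1,2)] assms(4)
  by (intro K.ori_pairing_eqI[OF assms(1) \<beta>_closed[OF assms(1,2)] assms(3)]) simp

lemma K_pair_closed: "i \<le> 4 \<Longrightarrow> x \<in> carrier (part K i) \<Longrightarrow> y \<in> carrier (part K (4 - i)) \<Longrightarrow>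
    gmult K i (4 - i) x y \<in> carrier K4"
  by (rule K.pairing_closed)

lemma M_pair_closed: "i \<le> 4 \<Longrightarrow> x \<in> carrier (part M i) \<Longrightarrow> y \<in> carrier (part M (4 - i)) \<Longrightarrow>
    gmult M i (4 - i) x y \<in> carrier M4"
  by (rule M.pairing_closed)

lemma \<beta>_module_hom:
  assumes "i \<le> 4"
  shows "\<beta> i \<in> module_hom P (part M i) (part K i)"
proof (rule module_homI)
  have e: "i + (4 - i) = 4" using assms by simp
  show "\<beta> i x \<in> carrier (part K i)" if "x \<in> carrier (part M i)" for x
    using \<beta>_closed[OF assms that] .
  show "\<beta> i (x \<oplus>\<^bsub>part M i\<^esub> y) = \<beta> i x \<oplus>\<^bsub>part K i\<^esub> \<beta> i y"
    if xy: "x \<in> carrier (part M i)" "y \<in> carrier (part M i)" for x y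
  proof (rule \<beta>_eqI[OF assms])
    fix \<phi> assume p: "\<phi> \<in> carrier (part K (4 - i))"
    show "orK (gmult K i (4 - i) (\<beta> i x \<oplus>\<^bsub>part K i\<^esub> \<beta> i y) \<phi>) =
      orM (gmult M i (4 - i) (x \<oplus>\<^bsub>part M i\<^esub> y) (\<alpha> (4 - i) \<phi>))"
      using K.gmult_add_left[OF \<beta>_closed[OF assms xy(1)] \<beta>_closed[OF assms xy(2)] p]
        M.gmult_add_left[OF xy \<alpha>_closed[OF p]] \<beta>_pair[OF assms _ p] xy
        module_hom_add[OF K.ori_hom] module_hom_add[OF M.ori_hom]
        K_pair_closed[OF assms \<beta>_closed[OF assms] p] M_pair_closed[OF assms _ \<alpha>_closed[OF p]]
      unfolding e by simp
  qed (use xy \<beta>_closed assms in auto)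
  show "\<beta> i (a \<odot>\<^bsub>part M i\<^esub> x) = a \<odot>\<^bsub>part K i\<^esub> \<beta> i x"
    if xy: "a \<in> carrier P" "x \<in> carrier (part M i)" for a x
  proof (rule \<beta>_eqI[OF assms])
    fix \<phi> assume p: "\<phi> \<in> carrier (part K (4 - i))"
    show "orK (gmult K i (4 - i) (a \<odot>\<^bsub>part K i\<^esub> \<beta> i x) \<phi>) =
      orM (gmult M i (4 - i) (a \<odot>\<^bsub>part M i\<^esub> x) (\<alpha> (4 - i) \<phi>))"
      using K.gmult_smult_left[OF xy(1) \<beta>_closed[OF assms xy(2)] p]
        M.gmult_smult_left[OF xy \<alpha>_closed[OF p]] \<beta>_pair[OF assms xy(2) p] xy
        orK_smult[OF xy(1)] orM_smult[OF xy(1)]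
        K_pair_closed[OF assms \<beta>_closed[OF assms] p] M_pair_closed[OF assms _ \<alpha>_closed[OF p]]
      unfolding e by simp
  qed (use xy \<beta>_closed assms in auto)
qed

lemma z_module_hom: "z i \<in> module_hom P (part K i) (part K (i + 1))"
  using K.gmult_hom_left[OF \<sigma>_closed] by (simp add: z_def[abs_def])

lemma w_module_hom: "w i \<in> module_hom P (part M i) (part M (i + 1))"
  using M.gmult_hom_left[OF \<alpha>_closed[OF \<sigma>_closed]] by (simp add: w_def[abs_def])

lemma \<beta>01_closed: "\<beta>01 \<in> carrier P"
  using K.coef_props(1)[OF \<beta>_closed[of 0]] M.gone_closed by (simp add: \<beta>01_def)

text \<open>With respect to the orientations, \<open>\<alpha>\<^sub>4\<close> is multiplication by \<open>\<beta>\<^sub>0(1)\<close>: this is the adjunction for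
  the unit of \<open>M\<close>.\<close>

lemma orM_\<alpha>:
  assumes "x \<in> carrier K4"
  shows "orM (\<alpha> 4 x) = \<beta>01 \<otimes> orK x"
proof -
  have b: "\<beta> 0 (gone M) \<in> carrier K0" using \<beta>_closed[of 0] M.gone_closed by simp
  have "orM (\<alpha> 4 x) = orM (gmult M 0 4 (gone M) (\<alpha> 4 x))"
    using M.gone_left[OF \<alpha>_closed[OF assms]] by simp
  also have "\<dots> = orK (gmult K 0 4 (\<beta> 0 (gone M)) x)"
    using \<beta>_pair[of 0 "gone M" x] M.gone_closed assms by simp
  also have "\<dots> = \<beta>01 \<otimes> orK x"
    using K.gmult_0_left[OF b assms] orK_smult[OF \<beta>01_closed assms] by (simp add: \<beta>01_def)
  finally show ?thesis .
qed

text \<open>The map \<open>\<beta>\<close> is adjoint to \<open>\<alpha>\<close>, so it is a chain map by the Leibniz rule in degree five,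
  where both algebras vanish.\<close>

lemma \<beta>_chain:
  assumes "1 \<le> i" "i \<le> 4" "\<theta> \<in> carrier (part M i)"
  shows "bd K i (\<beta> i \<theta>) = \<beta> (i - 1) (bd M i \<theta>)"
proof (rule sym, rule \<beta>_eqI)
  define j where "j = 4 - (i - 1)"
  have j: "1 \<le> j" "i + j = 5" "j - 1 = 4 - i" "i + j - 1 = 4" using assms(1,2) by (auto simp: j_def)
  fix \<phi> assume "\<phi> \<in> carrier (part K (4 - (i - 1)))"
  then have p: "\<phi> \<in> carrier (part K j)" by (simp add: j_def)
  have bp: "bd K j \<phi> \<in> carrier (part K (4 - i))" using K.bd_closed[OF j(1) p] j(3) by simp
  have b: "\<beta> i \<theta> \<in> carrier (part K i)" using \<beta>_closed assms by simp
  have "gmult K (i - 1) j (bd K i (\<beta> i \<theta>)) \<phi> = signed (i + 1) K4 (gmult K i (4 - i) (\<beta> i \<theta>) (bd K j \<phi>))"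
    using K.leibniz_top[of i j "\<beta> i \<theta>" \<phi>] assms j b p K_vanish[of "i + j"] by simp
  moreover have "gmult M (i - 1) j (bd M i \<theta>) (\<alpha> j \<phi>) = signed (i + 1) M4 (gmult M i (4 - i) \<theta> (\<alpha> (4 - i) (bd K j \<phi>)))"
    using M.leibniz_top[of i j \<theta> "\<alpha> j \<phi>"] assms j \<alpha>_closed[OF p] M.top[of "i + j"] \<alpha>_chain[OF j(1) p] by simp
  ultimately show "orK (gmult K (i - 1) (4 - (i - 1)) (bd K i (\<beta> i \<theta>)) \<phi>) =
    orM (gmult M (i - 1) (4 - (i - 1)) (bd M i \<theta>) (\<alpha> (4 - (i - 1)) \<phi>))"
    using \<beta>_pair[OF assms(2,3) bp] K_pair_closed[OF assms(2) b bp]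
      M_pair_closed[OF assms(2,3) \<alpha>_closed[OF bp]]
    unfolding j_def[symmetric] by (simp add: signed_def orK_neg orM_neg)
qed (use assms in \<open>auto intro!: M.bd_closed K.bd_closed \<beta>_closed\<close>)

text \<open>Since \<open>\<alpha>\<close> is multiplicative, \<open>[\<alpha>(x)\<alpha>(\<phi>)] = [\<alpha>\<^sub>4(x\<phi>)] = \<beta>\<^sub>0(1)[x\<phi>]\<close>.\<close>

lemma \<beta>_\<alpha>:
  assumes "i \<le> 4" "x \<in> carrier (part K i)"
  shows "\<beta> i (\<alpha> i x) = \<beta>01 \<odot>\<^bsub>part K i\<^esub> x"
proof (rule \<beta>_eqI[OF assms(1)])
  have e: "i + (4 - i) = 4" using assms(1) by simp
  fix \<phi> assume p: "\<phi> \<in> carrier (part K (4 - i))"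
  have "orM (gmult M i (4 - i) (\<alpha> i x) (\<alpha> (4 - i) \<phi>)) = orM (\<alpha> 4 (gmult K i (4 - i) x \<phi>))"
    using \<alpha>_mult[OF assms(2) p] e by simp
  also have "\<dots> = orK (gmult K i (4 - i) (\<beta>01 \<odot>\<^bsub>part K i\<^esub> x) \<phi>)"
    using K.gmult_smult_left[OF \<beta>01_closed assms(2) p] e orM_\<alpha> orK_smult \<beta>01_closed
      K_pair_closed[OF assms p] by simp
  finally show "orK (gmult K i (4 - i) (\<beta>01 \<odot>\<^bsub>part K i\<^esub> x) \<phi>) = orM (gmult M i (4 - i) (\<alpha> i x) (\<alpha> (4 - i) \<phi>))"
    by simp
qed (use assms \<alpha>_closed \<beta>01_closed in auto)

lemma orK_\<beta>4:
  assumes "c \<in> carrier M4"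
  shows "orK (\<beta> 4 c) = orM c"
  using \<beta>_pair[of 4 c "gone K"] assms K.gone_closed K.gone_right[OF \<beta>_closed[of 4 c]]
    M.gone_right[OF assms] by (simp add: \<alpha>_gone)

lemma \<alpha>4_\<beta>4:
  assumes "c \<in> carrier M4"
  shows "\<alpha> 4 (\<beta> 4 c) = \<beta>01 \<odot>\<^bsub>M4\<^esub> c"
  using orM_\<alpha>[of "\<beta> 4 c"] orK_\<beta>4[OF assms] orM_smult[OF \<beta>01_closed assms] \<beta>01_closed
    \<beta>_closed[of 4 c] \<alpha>_closed[of "\<beta> 4 c" 4] assms
  by (subst M.ori_eq_iff[symmetric]) auto

lemma \<beta>4_inj: "c \<in> carrier M4 \<Longrightarrow> \<beta> 4 c = \<zero>\<^bsub>K4\<^esub> \<Longrightarrow> c = \<zero>\<^bsub>M4\<^esub>"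
  using orK_\<beta>4[of c] M.ori_eq_iff[of c "\<zero>\<^bsub>M4\<^esub>"] orK_\<beta>4[of "\<zero>\<^bsub>M4\<^esub>"]
    module_hom_zero[OF \<beta>_module_hom[of 4] M.part_module K.part_module] by simp

lemma \<alpha>_z:
  assumes "x \<in> carrier (part K i)"
  shows "\<alpha> (i + 1) (z i x) = w i (\<alpha> i x)"
  using \<alpha>_mult[OF assms \<sigma>_closed] by (simp add: z_def w_def)

text \<open>The factor \<open>\<alpha>\<^sub>1\<sigma>\<close> moves across the pairing by associativity.\<close>

lemma \<beta>_w:
  assumes "i \<le> 3" "\<theta> \<in> carrier (part M i)"
  shows "\<beta> (i + 1) (w i \<theta>) = z i (\<beta> i \<theta>)"
proof (rule \<beta>_eqI)
  define j where "j = 4 - (i + 1)"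
  have j: "4 - i = 1 + j" "i + 1 + j = 4" using assms(1) by (auto simp: j_def)
  have b: "\<beta> i \<theta> \<in> carrier (part K i)" using \<beta>_closed assms by simp
  fix \<phi> assume "\<phi> \<in> carrier (part K (4 - (i + 1)))"
  then have p: "\<phi> \<in> carrier (part K j)" by (simp add: j_def)
  have sp: "gmult K 1 j \<sigma> \<phi> \<in> carrier (part K (1 + j))" using K.gmult_closed[OF \<sigma>_closed p] .
  have "orK (gmult K (i + 1) j (z i (\<beta> i \<theta>)) \<phi>) = orK (gmult K i (1 + j) (\<beta> i \<theta>) (gmult K 1 j \<sigma> \<phi>))"
    using K.gmult_assoc[OF b \<sigma>_closed p] by (simp add: z_def)
  also have "\<dots> = orM (gmult M i (1 + j) \<theta> (\<alpha> (1 + j) (gmult K 1 j \<sigma> \<phi>)))"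
    using \<beta>_pair[of i \<theta> "gmult K 1 j \<sigma> \<phi>"] assms sp unfolding j(1) by simp
  also have "\<dots> = orM (gmult M i (1 + j) \<theta> (gmult M 1 j (\<alpha> 1 \<sigma>) (\<alpha> j \<phi>)))"
    using \<alpha>_mult[OF \<sigma>_closed p] by simp
  also have "\<dots> = orM (gmult M (i + 1) j (w i \<theta>) (\<alpha> j \<phi>))"
    using M.gmult_assoc[OF assms(2) \<alpha>_closed[OF \<sigma>_closed] \<alpha>_closed[OF p]] by (simp add: w_def)
  finally show "orK (gmult K (i + 1) (4 - (i + 1)) (z i (\<beta> i \<theta>)) \<phi>) =
    orM (gmult M (i + 1) (4 - (i + 1)) (w i \<theta>) (\<alpha> (4 - (i + 1)) \<phi>))"
    unfolding j_def .
qed (use assms in \<open>auto intro!: module_hom_closed[OF w_module_hom] module_hom_closed[OF z_module_hom] \<beta>_closed\<close>)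

lemma z_z:
  assumes "x \<in> carrier (part K i)"
  shows "z (i + 1) (z i x) = \<zero>\<^bsub>part K (i + 2)\<^esub>"
  using K.gmult_assoc[OF assms \<sigma>_closed \<sigma>_closed] K.gmult_odd_square[of 1 \<sigma>] \<sigma>_closed
    K.gmult_zero_right[OF assms, of 2] by (simp add: z_def)

lemma w_w:
  assumes "x \<in> carrier (part M i)"
  shows "w (i + 1) (w i x) = \<zero>\<^bsub>part M (i + 2)\<^esub>"
  using M.gmult_assoc[OF assms \<alpha>_closed[OF \<sigma>_closed] \<alpha>_closed[OF \<sigma>_closed]]
    M.gmult_odd_square[of 1 "\<alpha> 1 \<sigma>"] \<alpha>_closed[OF \<sigma>_closed]
    M.gmult_zero_right[OF assms, of 2] by (simp add: w_def)

lemma bd_z: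
  assumes "1 \<le> i" "x \<in> carrier (part K i)"
  shows "bd K (i + 1) (z i x) = z (i - 1) (bd K i x) \<oplus>\<^bsub>part K i\<^esub> signed i (part K i) (s \<odot>\<^bsub>part K i\<^esub> x)"
  using K.leibniz_one[OF assms \<sigma>_closed] by (simp add: z_def)

lemma bd_w:
  assumes "1 \<le> i" "x \<in> carrier (part M i)"
  shows "bd M (i + 1) (w i x) = w (i - 1) (bd M i x) \<oplus>\<^bsub>part M i\<^esub> signed i (part M i) (s \<odot>\<^bsub>part M i\<^esub> x)"
proof -
  have "coef P M (bd M 1 (\<alpha> 1 \<sigma>)) = s"
    using \<alpha>_chain[of 1 \<sigma>] \<sigma>_closed coef_\<alpha> K.bd_closed[of 1 \<sigma>] by simp
  then show ?thesis using M.leibniz_one[OF assms \<alpha>_closed[OF \<sigma>_closed]] by (simp add: w_def)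
qed

section \<open>The adjoint of X\<close>

lemma adjoint_unique:
  assumes "t \<in> carrier M2"
  shows "\<exists>!y. y \<in> carrier M3 \<and>
     (\<forall>u\<in>carrier M1. gmult M 3 1 y u = gmult M 2 2 t (X u))"
proof (rule ex_ex1I)
  have "(\<lambda>u. gmult M 2 2 t (X u)) \<in> module_hom P M1 M4"
    using module_hom_comp[OF M.gmult_hom_right[OF assms, of 2] X_hom] by simp
  from M.pairing_represent[of 3, simplified, OF this]
  show "\<exists>y. y \<in> carrier M3 \<and> (\<forall>u\<in>carrier M1. gmult M 3 1 y u = gmult M 2 2 t (X u))"
    by auto
next
  fix x y
  assume "x \<in> carrier M3 \<and> (\<forall>u\<in>carrier M1. gmult M 3 1 x u = gmult M 2 2 t (X u))"
    "y \<in> carrier M3 \<and> (\<forall>u\<in>carrier M1. gmult M 3 1 y u = gmult M 2 2 t (X u))"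
  then show "x = y" by (intro M.pairing_eqI[of 3 x y]) auto
qed

lemma Xd_closed: "t \<in> carrier M2 \<Longrightarrow> Xd t \<in> carrier M3"
  and Xd_pair: "t \<in> carrier M2 \<Longrightarrow> u \<in> carrier M1 \<Longrightarrow>
    gmult M 3 1 (Xd t) u = gmult M 2 2 t (X u)"
  using theI'[OF adjoint_unique[of t]] unfolding adjoint_def by blast+

lemma X_closed: "u \<in> carrier M1 \<Longrightarrow> X u \<in> carrier M2"
  by (rule module_hom_closed[OF X_hom])

lemma M3_eqI:
  assumes "x \<in> carrier M3" "y \<in> carrier M3"
    "\<And>u. u \<in> carrier M1 \<Longrightarrow> gmult M 3 1 x u = gmult M 3 1 y u"
  shows "x = y"
  using M.pairing_eqI[of 3 x y] assms by simp

lemma Xd_module_hom: "Xd \<in> module_hom P M2 M3"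
proof (rule module_homI)
  fix x y assume xy: "x \<in> carrier M2" "y \<in> carrier M2"
  show "Xd (x \<oplus>\<^bsub>M2\<^esub> y) = Xd x \<oplus>\<^bsub>M3\<^esub> Xd y"
  proof (rule M3_eqI)
    fix u assume u: "u \<in> carrier M1"
    show "gmult M 3 1 (Xd (x \<oplus>\<^bsub>M2\<^esub> y)) u = gmult M 3 1 (Xd x \<oplus>\<^bsub>M3\<^esub> Xd y) u"
      using xy u by (simp add: Xd_pair Xd_closed X_closed M.gmult_add_left)
  qed (use xy in \<open>auto intro: Xd_closed\<close>)
next
  fix a x assume xy: "a \<in> carrier P" "x \<in> carrier M2"
  show "Xd (a \<odot>\<^bsub>M2\<^esub> x) = a \<odot>\<^bsub>M3\<^esub> Xd x"
  proof (rule M3_eqI)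
    fix u assume u: "u \<in> carrier M1"
    show "gmult M 3 1 (Xd (a \<odot>\<^bsub>M2\<^esub> x)) u = gmult M 3 1 (a \<odot>\<^bsub>M3\<^esub> Xd x) u"
      using xy u by (simp add: Xd_pair Xd_closed X_closed M.gmult_smult_left)
  qed (use xy in \<open>auto intro: Xd_closed\<close>)
qed (rule Xd_closed)

lemma M4_eqI: "x \<in> carrier M4 \<Longrightarrow> y \<in> carrier M4 \<Longrightarrow> orM x = orM y \<Longrightarrow> x = y"
  using M.ori_eq_iff by blast

text \<open>The transpose of \<open>X\<^sup>\<dagger> \<circ> \<alpha>\<^sub>2 = 0\<close>.\<close>

lemma \<beta>2_X:
  assumes "a \<in> carrier M1"
  shows "\<beta> 2 (X a) = \<zero>\<^bsub>K2\<^esub>"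
proof (rule \<beta>_eqI)
  fix \<phi> assume "\<phi> \<in> carrier (part K (4 - 2))"
  then have p: "\<phi> \<in> carrier K2" by simp
  have "gmult M 2 2 (X a) (\<alpha> 2 \<phi>) = gmult M 2 2 (\<alpha> 2 \<phi>) (X a)"
    using M.gmult_comm[OF X_closed[OF assms] \<alpha>_closed[OF p]] by (simp add: signed_def)
  also have "\<dots> = gmult M 3 1 (Xd (\<alpha> 2 \<phi>)) a"
    using Xd_pair[OF \<alpha>_closed[OF p] assms] by simp
  also have "\<dots> = \<zero>\<^bsub>M4\<^esub>" using X_e p M.gmult_zero_left[OF assms, of 3] by simp
  finally show "orK (gmult K 2 (4 - 2) \<zero>\<^bsub>K2\<^esub> \<phi>) = orM (gmult M 2 (4 - 2) (X a) (\<alpha> (4 - 2) \<phi>))"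
    using K.gmult_zero_left[OF p, of 2] module_hom_zero[OF K.ori_hom K.part_module K.module_ring_module]
      module_hom_zero[OF M.ori_hom M.part_module K.module_ring_module] by simp
qed (use X_closed[OF assms] in auto)

lemma Xd_\<alpha>1:
  assumes "t \<in> carrier M2" "\<phi> \<in> carrier K1"
  shows "gmult M 3 1 (Xd t) (\<alpha> 1 \<phi>) = \<zero>\<^bsub>M4\<^esub>"
  using Xd_pair[OF assms(1) \<alpha>_closed[OF assms(2)]] X_a assms(2) M.gmult_zero_right[OF assms(1), of 2] by simp

lemma w3_Xd: "t \<in> carrier M2 \<Longrightarrow> w 3 (Xd t) = \<zero>\<^bsub>M4\<^esub>"
  using Xd_\<alpha>1[OF _ \<sigma>_closed] by (simp add: w_def)

text \<open>The kernel of \<open>\<beta>\<^sub>3\<close> is the annihilator of \<open>\<alpha>\<^sub>1(K\<^sub>1)\<close>. It contains the image of \<open>X\<^sup>\<dagger>\<close>, because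
  \<open>X\<close> vanishes on \<open>\<alpha>\<^sub>1(K\<^sub>1)\<close>, and it is \<open>M\<^sub>3\<^sub>,\<^sub>2\<close>.\<close>

lemma \<beta>3_zero_iff:
  assumes "c \<in> carrier M3"
  shows "\<beta> 3 c = \<zero>\<^bsub>K3\<^esub> \<longleftrightarrow> (\<forall>\<phi>\<in>carrier K1. gmult M 3 1 c (\<alpha> 1 \<phi>) = \<zero>\<^bsub>M4\<^esub>)"
proof
  assume z: "\<beta> 3 c = \<zero>\<^bsub>K3\<^esub>"
  show "\<forall>\<phi>\<in>carrier K1. gmult M 3 1 c (\<alpha> 1 \<phi>) = \<zero>\<^bsub>M4\<^esub>"
  proof
    fix \<phi> assume p: "\<phi> \<in> carrier K1"
    have "orM (gmult M 3 1 c (\<alpha> 1 \<phi>)) = orK \<zero>\<^bsub>K4\<^esub>"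
      using \<beta>_pair[of 3 c \<phi>] assms p z K.gmult_zero_left[OF p, of 3] by simp
    also have "\<dots> = orM \<zero>\<^bsub>M4\<^esub>"
      using module_hom_zero[OF K.ori_hom K.part_module K.module_ring_module]
        module_hom_zero[OF M.ori_hom M.part_module K.module_ring_module] by simp
    finally show "gmult M 3 1 c (\<alpha> 1 \<phi>) = \<zero>\<^bsub>M4\<^esub>"
      using M.gmult_closed[OF assms \<alpha>_closed[OF p]] by (intro M4_eqI) auto
  qed
next
  assume z: "\<forall>\<phi>\<in>carrier K1. gmult M 3 1 c (\<alpha> 1 \<phi>) = \<zero>\<^bsub>M4\<^esub>"
  show "\<beta> 3 c = \<zero>\<^bsub>K3\<^esub>"
  proof (rule \<beta>_eqI)
    fix \<phi> assume "\<phi> \<in> carrier (part K (4 - 3))"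
    then have p: "\<phi> \<in> carrier K1" by simp
    show "orK (gmult K 3 (4 - 3) \<zero>\<^bsub>K3\<^esub> \<phi>) = orM (gmult M 3 (4 - 3) c (\<alpha> (4 - 3) \<phi>))"
      using z p K.gmult_zero_left[OF p, of 3] module_hom_zero[OF K.ori_hom K.part_module K.module_ring_module]
        module_hom_zero[OF M.ori_hom M.part_module K.module_ring_module] by simp
  qed (use assms in auto)
qed

lemma \<beta>3_Xd: "t \<in> carrier M2 \<Longrightarrow> \<beta> 3 (Xd t) = \<zero>\<^bsub>K3\<^esub>"
  using \<beta>3_zero_iff[OF Xd_closed] Xd_\<alpha>1 by blast

text \<open>The transpose of \<open>m\<^sub>2 \<circ> X + \<alpha>\<^sub>1 \<circ> \<beta>\<^sub>1 = \<beta>\<^sub>0(1)\<close> under the pairing of \<open>M\<^sub>3\<close> with \<open>M\<^sub>1\<close>: the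
  transpose of \<open>m\<^sub>2 \<circ> X\<close> is \<open>X\<^sup>\<dagger> \<circ> m\<^sub>3\<close> and that of \<open>\<alpha>\<^sub>1 \<circ> \<beta>\<^sub>1\<close> is \<open>\<alpha>\<^sub>3 \<circ> \<beta>\<^sub>3\<close>. It completes
  the homotopy from \<open>\<alpha>\<beta>\<close> to \<open>\<beta>\<^sub>0(1)\<close> in degree three.\<close>

lemma \<alpha>3_\<beta>3:
  assumes "c \<in> carrier M3"
  shows "Xd (bd M 3 c) \<oplus>\<^bsub>M3\<^esub> \<alpha> 3 (\<beta> 3 c) = \<beta>01 \<odot>\<^bsub>M3\<^esub> c"
proof (rule M3_eqI)
  have bc: "\<beta> 3 c \<in> carrier K3" using \<beta>_closed[of 3 c] assms by simp
  have dc: "bd M 3 c \<in> carrier M2" using M.bd_closed[of 3 c] assms by simp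
  fix u assume u: "u \<in> carrier M1"
  have bu: "\<beta> 1 u \<in> carrier K1" using \<beta>_closed[of 1 u] u by simp
  have "orM (gmult M 3 1 (\<alpha> 3 (\<beta> 3 c)) u) = orM (gmult M 3 1 c (\<alpha> 1 (\<beta> 1 u)))"
  proof -
    have "gmult M 3 1 (\<alpha> 3 (\<beta> 3 c)) u = \<ominus>\<^bsub>M4\<^esub> gmult M 1 3 u (\<alpha> 3 (\<beta> 3 c))"
      using M.gmult_comm[OF \<alpha>_closed[OF bc] u] by (simp add: signed_def)
    moreover have "orM (gmult M 1 3 u (\<alpha> 3 (\<beta> 3 c))) = orK (gmult K 1 3 (\<beta> 1 u) (\<beta> 3 c))"
      using \<beta>_pair[of 1 u "\<beta> 3 c"] u bc by simp
    moreover have "gmult K 1 3 (\<beta> 1 u) (\<beta> 3 c) = \<ominus>\<^bsub>K4\<^esub> gmult K 3 1 (\<beta> 3 c) (\<beta> 1 u)"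
      using K.gmult_comm[OF bu bc] by (simp add: signed_def)
    moreover have "orK (gmult K 3 1 (\<beta> 3 c) (\<beta> 1 u)) = orM (gmult M 3 1 c (\<alpha> 1 (\<beta> 1 u)))"
      using \<beta>_pair[of 3 c "\<beta> 1 u"] assms bu by simp
    ultimately show ?thesis
      using M.gmult_closed[OF u \<alpha>_closed[OF bc]] K.gmult_closed[OF bc bu]
        M.gmult_closed[OF assms \<alpha>_closed[OF bu]] by (simp add: orM_neg orK_neg orM_closed)
  qed
  then have 1: "gmult M 3 1 (\<alpha> 3 (\<beta> 3 c)) u = gmult M 3 1 c (\<alpha> 1 (\<beta> 1 u))"
    using M.gmult_closed[OF \<alpha>_closed[OF bc] u] M.gmult_closed[OF assms \<alpha>_closed[OF bu]]
    by (intro M4_eqI) auto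
  have "gmult M 3 1 (Xd (bd M 3 c)) u = gmult M 2 2 (bd M 3 c) (X u)"
    by (rule Xd_pair[OF dc u])
  also have "\<dots> = gmult M 3 1 c (bd M 2 (X u))"
    using M.leibniz_top[of 3 2 c "X u"] assms X_closed[OF u] M.top[of 5] by (simp add: signed_def)
  also have "\<dots> = gmult M 3 1 c (\<beta>01 \<odot>\<^bsub>M1\<^esub> u \<ominus>\<^bsub>M1\<^esub> \<alpha> 1 (\<beta> 1 u))"
    using X_b u by simp
  also have "\<dots> = \<beta>01 \<odot>\<^bsub>M4\<^esub> gmult M 3 1 c u \<ominus>\<^bsub>M4\<^esub> gmult M 3 1 c (\<alpha> 1 (\<beta> 1 u))"
    using assms u \<alpha>_closed[OF bu] \<beta>01_closed
    by (simp add: a_minus_def M.gmult_add_right M.gmult_smult_right M.gmult_neg_right)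
  finally have 2: "gmult M 3 1 (Xd (bd M 3 c)) u =
    \<beta>01 \<odot>\<^bsub>M4\<^esub> gmult M 3 1 c u \<ominus>\<^bsub>M4\<^esub> gmult M 3 1 c (\<alpha> 1 (\<beta> 1 u))" .
  have cl: "gmult M 3 1 c u \<in> carrier M4" "gmult M 3 1 c (\<alpha> 1 (\<beta> 1 u)) \<in> carrier M4"
    using M.gmult_closed[OF assms u] M.gmult_closed[OF assms \<alpha>_closed[OF bu]] by auto
  have "gmult M 3 1 (Xd (bd M 3 c) \<oplus>\<^bsub>M3\<^esub> \<alpha> 3 (\<beta> 3 c)) u =
    gmult M 3 1 (Xd (bd M 3 c)) u \<oplus>\<^bsub>M4\<^esub> gmult M 3 1 (\<alpha> 3 (\<beta> 3 c)) u"
    using M.gmult_add_left[OF Xd_closed[OF dc] \<alpha>_closed[OF bc] u] by simp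
  also have "\<dots> = \<beta>01 \<odot>\<^bsub>M4\<^esub> gmult M 3 1 c u"
    unfolding 1 2 using cl \<beta>01_closed by algebra
  also have "\<dots> = gmult M 3 1 (\<beta>01 \<odot>\<^bsub>M3\<^esub> c) u"
    using M.gmult_smult_left[OF \<beta>01_closed assms u] by simp
  finally show "gmult M 3 1 (Xd (bd M 3 c) \<oplus>\<^bsub>M3\<^esub> \<alpha> 3 (\<beta> 3 c)) u =
    gmult M 3 1 (\<beta>01 \<odot>\<^bsub>M3\<^esub> c) u" .
qed (use assms \<beta>01_closed \<beta>_closed[of 3 c] M.bd_closed[of 3 c] in \<open>auto intro!: \<alpha>_closed Xd_closed\<close>)

lemmas KK_homs = K.bd_hom[of 1, simplified] K.bd_hom[of 2, simplified] K.bd_hom[of 3, simplified]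
  K.bd_hom[of 4, simplified] z_module_hom[of 0, simplified] z_module_hom[of 1, simplified]
  z_module_hom[of 2, simplified] z_module_hom[of 3, simplified]

lemmas MM_homs = M.bd_hom[of 1, simplified] M.bd_hom[of 2, simplified] M.bd_hom[of 3, simplified]
  M.bd_hom[of 4, simplified] w_module_hom[of 0, simplified] w_module_hom[of 1, simplified]
  w_module_hom[of 2, simplified] w_module_hom[of 3, simplified] X_hom Xd_module_hom

lemmas MK_homs = \<beta>_module_hom[of 0, simplified] \<beta>_module_hom[of 1, simplified]
  \<beta>_module_hom[of 2, simplified] \<beta>_module_hom[of 3, simplified] \<beta>_module_hom[of 4, simplified]

lemmas hom_closed [simp] = KK_homs[THEN module_hom_closed] MM_homs[THEN module_hom_closed]
  MK_homs[THEN module_hom_closed] \<alpha>_closed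

lemmas hom_add = KK_homs[THEN module_hom_add] MM_homs[THEN module_hom_add]
  MK_homs[THEN module_hom_add] module_hom_add[OF \<alpha>_module_hom]

lemmas hom_smult = KK_homs[THEN module_hom_smult] MM_homs[THEN module_hom_smult]
  MK_homs[THEN module_hom_smult] module_hom_smult[OF \<alpha>_module_hom]

lemmas hom_neg = KK_homs[THEN module_hom_neg, OF K.part_module K.part_module]
  MM_homs[THEN module_hom_neg, OF M.part_module M.part_module]
  MK_homs[THEN module_hom_neg, OF M.part_module K.part_module]
  module_hom_neg[OF \<alpha>_module_hom K.part_module M.part_module]

lemmas hom_zero = KK_homs[THEN module_hom_zero, OF K.part_module K.part_module]
  MM_homs[THEN module_hom_zero, OF M.part_module M.part_module]
  MK_homs[THEN module_hom_zero, OF M.part_module K.part_module]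
  module_hom_zero[OF \<alpha>_module_hom K.part_module M.part_module]

lemmas bd_bd_rules = K.bd_bd[of 1, simplified] K.bd_bd[of 2, simplified] K.bd_bd[of 3, simplified]
  M.bd_bd[of 1, simplified] M.bd_bd[of 2, simplified] M.bd_bd[of 3, simplified]

lemmas chain_rules = \<alpha>_chain[of 1, simplified] \<alpha>_chain[of 2, simplified] \<alpha>_chain[of 3, simplified]
  \<alpha>_chain[of 4, simplified] \<beta>_chain[of 1, simplified] \<beta>_chain[of 2, simplified]
  \<beta>_chain[of 3, simplified] \<beta>_chain[of 4, simplified]

lemma z4_zero: "x \<in> carrier K4 \<Longrightarrow> z 4 x = \<zero>\<^bsub>part K 5\<^esub>"
  using module_hom_closed[OF z_module_hom[of 4]] K_vanish[of 5] by simp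

lemma w4_zero: "x \<in> carrier M4 \<Longrightarrow> w 4 x = \<zero>\<^bsub>part M 5\<^esub>"
  using module_hom_closed[OF w_module_hom[of 4]] M.top[of 5] by simp

lemma bd_z_rules:
  "x \<in> carrier K1 \<Longrightarrow> bd K 2 (z 1 x) = z 0 (bd K 1 x) \<ominus>\<^bsub>K1\<^esub> s \<odot>\<^bsub>K1\<^esub> x"
  "x \<in> carrier K2 \<Longrightarrow> bd K 3 (z 2 x) = z 1 (bd K 2 x) \<oplus>\<^bsub>K2\<^esub> s \<odot>\<^bsub>K2\<^esub> x"
  "x \<in> carrier K3 \<Longrightarrow> bd K 4 (z 3 x) = z 2 (bd K 3 x) \<ominus>\<^bsub>K3\<^esub> s \<odot>\<^bsub>K3\<^esub> x"
  using bd_z[of 1 x] bd_z[of 2 x] bd_z[of 3 x] by (simp_all add: signed_def a_minus_def)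

lemma bd_w_rules:
  "x \<in> carrier M1 \<Longrightarrow> bd M 2 (w 1 x) = w 0 (bd M 1 x) \<ominus>\<^bsub>M1\<^esub> s \<odot>\<^bsub>M1\<^esub> x"
  "x \<in> carrier M2 \<Longrightarrow> bd M 3 (w 2 x) = w 1 (bd M 2 x) \<oplus>\<^bsub>M2\<^esub> s \<odot>\<^bsub>M2\<^esub> x"
  "x \<in> carrier M3 \<Longrightarrow> bd M 4 (w 3 x) = w 2 (bd M 3 x) \<ominus>\<^bsub>M3\<^esub> s \<odot>\<^bsub>M3\<^esub> x"
  using bd_w[of 1 x] bd_w[of 2 x] bd_w[of 3 x] by (simp_all add: signed_def a_minus_def)

lemma z3_bd4: "x \<in> carrier K4 \<Longrightarrow> z 3 (bd K 4 x) = \<ominus>\<^bsub>K4\<^esub> (s \<odot>\<^bsub>K4\<^esub> x)"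
proof -
  assume x: "x \<in> carrier K4"
  have "z 3 (bd K 4 x) \<oplus>\<^bsub>K4\<^esub> s \<odot>\<^bsub>K4\<^esub> x = \<zero>\<^bsub>K4\<^esub>"
    using bd_z[of 4 x] x z4_zero[OF x] module_hom_zero[OF K.bd_hom[of 5, simplified] K.part_module K.part_module]
    by (simp add: signed_def)
  then show ?thesis using x s_closed by (intro MK.M.minus_equality[symmetric]) auto
qed

lemma w3_bd4: "x \<in> carrier M4 \<Longrightarrow> w 3 (bd M 4 x) = \<ominus>\<^bsub>M4\<^esub> (s \<odot>\<^bsub>M4\<^esub> x)"
proof -
  assume x: "x \<in> carrier M4"
  have "w 3 (bd M 4 x) \<oplus>\<^bsub>M4\<^esub> s \<odot>\<^bsub>M4\<^esub> x = \<zero>\<^bsub>M4\<^esub>"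
    using bd_w[of 4 x] x w4_zero[OF x] module_hom_zero[OF M.bd_hom[of 5, simplified] M.part_module M.part_module]
    by (simp add: signed_def)
  then show ?thesis using x s_closed by (intro MM.M.minus_equality[symmetric]) auto
qed

lemma z0_eq: "x \<in> carrier K0 \<Longrightarrow> z 0 x = coef P K x \<odot>\<^bsub>K1\<^esub> \<sigma>"
  using K.gmult_0_left[OF _ \<sigma>_closed] by (simp add: z_def)

lemma w0_eq: "x \<in> carrier M0 \<Longrightarrow> w 0 x = coef P M x \<odot>\<^bsub>M1\<^esub> \<alpha> 1 \<sigma>"
  using M.gmult_0_left[OF _ \<alpha>_closed[OF \<sigma>_closed]] by (simp add: w_def)

lemmas square_rules = z_z[of _ 0, simplified] z_z[of _ 1, simplified] z_z[of _ 2, simplified]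
  w_w[of _ 1, simplified] w_w[of _ 2, simplified]

lemmas \<alpha>_z_rules = \<alpha>_z[of _ 0, simplified] \<alpha>_z[of _ 1, simplified] \<alpha>_z[of _ 2, simplified] \<alpha>_z[of _ 3, simplified]

lemmas \<beta>_w_rules = \<beta>_w[of 0, simplified] \<beta>_w[of 1, simplified] \<beta>_w[of 2, simplified] \<beta>_w[of 3, simplified]

lemmas \<beta>_\<alpha>_rules = \<beta>_\<alpha>[of 0, simplified] \<beta>_\<alpha>[of 1, simplified] \<beta>_\<alpha>[of 2, simplified] \<beta>_\<alpha>[of 3, simplified] \<beta>_\<alpha>[of 4, simplified]

lemma m2_X: "a \<in> carrier M1 \<Longrightarrow>
    bd M 2 (X a) = \<beta>01 \<odot>\<^bsub>M1\<^esub> a \<ominus>\<^bsub>M1\<^esub> \<alpha> 1 (\<beta> 1 a)"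
  using X_b by blast

lemma \<alpha>2_\<beta>2: "t \<in> carrier M2 \<Longrightarrow>
    \<alpha> 2 (\<beta> 2 t) = \<beta>01 \<odot>\<^bsub>M2\<^esub> t \<ominus>\<^bsub>M2\<^esub> X (bd M 2 t) \<ominus>\<^bsub>M2\<^esub> bd M 3 (Xd t)"
proof -
  assume t: "t \<in> carrier M2"
  have "X (bd M 2 t) \<oplus>\<^bsub>M2\<^esub> bd M 3 (Xd t) = \<beta>01 \<odot>\<^bsub>M2\<^esub> t \<ominus>\<^bsub>M2\<^esub> \<alpha> 2 (\<beta> 2 t)"
    using X_c t by blast
  moreover have cl: "X (bd M 2 t) \<in> carrier M2" "bd M 3 (Xd t) \<in> carrier M2"
    "\<alpha> 2 (\<beta> 2 t) \<in> carrier M2" using t by simp_all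
  moreover have "\<alpha> 2 (\<beta> 2 t) = \<beta>01 \<odot>\<^bsub>M2\<^esub> t \<ominus>\<^bsub>M2\<^esub> (\<beta>01 \<odot>\<^bsub>M2\<^esub> t \<ominus>\<^bsub>M2\<^esub> \<alpha> 2 (\<beta> 2 t))"
    using cl t \<beta>01_closed by algebra
  ultimately have "\<alpha> 2 (\<beta> 2 t) = \<beta>01 \<odot>\<^bsub>M2\<^esub> t \<ominus>\<^bsub>M2\<^esub> (X (bd M 2 t) \<oplus>\<^bsub>M2\<^esub> bd M 3 (Xd t))"
    by simp
  also have "\<dots> = \<beta>01 \<odot>\<^bsub>M2\<^esub> t \<ominus>\<^bsub>M2\<^esub> X (bd M 2 t) \<ominus>\<^bsub>M2\<^esub> bd M 3 (Xd t)"
    using cl(1,2) t \<beta>01_closed by algebra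
  finally show ?thesis .
qed

lemma \<alpha>3_\<beta>3': "c \<in> carrier M3 \<Longrightarrow>
    \<alpha> 3 (\<beta> 3 c) = \<beta>01 \<odot>\<^bsub>M3\<^esub> c \<ominus>\<^bsub>M3\<^esub> Xd (bd M 3 c)"
proof -
  assume c: "c \<in> carrier M3"
  have cl: "Xd (bd M 3 c) \<in> carrier M3" "\<alpha> 3 (\<beta> 3 c) \<in> carrier M3" using c by simp_all
  have "\<alpha> 3 (\<beta> 3 c) = (Xd (bd M 3 c) \<oplus>\<^bsub>M3\<^esub> \<alpha> 3 (\<beta> 3 c)) \<ominus>\<^bsub>M3\<^esub> Xd (bd M 3 c)"
    using cl by algebra
  then show ?thesis using \<alpha>3_\<beta>3[OF c] by simp
qed

lemma X_\<alpha>1: "\<phi> \<in> carrier K1 \<Longrightarrow> X (\<alpha> 1 \<phi>) = \<zero>\<^bsub>M2\<^esub>"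
  using X_a by blast

lemma Xd_X: "a \<in> carrier M1 \<Longrightarrow> Xd (X a) = \<zero>\<^bsub>M3\<^esub>"
  using X_d by blast

lemma Xd_\<alpha>2: "\<phi> \<in> carrier K2 \<Longrightarrow> Xd (\<alpha> 2 \<phi>) = \<zero>\<^bsub>M3\<^esub>"
  using X_e by blast

lemma neg_zero: "\<ominus>\<^bsub>part M i\<^esub> \<zero>\<^bsub>part M i\<^esub> = \<zero>\<^bsub>part M i\<^esub>"
    "\<ominus>\<^bsub>part K i\<^esub> \<zero>\<^bsub>part K i\<^esub> = \<zero>\<^bsub>part K i\<^esub>"
  by (rule MM.M.minus_equality MK.M.minus_equality; simp)+

text \<open>Rewrites composites of the structure maps to a normal form in which multiplication by \<open>\<sigma>\<close> is outermost
  and the differentials are innermost, and in which \<open>\<alpha>\<beta>\<close> has been eliminated in degrees two and three in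
  favour of the homotopy. What remains after this is linear algebra over \<open>P\<close>.\<close>

lemmas rels = neg_zero bd_bd_rules chain_rules bd_z_rules bd_w_rules z3_bd4 w3_bd4 z0_eq w0_eq square_rules
  \<alpha>_z_rules \<beta>_w_rules \<beta>_\<alpha>_rules \<alpha>4_\<beta>4 m2_X \<alpha>2_\<beta>2 \<alpha>3_\<beta>3' X_\<alpha>1 Xd_X Xd_\<alpha>2 \<beta>2_X \<beta>3_Xd w3_Xd coef_\<alpha>
  a_minus_def hom_add hom_smult hom_neg hom_zero

lemma M_exact:
  assumes "1 \<le> i" "x \<in> carrier (part M i)" "bd M i x = \<zero>\<^bsub>part M (i - 1)\<^esub>"
  shows "\<exists>y\<in>carrier (part M (i + 1)). x = bd M (i + 1) y"
proof -
  have "\<forall>i\<ge>1. bd M (i + 1) ` carrier (part M (i + 1)) =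
      {x \<in> carrier (part M i). bd M i x = \<zero>\<^bsub>part M (i - 1)\<^esub>}"
    using M_resolution unfolding free_resolution_def by (elim conjE)
  from this[rule_format, OF assms(1)] assms(2,3)
  have "x \<in> bd M (i + 1) ` carrier (part M (i + 1))" by simp
  then show ?thesis by auto
qed

lemma K_exact:
  assumes "1 \<le> i" "x \<in> carrier (part K i)" "bd K i x = \<zero>\<^bsub>part K (i - 1)\<^esub>"
  shows "\<exists>y\<in>carrier (part K (i + 1)). x = bd K (i + 1) y"
proof -
  have "\<forall>i\<ge>1. bd K (i + 1) ` carrier (part K (i + 1)) =
      {x \<in> carrier (part K i). bd K i x = \<zero>\<^bsub>part K (i - 1)\<^esub>}"
    using K_resolution unfolding free_resolution_def by (elim conjE)
  from this[rule_format, OF assms(1)] assms(2,3)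
  have "x \<in> bd K (i + 1) ` carrier (part K (i + 1))" by simp
  then show ?thesis by auto
qed

lemma k4_inj: "x \<in> carrier K4 \<Longrightarrow> bd K 4 x = \<zero>\<^bsub>K3\<^esub> \<Longrightarrow> x = \<zero>\<^bsub>K4\<^esub>"
  using K_exact[of 4 x] K_vanish[of 5] module_hom_zero[OF K.bd_hom[of 5, simplified] K.part_module K.part_module]
  by auto

lemma m4_\<beta>3_inj:
  assumes "e \<in> carrier M4" "\<beta> 3 (bd M 4 e) = \<zero>\<^bsub>K3\<^esub>"
  shows "e = \<zero>\<^bsub>M4\<^esub>"
  using assms k4_inj[of "\<beta> 4 e"] \<beta>4_inj[of e] by (simp add: chain_rules)

text \<open>Both sides have the same boundary, so they differ by a boundary from \<open>M\<^sub>4\<close>, and this boundary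
  is killed by the composite \<open>\<beta>\<^sub>3 \<circ> m\<^sub>4 = k\<^sub>4 \<circ> \<beta>\<^sub>4\<close>, which is injective.\<close>

lemma Xd_w1:
  assumes a: "a \<in> carrier M1"
  shows "Xd (w 1 a) = w 2 (X a)"
proof -
  define T where "T = Xd (w 1 a) \<ominus>\<^bsub>M3\<^esub> w 2 (X a)"
  have cl: "Xd (w 1 a) \<in> carrier M3" "w 2 (X a) \<in> carrier M3" using a by simp_all
  then have T: "T \<in> carrier M3" by (simp add: T_def)
  have c1: "w 1 a \<in> carrier M2" "X a \<in> carrier M2" "w 1 (\<alpha> 1 (\<beta> 1 a)) \<in> carrier M2"
    "coef P M (bd M 1 a) \<in> carrier P" "bd M 3 (Xd (w 1 a)) \<in> carrier M2"
    using a M.coef_props(1)[of "bd M 1 a"] by simp_all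
  have "X (bd M 2 (w 1 a)) = \<ominus>\<^bsub>M2\<^esub> (s \<odot>\<^bsub>M2\<^esub> X a)"
    using a c1 s_closed \<sigma>_closed by (simp add: rels)
  moreover have "\<alpha> 2 (\<beta> 2 (w 1 a)) = w 1 (\<alpha> 1 (\<beta> 1 a))"
    using a by (simp add: \<beta>_w_rules \<alpha>_z_rules)
  moreover have "X (bd M 2 (w 1 a)) \<oplus>\<^bsub>M2\<^esub> bd M 3 (Xd (w 1 a)) =
      \<beta>01 \<odot>\<^bsub>M2\<^esub> w 1 a \<ominus>\<^bsub>M2\<^esub> \<alpha> 2 (\<beta> 2 (w 1 a))"
    using X_c c1(1) by blast
  ultimately have 1: "\<ominus>\<^bsub>M2\<^esub> (s \<odot>\<^bsub>M2\<^esub> X a) \<oplus>\<^bsub>M2\<^esub> bd M 3 (Xd (w 1 a)) =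
      \<beta>01 \<odot>\<^bsub>M2\<^esub> w 1 a \<ominus>\<^bsub>M2\<^esub> w 1 (\<alpha> 1 (\<beta> 1 a))" by simp
  have "bd M 3 (Xd (w 1 a)) = s \<odot>\<^bsub>M2\<^esub> X a \<oplus>\<^bsub>M2\<^esub> (\<ominus>\<^bsub>M2\<^esub> (s \<odot>\<^bsub>M2\<^esub> X a) \<oplus>\<^bsub>M2\<^esub> bd M 3 (Xd (w 1 a)))"
    using c1 s_closed by algebra
  then have 2: "bd M 3 (Xd (w 1 a)) = s \<odot>\<^bsub>M2\<^esub> X a \<oplus>\<^bsub>M2\<^esub>
      (\<beta>01 \<odot>\<^bsub>M2\<^esub> w 1 a \<ominus>\<^bsub>M2\<^esub> w 1 (\<alpha> 1 (\<beta> 1 a)))" using 1 by simp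
  have 3: "bd M 3 (w 2 (X a)) = (\<beta>01 \<odot>\<^bsub>M2\<^esub> w 1 a \<ominus>\<^bsub>M2\<^esub> w 1 (\<alpha> 1 (\<beta> 1 a))) \<oplus>\<^bsub>M2\<^esub> s \<odot>\<^bsub>M2\<^esub> X a"
    using a \<beta>01_closed by (simp add: rels)
  have "bd M 3 T = bd M 3 (Xd (w 1 a)) \<ominus>\<^bsub>M2\<^esub> bd M 3 (w 2 (X a))"
    using cl by (simp add: T_def a_minus_def hom_add hom_neg)
  also have "\<dots> = \<zero>\<^bsub>M2\<^esub>"
    unfolding 2 3 using c1(1-4) s_closed \<beta>01_closed by algebra
  finally obtain e where e: "e \<in> carrier M4" "T = bd M 4 e"
    using M_exact[of 3 T] T by auto
  have "\<beta> 3 T = \<zero>\<^bsub>K3\<^esub>"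
    using a cl by (simp add: T_def rels)
  then have "T = \<zero>\<^bsub>M3\<^esub>" using m4_\<beta>3_inj[of e] e by (simp add: hom_zero)
  then show ?thesis using cl MM.M.diff_zero_iff[OF cl] by (simp add: T_def)
qed

end

section \<open>The decomposition of M1\<close>

sublocale linkage_data \<subseteq> D1: direct_decomposition P "M1" M11 M12
  using M.part_module M11_submodule M12_submodule M1_sum
  by (simp add: direct_decomposition_def direct_decomposition_axioms_def)

context linkage_data
begin

lemma p11_\<alpha>1: "\<phi> \<in> carrier K1 \<Longrightarrow> p11 (\<alpha> 1 \<phi>) = \<alpha> 1 \<phi>"
proof -
  assume p: "\<phi> \<in> carrier K1"
  have "p11 (\<alpha> 1 \<phi>) \<oplus>\<^bsub>M1\<^esub> p12 (\<alpha> 1 \<phi>) = \<alpha> 1 \<phi>" using D1.proj_props(3)[OF \<alpha>_closed[OF p]] .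
  then show "p11 (\<alpha> 1 \<phi>) = \<alpha> 1 \<phi>"
    using \<alpha>1_p12 p D1.proj_props(1)[OF \<alpha>_closed[OF p]] D1.UE(1) by (auto simp: subset_iff)
qed

lemma \<alpha>1_bij: "bij_betw (\<alpha> 1) (carrier K1) M11"
proof -
  have "bij_betw (\<lambda>\<phi>. p11 (\<alpha> 1 \<phi>)) (carrier K1) M11"
    using module_isoD(2)[OF \<alpha>1_iso] by simp
  then show ?thesis by (rule bij_betw_cong[THEN iffD1, rotated]) (simp add: p11_\<alpha>1)
qed

lemma \<alpha>1_M11: "\<phi> \<in> carrier K1 \<Longrightarrow> \<alpha> 1 \<phi> \<in> M11"
  using \<alpha>1_bij by (auto simp: bij_betw_def)

text \<open>The component in \<open>M\<^sub>1\<^sub>,\<^sub>1\<close>, moved to \<open>K\<^sub>1\<close> along the inverse of \<open>\<alpha>\<^sub>1 : K\<^sub>1 \<rightarrow> M\<^sub>1\<^sub>,\<^sub>1\<close>.\<close>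

definition \<gamma> where
  "\<gamma> x = inv_into (carrier K1) (\<lambda>\<phi>. p11 (\<alpha> 1 \<phi>)) (p11 x)"

lemma \<gamma>_props:
  assumes "x \<in> carrier M1"
  shows "\<gamma> x \<in> carrier K1" "\<alpha> 1 (\<gamma> x) = p11 x"
proof -
  have bij: "bij_betw (\<lambda>\<phi>. p11 (\<alpha> 1 \<phi>)) (carrier K1) M11"
    using module_isoD(2)[OF \<alpha>1_iso] by simp
  have "p11 x \<in> M11" using D1.proj_props(1)[OF assms] .
  then show g: "\<gamma> x \<in> carrier K1"
    unfolding \<gamma>_def using bij_betwE[OF bij_betw_inv_into[OF bij]] by blast
  show "\<alpha> 1 (\<gamma> x) = p11 x"
    using bij_betw_inv_into_right[OF bij \<open>p11 x \<in> M11\<close>] p11_\<alpha>1[OF g] by (simp add: \<gamma>_def)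
qed

lemma M12_carrier: "a \<in> M12 \<Longrightarrow> a \<in> carrier M1"
  using D1.VE(1) by blast

lemma p12_closed: "x \<in> carrier M1 \<Longrightarrow> p12 x \<in> M12"
  by (rule D1.proj_props(2))

lemma p12_eq: "x \<in> carrier M1 \<Longrightarrow> p12 x = x \<ominus>\<^bsub>M1\<^esub> \<alpha> 1 (\<gamma> x)"
proof -
  assume x: "x \<in> carrier M1"
  have c: "p12 x \<in> carrier M1" "\<alpha> 1 (\<gamma> x) \<in> carrier M1"
    using M12_carrier p12_closed x \<gamma>_props(1)[OF x] by auto
  have "x = \<alpha> 1 (\<gamma> x) \<oplus>\<^bsub>M1\<^esub> p12 x" using D1.proj_props(3)[OF x] \<gamma>_props(2)[OF x] by simp
  then have "x \<ominus>\<^bsub>M1\<^esub> \<alpha> 1 (\<gamma> x) = (\<alpha> 1 (\<gamma> x) \<oplus>\<^bsub>M1\<^esub> p12 x) \<ominus>\<^bsub>M1\<^esub> \<alpha> 1 (\<gamma> x)" by simp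
  also have "\<dots> = p12 x" using c by algebra
  finally show ?thesis by simp
qed

lemma decompose_eqI:
  assumes "a \<in> M12" "\<phi> \<in> carrier K1" "x = a \<oplus>\<^bsub>M1\<^esub> \<alpha> 1 \<phi>"
  shows "p12 x = a" "\<gamma> x = \<phi>"
proof -
  have x: "x = \<alpha> 1 \<phi> \<oplus>\<^bsub>M1\<^esub> a" using assms M12_carrier by (simp add: MM.M.a_comm)
  note pr = D1.proj_eqI[OF \<alpha>1_M11[OF assms(2)] assms(1) x]
  show "p12 x = a" by (rule pr(2))
  have "x \<in> carrier M1" using assms M12_carrier by simp
  from \<gamma>_props[OF this] show "\<gamma> x = \<phi>"
    using \<alpha>1_bij assms(2) unfolding pr(1) by (auto simp: bij_betw_def inj_on_def)
qed

lemma \<gamma>_module_hom: "\<gamma> \<in> module_hom P M1 K1"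
proof (rule module_homI)
  have split: "x = p12 x \<oplus>\<^bsub>M1\<^esub> \<alpha> 1 (\<gamma> x)" if "x \<in> carrier M1" for x
    using D1.proj_props[OF that] \<gamma>_props[OF that] p12_closed[OF that] M12_carrier
    by (metis MM.M.a_comm \<alpha>_closed)
  fix x y assume xy: "x \<in> carrier M1" "y \<in> carrier M1"
  have "x \<oplus>\<^bsub>M1\<^esub> y = (p12 x \<oplus>\<^bsub>M1\<^esub> \<alpha> 1 (\<gamma> x)) \<oplus>\<^bsub>M1\<^esub> (p12 y \<oplus>\<^bsub>M1\<^esub> \<alpha> 1 (\<gamma> y))"
    using split[OF xy(1)] split[OF xy(2)] by simp
  also have "\<dots> = (p12 x \<oplus>\<^bsub>M1\<^esub> p12 y) \<oplus>\<^bsub>M1\<^esub> \<alpha> 1 (\<gamma> x \<oplus>\<^bsub>K1\<^esub> \<gamma> y)"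
    using xy \<gamma>_props(1) M12_carrier p12_closed by (simp add: hom_add MM.M.a_ac)
  finally show "\<gamma> (x \<oplus>\<^bsub>M1\<^esub> y) = \<gamma> x \<oplus>\<^bsub>K1\<^esub> \<gamma> y"
    using xy \<gamma>_props(1) D1.VE(5) p12_closed by (intro decompose_eqI(2)) auto
next
  fix a x assume xy: "a \<in> carrier P" "x \<in> carrier M1"
  have "x = p12 x \<oplus>\<^bsub>M1\<^esub> \<alpha> 1 (\<gamma> x)"
    using D1.proj_props[OF xy(2)] \<gamma>_props[OF xy(2)] p12_closed[OF xy(2)] M12_carrier
    by (metis MM.M.a_comm \<alpha>_closed)
  then have "a \<odot>\<^bsub>M1\<^esub> x = a \<odot>\<^bsub>M1\<^esub> (p12 x \<oplus>\<^bsub>M1\<^esub> \<alpha> 1 (\<gamma> x))" by simp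
  also have "\<dots> = a \<odot>\<^bsub>M1\<^esub> p12 x \<oplus>\<^bsub>M1\<^esub> \<alpha> 1 (a \<odot>\<^bsub>K1\<^esub> \<gamma> x)"
    using xy \<gamma>_props(1) M12_carrier p12_closed by (simp add: hom_smult MM.smult_r_distr)
  finally show "\<gamma> (a \<odot>\<^bsub>M1\<^esub> x) = a \<odot>\<^bsub>K1\<^esub> \<gamma> x"
    using xy \<gamma>_props(1) D1.VE(4) p12_closed by (intro decompose_eqI(2)) auto
qed (rule \<gamma>_props(1))

lemma \<gamma>_closed [simp]: "x \<in> carrier M1 \<Longrightarrow> \<gamma> x \<in> carrier K1"
  by (rule \<gamma>_props(1))

lemma Y_eq: "Y a = z 1 (\<gamma> (bd M 2 a))"
  by (simp add: Y_def \<gamma>_def)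

section \<open>The matrix factorization\<close>

text \<open>Multiplication by \<open>f\<close> is split into the two parts that the homotopies account for separately.\<close>

lemma f_smult_M: "x \<in> carrier (part M i) \<Longrightarrow>
    f \<odot>\<^bsub>part M i\<^esub> x = r \<odot>\<^bsub>part M i\<^esub> (\<beta>01 \<odot>\<^bsub>part M i\<^esub> x) \<oplus>\<^bsub>part M i\<^esub> s \<odot>\<^bsub>part M i\<^esub> x"
  using f_eq r_closed \<beta>01_closed s_closed by (simp add: MM.smult_l_distr MM.smult_assoc1)

lemma f_smult_K: "x \<in> carrier (part K i) \<Longrightarrow>
    f \<odot>\<^bsub>part K i\<^esub> x = r \<odot>\<^bsub>part K i\<^esub> (\<beta>01 \<odot>\<^bsub>part K i\<^esub> x) \<oplus>\<^bsub>part K i\<^esub> s \<odot>\<^bsub>part K i\<^esub> x"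
  using f_eq r_closed \<beta>01_closed s_closed by (simp add: MK.smult_l_distr MK.smult_assoc1)

lemmas scalars = r_closed \<beta>01_closed s_closed f_carrier \<sigma>_closed

lemma even_odd_1:
  assumes "a \<in> carrier M2" "b \<in> carrier K3" "c \<in> carrier M4"
  shows "(r \<odot>\<^bsub>M2\<^esub> X (p12 (bd M 2 a)) \<ominus>\<^bsub>M2\<^esub> w 1 (p12 (bd M 2 a))) \<oplus>\<^bsub>M2\<^esub>
      \<alpha> 2 ((r \<odot>\<^bsub>K2\<^esub> \<beta> 2 a \<ominus>\<^bsub>K2\<^esub> Y a) \<ominus>\<^bsub>K2\<^esub> bd K 3 b) \<oplus>\<^bsub>M2\<^esub>
      bd M 3 ((r \<odot>\<^bsub>M3\<^esub> Xd a \<oplus>\<^bsub>M3\<^esub> w 2 a) \<oplus>\<^bsub>M3\<^esub> \<alpha> 3 b \<oplus>\<^bsub>M3\<^esub> bd M 4 c)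
    = f \<odot>\<^bsub>M2\<^esub> a"
proof -
  have cl: "X (bd M 2 a) \<in> carrier M2" "w 1 (bd M 2 a) \<in> carrier M2"
    "w 1 (\<alpha> 1 (\<gamma> (bd M 2 a))) \<in> carrier M2" "bd M 3 (Xd a) \<in> carrier M2"
    "\<alpha> 2 (bd K 3 b) \<in> carrier M2"
    using assms by simp_all
  show ?thesis
    using assms scalars
    apply (simp add: rels p12_eq Y_eq f_smult_M)
    using assms scalars cl
    apply algebra
    done
qed

lemma even_odd_2:
  assumes "a \<in> carrier M2" "b \<in> carrier K3" "c \<in> carrier M4"
  shows "(\<ominus>\<^bsub>K3\<^esub> z 2 ((r \<odot>\<^bsub>K2\<^esub> \<beta> 2 a \<ominus>\<^bsub>K2\<^esub> Y a) \<ominus>\<^bsub>K2\<^esub> bd K 3 b)) \<oplus>\<^bsub>K3\<^esub>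
      r \<odot>\<^bsub>K3\<^esub> \<beta> 3 ((r \<odot>\<^bsub>M3\<^esub> Xd a \<oplus>\<^bsub>M3\<^esub> w 2 a) \<oplus>\<^bsub>M3\<^esub> \<alpha> 3 b \<oplus>\<^bsub>M3\<^esub> bd M 4 c)
      \<ominus>\<^bsub>K3\<^esub> bd K 4 (z 3 b \<oplus>\<^bsub>K4\<^esub> r \<odot>\<^bsub>K4\<^esub> \<beta> 4 c)
    = f \<odot>\<^bsub>K3\<^esub> b"
proof -
  have cl: "z 2 (\<beta> 2 a) \<in> carrier K3" "z 2 (bd K 3 b) \<in> carrier K3"
    "\<beta> 3 (bd M 4 c) \<in> carrier K3"
    using assms by simp_all
  show ?thesis
    using assms scalars
    apply (simp add: rels Y_eq f_smult_K)
    using assms scalars cl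
    apply algebra
    done
qed

lemma even_odd_3:
  assumes "a \<in> carrier M2" "b \<in> carrier K3" "c \<in> carrier M4"
  shows "(\<ominus>\<^bsub>M4\<^esub> w 3 ((r \<odot>\<^bsub>M3\<^esub> Xd a \<oplus>\<^bsub>M3\<^esub> w 2 a) \<oplus>\<^bsub>M3\<^esub> \<alpha> 3 b \<oplus>\<^bsub>M3\<^esub> bd M 4 c))
      \<oplus>\<^bsub>M4\<^esub> \<alpha> 4 (z 3 b \<oplus>\<^bsub>K4\<^esub> r \<odot>\<^bsub>K4\<^esub> \<beta> 4 c)
    = f \<odot>\<^bsub>M4\<^esub> c"
proof -
  have cl: "w 3 (\<alpha> 3 b) \<in> carrier M4"
    using assms by simp_all
  show ?thesis
    using assms scalars
    apply (simp add: rels f_smult_M)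
    using assms scalars cl
    apply algebra
    done
qed

text \<open>The coefficient of \<open>\<alpha>\<^sub>1\<close> on the right is what \<open>Y\<close> sees of the \<open>M\<^sub>2\<close>-component of \<open>g_even\<close>; the rest is
  \<open>fa\<close>. The term with \<open>\<sigma>\<close> disappears when \<open>Y\<close> multiplies it by \<open>\<sigma>\<close> again.\<close>

lemma boundary_of_even:
  assumes "a \<in> M12" "b \<in> carrier K2" "c \<in> carrier M3"
  shows "bd M 2 ((r \<odot>\<^bsub>M2\<^esub> X a \<ominus>\<^bsub>M2\<^esub> w 1 a) \<oplus>\<^bsub>M2\<^esub> \<alpha> 2 b \<oplus>\<^bsub>M2\<^esub> bd M 3 c) =
    f \<odot>\<^bsub>M1\<^esub> a \<oplus>\<^bsub>M1\<^esub> \<alpha> 1 (bd K 2 b \<ominus>\<^bsub>K1\<^esub> r \<odot>\<^bsub>K1\<^esub> \<beta> 1 a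
      \<ominus>\<^bsub>K1\<^esub> coef P M (bd M 1 a) \<odot>\<^bsub>K1\<^esub> \<sigma>)"
proof -
  have a: "a \<in> carrier M1" using assms(1) M12_carrier by blast
  have cl: "\<alpha> 1 (bd K 2 b) \<in> carrier M1" "\<alpha> 1 (\<beta> 1 a) \<in> carrier M1"
    "coef P M (bd M 1 a) \<in> carrier P" "\<alpha> 1 \<sigma> \<in> carrier M1"
    using assms a M.coef_props(1)[of "bd M 1 a"] \<sigma>_closed by simp_all
  show ?thesis
    using assms a scalars cl(3)
    apply (simp add: rels f_smult_M)
    using assms a scalars cl
    apply algebra
    done
qed

lemma odd_even_1:
  assumes "a \<in> M12" "b \<in> carrier K2" "c \<in> carrier M3"
  defines "A \<equiv> (r \<odot>\<^bsub>M2\<^esub> X a \<ominus>\<^bsub>M2\<^esub> w 1 a) \<oplus>\<^bsub>M2\<^esub> \<alpha> 2 b \<oplus>\<^bsub>M2\<^esub> bd M 3 c"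
  shows "p12 (bd M 2 A) = f \<odot>\<^bsub>M1\<^esub> a"
    and "\<gamma> (bd M 2 A) = bd K 2 b \<ominus>\<^bsub>K1\<^esub> r \<odot>\<^bsub>K1\<^esub> \<beta> 1 a
      \<ominus>\<^bsub>K1\<^esub> coef P M (bd M 1 a) \<odot>\<^bsub>K1\<^esub> \<sigma>"
  using decompose_eqI[OF _ _ boundary_of_even[OF assms(1-3)]] D1.VE(4)[OF f_carrier assms(1)]
    assms M12_carrier M.coef_props(1)[of "bd M 1 a"] scalars
  unfolding A_def by simp_all

lemma z1_\<sigma>: "z 1 \<sigma> = \<zero>\<^bsub>K2\<^esub>"
  using K.gmult_odd_square[of 1 \<sigma>] \<sigma>_closed by (simp add: z_def)

lemma odd_even_2:
  assumes "a \<in> M12" "b \<in> carrier K2" "c \<in> carrier M3" "d \<in> carrier K4"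
  defines "A \<equiv> (r \<odot>\<^bsub>M2\<^esub> X a \<ominus>\<^bsub>M2\<^esub> w 1 a) \<oplus>\<^bsub>M2\<^esub> \<alpha> 2 b \<oplus>\<^bsub>M2\<^esub> bd M 3 c"
  defines "B \<equiv> (\<ominus>\<^bsub>K3\<^esub> z 2 b) \<oplus>\<^bsub>K3\<^esub> r \<odot>\<^bsub>K3\<^esub> \<beta> 3 c \<ominus>\<^bsub>K3\<^esub> bd K 4 d"
  shows "(r \<odot>\<^bsub>K2\<^esub> \<beta> 2 A \<ominus>\<^bsub>K2\<^esub> Y A) \<ominus>\<^bsub>K2\<^esub> bd K 3 B = f \<odot>\<^bsub>K2\<^esub> b"
proof -
  have a: "a \<in> carrier M1" using assms(1) M12_carrier by blast
  have cl: "z 1 (\<beta> 1 a) \<in> carrier K2" "z 1 (bd K 2 b) \<in> carrier K2"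
    "\<beta> 2 (bd M 3 c) \<in> carrier K2" "coef P M (bd M 1 a) \<in> carrier P"
    using assms(1-4) a M.coef_props(1)[of "bd M 1 a"] by simp_all
  have Y: "Y A = z 1 (bd K 2 b \<ominus>\<^bsub>K1\<^esub> r \<odot>\<^bsub>K1\<^esub> \<beta> 1 a
      \<ominus>\<^bsub>K1\<^esub> coef P M (bd M 1 a) \<odot>\<^bsub>K1\<^esub> \<sigma>)"
    unfolding Y_eq A_def odd_even_1(2)[OF assms(1-3)] ..
  show ?thesis
    unfolding Y unfolding A_def B_def
    using assms(1-4) a scalars cl(4)
    apply (simp add: rels f_smult_K z1_\<sigma>)
    using assms(1-4) a scalars cl
    apply algebra
    done
qed

text \<open>The terms \<open>X\<^sup>\<dagger>(a \<cdot> \<alpha>\<^sub>1\<sigma>)\<close> and \<open>X(a) \<cdot> \<alpha>\<^sub>1\<sigma>\<close> occur with opposite signs.\<close>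

lemma odd_even_3:
  assumes "a \<in> M12" "b \<in> carrier K2" "c \<in> carrier M3" "d \<in> carrier K4"
  defines "A \<equiv> (r \<odot>\<^bsub>M2\<^esub> X a \<ominus>\<^bsub>M2\<^esub> w 1 a) \<oplus>\<^bsub>M2\<^esub> \<alpha> 2 b \<oplus>\<^bsub>M2\<^esub> bd M 3 c"
  defines "B \<equiv> (\<ominus>\<^bsub>K3\<^esub> z 2 b) \<oplus>\<^bsub>K3\<^esub> r \<odot>\<^bsub>K3\<^esub> \<beta> 3 c \<ominus>\<^bsub>K3\<^esub> bd K 4 d"
  defines "C \<equiv> (\<ominus>\<^bsub>M4\<^esub> w 3 c) \<oplus>\<^bsub>M4\<^esub> \<alpha> 4 d"
  shows "(r \<odot>\<^bsub>M3\<^esub> Xd A \<oplus>\<^bsub>M3\<^esub> w 2 A) \<oplus>\<^bsub>M3\<^esub> \<alpha> 3 B \<oplus>\<^bsub>M3\<^esub> bd M 4 C = f \<odot>\<^bsub>M3\<^esub> c"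
proof -
  have a: "a \<in> carrier M1" using assms(1) M12_carrier by blast
  have cl: "w 2 (X a) \<in> carrier M3" "Xd (bd M 3 c) \<in> carrier M3"
    "w 2 (\<alpha> 2 b) \<in> carrier M3" "w 2 (bd M 3 c) \<in> carrier M3" "\<alpha> 3 (bd K 4 d) \<in> carrier M3"
    using assms a by simp_all
  show ?thesis
    unfolding A_def B_def C_def
    using assms(1-4) a scalars
    apply (simp add: rels f_smult_M Xd_w1)
    using assms(1-4) a scalars cl
    apply algebra
    done
qed

lemma odd_even_4:
  assumes "b \<in> carrier K2" "c \<in> carrier M3" "d \<in> carrier K4"
  defines "B \<equiv> (\<ominus>\<^bsub>K3\<^esub> z 2 b) \<oplus>\<^bsub>K3\<^esub> r \<odot>\<^bsub>K3\<^esub> \<beta> 3 c \<ominus>\<^bsub>K3\<^esub> bd K 4 d"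
  defines "C \<equiv> (\<ominus>\<^bsub>M4\<^esub> w 3 c) \<oplus>\<^bsub>M4\<^esub> \<alpha> 4 d"
  shows "z 3 B \<oplus>\<^bsub>K4\<^esub> r \<odot>\<^bsub>K4\<^esub> \<beta> 4 C = f \<odot>\<^bsub>K4\<^esub> d"
proof -
  have cl: "z 3 (\<beta> 3 c) \<in> carrier K4"
    using assms by simp_all
  show ?thesis
    unfolding B_def C_def
    using assms(1-3) scalars
    apply (simp add: rels f_smult_K)
    using assms(1-3) scalars cl
    apply algebra
    done
qed

abbreviation "M12_mod \<equiv> M1\<lparr>carrier := M12\<rparr>"

lemma M12_module: "module P M12_mod"
  by (rule submodule.submodule_is_module[OF M12_submodule M.part_module])

lemma M0_module: "module P (zero_module M0)" and K0_module: "module P (zero_module K0)"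
  by (rule module_zero_module[OF M.part_module], rule module_zero_module[OF K.part_module])

lemma pr1_hom: "(\<lambda>x. fst x) \<in> module_hom P (A \<boxplus> B) A"
  and pr2_hom: "(\<lambda>x. fst (snd x)) \<in> module_hom P (A \<boxplus> B \<boxplus> C) B"
  and pr3_hom: "(\<lambda>x. fst (snd (snd x))) \<in> module_hom P (A \<boxplus> B \<boxplus> C \<boxplus> D) C"
  and pr4_hom: "(\<lambda>x. snd (snd (snd x))) \<in> module_hom P (A \<boxplus> B \<boxplus> C \<boxplus> D) D"
  by (auto intro!: module_homI)

lemma pr1_hom_M12: "(\<lambda>x. fst x) \<in> module_hom P (M12_mod \<boxplus> B) M1"
  by (rule module_hom_into_sub[OF pr1_hom]) (use M12_carrier in blast)

text \<open>Backward rules that take a block matrix apart into its entries and these into structure maps.\<close>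

lemmas hom_intros =
  pr1_hom_M12 pr1_hom pr2_hom pr3_hom pr4_hom
  module_hom_Pair module_hom_zero_module[OF M.part_module] module_hom_zero_module[OF K.part_module]
  KK_homs[THEN module_hom_comp] MM_homs[THEN module_hom_comp] MK_homs[THEN module_hom_comp]
  \<alpha>_module_hom[THEN module_hom_comp] \<gamma>_module_hom[THEN module_hom_comp]
  D1.proj_hom(2)[THEN module_hom_comp]
  module_hom_plus[OF M.part_module] module_hom_plus[OF K.part_module]
  module_hom_diff[OF M.part_module] module_hom_diff[OF K.part_module]
  module_hom_uminus[OF M.part_module] module_hom_uminus[OF K.part_module]
  module_hom_scale[OF M.part_module _ r_closed] module_hom_scale[OF K.part_module _ r_closed]

lemma g_even_hom: "g_even \<in> module_hom P G_even G_odd"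
proof -
  have "(\<lambda>x. ((r \<odot>\<^bsub>M2\<^esub> X (fst x) \<ominus>\<^bsub>M2\<^esub> w 1 (fst x)) \<oplus>\<^bsub>M2\<^esub> \<alpha> 2 (fst (snd x)) \<oplus>\<^bsub>M2\<^esub> bd M 3 (fst (snd (snd x))),
     (\<ominus>\<^bsub>K3\<^esub> z 2 (fst (snd x))) \<oplus>\<^bsub>K3\<^esub> r \<odot>\<^bsub>K3\<^esub> \<beta> 3 (fst (snd (snd x))) \<ominus>\<^bsub>K3\<^esub> bd K 4 (snd (snd (snd x))),
     (\<ominus>\<^bsub>M4\<^esub> w 3 (fst (snd (snd x)))) \<oplus>\<^bsub>M4\<^esub> \<alpha> 4 (snd (snd (snd x))),
     \<zero>\<^bsub>K0\<^esub>)) \<in> module_hom P G_even G_odd" (is "?h \<in> _")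
    unfolding G_even_def G_odd_def by (intro hom_intros)
  also have "?h = g_even" by auto
  finally show ?thesis .
qed

lemma g_odd_hom: "g_odd \<in> module_hom P G_odd G_even"
proof -
  have "(\<lambda>x. (p12 (bd M 2 (fst x)),
     (r \<odot>\<^bsub>K2\<^esub> \<beta> 2 (fst x) \<ominus>\<^bsub>K2\<^esub> z 1 (\<gamma> (bd M 2 (fst x)))) \<ominus>\<^bsub>K2\<^esub> bd K 3 (fst (snd x)),
     (r \<odot>\<^bsub>M3\<^esub> Xd (fst x) \<oplus>\<^bsub>M3\<^esub> w 2 (fst x)) \<oplus>\<^bsub>M3\<^esub> \<alpha> 3 (fst (snd x)) \<oplus>\<^bsub>M3\<^esub> bd M 4 (fst (snd (snd x))),
     z 3 (fst (snd x)) \<oplus>\<^bsub>K4\<^esub> r \<odot>\<^bsub>K4\<^esub> \<beta> 4 (fst (snd (snd x))))) \<in> module_hom P G_odd G_even" (is "?h \<in> _")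
    unfolding G_even_def G_odd_def by (intro hom_intros)
  also have "?h = g_odd" by (auto simp: Y_eq)
  finally show ?thesis .
qed

lemma l4_hom: "l4 \<in> module_hom P G_even L3"
proof -
  have "(\<lambda>x. ((r \<odot>\<^bsub>M2\<^esub> X (fst x) \<ominus>\<^bsub>M2\<^esub> w 1 (fst x)) \<oplus>\<^bsub>M2\<^esub> \<alpha> 2 (fst (snd x)) \<oplus>\<^bsub>M2\<^esub> bd M 3 (fst (snd (snd x))),
     (\<ominus>\<^bsub>K3\<^esub> z 2 (fst (snd x))) \<oplus>\<^bsub>K3\<^esub> r \<odot>\<^bsub>K3\<^esub> \<beta> 3 (fst (snd (snd x))) \<ominus>\<^bsub>K3\<^esub> bd K 4 (snd (snd (snd x))),
     \<zero>\<^bsub>M0\<^esub>, \<zero>\<^bsub>K0\<^esub>)) \<in> module_hom P G_even L3" (is "?h \<in> _")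
    unfolding G_even_def L3_def by (intro hom_intros)
  also have "?h = l4" by auto
  finally show ?thesis .
qed

lemma l3_hom: "l3 \<in> module_hom P L3 L2"
proof -
  have "(\<lambda>x. (p12 (bd M 2 (fst x)),
     (r \<odot>\<^bsub>K2\<^esub> \<beta> 2 (fst x) \<ominus>\<^bsub>K2\<^esub> z 1 (\<gamma> (bd M 2 (fst x)))) \<ominus>\<^bsub>K2\<^esub> bd K 3 (fst (snd x)),
     \<zero>\<^bsub>M0\<^esub>, \<zero>\<^bsub>K0\<^esub>)) \<in> module_hom P L3 L2" (is "?h \<in> _")
    unfolding L3_def L2_def by (intro hom_intros)
  also have "?h = l3" by (auto simp: Y_eq)
  finally show ?thesis .
qed

text \<open>The differential \<open>m\<^sub>1\<close> with \<open>M\<^sub>0\<close> identified with \<open>P\<close>.\<close>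

definition \<mu> where "\<mu> x = coef P M (bd M 1 x)"

lemma \<mu>_closed: "x \<in> carrier M1 \<Longrightarrow> \<mu> x \<in> carrier P"
  using M.coef_props(1)[of "bd M 1 x"] by (simp add: \<mu>_def)

lemma bd1_\<mu>: "x \<in> carrier M1 \<Longrightarrow> bd M 1 x = \<mu> x \<odot>\<^bsub>M0\<^esub> gone M"
  using M.coef_props(2)[of "bd M 1 x"] by (simp add: \<mu>_def)

lemma \<mu>_hom: "\<mu> \<in> module_hom P M1 (ring_module P)"
  using module_hom_comp[OF module_isoD(1)[OF M.coef_iso] M.bd_hom[of 1, simplified]]
  by (simp add: \<mu>_def[abs_def])

lemma \<mu>_add: "x \<in> carrier M1 \<Longrightarrow> y \<in> carrier M1 \<Longrightarrow> \<mu> (x \<oplus>\<^bsub>M1\<^esub> y) = \<mu> x \<oplus> \<mu> y"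
  and \<mu>_smult: "a \<in> carrier P \<Longrightarrow> x \<in> carrier M1 \<Longrightarrow> \<mu> (a \<odot>\<^bsub>M1\<^esub> x) = a \<otimes> \<mu> x"
  using module_hom_add[OF \<mu>_hom] module_hom_smult[OF \<mu>_hom] by simp_all

lemma \<mu>_neg: "x \<in> carrier M1 \<Longrightarrow> \<mu> (\<ominus>\<^bsub>M1\<^esub> x) = \<ominus> \<mu> x"
  using \<mu>_smult[of "\<ominus> \<one>" x] \<mu>_closed[of x] by (simp add: MM.smult_l_minus K.l_minus)

lemma \<mu>_\<alpha>1: "\<phi> \<in> carrier K1 \<Longrightarrow> \<mu> (\<alpha> 1 \<phi>) = coef P K (bd K 1 \<phi>)"
  by (simp add: \<mu>_def chain_rules coef_\<alpha>)

lemma z0_gone: "p \<in> carrier P \<Longrightarrow> z 0 (p \<odot>\<^bsub>K0\<^esub> gone K) = p \<odot>\<^bsub>K1\<^esub> \<sigma>"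
  using K.gone_closed by (simp add: z0_eq)

lemma l2_alt:
  "a \<in> carrier M1 \<Longrightarrow> l2 (a, b, c, d) = (\<zero>\<^bsub>M0\<^esub>,
     (r \<odot>\<^bsub>K1\<^esub> \<beta> 1 a \<oplus>\<^bsub>K1\<^esub> \<mu> a \<odot>\<^bsub>K1\<^esub> \<sigma>) \<ominus>\<^bsub>K1\<^esub> bd K 2 b,
     \<zero>\<^bsub>M0\<^esub>, \<zero>\<^bsub>K0\<^esub>)"
  using z0_gone[OF \<mu>_closed] by (simp add: \<mu>_def)

lemma \<mu>_scale_hom: "h \<in> module_hom P A M1 \<Longrightarrow> (\<lambda>x. \<mu> (h x) \<odot>\<^bsub>K1\<^esub> \<sigma>) \<in> module_hom P A K1"
  using \<sigma>_closed \<mu>_closed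
  by (auto simp: module_hom_def Pi_def \<mu>_add \<mu>_smult MK.smult_l_distr MK.smult_assoc1)

lemma l2_hom: "l2 \<in> module_hom P L2 L1"
proof -
  have h: "(\<lambda>x. (\<zero>\<^bsub>M0\<^esub>,
     (r \<odot>\<^bsub>K1\<^esub> \<beta> 1 (fst x) \<oplus>\<^bsub>K1\<^esub> \<mu> (fst x) \<odot>\<^bsub>K1\<^esub> \<sigma>) \<ominus>\<^bsub>K1\<^esub> bd K 2 (fst (snd x)),
     \<zero>\<^bsub>M0\<^esub>, \<zero>\<^bsub>K0\<^esub>)) \<in> module_hom P L2 L1" (is "?h \<in> _")
    unfolding L2_def L1_def by (intro \<mu>_scale_hom hom_intros)
  have eq: "l2 x = ?h x" if "x \<in> carrier L2" for x
    using that l2_alt M12_carrier by (cases x) (auto simp: L2_def simp del: l2.simps)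
  interpret L2: module P L2 unfolding L2_def
    by (intro module_direct_sum M12_module K.part_module M0_module K0_module)
  show ?thesis
    using h unfolding module_hom_def by (auto simp: Pi_def eq simp del: l2.simps)
qed

lemma l1_hom: "l1 \<in> module_hom P L1 L0"
proof -
  have "(\<lambda>x. (\<zero>\<^bsub>M0\<^esub>, \<ominus>\<^bsub>K0\<^esub> bd K 1 (fst (snd x)), \<zero>\<^bsub>M0\<^esub>, \<zero>\<^bsub>K0\<^esub>)) \<in> module_hom P L1 L0" (is "?h \<in> _")
    unfolding L1_def L0_def by (intro hom_intros)
  also have "?h = l1" by auto
  finally show ?thesis .
qed

section \<open>Exactness in low degrees\<close>

lemma f_inj_M: "x \<in> carrier (part M i) \<Longrightarrow> y \<in> carrier (part M i) \<Longrightarrow> f \<odot>\<^bsub>part M i\<^esub> x = f \<odot>\<^bsub>part M i\<^esub> y \<Longrightarrow> x = y"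
  by (rule regular_smult_inject[OF M.part_fg_free f_regular])

lemma f_inj_K: "x \<in> carrier (part K i) \<Longrightarrow> y \<in> carrier (part K i) \<Longrightarrow> f \<odot>\<^bsub>part K i\<^esub> x = f \<odot>\<^bsub>part K i\<^esub> y \<Longrightarrow> x = y"
  by (rule regular_smult_inject[OF K.part_fg_free f_regular])

text \<open>Here \<open>k\<^sub>1 \<circ> \<beta>\<^sub>1 = \<beta>\<^sub>0 \<circ> m\<^sub>1\<close> contributes \<open>r\<beta>\<^sub>0(1)\<close> and the term with \<open>\<sigma>\<close> contributes \<open>k\<^sub>1(\<sigma>)\<close>. The
  formula is needed on all of \<open>M\<^sub>1\<close>, not only on \<open>M\<^sub>1\<^sub>,\<^sub>2\<close>.\<close>

lemma l1_l2:
  assumes "\<theta> \<in> carrier M1" "b \<in> carrier K2"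
  shows "bd K 1 ((r \<odot>\<^bsub>K1\<^esub> \<beta> 1 \<theta> \<oplus>\<^bsub>K1\<^esub> \<mu> \<theta> \<odot>\<^bsub>K1\<^esub> \<sigma>) \<ominus>\<^bsub>K1\<^esub> bd K 2 b) =
    f \<odot>\<^bsub>K0\<^esub> (\<mu> \<theta> \<odot>\<^bsub>K0\<^esub> gone K)"
proof -
  have b0: "\<beta> 0 (gone M) = \<beta>01 \<odot>\<^bsub>K0\<^esub> gone K"
    using K.coef_props(2)[of "\<beta> 0 (gone M)"] M.gone_closed by (simp add: \<beta>01_def)
  \<comment> \<open>A name for \<open>s\<close> that hides its definition, so that \<open>k\<^sub>1 \<sigma> = t \<cdot> 1\<close> is a terminating rewrite rule.\<close>
  define t where "t = s"
  have t: "bd K 1 \<sigma> = t \<odot>\<^bsub>K0\<^esub> gone K" "t \<in> carrier P"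
    using K.coef_props(2)[of "bd K 1 \<sigma>"] \<sigma>_closed s_closed by (simp_all add: t_def)
  note cl = r_closed \<beta>01_closed f_carrier \<sigma>_closed \<mu>_closed[OF assms(1)] M.gone_closed K.gone_closed t(2)
  show ?thesis
    using assms cl
    apply (simp add: rels bd1_\<mu> b0 t(1) f_smult_K[folded t_def])
    using assms cl
    apply algebra
    done
qed

text \<open>Modulo \<open>f\<close> and boundaries \<open>M\<^sub>1\<^sub>,\<^sub>1\<close> contributes nothing to the cycles in \<open>K\<^sub>1\<close>, so that \<open>M\<^sub>1\<^sub>,\<^sub>2\<close> is
  enough in degree two.\<close>

lemma l2_\<alpha>1:
  assumes "\<phi> \<in> carrier K1"
  shows "r \<odot>\<^bsub>K1\<^esub> \<beta> 1 (\<alpha> 1 \<phi>) \<oplus>\<^bsub>K1\<^esub> \<mu> (\<alpha> 1 \<phi>) \<odot>\<^bsub>K1\<^esub> \<sigma> =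
    f \<odot>\<^bsub>K1\<^esub> \<phi> \<oplus>\<^bsub>K1\<^esub> bd K 2 (z 1 \<phi>)"
proof -
  have cl: "coef P K (bd K 1 \<phi>) \<in> carrier P" using assms K.coef_props(1)[of "bd K 1 \<phi>"] by simp
  show ?thesis
    using assms scalars cl
    apply (simp add: rels \<mu>_\<alpha>1 f_smult_K)
    using assms scalars cl
    apply algebra
    done
qed

text \<open>If \<open>k\<^sub>1(\<phi>) = fp\<close>, then \<open>p \<in> KK : f\<close>, so \<open>p = m\<^sub>1(\<theta>)\<close> for some \<open>\<theta>\<close>. The element
  \<open>r\<beta>\<^sub>1(\<theta>) + p\<sigma>\<close> has the same boundary as \<open>\<phi>\<close>, and the two differ by a boundary of \<open>K\<close>. Only the component
  of \<open>\<theta>\<close> in \<open>M\<^sub>1\<^sub>,\<^sub>2\<close> may be used, and the other one is harmless.\<close>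

lemma exact_1: "R.exact_mod L2 l2 L1 l1 L0"
  unfolding R.exact_mod_def
proof (intro conjI ballI impI)
  fix x assume "x \<in> carrier L2"
  then obtain a b c d where x: "x = (a, b, c, d)" "a \<in> carrier M1" "b \<in> carrier K2"
    using M12_carrier by (auto simp: L2_def)
  have "l1 (l2 x) = f \<odot>\<^bsub>L0\<^esub> (\<zero>\<^bsub>M0\<^esub>, \<ominus>\<^bsub>K0\<^esub> (\<mu> a \<odot>\<^bsub>K0\<^esub> gone K), \<zero>\<^bsub>M0\<^esub>, \<zero>\<^bsub>K0\<^esub>)"
    using l1_l2[OF x(2,3)] \<mu>_closed[OF x(2)] K.gone_closed f_carrier
    by (simp add: x(1) l2_alt[OF x(2)] L0_def MK.smult_r_minus del: l2.simps)
  then show "\<exists>y\<in>carrier L0. l1 (l2 x) = f \<odot>\<^bsub>L0\<^esub> y"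
    by (rule bexI) (use \<mu>_closed[OF x(2)] K.gone_closed in \<open>simp add: L0_def\<close>)
next
  fix x y assume "x \<in> carrier L1" "y \<in> carrier L0" and eq: "l1 x = f \<odot>\<^bsub>L0\<^esub> y"
  then obtain \<phi> \<psi> where x: "x = (\<zero>\<^bsub>M0\<^esub>, \<phi>, \<zero>\<^bsub>M0\<^esub>, \<zero>\<^bsub>K0\<^esub>)" "\<phi> \<in> carrier K1"
    and y: "y = (\<zero>\<^bsub>M0\<^esub>, \<psi>, \<zero>\<^bsub>M0\<^esub>, \<zero>\<^bsub>K0\<^esub>)" "\<psi> \<in> carrier K0"
    by (auto simp: L1_def L0_def)
  \<comment> \<open>The sign is that of \<open>l1 = -k\<^sub>1\<close>.\<close>
  define p where "p = \<ominus> coef P K \<psi>"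
  have p: "p \<in> carrier P" using K.coef_props(1)[OF y(2)] by (simp add: p_def)
  have "\<ominus>\<^bsub>K0\<^esub> bd K 1 \<phi> = f \<odot>\<^bsub>K0\<^esub> \<psi>" using eq by (simp add: x(1) y(1) L0_def)
  then have "bd K 1 \<phi> = \<ominus>\<^bsub>K0\<^esub> (f \<odot>\<^bsub>K0\<^esub> \<psi>)"
    using x(2) MK.M.minus_minus[of "bd K 1 \<phi>" 0] by simp
  also have "\<dots> = \<ominus>\<^bsub>K0\<^esub> (f \<odot>\<^bsub>K0\<^esub> (coef P K \<psi> \<odot>\<^bsub>K0\<^esub> gone K))"
    using K.coef_props(2)[OF y(2)] by simp
  also have "\<dots> = f \<odot>\<^bsub>K0\<^esub> (p \<odot>\<^bsub>K0\<^esub> gone K)"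
    unfolding p_def using K.coef_props(1)[OF y(2)] K.gone_closed f_carrier by algebra
  finally have k: "bd K 1 \<phi> = f \<odot>\<^bsub>K0\<^esub> (p \<odot>\<^bsub>K0\<^esub> gone K)" .
  then have "coef P K (bd K 1 \<phi>) = p \<otimes> f"
    using p f_carrier K.gone_closed by (intro K.coef_eqI) (auto simp: MK.smult_assoc1[symmetric] K.m_comm)
  moreover have "coef P K (bd K 1 \<phi>) \<in> KK"
    using K.resolution_image[OF K_resolution KK_ideal] x(2) by auto
  ultimately have "p \<in> colon_ideal P KK f" using p by (simp add: colon_ideal_def)
  then have "p \<in> (\<lambda>x. coef P M (bd M 1 x)) ` carrier M1"
    using M.resolution_image[OF M_resolution] cring.colon_ideal_ideal[OF cring_P KK_ideal f_carrier] by simp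
  then obtain \<theta> where \<theta>: "\<theta> \<in> carrier M1" "\<mu> \<theta> = p" by (auto simp: \<mu>_def)
  define \<rho> where "\<rho> = r \<odot>\<^bsub>K1\<^esub> \<beta> 1 \<theta> \<oplus>\<^bsub>K1\<^esub> \<mu> \<theta> \<odot>\<^bsub>K1\<^esub> \<sigma>"
  have \<rho>: "\<rho> \<in> carrier K1" using \<theta> p scalars by (simp add: \<rho>_def)
  have "bd K 1 \<rho> = bd K 1 \<phi>"
    using l1_l2[OF \<theta>(1) MK.M.zero_closed] \<rho> k
    unfolding \<rho>_def[symmetric] unfolding \<theta>(2) by (simp add: a_minus_def hom_zero neg_zero)
  then have "bd K 1 (\<phi> \<ominus>\<^bsub>K1\<^esub> \<rho>) = \<zero>\<^bsub>K0\<^esub>"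
    using x(2) \<rho> by (simp add: a_minus_def hom_add hom_neg MK.M.r_neg)
  then obtain b where b: "b \<in> carrier K2" "\<phi> \<ominus>\<^bsub>K1\<^esub> \<rho> = bd K 2 b"
    using K_exact[of 1 "\<phi> \<ominus>\<^bsub>K1\<^esub> \<rho>"] x(2) \<rho> by auto
  define a where "a = p12 \<theta>"
  define g where "g = \<gamma> \<theta>"
  have a: "a \<in> M12" "a \<in> carrier M1" and g: "g \<in> carrier K1"
    using p12_closed[OF \<theta>(1)] M12_carrier \<theta>(1) by (simp_all add: a_def g_def)
  have \<theta>_eq: "\<theta> = a \<oplus>\<^bsub>M1\<^esub> \<alpha> 1 g"
    using p12_eq[OF \<theta>(1)] \<theta>(1) g by (simp add: a_def g_def a_minus_def MM.M.a_assoc MM.M.l_neg)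
  \<comment> \<open>The second summand is a multiple of \<open>f\<close> plus a boundary.\<close>
  have "\<rho> = (r \<odot>\<^bsub>K1\<^esub> \<beta> 1 a \<oplus>\<^bsub>K1\<^esub> \<mu> a \<odot>\<^bsub>K1\<^esub> \<sigma>) \<oplus>\<^bsub>K1\<^esub>
    (r \<odot>\<^bsub>K1\<^esub> \<beta> 1 (\<alpha> 1 g) \<oplus>\<^bsub>K1\<^esub> \<mu> (\<alpha> 1 g) \<odot>\<^bsub>K1\<^esub> \<sigma>)"
  proof -
    have cl: "\<beta> 1 a \<in> carrier K1" "\<beta> 1 (\<alpha> 1 g) \<in> carrier K1" "\<mu> a \<in> carrier P" "\<mu> (\<alpha> 1 g) \<in> carrier P"
      using a g by (simp_all add: \<mu>_closed)
    have "\<rho> = r \<odot>\<^bsub>K1\<^esub> (\<beta> 1 a \<oplus>\<^bsub>K1\<^esub> \<beta> 1 (\<alpha> 1 g)) \<oplus>\<^bsub>K1\<^esub> (\<mu> a \<oplus> \<mu> (\<alpha> 1 g)) \<odot>\<^bsub>K1\<^esub> \<sigma>"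
      using a g by (simp add: \<rho>_def \<theta>_eq hom_add \<mu>_add)
    then show ?thesis using cl scalars by algebra
  qed
  also have "\<dots> = (r \<odot>\<^bsub>K1\<^esub> \<beta> 1 a \<oplus>\<^bsub>K1\<^esub> \<mu> a \<odot>\<^bsub>K1\<^esub> \<sigma>) \<oplus>\<^bsub>K1\<^esub>
    (f \<odot>\<^bsub>K1\<^esub> g \<oplus>\<^bsub>K1\<^esub> bd K 2 (z 1 g))"
    unfolding l2_\<alpha>1[OF g] ..
  finally have \<rho>_eq: "\<rho> = \<dots>" .
  have "\<phi> = \<rho> \<oplus>\<^bsub>K1\<^esub> bd K 2 b"
    using MK.M.add_diff[OF \<rho> x(2)] b(2) by simp
  also have "\<dots> = ((r \<odot>\<^bsub>K1\<^esub> \<beta> 1 a \<oplus>\<^bsub>K1\<^esub> \<mu> a \<odot>\<^bsub>K1\<^esub> \<sigma>)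
      \<ominus>\<^bsub>K1\<^esub> bd K 2 (\<ominus>\<^bsub>K2\<^esub> (b \<oplus>\<^bsub>K2\<^esub> z 1 g))) \<oplus>\<^bsub>K1\<^esub> f \<odot>\<^bsub>K1\<^esub> g"
  proof -
    have 1: "bd K 2 (\<ominus>\<^bsub>K2\<^esub> (b \<oplus>\<^bsub>K2\<^esub> z 1 g)) = \<ominus>\<^bsub>K1\<^esub> (bd K 2 b \<oplus>\<^bsub>K1\<^esub> bd K 2 (z 1 g))"
      using b(1) g by (simp add: hom_add hom_neg)
    have "\<beta> 1 a \<in> carrier K1" "bd K 2 b \<in> carrier K1" "bd K 2 (z 1 g) \<in> carrier K1"
      using a(2) b(1) g by simp_all
    then show ?thesis
      unfolding \<rho>_eq 1 using scalars \<mu>_closed[OF a(2)] g by algebra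
  qed
  finally have "x = l2 (a, \<ominus>\<^bsub>K2\<^esub> (b \<oplus>\<^bsub>K2\<^esub> z 1 g), \<zero>\<^bsub>M0\<^esub>, \<zero>\<^bsub>K0\<^esub>) \<oplus>\<^bsub>L1\<^esub>
      f \<odot>\<^bsub>L1\<^esub> (\<zero>\<^bsub>M0\<^esub>, g, \<zero>\<^bsub>M0\<^esub>, \<zero>\<^bsub>K0\<^esub>)"
    using f_carrier unfolding x(1) l2_alt[OF a(2)] by (simp add: L1_def)
  moreover have "(a, \<ominus>\<^bsub>K2\<^esub> (b \<oplus>\<^bsub>K2\<^esub> z 1 g), \<zero>\<^bsub>M0\<^esub>, \<zero>\<^bsub>K0\<^esub>) \<in> carrier L2"
    "(\<zero>\<^bsub>M0\<^esub>, g, \<zero>\<^bsub>M0\<^esub>, \<zero>\<^bsub>K0\<^esub>) \<in> carrier L1"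
    using a(1) b(1) g by (simp_all add: L2_def L1_def)
  ultimately show "\<exists>u\<in>carrier L2. \<exists>v\<in>carrier L1. x = l2 u \<oplus>\<^bsub>L1\<^esub> f \<odot>\<^bsub>L1\<^esub> v"
    by blast
qed

text \<open>The \<open>M\<^sub>1\<^sub>,\<^sub>2\<close>-component of \<open>m\<^sub>2(\<theta>)\<close> is \<open>m\<^sub>2(\<theta>) - \<alpha>\<^sub>1(g)\<close> with \<open>g = \<gamma>(m\<^sub>2(\<theta>))\<close>. The first term is
  cancelled by \<open>k\<^sub>2(r\<beta>\<^sub>2(\<theta>))\<close>. The second one yields \<open>-fg\<close> and the boundary of \<open>-g\<sigma>\<close>, which
  \<open>Y\<close> cancels.\<close>

lemma l2_l3:
  assumes "\<theta> \<in> carrier M2" "b \<in> carrier K3"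
  defines "a \<equiv> p12 (bd M 2 \<theta>)"
  shows "(r \<odot>\<^bsub>K1\<^esub> \<beta> 1 a \<oplus>\<^bsub>K1\<^esub> \<mu> a \<odot>\<^bsub>K1\<^esub> \<sigma>)
      \<ominus>\<^bsub>K1\<^esub> bd K 2 ((r \<odot>\<^bsub>K2\<^esub> \<beta> 2 \<theta> \<ominus>\<^bsub>K2\<^esub> Y \<theta>) \<ominus>\<^bsub>K2\<^esub> bd K 3 b) =
    f \<odot>\<^bsub>K1\<^esub> (\<ominus>\<^bsub>K1\<^esub> \<gamma> (bd M 2 \<theta>))"
proof -
  define g where "g = \<gamma> (bd M 2 \<theta>)"
  have g: "g \<in> carrier K1" using assms by (simp add: g_def)
  have m: "\<mu> (bd M 2 \<theta>) = \<zero>"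
    using assms(1) by (simp add: \<mu>_def bd_bd_rules) (use M.coef_smult_gone[of \<zero>] M.gone_closed in simp)
  have cl: "coef P K (bd K 1 g) \<in> carrier P" "\<beta> 1 (bd M 2 \<theta>) \<in> carrier K1"
    using g K.coef_props(1)[of "bd K 1 g"] assms(1) by simp_all
  have a_eq: "a = bd M 2 \<theta> \<oplus>\<^bsub>M1\<^esub> \<ominus>\<^bsub>M1\<^esub> \<alpha> 1 g"
    using p12_eq assms(1) by (simp add: a_def g_def a_minus_def)
  show ?thesis
    unfolding g_def[symmetric] a_eq Y_eq
    using assms(1,2) scalars cl g
    apply (simp add: rels \<mu>_add \<mu>_neg m \<mu>_\<alpha>1 \<mu>_closed f_smult_K)
    using assms(1,2) scalars cl g
    apply algebra
    done
qed

text \<open>Applying \<open>k\<^sub>1\<close> to \<open>l2(a, b) = fc\<close> and cancelling \<open>f\<close> gives \<open>m\<^sub>1(a) = k\<^sub>1(c)\<close>. Hence \<open>a - \<alpha>\<^sub>1(c)\<close>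
  is a cycle and equals \<open>m\<^sub>2(\<theta>)\<close> for some \<open>\<theta>\<close>, whose image under \<open>l3\<close> has first component \<open>a\<close>. The
  second components then differ by a cycle of \<open>K\<^sub>2\<close>.\<close>

lemma exact_2: "R.exact_mod L3 l3 L2 l2 L1"
  unfolding R.exact_mod_def
proof (intro conjI ballI impI)
  fix x assume "x \<in> carrier L3"
  then obtain \<theta> b c d where x: "x = (\<theta>, b, c, d)" "\<theta> \<in> carrier M2" "b \<in> carrier K3"
    by (auto simp: L3_def)
  have a: "p12 (bd M 2 \<theta>) \<in> carrier M1" using p12_closed M12_carrier x(2) by simp
  have "l2 (l3 x) = f \<odot>\<^bsub>L1\<^esub> (\<zero>\<^bsub>M0\<^esub>, \<ominus>\<^bsub>K1\<^esub> \<gamma> (bd M 2 \<theta>), \<zero>\<^bsub>M0\<^esub>, \<zero>\<^bsub>K0\<^esub>)"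
    using l2_l3[OF x(2,3)] f_carrier
    unfolding x(1) l3.simps l2_alt[OF a] by (simp add: L1_def)
  then show "\<exists>y\<in>carrier L1. l2 (l3 x) = f \<odot>\<^bsub>L1\<^esub> y"
    by (rule bexI) (use x(2) in \<open>simp add: L1_def\<close>)
next
  fix x y assume "x \<in> carrier L2" "y \<in> carrier L1" and eq: "l2 x = f \<odot>\<^bsub>L1\<^esub> y"
  then obtain a b c where x: "x = (a, b, \<zero>\<^bsub>M0\<^esub>, \<zero>\<^bsub>K0\<^esub>)" "a \<in> M12" "b \<in> carrier K2"
    and y: "y = (\<zero>\<^bsub>M0\<^esub>, c, \<zero>\<^bsub>M0\<^esub>, \<zero>\<^bsub>K0\<^esub>)" "c \<in> carrier K1"
    by (auto simp: L1_def L2_def)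
  have a: "a \<in> carrier M1" using M12_carrier x(2) by blast
  define \<rho> where "\<rho> = r \<odot>\<^bsub>K1\<^esub> \<beta> 1 a \<oplus>\<^bsub>K1\<^esub> \<mu> a \<odot>\<^bsub>K1\<^esub> \<sigma>"
  have \<rho>: "\<rho> \<in> carrier K1" using a \<mu>_closed[OF a] scalars by (simp add: \<rho>_def)
  have e: "\<rho> \<ominus>\<^bsub>K1\<^esub> bd K 2 b = f \<odot>\<^bsub>K1\<^esub> c"
    using eq unfolding x(1) y(1) l2_alt[OF a] by (simp add: L1_def \<rho>_def)
  have "f \<odot>\<^bsub>K0\<^esub> (\<mu> a \<odot>\<^bsub>K0\<^esub> gone K) = bd K 1 (f \<odot>\<^bsub>K1\<^esub> c)"
    using l1_l2[OF a x(3)] e by (simp add: \<rho>_def)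
  also have "\<dots> = f \<odot>\<^bsub>K0\<^esub> bd K 1 c" using y(2) f_carrier by (simp add: hom_smult)
  finally have "\<mu> a \<odot>\<^bsub>K0\<^esub> gone K = bd K 1 c"
    by (rule f_inj_K[rotated 2]) (use y(2) \<mu>_closed[OF a] K.gone_closed in simp_all)
  then have "coef P K (bd K 1 c) = \<mu> a" using \<mu>_closed[OF a] by (intro K.coef_eqI) auto
  then have "\<mu> (a \<oplus>\<^bsub>M1\<^esub> \<alpha> 1 (\<ominus>\<^bsub>K1\<^esub> c)) = \<zero>"
    using a y(2) \<mu>_closed[OF a] by (simp add: \<mu>_add \<mu>_neg \<mu>_\<alpha>1 hom_neg K.r_neg)
  then have "bd M 1 (a \<oplus>\<^bsub>M1\<^esub> \<alpha> 1 (\<ominus>\<^bsub>K1\<^esub> c)) = \<zero>\<^bsub>M0\<^esub>"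
    using a y(2) M.gone_closed by (subst bd1_\<mu>) auto
  then obtain \<theta> where \<theta>: "\<theta> \<in> carrier M2" "bd M 2 \<theta> = a \<oplus>\<^bsub>M1\<^esub> \<alpha> 1 (\<ominus>\<^bsub>K1\<^esub> c)"
    using M_exact[of 1 "a \<oplus>\<^bsub>M1\<^esub> \<alpha> 1 (\<ominus>\<^bsub>K1\<^esub> c)"] a y(2) by auto
  have d: "p12 (bd M 2 \<theta>) = a" "\<gamma> (bd M 2 \<theta>) = \<ominus>\<^bsub>K1\<^esub> c"
    using decompose_eqI[OF x(2) _ \<theta>(2)] y(2) by auto
  define \<eta> where "\<eta> = r \<odot>\<^bsub>K2\<^esub> \<beta> 2 \<theta> \<ominus>\<^bsub>K2\<^esub> Y \<theta>"
  have \<eta>: "\<eta> \<in> carrier K2" using \<theta>(1) r_closed by (simp add: \<eta>_def Y_eq)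
  have "\<rho> \<ominus>\<^bsub>K1\<^esub> bd K 2 (\<eta> \<ominus>\<^bsub>K2\<^esub> bd K 3 \<zero>\<^bsub>K3\<^esub>) = f \<odot>\<^bsub>K1\<^esub> (\<ominus>\<^bsub>K1\<^esub> (\<ominus>\<^bsub>K1\<^esub> c))"
    using l2_l3[OF \<theta>(1), of "\<zero>\<^bsub>K3\<^esub>"] unfolding d \<rho>_def[symmetric] \<eta>_def[symmetric] by simp
  then have e': "\<rho> \<ominus>\<^bsub>K1\<^esub> bd K 2 \<eta> = f \<odot>\<^bsub>K1\<^esub> c"
    using \<eta> y(2) by (simp add: a_minus_def hom_zero neg_zero)
  have "bd K 2 \<eta> \<ominus>\<^bsub>K1\<^esub> bd K 2 b = (\<rho> \<ominus>\<^bsub>K1\<^esub> bd K 2 b) \<ominus>\<^bsub>K1\<^esub> (\<rho> \<ominus>\<^bsub>K1\<^esub> bd K 2 \<eta>)"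
  proof -
    have "bd K 2 \<eta> \<in> carrier K1" "bd K 2 b \<in> carrier K1" using \<eta> x(3) by simp_all
    then show ?thesis using \<rho> by algebra
  qed
  then have "bd K 2 (\<eta> \<ominus>\<^bsub>K2\<^esub> b) = \<zero>\<^bsub>K1\<^esub>"
    unfolding e e' using \<eta> x(3) y(2) f_carrier by (simp add: a_minus_def hom_add hom_neg MK.M.r_neg)
  then obtain b' where b': "b' \<in> carrier K3" "\<eta> \<ominus>\<^bsub>K2\<^esub> b = bd K 3 b'"
    using K_exact[of 2 "\<eta> \<ominus>\<^bsub>K2\<^esub> b"] \<eta> x(3) by auto
  have "b = \<eta> \<ominus>\<^bsub>K2\<^esub> (\<eta> \<ominus>\<^bsub>K2\<^esub> b)" using \<eta> x(3) by algebra
  then have "x = l3 (\<theta>, b', \<zero>\<^bsub>M0\<^esub>, \<zero>\<^bsub>K0\<^esub>) \<oplus>\<^bsub>L2\<^esub>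
      f \<odot>\<^bsub>L2\<^esub> (\<zero>\<^bsub>M1\<^esub>, \<zero>\<^bsub>K2\<^esub>, \<zero>\<^bsub>M0\<^esub>, \<zero>\<^bsub>K0\<^esub>)"
    using f_carrier a x(3) unfolding x(1) l3.simps d(1) \<eta>_def[symmetric] b'(2)[symmetric] by (simp add: L2_def)
  moreover have "(\<theta>, b', \<zero>\<^bsub>M0\<^esub>, \<zero>\<^bsub>K0\<^esub>) \<in> carrier L3"
    "(\<zero>\<^bsub>M1\<^esub>, \<zero>\<^bsub>K2\<^esub>, \<zero>\<^bsub>M0\<^esub>, \<zero>\<^bsub>K0\<^esub>) \<in> carrier L2"
    using \<theta>(1) b'(1) D1.zero_in(2) by (simp_all add: L2_def L3_def)
  ultimately show "\<exists>u\<in>carrier L3. \<exists>v\<in>carrier L2. x = l3 u \<oplus>\<^bsub>L2\<^esub> f \<odot>\<^bsub>L2\<^esub> v"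
    by blast
qed

lemma g_even_g_odd: "x \<in> carrier G_odd \<Longrightarrow> g_even (g_odd x) = f \<odot>\<^bsub>G_odd\<^esub> x"
  using even_odd_1 even_odd_2 even_odd_3 f_carrier by (auto simp: G_odd_def)

lemma g_odd_g_even: "x \<in> carrier G_even \<Longrightarrow> g_odd (g_even x) = f \<odot>\<^bsub>G_even\<^esub> x"
  using odd_even_1(1) odd_even_2 odd_even_3 odd_even_4 by (auto simp: G_even_def)

text \<open>If \<open>m\<^sub>i(x) = fy\<close>, then \<open>f m\<^sub>i\<^sub>-\<^sub>1(y) = 0\<close>, so \<open>y\<close> is a cycle and \<open>y = m\<^sub>i(v)\<close>, as \<open>i - 1 \<ge> 1\<close>. Then
  \<open>x - fv\<close> is a cycle too.\<close>

lemma M_exact_mod: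
  assumes "2 \<le> i" "x \<in> carrier (part M i)" "y \<in> carrier (part M (i - 1))" "bd M i x = f \<odot>\<^bsub>part M (i - 1)\<^esub> y"
  obtains v e where "v \<in> carrier (part M i)" "e \<in> carrier (part M (i + 1))"
    "x = f \<odot>\<^bsub>part M i\<^esub> v \<oplus>\<^bsub>part M i\<^esub> bd M (i + 1) e"
proof -
  have i: "i - 1 + 1 = i" "1 \<le> i - 1" "1 \<le> i" using assms(1) by auto
  note dh = M.bd_hom[OF i(2)] M.bd_hom[OF i(3)]
  have dy: "bd M (i - 1) y \<in> carrier (part M (i - 1 - 1))" using M.bd_closed[OF i(2) assms(3)] .
  have "f \<odot>\<^bsub>part M (i - 1 - 1)\<^esub> bd M (i - 1) y = bd M (i - 1) (bd M (i - 1 + 1) x)"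
    using assms(4) module_hom_smult[OF dh(1) f_carrier assms(3)] i(1) by simp
  also have "\<dots> = \<zero>\<^bsub>part M (i - 1 - 1)\<^esub>"
    by (rule M.bd_bd) (use assms i in simp_all)
  also have "\<dots> = f \<odot>\<^bsub>part M (i - 1 - 1)\<^esub> \<zero>\<^bsub>part M (i - 1 - 1)\<^esub>" using f_carrier by simp
  finally have "bd M (i - 1) y = \<zero>\<^bsub>part M (i - 1 - 1)\<^esub>"
    by (rule f_inj_M[OF dy MM.M.zero_closed])
  from M_exact[OF i(2) assms(3) this] obtain v where v: "v \<in> carrier (part M i)" "y = bd M i v"
    unfolding i(1) by blast
  have fv: "f \<odot>\<^bsub>part M i\<^esub> v \<in> carrier (part M i)" using v f_carrier by simp
  have "bd M i (x \<ominus>\<^bsub>part M i\<^esub> f \<odot>\<^bsub>part M i\<^esub> v) = \<zero>\<^bsub>part M (i - 1)\<^esub>"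
    using module_hom_minus[OF dh(2) M.part_module M.part_module assms(2) fv]
      module_hom_smult[OF dh(2) f_carrier v(1)] assms(3,4) v(2) f_carrier
    by (simp add: MM.M.diff_zero_iff)
  from M_exact[OF i(3) MM.M.minus_closed[OF assms(2) fv] this] obtain e
    where e: "e \<in> carrier (part M (i + 1))" "x \<ominus>\<^bsub>part M i\<^esub> f \<odot>\<^bsub>part M i\<^esub> v = bd M (i + 1) e" by blast
  have "x = f \<odot>\<^bsub>part M i\<^esub> v \<oplus>\<^bsub>part M i\<^esub> bd M (i + 1) e"
    unfolding e(2)[symmetric] by (rule MM.M.add_diff[OF fv assms(2), symmetric])
  then show ?thesis using that v(1) e(1) by blast
qed

lemma m4_div:
  assumes "e \<in> carrier M4" "y \<in> carrier M3" "bd M 4 e = f \<odot>\<^bsub>M3\<^esub> y"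
  obtains e' where "e' \<in> carrier M4" "e = f \<odot>\<^bsub>M4\<^esub> e'"
proof -
  obtain v u where vu: "v \<in> carrier M4" "u \<in> carrier (part M 5)" "e = f \<odot>\<^bsub>M4\<^esub> v \<oplus>\<^bsub>M4\<^esub> bd M 5 u"
    using M_exact_mod[of 4 e y] assms by auto
  have "bd M 5 u = \<zero>\<^bsub>M4\<^esub>"
    using M.top[of 5] vu(2) module_hom_zero[OF M.bd_hom[of 5, simplified] M.part_module M.part_module] by simp
  then show ?thesis using that vu f_carrier by simp
qed

lemma k4_div:
  assumes "t \<in> carrier K4" "y \<in> carrier K3" "bd K 4 t = f \<odot>\<^bsub>K3\<^esub> y"
  obtains t' where "t' \<in> carrier K4" "t = f \<odot>\<^bsub>K4\<^esub> t'"
proof -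
  have dy: "bd K 3 y \<in> carrier K2" using assms(2) by simp
  have "f \<odot>\<^bsub>K2\<^esub> bd K 3 y = bd K 3 (bd K 4 t)"
    using assms(2,3) f_carrier by (simp add: hom_smult)
  also have "\<dots> = f \<odot>\<^bsub>K2\<^esub> \<zero>\<^bsub>K2\<^esub>" using assms(1) f_carrier by (simp add: bd_bd_rules)
  finally have "bd K 3 y = \<zero>\<^bsub>K2\<^esub>" by (rule f_inj_K[OF dy MK.M.zero_closed])
  then obtain t' where t': "t' \<in> carrier K4" "y = bd K 4 t'"
    using K_exact[of 3 y] assms(2) by auto
  have ft: "f \<odot>\<^bsub>K4\<^esub> t' \<in> carrier K4" using t' f_carrier by simp
  have "bd K 4 (t \<ominus>\<^bsub>K4\<^esub> f \<odot>\<^bsub>K4\<^esub> t') = \<zero>\<^bsub>K3\<^esub>"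
    using assms t' f_carrier by (simp add: a_minus_def hom_add hom_neg hom_smult MK.M.r_neg)
  then have "t \<ominus>\<^bsub>K4\<^esub> f \<odot>\<^bsub>K4\<^esub> t' = \<zero>\<^bsub>K4\<^esub>"
    by (rule k4_inj[OF MK.M.minus_closed[OF assms(1) ft]])
  then have "t = f \<odot>\<^bsub>K4\<^esub> t'" using MK.M.diff_zero_iff[OF assms(1) ft] by simp
  then show ?thesis using that t'(1) by blast
qed

text \<open>The summand \<open>M\<^sub>1\<^sub>,\<^sub>2\<close> is free and is an image of \<open>M\<^sub>1\<close>, which has finite rank.\<close>

lemma M12_fg_free: "fg_free_module P M12_mod"
proof (rule fg_free_of_surjection[OF M12_free M.part_fg_free[of 1] D1.proj_hom(2) _ one_neq_zero])
  show "p12 ` carrier M1 = carrier M12_mod"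
    using p12_closed D1.proj_on(3) M12_carrier by force
qed

lemma G_even_free: "fg_free_module P G_even" and G_odd_free: "fg_free_module P G_odd"
  and L0_free: "fg_free_module P L0" and L1_free: "fg_free_module P L1"
  and L2_free: "fg_free_module P L2" and L3_free: "fg_free_module P L3"
  unfolding G_even_def G_odd_def L0_def L1_def L2_def L3_def
  by (intro fg_free_direct_sum fg_free_zero_module M12_fg_free M.part_fg_free K.part_fg_free
      M.part_module K.part_module)+

section \<open>Exactness in high degrees\<close>

lemma odd_even_exact: "R.exact_mod G_odd g_odd G_even g_even G_odd"
  by (rule R.factorization_exact_mod[OF f_regular G_even_free g_odd_hom g_even_g_odd g_odd_g_even])

lemma even_odd_exact: "R.exact_mod G_even g_even G_odd g_odd G_even"
  by (rule R.factorization_exact_mod[OF f_regular G_odd_free g_even_hom g_odd_g_even g_even_g_odd])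

text \<open>If the first two components of \<open>g_even(x)\<close> are divisible by \<open>f\<close>, then so is the third component \<open>e\<close>: the
  \<open>M\<^sub>3\<close>-row of \<open>g_odd(g_even(x)) = fx\<close> shows that \<open>f\<close> divides \<open>m\<^sub>4(e)\<close>. From \<open>g_even(x) = fu\<close>
  follows \<open>x = g_odd(u)\<close>.\<close>

lemma exact_4: "R.exact_mod G_odd g_odd G_even l4 L3"
  unfolding R.exact_mod_def
proof (intro conjI ballI impI)
  fix x assume x: "x \<in> carrier G_odd"
  then obtain a b c where xe: "x = (a, b, c, \<zero>\<^bsub>K0\<^esub>)" "a \<in> carrier M2" "b \<in> carrier K3"
    "c \<in> carrier M4" by (auto simp: G_odd_def)
  have "l4 (g_odd x) = f \<odot>\<^bsub>L3\<^esub> (a, b, \<zero>\<^bsub>M0\<^esub>, \<zero>\<^bsub>K0\<^esub>)"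
    using even_odd_1[OF xe(2-4)] even_odd_2[OF xe(2-4)] f_carrier unfolding xe(1) by (simp add: L3_def)
  then show "\<exists>y\<in>carrier L3. l4 (g_odd x) = f \<odot>\<^bsub>L3\<^esub> y"
    by (rule bexI) (use xe in \<open>simp add: L3_def\<close>)
next
  fix x y assume x: "x \<in> carrier G_even" and "y \<in> carrier L3" and eq: "l4 x = f \<odot>\<^bsub>L3\<^esub> y"
  then obtain y1 y2 where y: "y = (y1, y2, \<zero>\<^bsub>M0\<^esub>, \<zero>\<^bsub>K0\<^esub>)" "y1 \<in> carrier M2" "y2 \<in> carrier K3"
    by (auto simp: L3_def)
  obtain a b c d where xe: "x = (a, b, c, d)" "a \<in> M12" "b \<in> carrier K2" "c \<in> carrier M3" "d \<in> carrier K4"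
    using x by (auto simp: G_even_def)
  define e where "e = (\<ominus>\<^bsub>M4\<^esub> w 3 c) \<oplus>\<^bsub>M4\<^esub> \<alpha> 4 d"
  have e: "e \<in> carrier M4" using xe by (simp add: e_def)
  have ge: "g_even x = (f \<odot>\<^bsub>M2\<^esub> y1, f \<odot>\<^bsub>K3\<^esub> y2, e, \<zero>\<^bsub>K0\<^esub>)"
    using eq unfolding xe(1) y(1) by (simp add: L3_def e_def)
  have "(r \<odot>\<^bsub>M3\<^esub> Xd (f \<odot>\<^bsub>M2\<^esub> y1) \<oplus>\<^bsub>M3\<^esub> w 2 (f \<odot>\<^bsub>M2\<^esub> y1)) \<oplus>\<^bsub>M3\<^esub>
      \<alpha> 3 (f \<odot>\<^bsub>K3\<^esub> y2) \<oplus>\<^bsub>M3\<^esub> bd M 4 e = f \<odot>\<^bsub>M3\<^esub> c"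
    using g_odd_g_even[OF x] unfolding ge unfolding xe(1) by (simp add: G_even_def)
  then have 1: "f \<odot>\<^bsub>M3\<^esub> (r \<odot>\<^bsub>M3\<^esub> Xd y1 \<oplus>\<^bsub>M3\<^esub> w 2 y1 \<oplus>\<^bsub>M3\<^esub> \<alpha> 3 y2) \<oplus>\<^bsub>M3\<^esub> bd M 4 e
      = f \<odot>\<^bsub>M3\<^esub> c"
    using y(2,3) f_carrier r_closed e
    by (simp add: hom_smult MM.smult_r_distr MM.smult_assoc1[symmetric] K.m_comm)
  define q where "q = r \<odot>\<^bsub>M3\<^esub> Xd y1 \<oplus>\<^bsub>M3\<^esub> w 2 y1 \<oplus>\<^bsub>M3\<^esub> \<alpha> 3 y2"
  have q: "q \<in> carrier M3" using y r_closed by (simp add: q_def)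
  have d4: "bd M 4 e \<in> carrier M3" using e by simp
  have "bd M 4 e = (f \<odot>\<^bsub>M3\<^esub> q \<oplus>\<^bsub>M3\<^esub> bd M 4 e) \<ominus>\<^bsub>M3\<^esub> f \<odot>\<^bsub>M3\<^esub> q"
    using q d4 f_carrier by algebra
  also have "\<dots> = f \<odot>\<^bsub>M3\<^esub> c \<ominus>\<^bsub>M3\<^esub> f \<odot>\<^bsub>M3\<^esub> q" using 1 unfolding q_def by simp
  also have "\<dots> = f \<odot>\<^bsub>M3\<^esub> (c \<ominus>\<^bsub>M3\<^esub> q)" using q xe(4) f_carrier by algebra
  finally obtain e' where e': "e' \<in> carrier M4" "e = f \<odot>\<^bsub>M4\<^esub> e'"
    using m4_div[OF e MM.M.minus_closed[OF xe(4) q]] by blast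
  define u where "u = (y1, y2, e', \<zero>\<^bsub>K0\<^esub>)"
  have u: "u \<in> carrier G_odd" using y e' by (simp add: u_def G_odd_def)
  have "g_even x = f \<odot>\<^bsub>G_odd\<^esub> u"
    unfolding ge e'(2) u_def using f_carrier by (simp add: G_odd_def)
  then have "f \<odot>\<^bsub>G_even\<^esub> x = f \<odot>\<^bsub>G_even\<^esub> g_odd u"
    using g_odd_g_even[OF x] module_hom_smult[OF g_odd_hom f_carrier u] by simp
  then have "x = g_odd u"
    by (rule regular_smult_inject[OF G_even_free f_regular x module_hom_closed[OF g_odd_hom u]])
  moreover interpret GE: module P G_even by (rule fg_free_imp_module[OF G_even_free])
  have "x = x \<oplus>\<^bsub>G_even\<^esub> f \<odot>\<^bsub>G_even\<^esub> \<zero>\<^bsub>G_even\<^esub>" using x f_carrier by simp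
  ultimately show "\<exists>u\<in>carrier G_odd. \<exists>v\<in>carrier G_even. x = g_odd u \<oplus>\<^bsub>G_even\<^esub> f \<odot>\<^bsub>G_even\<^esub> v"
    using u GE.M.zero_closed by metis
qed

text \<open>Given \<open>(a, b)\<close> for which the first two components of \<open>g_odd(a, b, c)\<close> are divisible by \<open>f\<close>, the
  task is to find \<open>c \<in> M\<^sub>4\<close> that makes the other two divisible as well. Then \<open>g_odd(a, b, c) = fh\<close> implies
  \<open>(a, b, c) = g_even(h)\<close>.\<close>

lemma exact_3: "R.exact_mod G_even l4 L3 l3 L2"
  unfolding R.exact_mod_def
proof (intro conjI ballI impI)
  fix x assume x: "x \<in> carrier G_even"
  then obtain a b c d where xe: "x = (a, b, c, d)" "a \<in> M12" "b \<in> carrier K2" "c \<in> carrier M3" "d \<in> carrier K4"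
    by (auto simp: G_even_def)
  have "l3 (l4 x) = f \<odot>\<^bsub>L2\<^esub> (a, b, \<zero>\<^bsub>M0\<^esub>, \<zero>\<^bsub>K0\<^esub>)"
    using odd_even_1(1)[OF xe(2-4)] odd_even_2[OF xe(2-5)] f_carrier unfolding xe(1) by (simp add: L2_def)
  then show "\<exists>y\<in>carrier L2. l3 (l4 x) = f \<odot>\<^bsub>L2\<^esub> y"
    by (rule bexI) (use xe in \<open>simp add: L2_def\<close>)
next
  fix x y assume "x \<in> carrier L3" and "y \<in> carrier L2" and eq: "l3 x = f \<odot>\<^bsub>L2\<^esub> y"
  then obtain a b u v where x: "x = (a, b, \<zero>\<^bsub>M0\<^esub>, \<zero>\<^bsub>K0\<^esub>)" "a \<in> carrier M2" "b \<in> carrier K3"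
    and y: "y = (u, v, \<zero>\<^bsub>M0\<^esub>, \<zero>\<^bsub>K0\<^esub>)" "u \<in> M12" "v \<in> carrier K2"
    by (auto simp: L3_def L2_def)
  have u: "u \<in> carrier M1" using M12_carrier y(2) by blast
  have uv: "p12 (bd M 2 a) = f \<odot>\<^bsub>M1\<^esub> u"
    "(r \<odot>\<^bsub>K2\<^esub> \<beta> 2 a \<ominus>\<^bsub>K2\<^esub> Y a) \<ominus>\<^bsub>K2\<^esub> bd K 3 b = f \<odot>\<^bsub>K2\<^esub> v"
    using eq unfolding x(1) y(1) by (simp_all add: L2_def)
  define Q where "Q = (r \<odot>\<^bsub>M2\<^esub> X u \<ominus>\<^bsub>M2\<^esub> w 1 u) \<oplus>\<^bsub>M2\<^esub> \<alpha> 2 v"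
  have Q: "Q \<in> carrier M2" using u y r_closed by (simp add: Q_def)
  have fQ: "(r \<odot>\<^bsub>M2\<^esub> X (f \<odot>\<^bsub>M1\<^esub> u) \<ominus>\<^bsub>M2\<^esub> w 1 (f \<odot>\<^bsub>M1\<^esub> u)) \<oplus>\<^bsub>M2\<^esub> \<alpha> 2 (f \<odot>\<^bsub>K2\<^esub> v)
      = f \<odot>\<^bsub>M2\<^esub> Q"
    unfolding Q_def using u y r_closed f_carrier
    by (simp add: hom_smult a_minus_def MM.smult_r_distr MM.smult_r_minus MM.smult_assoc1[symmetric] K.m_comm)
  \<comment> \<open>The third component of \<open>g_odd(a, b, c)\<close> is \<open>s\<^sub>0 + m\<^sub>4(c)\<close>, and \<open>m\<^sub>3(s\<^sub>0)\<close> is divisible by \<open>f\<close>.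
    So \<open>s\<^sub>0\<close> is congruent to a boundary \<open>m\<^sub>4(e)\<close>, which suggests \<open>c = -e\<close>.\<close>
  define s0 where "s0 = (r \<odot>\<^bsub>M3\<^esub> Xd a \<oplus>\<^bsub>M3\<^esub> w 2 a) \<oplus>\<^bsub>M3\<^esub> \<alpha> 3 b"
  have s0: "s0 \<in> carrier M3" using x r_closed by (simp add: s0_def)
  have row: "f \<odot>\<^bsub>M2\<^esub> Q \<oplus>\<^bsub>M2\<^esub> bd M 3 (s0 \<oplus>\<^bsub>M3\<^esub> bd M 4 c) = f \<odot>\<^bsub>M2\<^esub> a"
    if "c \<in> carrier M4" for c
    using even_odd_1[OF x(2,3) that] unfolding uv fQ s0_def .
  have d3: "bd M 3 s0 \<in> carrier M2" using s0 by simp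
  have "bd M 3 s0 = (f \<odot>\<^bsub>M2\<^esub> Q \<oplus>\<^bsub>M2\<^esub> bd M 3 s0) \<ominus>\<^bsub>M2\<^esub> f \<odot>\<^bsub>M2\<^esub> Q"
    using d3 Q f_carrier by algebra
  also have "\<dots> = f \<odot>\<^bsub>M2\<^esub> a \<ominus>\<^bsub>M2\<^esub> f \<odot>\<^bsub>M2\<^esub> Q"
    using row[of "\<zero>\<^bsub>M4\<^esub>"] s0 by (simp add: hom_zero)
  also have "\<dots> = f \<odot>\<^bsub>M2\<^esub> (a \<ominus>\<^bsub>M2\<^esub> Q)" using Q x(2) f_carrier by algebra
  finally have "bd M 3 s0 = f \<odot>\<^bsub>part M (3 - 1)\<^esub> (a \<ominus>\<^bsub>M2\<^esub> Q)" by simp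
  moreover have "a \<ominus>\<^bsub>M2\<^esub> Q \<in> carrier (part M (3 - 1))" using Q x(2) by simp
  ultimately obtain s' e where s': "s' \<in> carrier M3" "e \<in> carrier M4"
    "s0 = f \<odot>\<^bsub>M3\<^esub> s' \<oplus>\<^bsub>M3\<^esub> bd M 4 e"
    using M_exact_mod[of 3 s0] s0 by auto
  define c where "c = \<ominus>\<^bsub>M4\<^esub> e"
  have c: "c \<in> carrier M4" using s' by (simp add: c_def)
  have s: "s0 \<oplus>\<^bsub>M3\<^esub> bd M 4 c = f \<odot>\<^bsub>M3\<^esub> s'"
  proof -
    have "bd M 4 e \<in> carrier M3" "bd M 4 c = \<ominus>\<^bsub>M3\<^esub> bd M 4 e"
      using s'(2) by (simp_all add: c_def hom_neg)
    then show ?thesis unfolding s'(3) using s'(1) f_carrier by (simp add: MM.M.a_assoc MM.M.r_neg)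
  qed
  \<comment> \<open>For this \<open>c\<close> the fourth component \<open>t\<close> is divisible too, because \<open>f\<close> divides \<open>k\<^sub>4(t)\<close>.\<close>
  define t where "t = z 3 b \<oplus>\<^bsub>K4\<^esub> r \<odot>\<^bsub>K4\<^esub> \<beta> 4 c"
  have t: "t \<in> carrier K4" using x c r_closed by (simp add: t_def)
  have row2: "(\<ominus>\<^bsub>K3\<^esub> z 2 (f \<odot>\<^bsub>K2\<^esub> v)) \<oplus>\<^bsub>K3\<^esub> r \<odot>\<^bsub>K3\<^esub> \<beta> 3 (f \<odot>\<^bsub>M3\<^esub> s') \<ominus>\<^bsub>K3\<^esub> bd K 4 t
      = f \<odot>\<^bsub>K3\<^esub> b"
    using even_odd_2[OF x(2,3) c] unfolding uv s0_def[symmetric] s t_def[symmetric] .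
  define R where "R = (\<ominus>\<^bsub>K3\<^esub> z 2 v) \<oplus>\<^bsub>K3\<^esub> r \<odot>\<^bsub>K3\<^esub> \<beta> 3 s'"
  have R: "R \<in> carrier K3" using y s' r_closed by (simp add: R_def)
  have fR: "(\<ominus>\<^bsub>K3\<^esub> z 2 (f \<odot>\<^bsub>K2\<^esub> v)) \<oplus>\<^bsub>K3\<^esub> r \<odot>\<^bsub>K3\<^esub> \<beta> 3 (f \<odot>\<^bsub>M3\<^esub> s') = f \<odot>\<^bsub>K3\<^esub> R"
    unfolding R_def using s' y r_closed f_carrier
    by (simp add: hom_smult MK.smult_r_distr MK.smult_r_minus MK.smult_assoc1[symmetric] K.m_comm)
  have k4: "bd K 4 t \<in> carrier K3" using t by simp
  have "bd K 4 t = f \<odot>\<^bsub>K3\<^esub> R \<ominus>\<^bsub>K3\<^esub> (f \<odot>\<^bsub>K3\<^esub> R \<ominus>\<^bsub>K3\<^esub> bd K 4 t)"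
    using k4 R f_carrier by algebra
  also have "\<dots> = f \<odot>\<^bsub>K3\<^esub> R \<ominus>\<^bsub>K3\<^esub> f \<odot>\<^bsub>K3\<^esub> b" using row2 unfolding fR by simp
  also have "\<dots> = f \<odot>\<^bsub>K3\<^esub> (R \<ominus>\<^bsub>K3\<^esub> b)" using R x(3) f_carrier by algebra
  finally obtain t' where t': "t' \<in> carrier K4" "t = f \<odot>\<^bsub>K4\<^esub> t'"
    using k4_div[OF t MK.M.minus_closed[OF R x(3)]] by blast
  define h where "h = (u, v, s', t')"
  have h: "h \<in> carrier G_even" using y s' t' by (simp add: h_def G_even_def)
  define k where "k = (a, b, c, \<zero>\<^bsub>K0\<^esub>)"
  have k: "k \<in> carrier G_odd" using x c by (simp add: k_def G_odd_def)
  have "g_odd k = f \<odot>\<^bsub>G_even\<^esub> h"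
    using s t'(2) unfolding k_def h_def g_odd.simps uv s0_def[symmetric] t_def[symmetric] by (simp add: G_even_def)
  then have "f \<odot>\<^bsub>G_odd\<^esub> k = f \<odot>\<^bsub>G_odd\<^esub> g_even h"
    using g_even_g_odd[OF k] module_hom_smult[OF g_even_hom f_carrier h] by simp
  then have "k = g_even h"
    by (rule regular_smult_inject[OF G_odd_free f_regular k module_hom_closed[OF g_even_hom h]])
  then have "x = l4 h" unfolding k_def h_def x(1) by simp
  moreover interpret L3: module P L3 by (rule fg_free_imp_module[OF L3_free])
  have "x = x \<oplus>\<^bsub>L3\<^esub> f \<odot>\<^bsub>L3\<^esub> \<zero>\<^bsub>L3\<^esub>" using \<open>x \<in> carrier L3\<close> f_carrier by simp
  ultimately show "\<exists>u\<in>carrier G_even. \<exists>v\<in>carrier L3. x = l4 u \<oplus>\<^bsub>L3\<^esub> f \<odot>\<^bsub>L3\<^esub> v"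
    using h L3.M.zero_closed by metis
qed

section \<open>The resolution N\<close>

lemma L0_iso: "(\<lambda>x. coef P K (fst (snd x))) \<in> module_iso P L0 (ring_module P)"
proof -
  have "(\<lambda>x. coef P K (fst (snd x))) \<in> module_hom P L0 (ring_module P)"
    unfolding L0_def by (rule module_hom_comp[OF module_isoD(1)[OF K.coef_iso] pr2_hom])
  moreover have "bij_betw (\<lambda>x. coef P K (fst (snd x))) (carrier L0) (carrier P)"
    by (rule bij_betw_byWitness[of _ "\<lambda>p. (\<zero>\<^bsub>M0\<^esub>, p \<odot>\<^bsub>K0\<^esub> gone K, \<zero>\<^bsub>M0\<^esub>, \<zero>\<^bsub>K0\<^esub>)"])
      (use K.coef_props K.gone_closed in \<open>auto simp: L0_def\<close>)
  ultimately show ?thesis by (simp add: module_iso_def)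
qed

lemma L1_image: "(\<lambda>x. coef P K (fst (snd x))) ` l1 ` carrier L1 = KK"
proof -
  have "(\<lambda>x. coef P K (fst (snd x))) ` l1 ` carrier L1 = (\<lambda>\<phi>. coef P K (bd K 1 (\<ominus>\<^bsub>K1\<^esub> \<phi>))) ` carrier K1"
    by (force simp: L1_def image_iff hom_neg)
  also have "\<dots> = (\<lambda>\<phi>. coef P K (bd K 1 \<phi>)) ` (\<lambda>\<phi>. \<ominus>\<^bsub>K1\<^esub> \<phi>) ` carrier K1"
    by (simp add: image_image)
  also have "(\<lambda>\<phi>. \<ominus>\<^bsub>K1\<^esub> \<phi>) ` carrier K1 = carrier K1"
    by (auto intro!: image_eqI[of _ _ "\<ominus>\<^bsub>K1\<^esub> _"])
  also have "(\<lambda>\<phi>. coef P K (bd K 1 \<phi>)) ` carrier K1 = KK"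
    by (rule K.resolution_image[OF K_resolution KK_ideal])
  finally show ?thesis .
qed

lemma nat_ge1_cases:
  assumes "1 \<le> (i::nat)"
  obtains "i = 1" | "i = 2" | "i = 3" | "i = 4" | "5 \<le> i" "odd i" | "6 \<le> i" "even i"
proof -
  have "i = 1 \<or> i = 2 \<or> i = 3 \<or> i = 4 \<or> (5 \<le> i \<and> odd i) \<or> (6 \<le> i \<and> even i)"
    using assms by (cases "i = 5"; presburger)
  then show ?thesis using that by blast
qed

lemma N_resolution: "free_resolution Pbar N n (quot_module Pbar KKbar)"
proof -
  have "free_resolution Pbar (\<lambda>i. bar (L i)) (\<lambda>i. bar_map (L (i - 1)) (l i)) (quot_module Pbar KKbar)"
    unfolding KKbar_def
  proof (rule R.resolution_bar)
    show "fg_free_module P (L i)" for i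
      by (simp add: L_def L0_free L1_free L2_free L3_free G_even_free G_odd_free)
    show "l i \<in> module_hom P (L i) (L (i - 1))" if "1 \<le> i" for i
      using that by (cases rule: nat_ge1_cases)
        (auto simp: L_def l_def l1_hom l2_hom l3_hom l4_hom g_even_hom g_odd_hom)
    show "R.exact_mod (L (i + 1)) (l (i + 1)) (L i) (l i) (L (i - 1))" if "1 \<le> i" for i
      using that by (cases rule: nat_ge1_cases)
        (auto simp: L_def l_def exact_1 exact_2 exact_3 exact_4 odd_even_exact even_odd_exact)
    show "(\<lambda>x. coef P K (fst (snd x))) \<in> module_iso P (L 0) (ring_module P)"
      using L0_iso by (simp add: L_def)
    show "ideal KK P" by (rule KK_ideal)
    show "(\<lambda>x. coef P K (fst (snd x))) ` l 1 ` carrier (L 1) = KK"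
      using L1_image by (simp add: L_def l_def)
  qed
  moreover have "N = (\<lambda>i. bar (L i))" "n = (\<lambda>i. bar_map (L (i - 1)) (l i))"
    by (auto simp: N_def n_def)
  ultimately show ?thesis by simp
qed

section \<open>The decomposition of M3\<close>

lemma \<gamma>_\<alpha>1: "\<phi> \<in> carrier K1 \<Longrightarrow> \<gamma> (\<alpha> 1 \<phi>) = \<phi>"
  using decompose_eqI(2)[OF D1.zero_in(2), of \<phi> "\<alpha> 1 \<phi>"] by simp

lemma \<gamma>_M12: "a \<in> M12 \<Longrightarrow> \<gamma> a = \<zero>\<^bsub>K1\<^esub>"
  using decompose_eqI(2)[of a "\<zero>\<^bsub>K1\<^esub>" a] M12_carrier by (simp add: hom_zero)

lemma split_M1: "u \<in> carrier M1 \<Longrightarrow> u = p12 u \<oplus>\<^bsub>M1\<^esub> \<alpha> 1 (\<gamma> u)"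
  by (simp add: p12_eq a_minus_def MM.M.a_assoc MM.M.l_neg)

lemma M31_D: "c \<in> M31 \<Longrightarrow> c \<in> carrier M3" "c \<in> M31 \<Longrightarrow> a \<in> M12 \<Longrightarrow> gmult M 3 1 c a = \<zero>\<^bsub>M4\<^esub>"
  by (auto simp: M31_def)

lemma M32_iff: "c \<in> M32 \<longleftrightarrow> c \<in> carrier M3 \<and> \<beta> 3 c = \<zero>\<^bsub>K3\<^esub>"
proof -
  have M11: "M11 = \<alpha> 1 ` carrier K1" using \<alpha>1_bij by (simp add: bij_betw_def)
  have "c \<in> M32 \<longleftrightarrow> c \<in> carrier M3 \<and> (\<forall>u\<in>M11. gmult M 3 1 c u = \<zero>\<^bsub>M4\<^esub>)"
    by (simp add: M32_def)
  also have "\<dots> \<longleftrightarrow> c \<in> carrier M3 \<and> \<beta> 3 c = \<zero>\<^bsub>K3\<^esub>"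
    by (subst M11) (auto simp: \<beta>3_zero_iff)
  finally show ?thesis .
qed

lemma M3_eqI_split:
  assumes c: "c \<in> carrier M3" and d: "d \<in> carrier M3"
    and 1: "\<And>\<phi>. \<phi> \<in> carrier K1 \<Longrightarrow> gmult M 3 1 c (\<alpha> 1 \<phi>) = gmult M 3 1 d (\<alpha> 1 \<phi>)"
    and 2: "\<And>a. a \<in> M12 \<Longrightarrow> gmult M 3 1 c a = gmult M 3 1 d a"
  shows "c = d"
proof (rule M3_eqI[OF c d])
  fix u assume u: "u \<in> carrier M1"
  have p: "p12 u \<in> M12" "p12 u \<in> carrier M1" using p12_closed[OF u] M12_carrier by auto
  have a: "\<alpha> 1 (\<gamma> u) \<in> carrier M1" using u by simp
  have "gmult M 3 1 c (p12 u \<oplus>\<^bsub>M1\<^esub> \<alpha> 1 (\<gamma> u)) = gmult M 3 1 d (p12 u \<oplus>\<^bsub>M1\<^esub> \<alpha> 1 (\<gamma> u))"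
    using M.gmult_add_right[OF c p(2) a] M.gmult_add_right[OF d p(2) a] 1[OF \<gamma>_closed[OF u]] 2[OF p(1)] by simp
  then show "gmult M 3 1 c u = gmult M 3 1 d u" using split_M1[OF u] by simp
qed

lemma M3_hom_represent:
  assumes "h \<in> module_hom P M1 (ring_module P)"
  shows "\<exists>c\<in>carrier M3. \<forall>u\<in>carrier M1. orM (gmult M 3 1 c u) = h u"
  using M.ori_represent[of 3 h] assms by auto

lemma orM_zero: "orM \<zero>\<^bsub>M4\<^esub> = \<zero>" and orK_zero: "orK \<zero>\<^bsub>K4\<^esub> = \<zero>"
  using module_hom_zero[OF M.ori_hom M.part_module K.module_ring_module]
    module_hom_zero[OF K.ori_hom K.part_module K.module_ring_module] by simp_all

lemma orM_eq_zero: "x \<in> carrier M4 \<Longrightarrow> orM x = \<zero> \<Longrightarrow> x = \<zero>\<^bsub>M4\<^esub>"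
  using M.ori_eq_iff[of x "\<zero>\<^bsub>M4\<^esub>"] orM_zero by simp

text \<open>Under duality \<open>\<phi> \<in> K\<^sub>3\<close> is a functional on \<open>K\<^sub>1\<close>. Its composite with \<open>\<gamma>\<close> is a functional on \<open>M\<^sub>1\<close> that
  vanishes on \<open>M\<^sub>1\<^sub>,\<^sub>2\<close>, and so it comes from \<open>M\<^sub>3\<^sub>,\<^sub>1\<close>.\<close>

lemma \<beta>3_M31_surj:
  assumes "\<phi> \<in> carrier K3"
  obtains c where "c \<in> M31" "\<beta> 3 c = \<phi>"
proof -
  have "(\<lambda>u. orK (gmult K 3 1 \<phi> (\<gamma> u))) \<in> module_hom P M1 (ring_module P)"
    using module_hom_comp[OF module_hom_comp[OF K.ori_hom K.gmult_hom_right[OF assms, of 1, simplified]] \<gamma>_module_hom] .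
  from M3_hom_represent[OF this] obtain c where c: "c \<in> carrier M3"
    "\<And>u. u \<in> carrier M1 \<Longrightarrow> orM (gmult M 3 1 c u) = orK (gmult K 3 1 \<phi> (\<gamma> u))"
    by blast
  have "gmult M 3 1 c a = \<zero>\<^bsub>M4\<^esub>" if a: "a \<in> M12" for a
  proof (rule orM_eq_zero)
    show "gmult M 3 1 c a \<in> carrier M4" using M.gmult_closed[OF c(1) M12_carrier[OF a]] by simp
    show "orM (gmult M 3 1 c a) = \<zero>"
      using c(2)[OF M12_carrier[OF a]] K.gmult_zero_right[OF assms, of 1] by (simp add: \<gamma>_M12[OF a] orK_zero)
  qed
  then have "c \<in> M31" using c(1) by (simp add: M31_def)
  moreover have "\<beta> 3 c = \<phi>"
    by (rule \<beta>_eqI) (use c assms in \<open>simp_all add: \<gamma>_\<alpha>1\<close>)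
  ultimately show ?thesis using that by blast
qed

lemma \<beta>3_M31_inj:
  assumes "c \<in> M31" "d \<in> M31" "\<beta> 3 c = \<beta> 3 d"
  shows "c = d"
proof (rule M3_eqI_split)
  note cd = M31_D(1)[OF assms(1)] M31_D(1)[OF assms(2)]
  show "c \<in> carrier M3" "d \<in> carrier M3" by (rule cd)+
  show "gmult M 3 1 c a = gmult M 3 1 d a" if "a \<in> M12" for a
    using M31_D(2)[OF assms(1) that] M31_D(2)[OF assms(2) that] by simp
  fix \<phi> assume p: "\<phi> \<in> carrier K1"
  have "orM (gmult M 3 1 c (\<alpha> 1 \<phi>)) = orM (gmult M 3 1 d (\<alpha> 1 \<phi>))"
    using \<beta>_pair[of 3 c \<phi>] \<beta>_pair[of 3 d \<phi>] cd p assms(3) by simp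
  then show "gmult M 3 1 c (\<alpha> 1 \<phi>) = gmult M 3 1 d (\<alpha> 1 \<phi>)"
    using M.gmult_closed[OF cd(1) \<alpha>_closed[OF p]] M.gmult_closed[OF cd(2) \<alpha>_closed[OF p]]
    by (intro M4_eqI) auto
qed

text \<open>The inverse of the isomorphism \<open>\<beta>\<^sub>3 : M\<^sub>3\<^sub>,\<^sub>1 \<rightarrow> K\<^sub>3\<close>.\<close>

definition \<kappa> where "\<kappa> = inv_into M31 (\<beta> 3)"

lemma \<kappa>_props:
  assumes "\<phi> \<in> carrier K3"
  shows "\<kappa> \<phi> \<in> M31" "\<kappa> \<phi> \<in> carrier M3" "\<beta> 3 (\<kappa> \<phi>) = \<phi>"
proof -
  have "\<phi> \<in> \<beta> 3 ` M31" using \<beta>3_M31_surj[OF assms] by blast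
  then show "\<kappa> \<phi> \<in> M31" "\<beta> 3 (\<kappa> \<phi>) = \<phi>"
    unfolding \<kappa>_def by (rule inv_into_into, rule f_inv_into_f)
  then show "\<kappa> \<phi> \<in> carrier M3" using M31_D(1) by blast
qed

lemma M31_submodule: "submodule M31 P M3"
proof (rule MM.submoduleI)
  show "M31 \<subseteq> carrier M3" using M31_D(1) by blast
  show "\<zero>\<^bsub>M3\<^esub> \<in> M31" using M.gmult_zero_left[of _ 1 3] M12_carrier by (auto simp: M31_def)
  show "\<ominus>\<^bsub>M3\<^esub> c \<in> M31" if c: "c \<in> M31" for c
  proof -
    have "gmult M 3 1 (\<ominus>\<^bsub>M3\<^esub> c) a = \<zero>\<^bsub>M4\<^esub>" if "a \<in> M12" for a
      using M.gmult_neg_left[OF M31_D(1)[OF c] M12_carrier[OF that]] M31_D(2)[OF c that] by (simp add: neg_zero)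
    then show ?thesis using M31_D(1)[OF c] by (simp add: M31_def)
  qed
  show "c \<oplus>\<^bsub>M3\<^esub> d \<in> M31" if c: "c \<in> M31" and d: "d \<in> M31" for c d
  proof -
    have "gmult M 3 1 (c \<oplus>\<^bsub>M3\<^esub> d) a = \<zero>\<^bsub>M4\<^esub>" if "a \<in> M12" for a
      using M.gmult_add_left[OF M31_D(1)[OF c] M31_D(1)[OF d] M12_carrier[OF that]] M31_D(2)[OF c that]
        M31_D(2)[OF d that] by simp
    then show ?thesis using M31_D(1)[OF c] M31_D(1)[OF d] by (simp add: M31_def)
  qed
  show "q \<odot>\<^bsub>M3\<^esub> c \<in> M31" if q: "q \<in> carrier P" and c: "c \<in> M31" for q c
  proof -
    have "gmult M 3 1 (q \<odot>\<^bsub>M3\<^esub> c) a = \<zero>\<^bsub>M4\<^esub>" if "a \<in> M12" for a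
      using M.gmult_smult_left[OF q M31_D(1)[OF c] M12_carrier[OF that]] M31_D(2)[OF c that] q by simp
    then show ?thesis using M31_D(1)[OF c] q by (simp add: M31_def)
  qed
qed

lemma M32_submodule: "submodule M32 P M3"
  by (rule MM.submoduleI) (auto simp: M32_iff hom_neg hom_add hom_smult hom_zero neg_zero)

lemma M3_sum: "internal_direct_sum M3 M31 M32"
  unfolding internal_direct_sum_def
proof (intro conjI ballI)
  show "M31 \<subseteq> carrier M3" "M32 \<subseteq> carrier M3" using M31_D(1) M32_iff by auto
  fix x assume x: "x \<in> carrier M3"
  define u where "u = \<kappa> (\<beta> 3 x)"
  have u: "u \<in> M31" "u \<in> carrier M3" "\<beta> 3 u = \<beta> 3 x"
    using \<kappa>_props[of "\<beta> 3 x"] x by (simp_all add: u_def)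
  have v: "x \<ominus>\<^bsub>M3\<^esub> u \<in> M32"
    using x u by (simp add: M32_iff a_minus_def hom_add hom_neg MK.M.r_neg)
  show "\<exists>!(u, v). u \<in> M31 \<and> v \<in> M32 \<and> x = u \<oplus>\<^bsub>M3\<^esub> v"
  proof (rule ex1I[of _ "(u, x \<ominus>\<^bsub>M3\<^esub> u)"])
    show "case (u, x \<ominus>\<^bsub>M3\<^esub> u) of (u, v) \<Rightarrow> u \<in> M31 \<and> v \<in> M32 \<and> x = u \<oplus>\<^bsub>M3\<^esub> v"
      using u(1) v MM.M.add_diff[OF u(2) x] by simp
    fix y assume "case y of (u, v) \<Rightarrow> u \<in> M31 \<and> v \<in> M32 \<and> x = u \<oplus>\<^bsub>M3\<^esub> v"
    then obtain u' v' where y: "y = (u', v')" "u' \<in> M31" "v' \<in> carrier M3" "\<beta> 3 v' = \<zero>\<^bsub>K3\<^esub>" "x = u' \<oplus>\<^bsub>M3\<^esub> v'"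
      by (auto simp: M32_iff)
    have u': "u' \<in> carrier M3" using M31_D(1)[OF y(2)] .
    have "\<beta> 3 u' = \<beta> 3 x" using y u' by (simp add: hom_add)
    then have "u' = u" using \<beta>3_M31_inj[OF y(2) u(1)] u(3) by simp
    moreover have "v' = x \<ominus>\<^bsub>M3\<^esub> u'" unfolding y(5) using u' y(3) by algebra
    ultimately show "y = (u, x \<ominus>\<^bsub>M3\<^esub> u)" using y(1) by simp
  qed
qed

end

sublocale linkage_data \<subseteq> D3: direct_decomposition P "M3" M31 M32
  using M.part_module M31_submodule M32_submodule M3_sum
  by (simp add: direct_decomposition_def direct_decomposition_axioms_def)

context linkage_data
begin

lemma p32_eq: "x \<in> carrier M3 \<Longrightarrow> p32 x = x \<ominus>\<^bsub>M3\<^esub> \<kappa> (\<beta> 3 x)"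
proof -
  assume x: "x \<in> carrier M3"
  note k = \<kappa>_props[of "\<beta> 3 x"]
  have "x \<ominus>\<^bsub>M3\<^esub> \<kappa> (\<beta> 3 x) \<in> M32"
    using x k by (simp add: M32_iff a_minus_def hom_add hom_neg MK.M.r_neg)
  then show "p32 x = x \<ominus>\<^bsub>M3\<^esub> \<kappa> (\<beta> 3 x)"
    using x k MM.M.add_diff[of "\<kappa> (\<beta> 3 x)" 3 x] by (intro D3.proj_eqI(2)[of "\<kappa> (\<beta> 3 x)"]) auto
qed

lemma \<kappa>_eqI: "c \<in> M31 \<Longrightarrow> \<beta> 3 c = \<phi> \<Longrightarrow> \<kappa> \<phi> = c"
  using \<beta>3_M31_inj[of "\<kappa> \<phi>" c] \<kappa>_props[of \<phi>] M31_D(1)[of c] by auto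

lemma \<kappa>_hom: "\<kappa> \<in> module_hom P K3 M3"
proof (rule module_homI)
  show "\<kappa> x \<in> carrier M3" if "x \<in> carrier K3" for x using \<kappa>_props(2)[OF that] .
  show "\<kappa> (x \<oplus>\<^bsub>K3\<^esub> y) = \<kappa> x \<oplus>\<^bsub>M3\<^esub> \<kappa> y" if "x \<in> carrier K3" "y \<in> carrier K3" for x y
    using \<kappa>_props[OF that(1)] \<kappa>_props[OF that(2)] D3.UE(5) by (intro \<kappa>_eqI) (auto simp: hom_add)
  show "\<kappa> (a \<odot>\<^bsub>K3\<^esub> x) = a \<odot>\<^bsub>M3\<^esub> \<kappa> x" if "a \<in> carrier P" "x \<in> carrier K3" for a x
    using \<kappa>_props[OF that(2)] that(1) D3.UE(4) by (intro \<kappa>_eqI) (auto simp: hom_smult)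
qed

lemma W_eq: "W b = bd M 3 (\<kappa> (z 2 b))"
  by (simp add: W_def \<kappa>_def)

abbreviation "M32_mod \<equiv> M3\<lparr>carrier := M32\<rparr>"

lemma M32_module: "module P M32_mod"
  by (rule submodule.submodule_is_module[OF M32_submodule M.part_module])

text \<open>The product \<open>M\<^sub>3 \<times> M\<^sub>1 \<rightarrow> M\<^sub>4\<close> identifies \<open>M\<^sub>3\<^sub>,\<^sub>2\<close> with the dual of \<open>M\<^sub>1\<^sub>,\<^sub>2\<close>, and the dual of
  a free module of finite rank is free.\<close>

lemma M32_fg_free: "fg_free_module P M32_mod"
proof -
  obtain I :: "'b set" and \<phi> where \<phi>: "coords P M12_mod I \<phi>" and D: "module P M12_mod"
    using fg_free_obtain_coords[OF M12_fg_free] .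
  interpret RM: module P "ring_module P" by (rule K.module_ring_module)
  interpret D: module P M12_mod by (rule D)
  note C = coordsD[OF \<phi>]
  have "\<exists>x. x \<in> carrier M12_mod \<and> (\<forall>j\<in>I. \<phi> x j = (if i = j then \<one> else \<zero>))" for i
    by (rule coords_surj[OF \<phi>, of "\<lambda>j. if i = j then \<one> else \<zero>"]) auto
  then obtain e where e: "\<And>i. e i \<in> carrier M12_mod" "\<And>i j. j \<in> I \<Longrightarrow> \<phi> (e i) j = (if i = j then \<one> else \<zero>)"
    by metis
  have eM: "e i \<in> M12" "e i \<in> carrier M1" for i using e(1)[of i] M12_carrier by auto
  \<comment> \<open>The coordinates of a functional on \<open>M\<^sub>1\<^sub>,\<^sub>2\<close> are its values on the basis \<open>e\<close>.\<close>
  define \<psi> where "\<psi> c i = orM (gmult M 3 1 c (e i))" for c i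
  have gc: "gmult M 3 1 c u \<in> carrier M4" if "c \<in> carrier M3" "u \<in> carrier M1" for c u
    using M.gmult_closed[OF that] by simp
  have expand: "u = (\<Oplus>\<^bsub>M12_mod\<^esub>i\<in>I. \<phi> u i \<odot>\<^bsub>M12_mod\<^esub> e i)" if u: "u \<in> carrier M12_mod" for u
  proof (rule coords_eqI[OF \<phi> u])
    show "(\<Oplus>\<^bsub>M12_mod\<^esub>i\<in>I. \<phi> u i \<odot>\<^bsub>M12_mod\<^esub> e i) \<in> carrier M12_mod"
      using D.smult_closed[OF C(5)[OF u] e(1)] by (intro D.M.finsum_closed) blast
    show "\<phi> u j = \<phi> (\<Oplus>\<^bsub>M12_mod\<^esub>i\<in>I. \<phi> u i \<odot>\<^bsub>M12_mod\<^esub> e i) j" if "j \<in> I" for j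
      by (rule coords_expand[OF D \<phi> e(1) e(2) C(5)[OF u] that, symmetric])
  qed
  have pairing: "orM (gmult M 3 1 c u) = (\<Oplus>\<^bsub>ring_module P\<^esub>i\<in>I. \<phi> u i \<otimes> \<psi> c i)"
    if c: "c \<in> carrier M3" and u: "u \<in> carrier M12_mod" for c u
  proof -
    have "(\<lambda>u. u) \<in> module_hom P M12_mod M1"
      by (rule module_homI) (use M12_carrier in auto)
    then have h: "(\<lambda>u. orM (gmult M 3 1 c u)) \<in> module_hom P M12_mod (ring_module P)"
      by (rule module_hom_comp[OF module_hom_comp[OF M.ori_hom M.gmult_hom_right[OF c, of 1, simplified]]])
    have "orM (gmult M 3 1 c u) = orM (gmult M 3 1 c (\<Oplus>\<^bsub>M12_mod\<^esub>i\<in>I. \<phi> u i \<odot>\<^bsub>M12_mod\<^esub> e i))"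
      using expand[OF u] by simp
    also have "\<dots> = (\<Oplus>\<^bsub>ring_module P\<^esub>i\<in>I. orM (gmult M 3 1 c (\<phi> u i \<odot>\<^bsub>M12_mod\<^esub> e i)))"
      by (rule module_hom_finsum[OF h D RM.module_axioms C(1)]) (use D.smult_closed[OF C(5)[OF u] e(1)] in blast)
    also have "\<dots> = (\<Oplus>\<^bsub>ring_module P\<^esub>i\<in>I. \<phi> u i \<otimes> \<psi> c i)"
    proof (rule RM.M.finsum_cong')
      show "(\<lambda>i. \<phi> u i \<otimes> \<psi> c i) \<in> I \<rightarrow> carrier (ring_module P)"
        using C(5)[OF u] orM_closed[OF gc[OF c eM(2)]] by (auto simp: \<psi>_def)
      show "orM (gmult M 3 1 c (\<phi> u i \<odot>\<^bsub>M12_mod\<^esub> e i)) = \<phi> u i \<otimes> \<psi> c i" if "i \<in> I" for i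
        using module_hom_smult[OF h C(5)[OF u that] e(1)] by (simp add: \<psi>_def)
    qed simp
    finally show ?thesis .
  qed
  have "coords P M32_mod I (\<lambda>c. restrict (\<psi> c) I)"
  proof (rule coordsI[OF C(1)])
    show "\<psi> c i \<in> carrier P" if "c \<in> carrier M32_mod" "i \<in> I" for c i
      using that orM_closed[OF gc[OF _ eM(2)]] by (auto simp: \<psi>_def M32_iff)
    show "\<psi> (c \<oplus>\<^bsub>M32_mod\<^esub> d) i = \<psi> c i \<oplus> \<psi> d i" if "c \<in> carrier M32_mod" "d \<in> carrier M32_mod" "i \<in> I" for c d i
      using that M.gmult_add_left[of c 3 d "e i" 1] eM(2)[of i] gc module_hom_add[OF M.ori_hom]
      by (simp add: \<psi>_def M32_iff)
    show "\<psi> (a \<odot>\<^bsub>M32_mod\<^esub> c) i = a \<otimes> \<psi> c i" if "a \<in> carrier P" "c \<in> carrier M32_mod" "i \<in> I" for a c i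
      using that M.gmult_smult_left[of a c 3 "e i" 1] eM(2)[of i] gc orM_smult
      by (simp add: \<psi>_def M32_iff)
    show "module P M32_mod" by (rule M32_module)
    show "c = d" if cd: "c \<in> carrier M32_mod" "d \<in> carrier M32_mod" and eq: "\<And>i. i \<in> I \<Longrightarrow> \<psi> c i = \<psi> d i" for c d
    proof -
      have cd': "c \<in> carrier M3" "d \<in> carrier M3" using cd by (auto simp: M32_iff)
      show ?thesis
      proof (rule M3_eqI_split[OF cd'])
        show "gmult M 3 1 c (\<alpha> 1 \<phi>) = gmult M 3 1 d (\<alpha> 1 \<phi>)" if "\<phi> \<in> carrier K1" for \<phi>
          using cd \<beta>3_zero_iff[OF cd'(1)] \<beta>3_zero_iff[OF cd'(2)] that by (simp add: M32_iff)
        fix a assume a: "a \<in> M12"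
        have "(\<Oplus>\<^bsub>ring_module P\<^esub>i\<in>I. \<phi> a i \<otimes> \<psi> c i) = (\<Oplus>\<^bsub>ring_module P\<^esub>i\<in>I. \<phi> a i \<otimes> \<psi> d i)"
          using C(5)[of a] a orM_closed[OF gc[OF cd'(2) eM(2)]] eq
          by (intro RM.M.finsum_cong') (auto simp: \<psi>_def)
        then have "orM (gmult M 3 1 c a) = orM (gmult M 3 1 d a)" using pairing cd' a by simp
        then show "gmult M 3 1 c a = gmult M 3 1 d a"
          using M4_eqI gc cd' M12_carrier[OF a] by blast
      qed
    qed
    show "\<exists>c\<in>carrier M32_mod. \<forall>i\<in>I. \<psi> c i = k i" if k: "k \<in> I \<rightarrow>\<^sub>E carrier P" for k
    proof -
      have kc: "k i \<in> carrier P" if "i \<in> I" for i using PiE_mem[OF k that] .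
      \<comment> \<open>The functional with prescribed values on \<open>e\<close>, extended by zero to \<open>M\<^sub>1\<^sub>,\<^sub>1\<close>.\<close>
      define h where "h u = (\<Oplus>\<^bsub>ring_module P\<^esub>i\<in>I. k i \<otimes> \<phi> (p12 u) i)" for u
      have pM: "p12 u \<in> carrier M12_mod" if "u \<in> carrier M1" for u using p12_closed[OF that] by simp
      have tc: "(\<lambda>i. k i \<otimes> \<phi> (p12 u) i) \<in> I \<rightarrow> carrier (ring_module P)" if "u \<in> carrier M1" for u
        using kc C(5)[OF pM[OF that]] by auto
      have "h \<in> module_hom P M1 (ring_module P)"
      proof (rule module_homI)
        show "h u \<in> carrier (ring_module P)" if "u \<in> carrier M1" for u
          unfolding h_def by (rule RM.M.finsum_closed[OF tc[OF that]])
        fix u v assume uv: "u \<in> carrier M1" "v \<in> carrier M1"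
        have "h u \<oplus>\<^bsub>ring_module P\<^esub> h v =
            (\<Oplus>\<^bsub>ring_module P\<^esub>i\<in>I. (k i \<otimes> \<phi> (p12 u) i) \<oplus>\<^bsub>ring_module P\<^esub> (k i \<otimes> \<phi> (p12 v) i))"
          unfolding h_def by (rule RM.M.finsum_addf[OF tc[OF uv(1)] tc[OF uv(2)], symmetric])
        also have "\<dots> = h (u \<oplus>\<^bsub>M1\<^esub> v)"
          unfolding h_def
        proof (rule RM.M.finsum_cong'[OF refl tc])
          fix i assume i: "i \<in> I"
          have "\<phi> (p12 (u \<oplus>\<^bsub>M1\<^esub> v)) i = \<phi> (p12 u) i \<oplus> \<phi> (p12 v) i"
            using C(3)[OF pM[OF uv(1)] pM[OF uv(2)] i] uv by (simp add: D1.proj_add)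
          then show "(k i \<otimes> \<phi> (p12 u) i) \<oplus>\<^bsub>ring_module P\<^esub> (k i \<otimes> \<phi> (p12 v) i) = k i \<otimes> \<phi> (p12 (u \<oplus>\<^bsub>M1\<^esub> v)) i"
            using kc[OF i] C(5)[OF pM[OF uv(1)] i] C(5)[OF pM[OF uv(2)] i] by (simp add: K.r_distr)
        qed (use uv in simp)
        finally show "h (u \<oplus>\<^bsub>M1\<^esub> v) = h u \<oplus>\<^bsub>ring_module P\<^esub> h v" by simp
      next
        fix a u assume au: "a \<in> carrier P" "u \<in> carrier M1"
        have "a \<odot>\<^bsub>ring_module P\<^esub> h u = (\<Oplus>\<^bsub>ring_module P\<^esub>i\<in>I. a \<odot>\<^bsub>ring_module P\<^esub> (k i \<otimes> \<phi> (p12 u) i))"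
          unfolding h_def by (rule RM.finsum_smult_ldistr[OF C(1) au(1) tc[OF au(2)]])
        also have "\<dots> = h (a \<odot>\<^bsub>M1\<^esub> u)"
          unfolding h_def
        proof (rule RM.M.finsum_cong'[OF refl tc])
          fix i assume i: "i \<in> I"
          have "\<phi> (p12 (a \<odot>\<^bsub>M1\<^esub> u)) i = a \<otimes> \<phi> (p12 u) i"
            using C(4)[OF au(1) pM[OF au(2)] i] au by (simp add: D1.proj_smult)
          then show "a \<odot>\<^bsub>ring_module P\<^esub> (k i \<otimes> \<phi> (p12 u) i) = k i \<otimes> \<phi> (p12 (a \<odot>\<^bsub>M1\<^esub> u)) i"
            using kc[OF i] C(5)[OF pM[OF au(2)] i] au(1) by (simp add: K.m_lcomm)
        qed (use au in simp)
        finally show "h (a \<odot>\<^bsub>M1\<^esub> u) = a \<odot>\<^bsub>ring_module P\<^esub> h u" by simp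
      qed
      from M3_hom_represent[OF this] obtain c
        where c: "c \<in> carrier M3" "\<And>u. u \<in> carrier M1 \<Longrightarrow> orM (gmult M 3 1 c u) = h u"
        by blast
      have "gmult M 3 1 c u = \<zero>\<^bsub>M4\<^esub>" if u: "u \<in> M11" for u
      proof (rule orM_eq_zero)
        have uM: "u \<in> carrier M1" using u D1.UE(1) by blast
        show "gmult M 3 1 c u \<in> carrier M4" by (rule gc[OF c(1) uM])
        have "\<phi> \<zero>\<^bsub>M12_mod\<^esub> i = \<zero>" if "i \<in> I" for i
          using C(4)[of \<zero> "\<zero>\<^bsub>M12_mod\<^esub>" i] C(5)[of "\<zero>\<^bsub>M12_mod\<^esub>" i] that D.M.zero_closed D.smult_l_null[of "\<zero>\<^bsub>M12_mod\<^esub>"] by simp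
        then have "h u = (\<Oplus>\<^bsub>ring_module P\<^esub>i\<in>I. \<zero>\<^bsub>ring_module P\<^esub>)"
          unfolding h_def using D1.proj_on(2)[OF u] kc by (intro RM.M.finsum_cong') auto
        then show "orM (gmult M 3 1 c u) = \<zero>" using c(2)[OF uM] RM.M.finsum_zero by simp
      qed
      then have "c \<in> carrier M32_mod" using c(1) by (simp add: M32_def)
      moreover have "\<psi> c j = k j" if j: "j \<in> I" for j
      proof -
        have "\<psi> c j = (\<Oplus>\<^bsub>ring_module P\<^esub>i\<in>I. k i \<otimes> \<phi> (p12 (e j)) i)"
          using c(2)[OF eM(2)] by (simp add: \<psi>_def h_def)
        also have "\<dots> = (\<Oplus>\<^bsub>ring_module P\<^esub>i\<in>I. if j = i then k i else \<zero>\<^bsub>ring_module P\<^esub>)"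
          using D1.proj_on(3)[OF eM(1)] kc e(2) by (intro RM.M.finsum_cong') auto
        also have "\<dots> = k j"
          using RM.M.finsum_singleton[OF j C(1), of k] kc by auto
        finally show ?thesis .
      qed
      ultimately show ?thesis by blast
    qed
  qed
  then show ?thesis using M32_module fg_free_of_coords by blast
qed

end

section \<open>The case of a unit r\<close>

locale linkage_unit = linkage_data +
  assumes r_unit: "r \<in> Units P"
begin

abbreviation "ri \<equiv> inv r"

lemma ri_closed: "ri \<in> carrier P" and ri_r: "ri \<otimes> r = \<one>" and r_ri: "r \<otimes> ri = \<one>"
  using r_unit by simp_all

lemma r_ri_K: "x \<in> carrier (part K i) \<Longrightarrow> r \<odot>\<^bsub>part K i\<^esub> (ri \<odot>\<^bsub>part K i\<^esub> x) = x"
  using MK.smult_assoc1[OF r_closed ri_closed, of x i] r_ri by simp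

lemma ri_r_M: "x \<in> carrier (part M i) \<Longrightarrow> ri \<odot>\<^bsub>part M i\<^esub> (r \<odot>\<^bsub>part M i\<^esub> x) = x"
  using MM.smult_assoc1[OF ri_closed r_closed, of x i] ri_r by simp

lemma r_K_zero: "x \<in> carrier (part K i) \<Longrightarrow> r \<odot>\<^bsub>part K i\<^esub> x = \<zero>\<^bsub>part K i\<^esub> \<Longrightarrow> x = \<zero>\<^bsub>part K i\<^esub>"
  using MK.smult_assoc1[OF ri_closed r_closed, of x i] ri_r ri_closed by simp

lemma \<kappa>_closed [simp]: "x \<in> carrier K3 \<Longrightarrow> \<kappa> x \<in> carrier M3"
  by (rule \<kappa>_props(2))

text \<open>The component in \<open>M\<^sub>3\<^sub>,\<^sub>1\<close> is the one for which \<open>r\<beta>\<^sub>3\<close> cancels \<open>z\<^sub>2(b)\<close> in the \<open>K\<^sub>3\<close>-row of \<open>g_even\<close>.\<close>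

fun \<iota> where
  "\<iota> (a, b, c, d) = (a, b, c \<oplus>\<^bsub>M3\<^esub> ri \<odot>\<^bsub>M3\<^esub> \<kappa> (z 2 b), \<zero>\<^bsub>K4\<^esub>)"

fun \<epsilon> where
  "\<epsilon> (a, b, c, d) = (a, \<zero>\<^bsub>K3\<^esub>, \<zero>\<^bsub>M4\<^esub>, \<zero>\<^bsub>K0\<^esub>)"

lemma \<iota>_closed: "y \<in> carrier G'_even \<Longrightarrow> \<iota> y \<in> carrier G_even"
  using ri_closed by (auto simp: G'_even_def G_even_def M32_iff)

lemma \<epsilon>_closed: "x \<in> carrier G'_odd \<Longrightarrow> \<epsilon> x \<in> carrier G_odd"
  by (auto simp: G'_odd_def G_odd_def)

lemma \<iota>_smult:
  "y \<in> carrier G'_even \<Longrightarrow> \<iota> (f \<odot>\<^bsub>G'_even\<^esub> y) = f \<odot>\<^bsub>G_even\<^esub> \<iota> y"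
  using ri_closed f_carrier module_hom_smult[OF \<kappa>_hom f_carrier]
  by (auto simp: G'_even_def G_even_def M32_iff hom_smult MM.smult_r_distr MM.smult_assoc1[symmetric] K.m_comm)

lemma \<epsilon>_smult: "x \<in> carrier G'_odd \<Longrightarrow> \<epsilon> (f \<odot>\<^bsub>G'_odd\<^esub> x) = f \<odot>\<^bsub>G_odd\<^esub> \<epsilon> x"
  using f_carrier by (auto simp: G'_odd_def G_odd_def)

lemma \<iota>_inj: "x \<in> carrier G'_even \<Longrightarrow> y \<in> carrier G'_even \<Longrightarrow> \<iota> x = \<iota> y \<Longrightarrow> x = y"
  using ri_closed by (auto simp: G'_even_def M32_iff)

lemma \<epsilon>_inj: "x \<in> carrier G'_odd \<Longrightarrow> y \<in> carrier G'_odd \<Longrightarrow> \<epsilon> x = \<epsilon> y \<Longrightarrow> x = y"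
  by (auto simp: G'_odd_def)

text \<open>The \<open>K\<^sub>3\<close>-component vanishes by the choice of \<open>\<iota>\<close>. For the \<open>M\<^sub>4\<close>-component \<open>C\<close>, the \<open>K\<^sub>4\<close>-row of
  \<open>g_odd \<circ> g_even = f\<close> then reads \<open>r\<beta>\<^sub>4(C) = 0\<close>.\<close>

lemma g_even_\<iota>:
  assumes "y \<in> carrier G'_even"
  shows "g_even (\<iota> y) = \<epsilon> (g'_even y)"
proof -
  obtain a b c where y: "y = (a, b, c, \<zero>\<^bsub>K0\<^esub>)" "a \<in> M12" "b \<in> carrier K2"
    "c \<in> carrier M3" "\<beta> 3 c = \<zero>\<^bsub>K3\<^esub>"
    using assms by (auto simp: G'_even_def M32_iff)
  have a: "a \<in> carrier M1" using M12_carrier y(2) by blast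
  define k where "k = ri \<odot>\<^bsub>M3\<^esub> \<kappa> (z 2 b)"
  have k: "k \<in> carrier M3" "r \<odot>\<^bsub>K3\<^esub> \<beta> 3 k = z 2 b"
    using \<kappa>_props[of "z 2 b"] y(3) ri_closed by (simp_all add: k_def hom_smult r_ri_K)
  have c': "c \<oplus>\<^bsub>M3\<^esub> k \<in> carrier M3" using y k by simp
  have 1: "(r \<odot>\<^bsub>M2\<^esub> X a \<ominus>\<^bsub>M2\<^esub> w 1 a) \<oplus>\<^bsub>M2\<^esub> \<alpha> 2 b \<oplus>\<^bsub>M2\<^esub> bd M 3 (c \<oplus>\<^bsub>M3\<^esub> k)
     = (r \<odot>\<^bsub>M2\<^esub> X a \<ominus>\<^bsub>M2\<^esub> w 1 a)
       \<oplus>\<^bsub>M2\<^esub> (\<alpha> 2 b \<oplus>\<^bsub>M2\<^esub> ri \<odot>\<^bsub>M2\<^esub> W b) \<oplus>\<^bsub>M2\<^esub> bd M 3 c"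
  proof -
    have W: "ri \<odot>\<^bsub>M2\<^esub> W b = bd M 3 k"
      using y(3) ri_closed by (simp add: W_eq k_def hom_smult)
    have cl: "X a \<in> carrier M2" "w 1 a \<in> carrier M2" "\<alpha> 2 b \<in> carrier M2"
      "bd M 3 c \<in> carrier M2" "bd M 3 k \<in> carrier M2"
      using a y k by simp_all
    have h: "bd M 3 (c \<oplus>\<^bsub>M3\<^esub> k) = bd M 3 c \<oplus>\<^bsub>M2\<^esub> bd M 3 k" using y(4) k(1) by (simp add: hom_add)
    show ?thesis unfolding W h using cl r_closed by algebra
  qed
  define B where "B = (\<ominus>\<^bsub>K3\<^esub> z 2 b) \<oplus>\<^bsub>K3\<^esub> r \<odot>\<^bsub>K3\<^esub> \<beta> 3 (c \<oplus>\<^bsub>M3\<^esub> k)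
    \<ominus>\<^bsub>K3\<^esub> bd K 4 \<zero>\<^bsub>K4\<^esub>"
  have B: "B = \<zero>\<^bsub>K3\<^esub>"
    using y k r_closed unfolding B_def by (simp add: hom_add hom_zero neg_zero a_minus_def MK.M.l_neg)
  define C where "C = (\<ominus>\<^bsub>M4\<^esub> w 3 (c \<oplus>\<^bsub>M3\<^esub> k)) \<oplus>\<^bsub>M4\<^esub> \<alpha> 4 \<zero>\<^bsub>K4\<^esub>"
  have C_in: "C \<in> carrier M4" using y k by (simp add: C_def)
  have "z 3 B \<oplus>\<^bsub>K4\<^esub> r \<odot>\<^bsub>K4\<^esub> \<beta> 4 C = f \<odot>\<^bsub>K4\<^esub> \<zero>\<^bsub>K4\<^esub>"
    unfolding B_def C_def by (rule odd_even_4[OF y(3) c' MK.M.zero_closed])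
  then have "r \<odot>\<^bsub>K4\<^esub> \<beta> 4 C = \<zero>\<^bsub>K4\<^esub>"
    unfolding B using C_in r_closed f_carrier by (simp add: hom_zero)
  then have "\<beta> 4 C = \<zero>\<^bsub>K4\<^esub>" by (rule r_K_zero[rotated]) (use C_in in simp)
  then have C: "C = \<zero>\<^bsub>M4\<^esub>" by (rule \<beta>4_inj[OF C_in])
  show ?thesis
    unfolding y(1) \<iota>.simps k_def[symmetric] g_even.simps g'_even.simps \<epsilon>.simps
      B_def[symmetric] C_def[symmetric] B C 1 ..
qed

text \<open>The \<open>M\<^sub>3\<close>-component \<open>t\<close> of the left-hand side has \<open>\<beta>\<^sub>3(t) = z\<^sub>2(\<beta>\<^sub>2(a))\<close>, which is \<open>r\<^sup>-\<^sup>1 z\<^sub>2(v)\<close>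
  for the \<open>K\<^sub>2\<close>-component \<open>v\<close> since \<open>z\<^sub>2 \<circ> Y = 0\<close>. Thus the part of \<open>t\<close> in \<open>M\<^sub>3\<^sub>,\<^sub>1\<close> is the one that \<open>\<iota>\<close>
  restores.\<close>

lemma g_odd_\<epsilon>:
  assumes "x \<in> carrier G'_odd"
  shows "g_odd (\<epsilon> x) = \<iota> (g'_odd x)"
proof -
  obtain a where x: "x = (a, \<zero>\<^bsub>K0\<^esub>, \<zero>\<^bsub>M0\<^esub>, \<zero>\<^bsub>K0\<^esub>)" "a \<in> carrier M2"
    using assms by (auto simp: G'_odd_def)
  define t where "t = r \<odot>\<^bsub>M3\<^esub> Xd a \<oplus>\<^bsub>M3\<^esub> w 2 a"
  have t: "t \<in> carrier M3" using x r_closed by (simp add: t_def)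
  have bt: "\<beta> 3 t = z 2 (\<beta> 2 a)" using x r_closed by (simp add: t_def rels)
  define v where "v = r \<odot>\<^bsub>K2\<^esub> \<beta> 2 a \<ominus>\<^bsub>K2\<^esub> Y a"
  have v: "v \<in> carrier K2" using x r_closed by (simp add: v_def Y_eq)
  have zv: "z 2 v = r \<odot>\<^bsub>K3\<^esub> z 2 (\<beta> 2 a)"
    using x r_closed unfolding v_def Y_eq by (simp add: rels)
  have "ri \<odot>\<^bsub>M3\<^esub> \<kappa> (z 2 v) = \<kappa> (\<beta> 3 t)"
    unfolding zv bt using x by (simp add: module_hom_smult[OF \<kappa>_hom r_closed] ri_r_M)
  then have "p32 t \<oplus>\<^bsub>M3\<^esub> ri \<odot>\<^bsub>M3\<^esub> \<kappa> (z 2 v) = t"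
    using t by (simp add: p32_eq a_minus_def MM.M.a_assoc MM.M.l_neg)
  then show ?thesis
    unfolding x(1) \<epsilon>.simps g'_odd.simps \<iota>.simps g_odd.simps t_def[symmetric] v_def[symmetric]
    using t v r_closed by (simp add: hom_zero a_minus_def neg_zero)
qed

lemma M32_carrier_hom: "(\<lambda>x. fst (snd (snd x))) \<in> module_hom P (A \<boxplus> B \<boxplus> M32_mod \<boxplus> D) M3"
  by (rule module_hom_into_sub[OF pr3_hom]) (use M32_iff in blast)

lemmas hom_intros' = M32_carrier_hom hom_intros \<kappa>_hom[THEN module_hom_comp] D3.proj_hom(2)[THEN module_hom_comp]
  module_hom_scale[OF M.part_module _ ri_closed]

lemma g'_even_hom: "g'_even \<in> module_hom P G'_even G'_odd"
proof -
  have "(\<lambda>x. ((r \<odot>\<^bsub>M2\<^esub> X (fst x) \<ominus>\<^bsub>M2\<^esub> w 1 (fst x))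
       \<oplus>\<^bsub>M2\<^esub> (\<alpha> 2 (fst (snd x)) \<oplus>\<^bsub>M2\<^esub> ri \<odot>\<^bsub>M2\<^esub> bd M 3 (\<kappa> (z 2 (fst (snd x)))))
       \<oplus>\<^bsub>M2\<^esub> bd M 3 (fst (snd (snd x))),
     \<zero>\<^bsub>K0\<^esub>, \<zero>\<^bsub>M0\<^esub>, \<zero>\<^bsub>K0\<^esub>)) \<in> module_hom P G'_even G'_odd" (is "?h \<in> _")
    unfolding G'_even_def G'_odd_def by (intro hom_intros')
  also have "?h = g'_even" by (auto simp: W_eq)
  finally show ?thesis .
qed

lemma g'_odd_hom: "g'_odd \<in> module_hom P G'_odd G'_even"
proof -
  have "(\<lambda>x. (p12 (bd M 2 (fst x)),
     r \<odot>\<^bsub>K2\<^esub> \<beta> 2 (fst x) \<ominus>\<^bsub>K2\<^esub> z 1 (\<gamma> (bd M 2 (fst x))),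
     p32 (r \<odot>\<^bsub>M3\<^esub> Xd (fst x) \<oplus>\<^bsub>M3\<^esub> w 2 (fst x)),
     \<zero>\<^bsub>K0\<^esub>)) \<in> module_hom P G'_odd G'_even" (is "?h \<in> _")
    unfolding G'_even_def G'_odd_def by (intro hom_intros')
  also have "?h = g'_odd" by (auto simp: Y_eq)
  finally show ?thesis .
qed

lemma l'3_hom: "l'3 \<in> module_hom P G'_odd L2"
proof -
  have "(\<lambda>x. (p12 (bd M 2 (fst x)),
     r \<odot>\<^bsub>K2\<^esub> \<beta> 2 (fst x) \<ominus>\<^bsub>K2\<^esub> z 1 (\<gamma> (bd M 2 (fst x))),
     \<zero>\<^bsub>M0\<^esub>, \<zero>\<^bsub>K0\<^esub>)) \<in> module_hom P G'_odd L2" (is "?h \<in> _")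
    unfolding L2_def G'_odd_def by (intro hom_intros')
  also have "?h = l'3" by (auto simp: Y_eq)
  finally show ?thesis .
qed

lemma G'_even_free: "fg_free_module P G'_even" and G'_odd_free: "fg_free_module P G'_odd"
  unfolding G'_even_def G'_odd_def
  by (intro fg_free_direct_sum fg_free_zero_module M12_fg_free M32_fg_free M.part_fg_free K.part_fg_free
      M.part_module K.part_module)+

lemma f_smult_closed:
  "y \<in> carrier G'_even \<Longrightarrow> f \<odot>\<^bsub>G'_even\<^esub> y \<in> carrier G'_even"
  "x \<in> carrier G'_odd \<Longrightarrow> f \<odot>\<^bsub>G'_odd\<^esub> x \<in> carrier G'_odd"
  using module.smult_closed[OF fg_free_imp_module[OF G'_even_free] f_carrier]
    module.smult_closed[OF fg_free_imp_module[OF G'_odd_free] f_carrier] by blast+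

lemma g'_even_g'_odd:
  assumes "x \<in> carrier G'_odd"
  shows "g'_even (g'_odd x) = f \<odot>\<^bsub>G'_odd\<^esub> x"
proof (rule \<epsilon>_inj)
  have c: "g'_odd x \<in> carrier G'_even" by (rule module_hom_closed[OF g'_odd_hom assms])
  show "g'_even (g'_odd x) \<in> carrier G'_odd" by (rule module_hom_closed[OF g'_even_hom c])
  show "f \<odot>\<^bsub>G'_odd\<^esub> x \<in> carrier G'_odd" by (rule f_smult_closed(2)[OF assms])
  show "\<epsilon> (g'_even (g'_odd x)) = \<epsilon> (f \<odot>\<^bsub>G'_odd\<^esub> x)"
    by (simp only: g_even_\<iota>[OF c, symmetric] g_odd_\<epsilon>[OF assms, symmetric]
        g_even_g_odd[OF \<epsilon>_closed[OF assms]] \<epsilon>_smult[OF assms])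
qed

lemma g'_odd_g'_even:
  assumes "y \<in> carrier G'_even"
  shows "g'_odd (g'_even y) = f \<odot>\<^bsub>G'_even\<^esub> y"
proof (rule \<iota>_inj)
  have c: "g'_even y \<in> carrier G'_odd" by (rule module_hom_closed[OF g'_even_hom assms])
  show "g'_odd (g'_even y) \<in> carrier G'_even" by (rule module_hom_closed[OF g'_odd_hom c])
  show "f \<odot>\<^bsub>G'_even\<^esub> y \<in> carrier G'_even" by (rule f_smult_closed(1)[OF assms])
  show "\<iota> (g'_odd (g'_even y)) = \<iota> (f \<odot>\<^bsub>G'_even\<^esub> y)"
    by (simp only: g_odd_\<epsilon>[OF c, symmetric] g_even_\<iota>[OF assms, symmetric]
        g_odd_g_even[OF \<iota>_closed[OF assms]] \<iota>_smult[OF assms])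
qed

lemma odd_even_exact': "R.exact_mod G'_odd g'_odd G'_even g'_even G'_odd"
  by (rule R.factorization_exact_mod[OF f_regular G'_even_free g'_odd_hom g'_even_g'_odd g'_odd_g'_even])

lemma even_odd_exact': "R.exact_mod G'_even g'_even G'_odd g'_odd G'_even"
  by (rule R.factorization_exact_mod[OF f_regular G'_odd_free g'_even_hom g'_odd_g'_even g'_even_g'_odd])

lemma l'3_l3: "l'3 (a, b, c, d) = l3 (a, \<zero>\<^bsub>K3\<^esub>, c', d')" if "a \<in> carrier M2"
  using that r_closed by (simp add: a_minus_def Y_eq hom_zero neg_zero)

text \<open>As \<open>r\<beta>\<^sub>3\<close> is onto, \<open>k\<^sub>3(b)\<close> can be absorbed into \<open>r\<beta>\<^sub>2\<close> by changing \<open>\<theta>\<close> by a boundary, which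
  leaves \<open>m\<^sub>2(\<theta>)\<close> unchanged.\<close>

lemma l3_l'3:
  assumes \<theta>: "\<theta> \<in> carrier M2" and b: "b \<in> carrier K3"
  shows "l3 (\<theta>, b, c, d) = l'3 (\<theta> \<ominus>\<^bsub>M2\<^esub> bd M 3 (ri \<odot>\<^bsub>M3\<^esub> \<kappa> b), \<zero>\<^bsub>K0\<^esub>, \<zero>\<^bsub>M0\<^esub>, \<zero>\<^bsub>K0\<^esub>)"
proof -
  define k where "k = ri \<odot>\<^bsub>M3\<^esub> \<kappa> b"
  have k: "k \<in> carrier M3" "r \<odot>\<^bsub>K3\<^esub> \<beta> 3 k = b"
    using \<kappa>_props[OF b] ri_closed b by (simp_all add: k_def hom_smult r_ri_K)
  have m: "bd M 2 (\<theta> \<ominus>\<^bsub>M2\<^esub> bd M 3 k) = bd M 2 \<theta>"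
    using \<theta> k(1) by (simp add: a_minus_def hom_add hom_neg bd_bd_rules neg_zero)
  have "r \<odot>\<^bsub>K2\<^esub> \<beta> 2 (bd M 3 k) = bd K 3 (r \<odot>\<^bsub>K3\<^esub> \<beta> 3 k)"
    using k(1) r_closed by (simp add: hom_smult chain_rules)
  then have kb: "r \<odot>\<^bsub>K2\<^esub> \<beta> 2 (bd M 3 k) = bd K 3 b" using k(2) by simp
  have Y: "Y \<theta> \<in> carrier K2" using \<theta> by (simp add: Y_eq)
  have cl: "\<beta> 2 \<theta> \<in> carrier K2" "\<beta> 2 (bd M 3 k) \<in> carrier K2" "bd K 3 b \<in> carrier K2"
    using \<theta> k(1) b by simp_all
  have "r \<odot>\<^bsub>K2\<^esub> \<beta> 2 (\<theta> \<ominus>\<^bsub>M2\<^esub> bd M 3 k) \<ominus>\<^bsub>K2\<^esub> Y \<theta>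
      = (r \<odot>\<^bsub>K2\<^esub> \<beta> 2 \<theta> \<ominus>\<^bsub>K2\<^esub> Y \<theta>) \<ominus>\<^bsub>K2\<^esub> r \<odot>\<^bsub>K2\<^esub> \<beta> 2 (bd M 3 k)"
  proof -
    have h: "\<beta> 2 (\<theta> \<ominus>\<^bsub>M2\<^esub> bd M 3 k) = \<beta> 2 \<theta> \<ominus>\<^bsub>K2\<^esub> \<beta> 2 (bd M 3 k)"
      using \<theta> k(1) by (simp add: a_minus_def hom_add hom_neg)
    show ?thesis unfolding h using cl Y r_closed by algebra
  qed
  then show ?thesis unfolding k_def[symmetric] l3.simps l'3.simps m Y_eq[of "\<theta> \<ominus>\<^bsub>M2\<^esub> bd M 3 k"]
    unfolding m Y_eq[of \<theta>, symmetric] kb by simp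
qed

lemma exact_2': "R.exact_mod G'_odd l'3 L2 l2 L1"
  unfolding R.exact_mod_def
proof (intro conjI ballI impI)
  fix x assume x: "x \<in> carrier G'_odd"
  then obtain a where xe: "x = (a, \<zero>\<^bsub>K0\<^esub>, \<zero>\<^bsub>M0\<^esub>, \<zero>\<^bsub>K0\<^esub>)" "a \<in> carrier M2"
    by (auto simp: G'_odd_def)
  have "l'3 x = l3 (a, \<zero>\<^bsub>K3\<^esub>, \<zero>\<^bsub>M0\<^esub>, \<zero>\<^bsub>K0\<^esub>)" unfolding xe(1) by (rule l'3_l3[OF xe(2)])
  moreover have "(a, \<zero>\<^bsub>K3\<^esub>, \<zero>\<^bsub>M0\<^esub>, \<zero>\<^bsub>K0\<^esub>) \<in> carrier L3" using xe(2) by (simp add: L3_def)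
  ultimately show "\<exists>y\<in>carrier L1. l2 (l'3 x) = f \<odot>\<^bsub>L1\<^esub> y"
    using exact_2 unfolding R.exact_mod_def by metis
next
  fix x y assume x: "x \<in> carrier L2" and y: "y \<in> carrier L1" and eq: "l2 x = f \<odot>\<^bsub>L1\<^esub> y"
  then obtain u v where u: "u \<in> carrier L3" and v: "v \<in> carrier L2" and xu: "x = l3 u \<oplus>\<^bsub>L2\<^esub> f \<odot>\<^bsub>L2\<^esub> v"
    using exact_2 unfolding R.exact_mod_def by blast
  obtain \<theta> b c d where ue: "u = (\<theta>, b, c, d)" "\<theta> \<in> carrier M2" "b \<in> carrier K3"
    using u by (auto simp: L3_def)
  define u' where "u' = (\<theta> \<ominus>\<^bsub>M2\<^esub> bd M 3 (ri \<odot>\<^bsub>M3\<^esub> \<kappa> b), \<zero>\<^bsub>K0\<^esub>, \<zero>\<^bsub>M0\<^esub>, \<zero>\<^bsub>K0\<^esub>)"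
  have "u' \<in> carrier G'_odd" using ue(2,3) ri_closed by (simp add: u'_def G'_odd_def)
  moreover have "l3 u = l'3 u'" unfolding ue(1) u'_def by (rule l3_l'3[OF ue(2,3)])
  ultimately show "\<exists>u\<in>carrier G'_odd. \<exists>v\<in>carrier L2. x = l'3 u \<oplus>\<^bsub>L2\<^esub> f \<odot>\<^bsub>L2\<^esub> v"
    using v xu by auto
qed

text \<open>If \<open>f\<close> divides the first two components of \<open>g'_odd(x)\<close>, then \<open>f\<close> also divides the third component \<open>t\<close> in
  \<open>M\<^sub>3\<^sub>,\<^sub>2\<close>. Since \<open>f\<close> divides \<open>m\<^sub>3(t)\<close>, there are \<open>s'\<close> and \<open>e\<close> with \<open>t = fs' + m\<^sub>4(e)\<close>. From
  \<open>\<beta>\<^sub>3(t) = 0\<close> follows that \<open>f\<close> divides \<open>k\<^sub>4(\<beta>\<^sub>4(e))\<close>, hence \<open>\<beta>\<^sub>4(e)\<close> and \<open>e\<close>.\<close>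

lemma exact_3': "R.exact_mod G'_even g'_even G'_odd l'3 L2"
  unfolding R.exact_mod_def
proof (intro conjI ballI impI)
  fix y assume y: "y \<in> carrier G'_even"
  then obtain a b c where ye: "y = (a, b, c, \<zero>\<^bsub>K0\<^esub>)" "a \<in> M12" "b \<in> carrier K2" "c \<in> M32"
    by (auto simp: G'_even_def)
  obtain A where A: "g'_even y = (A, \<zero>\<^bsub>K0\<^esub>, \<zero>\<^bsub>M0\<^esub>, \<zero>\<^bsub>K0\<^esub>)"
    unfolding ye(1) by simp
  have "l'3 (g'_even y) = f \<odot>\<^bsub>L2\<^esub> (a, b, \<zero>\<^bsub>M0\<^esub>, \<zero>\<^bsub>K0\<^esub>)"
    using g'_odd_g'_even[OF y] f_carrier unfolding A unfolding ye(1) by (simp add: L2_def G'_even_def)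
  then show "\<exists>z\<in>carrier L2. l'3 (g'_even y) = f \<odot>\<^bsub>L2\<^esub> z"
    by (rule bexI) (use ye in \<open>simp add: L2_def\<close>)
next
  fix x y assume x: "x \<in> carrier G'_odd" and "y \<in> carrier L2" and eq: "l'3 x = f \<odot>\<^bsub>L2\<^esub> y"
  then obtain a u v where xe: "x = (a, \<zero>\<^bsub>K0\<^esub>, \<zero>\<^bsub>M0\<^esub>, \<zero>\<^bsub>K0\<^esub>)" "a \<in> carrier M2"
    and y: "y = (u, v, \<zero>\<^bsub>M0\<^esub>, \<zero>\<^bsub>K0\<^esub>)" "u \<in> M12" "v \<in> carrier K2"
    by (auto simp: G'_odd_def L2_def)
  have u: "u \<in> carrier M1" using M12_carrier y(2) by blast
  have uv: "p12 (bd M 2 a) = f \<odot>\<^bsub>M1\<^esub> u"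
    "r \<odot>\<^bsub>K2\<^esub> \<beta> 2 a \<ominus>\<^bsub>K2\<^esub> Y a = f \<odot>\<^bsub>K2\<^esub> v"
    using eq unfolding xe(1) y(1) by (simp_all add: L2_def)
  define t where "t = p32 (r \<odot>\<^bsub>M3\<^esub> Xd a \<oplus>\<^bsub>M3\<^esub> w 2 a)"
  have "t \<in> M32" using D3.proj_props(2) xe(2) r_closed by (simp add: t_def)
  then have t: "t \<in> carrier M3" "\<beta> 3 t = \<zero>\<^bsub>K3\<^esub>" by (simp_all add: M32_iff)
  have go: "g'_odd x = (f \<odot>\<^bsub>M1\<^esub> u, f \<odot>\<^bsub>K2\<^esub> v, t, \<zero>\<^bsub>K0\<^esub>)"
    unfolding xe(1) g'_odd.simps uv t_def ..
  \<comment> \<open>Splitting off \<open>t\<close>, the identity \<open>g'_even(g'_odd(x)) = fx\<close> shows that \<open>f\<close> divides \<open>m\<^sub>3(t)\<close>.\<close>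
  define y0 where "y0 = (u, v, \<zero>\<^bsub>M3\<^esub>, \<zero>\<^bsub>K0\<^esub>)"
  have y0: "y0 \<in> carrier G'_even" using y D3.zero_in(2) by (simp add: y0_def G'_even_def)
  define q where "q = (\<zero>\<^bsub>M1\<^esub>, \<zero>\<^bsub>K2\<^esub>, t, \<zero>\<^bsub>K0\<^esub>)"
  have q: "q \<in> carrier G'_even" using \<open>t \<in> M32\<close> D1.zero_in(2) by (simp add: q_def G'_even_def)
  obtain Q where Q: "g'_even y0 = (Q, \<zero>\<^bsub>K0\<^esub>, \<zero>\<^bsub>M0\<^esub>, \<zero>\<^bsub>K0\<^esub>)" "Q \<in> carrier M2"
    using module_hom_closed[OF g'_even_hom y0] by (auto simp: G'_odd_def simp del: g'_even.simps)
  have gq: "g'_even q = (bd M 3 t, \<zero>\<^bsub>K0\<^esub>, \<zero>\<^bsub>M0\<^esub>, \<zero>\<^bsub>K0\<^esub>)"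
    unfolding q_def using t r_closed ri_closed module_hom_zero[OF \<kappa>_hom K.part_module M.part_module]
    by (simp add: W_eq hom_zero a_minus_def neg_zero)
  have "g'_odd x = f \<odot>\<^bsub>G'_even\<^esub> y0 \<oplus>\<^bsub>G'_even\<^esub> q"
    unfolding go y0_def q_def using u y t f_carrier by (simp add: G'_even_def)
  then have "f \<odot>\<^bsub>G'_odd\<^esub> x = f \<odot>\<^bsub>G'_odd\<^esub> g'_even y0 \<oplus>\<^bsub>G'_odd\<^esub> g'_even q"
    using g'_even_g'_odd[OF x] module_hom_add[OF g'_even_hom f_smult_closed(1)[OF y0] q]
      module_hom_smult[OF g'_even_hom f_carrier y0] by simp
  then have fa: "f \<odot>\<^bsub>M2\<^esub> a = f \<odot>\<^bsub>M2\<^esub> Q \<oplus>\<^bsub>M2\<^esub> bd M 3 t"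
    unfolding Q(1) gq xe(1) by (simp add: G'_odd_def)
  have d3: "bd M 3 t \<in> carrier M2" using t by simp
  have "bd M 3 t = (f \<odot>\<^bsub>M2\<^esub> Q \<oplus>\<^bsub>M2\<^esub> bd M 3 t) \<ominus>\<^bsub>M2\<^esub> f \<odot>\<^bsub>M2\<^esub> Q"
    using d3 Q(2) f_carrier by algebra
  also have "\<dots> = f \<odot>\<^bsub>M2\<^esub> (a \<ominus>\<^bsub>M2\<^esub> Q)"
    unfolding fa[symmetric] using Q(2) xe(2) f_carrier by algebra
  finally have "bd M 3 t = f \<odot>\<^bsub>part M (3 - 1)\<^esub> (a \<ominus>\<^bsub>M2\<^esub> Q)" by simp
  moreover have "a \<ominus>\<^bsub>M2\<^esub> Q \<in> carrier (part M (3 - 1))" using Q xe(2) by simp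
  ultimately obtain s' e where s': "s' \<in> carrier M3" "e \<in> carrier M4"
    "t = f \<odot>\<^bsub>M3\<^esub> s' \<oplus>\<^bsub>M3\<^esub> bd M 4 e"
    using M_exact_mod[of 3 t] t(1) by auto
  have b4: "\<beta> 4 e \<in> carrier K4" "bd K 4 (\<beta> 4 e) \<in> carrier K3" "\<beta> 3 s' \<in> carrier K3"
    using s' by simp_all
  have "\<beta> 3 t = f \<odot>\<^bsub>K3\<^esub> \<beta> 3 s' \<oplus>\<^bsub>K3\<^esub> bd K 4 (\<beta> 4 e)"
    unfolding s'(3) using s' f_carrier by (simp add: hom_add hom_smult chain_rules)
  then have z0: "f \<odot>\<^bsub>K3\<^esub> \<beta> 3 s' \<oplus>\<^bsub>K3\<^esub> bd K 4 (\<beta> 4 e) = \<zero>\<^bsub>K3\<^esub>" using t(2) by simp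
  have "bd K 4 (\<beta> 4 e) = (f \<odot>\<^bsub>K3\<^esub> \<beta> 3 s' \<oplus>\<^bsub>K3\<^esub> bd K 4 (\<beta> 4 e)) \<ominus>\<^bsub>K3\<^esub> f \<odot>\<^bsub>K3\<^esub> \<beta> 3 s'"
    using b4 f_carrier by algebra
  also have "\<dots> = f \<odot>\<^bsub>K3\<^esub> (\<ominus>\<^bsub>K3\<^esub> \<beta> 3 s')"
    unfolding z0 using b4 f_carrier by algebra
  finally obtain d' where d': "d' \<in> carrier K4" "\<beta> 4 e = f \<odot>\<^bsub>K4\<^esub> d'"
    using k4_div[OF b4(1) MK.M.a_inv_closed[OF b4(3)]] by blast
  have "orK d' \<in> orM ` carrier M4"
    using module_isoD(2)[OF orM_iso] orK_closed[OF d'(1)] by (simp add: bij_betw_def)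
  then obtain e' where e': "e' \<in> carrier M4" "orM e' = orK d'" by auto
  have "orM e = orM (f \<odot>\<^bsub>M4\<^esub> e')"
    using orK_\<beta>4[OF s'(2)] d' e' f_carrier by (simp add: orK_smult orM_smult)
  then have e_eq: "e = f \<odot>\<^bsub>M4\<^esub> e'" using s'(2) e'(1) f_carrier by (intro M4_eqI) auto
  define t' where "t' = s' \<oplus>\<^bsub>M3\<^esub> bd M 4 e'"
  have t': "t' \<in> carrier M3" "t = f \<odot>\<^bsub>M3\<^esub> t'"
    using s' e' f_carrier unfolding s'(3) e_eq t'_def by (simp_all add: hom_smult MM.smult_r_distr)
  have "f \<odot>\<^bsub>K3\<^esub> \<beta> 3 t' = f \<odot>\<^bsub>K3\<^esub> \<zero>\<^bsub>K3\<^esub>"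
    using t(2) t' f_carrier by (simp add: hom_smult)
  then have "\<beta> 3 t' = \<zero>\<^bsub>K3\<^esub>" by (rule f_inj_K[rotated 2]) (use t'(1) in simp_all)
  then have "t' \<in> M32" using t'(1) by (simp add: M32_iff)
  define y' where "y' = (u, v, t', \<zero>\<^bsub>K0\<^esub>)"
  have y': "y' \<in> carrier G'_even" using y \<open>t' \<in> M32\<close> by (simp add: y'_def G'_even_def)
  have "g'_odd x = f \<odot>\<^bsub>G'_even\<^esub> y'"
    unfolding go y'_def t'(2) using f_carrier by (simp add: G'_even_def)
  then have "f \<odot>\<^bsub>G'_odd\<^esub> x = f \<odot>\<^bsub>G'_odd\<^esub> g'_even y'"
    using g'_even_g'_odd[OF x] module_hom_smult[OF g'_even_hom f_carrier y'] by simp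
  then have xy: "x = g'_even y'"
    by (rule regular_smult_inject[OF G'_odd_free f_regular x module_hom_closed[OF g'_even_hom y']])
  interpret GO: module P G'_odd by (rule fg_free_imp_module[OF G'_odd_free])
  have "x = x \<oplus>\<^bsub>G'_odd\<^esub> f \<odot>\<^bsub>G'_odd\<^esub> \<zero>\<^bsub>G'_odd\<^esub>" using x f_carrier by simp
  then show "\<exists>u\<in>carrier G'_even. \<exists>v\<in>carrier G'_odd. x = g'_even u \<oplus>\<^bsub>G'_odd\<^esub> f \<odot>\<^bsub>G'_odd\<^esub> v"
    using y' xy GO.M.zero_closed by metis
qed

lemma N'_resolution: "free_resolution Pbar N' n' (quot_module Pbar KKbar)"
proof -
  have "free_resolution Pbar (\<lambda>i. bar (L' i)) (\<lambda>i. bar_map (L' (i - 1)) (l' i)) (quot_module Pbar KKbar)"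
    unfolding KKbar_def
  proof (rule R.resolution_bar)
    show "fg_free_module P (L' i)" for i
      by (simp add: L'_def L0_free L1_free L2_free G'_even_free G'_odd_free)
    show "l' i \<in> module_hom P (L' i) (L' (i - 1))" if "1 \<le> i" for i
      using that by (cases rule: nat_ge1_cases)
        (auto simp: L'_def l'_def l1_hom l2_hom l'3_hom g'_even_hom g'_odd_hom)
    show "R.exact_mod (L' (i + 1)) (l' (i + 1)) (L' i) (l' i) (L' (i - 1))" if "1 \<le> i" for i
      using that by (cases rule: nat_ge1_cases)
        (auto simp: L'_def l'_def exact_1 exact_2' exact_3' odd_even_exact' even_odd_exact')
    show "(\<lambda>x. coef P K (fst (snd x))) \<in> module_iso P (L' 0) (ring_module P)"
      using L0_iso by (simp add: L'_def)
    show "ideal KK P" by (rule KK_ideal)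
    show "(\<lambda>x. coef P K (fst (snd x))) ` l' 1 ` carrier (L' 1) = KK"
      using L1_image by (simp add: L'_def l'_def)
  qed
  moreover have "N' = (\<lambda>i. bar (L' i))" "n' = (\<lambda>i. bar_map (L' (i - 1)) (l' i))"
    by (auto simp: N'_def n'_def)
  ultimately show ?thesis by simp
qed

end

theorem theorem10p1:
  fixes P :: "'p ring" and f :: 'p and KK :: "'p set"
    and M :: "('p, 'm) dg" and M11 M12 :: "'m set"
    and K :: "('p, 'k) dg"
    and orK :: "'k \<Rightarrow> 'p" and orM :: "'m \<Rightarrow> 'p"
    and \<alpha> :: "nat \<Rightarrow> 'k \<Rightarrow> 'm" and r :: 'p and \<sigma> :: 'k
    and X :: "'m \<Rightarrow> 'm"
  assumes "linkage_data P f KK M M11 M12 K orK orM \<alpha> r \<sigma> X"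
  shows "free_resolution (P Quot (PIdl\<^bsub>P\<^esub> f))
           (linkage_params.N P f M M12 K)
           (linkage_params.n P f M M11 M12 K orK orM \<alpha> r \<sigma> X)
           (quot_module (P Quot (PIdl\<^bsub>P\<^esub> f)) (linkage_params.KKbar P f KK)) \<and>
         (r \<in> Units P \<longrightarrow>
         free_resolution (P Quot (PIdl\<^bsub>P\<^esub> f))
           (linkage_params.N' P f M M11 M12 K)
           (linkage_params.n' P f M M11 M12 K orK orM \<alpha> r \<sigma> X)
           (quot_module (P Quot (PIdl\<^bsub>P\<^esub> f)) (linkage_params.KKbar P f KK)))"
proof (intro conjI impI)
  show "free_resolution (P Quot (PIdl\<^bsub>P\<^esub> f)) (linkage_params.N P f M M12 K)
      (linkage_params.n P f M M11 M12 K orK orM \<alpha> r \<sigma> X)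
      (quot_module (P Quot (PIdl\<^bsub>P\<^esub> f)) (linkage_params.KKbar P f KK))"
    by (rule linkage_data.N_resolution[OF assms])
next
  assume "r \<in> Units P"
  then have "linkage_unit P f KK M M11 M12 K orK orM \<alpha> r \<sigma> X"
    using assms by (simp add: linkage_unit_def linkage_unit_axioms_def)
  then show "free_resolution (P Quot (PIdl\<^bsub>P\<^esub> f)) (linkage_params.N' P f M M11 M12 K)
      (linkage_params.n' P f M M11 M12 K orK orM \<alpha> r \<sigma> X)
      (quot_module (P Quot (PIdl\<^bsub>P\<^esub> f)) (linkage_params.KKbar P f KK))"
    by (rule linkage_unit.N'_resolution)
qed

end
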